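(* Let $\lambda,\sigma>0$ and $T>0$. For $H\in(\frac12,1)$ let $$X^H(t)=\sigma\int_{-\infty}^t e^{-\lambda(t-u)}\,dZ^H(u),\qquad t\in[0,T],$$ be the stationary Rosenblatt Ornstein-Uhlenbeck process. Then, as $H\to\frac12$ (with $H>\frac12$), the process $(X^H(t))_{t\in[0,T]}$ converges weakly, in the space of continuous functions $C[0,T]$, to the stationary Ornstein-Uhlenbeck process $(X_0(t))_{t\in[0,T]}$, $$X_0(t)=\sigma\int_{-\infty}^t e^{-\lambda(t-u)}\,dW(u),$$ where $(W(u))_{u\in\mathbb{R}}$ is a Wiener process on the whole real line.
   Context: Let $(B(y))_{y\in\mathbb{R}}$ be a Wiener process on a probability space $(\Omega,\mathcal{F},P)$ and let $I_2$ denote the multiple (Wiener-Itô) stochastic integral of order two with respect to $B$, normalized so that $\mathbf{E}[I_2(h)^2]=2\|h\|_{L^2(\mathbb{R}^2)}^2$ for symmetric $h\in L^2(\mathbb{R}^2)$. Write $x_+=\max(x,0)$. For $H\in(\frac12,1)$ let $c(H,2)>0$ be given by $$c(H,2)^2=\frac{H(2H-1)}{2\,\beta\left(\frac H2,1-H\right)^2},\qquad \beta(p,q)=\int_0^1 z^{p-1}(1-z)^{q-1}dz .$$ The Rosenblatt process with self-similarity index $H$ is $Z^H(t)=I_2(L^H_t)$, $t\ge0$, where $L^H_t(y_1,y_2)=c(H,2)\int_0^t (u-y_1)_+^{\frac H2-1}(u-y_2)_+^{\frac H2-1}du$. For measurable $f:\mathbb{R}\to\mathbb{R}$ with $\int_{\mathbb{R}}\int_{\mathbb{R}}|f(u)f(v)||u-v|^{2H-2}\,du\,dv<\infty$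 the Wiener-Rosenblatt integral is $$\int_{\mathbb{R}} f(u)\,dZ^H(u):=I_2(J_Hf),\qquad (J_Hf)(y_1,y_2)=c(H,2)\int_{\mathbb{R}} f(u)(u-y_1)_+^{\frac H2-1}(u-y_2)_+^{\frac H2-1}du ,$$ and $\int_{-\infty}^t f(u)\,dZ^H(u)=\int_{\mathbb{R}}1_{(-\infty,t]}(u)f(u)\,dZ^H(u)$. The process $X^H$ is taken in its modification with continuous paths. The process $X_0$ (also taken with continuous paths) is a centered Gaussian process with covariance $\mathbf{E}[X_0(t)X_0(s)]=\frac{\sigma^2}{2\lambda}e^{-\lambda|t-s|}$. *)

theory Defs
  imports "HOL-Probability.Probability"
begin

text \<open>Wiener process indexed by the whole real line.\<close>

locale wiener_process = prob_space M for M :: "'a measure" +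
  fixes B :: "real \<Rightarrow> 'a \<Rightarrow> real"
  assumes random_variable_B: "B t \<in> borel_measurable M"
    and B_zero: "AE \<omega> in M. B 0 \<omega> = 0"
    and indep_increments: "strict_mono_on {..n} p \<Longrightarrow>
      indep_vars (\<lambda>_. borel) (\<lambda>i \<omega>. B (p (Suc i)) \<omega> - B (p i) \<omega>) {..<n}"
    and normal_increments: "s < t \<Longrightarrow>
      distributed M lborel (\<lambda>\<omega>. B t \<omega> - B s \<omega>) (normal_density 0 (sqrt (t - s)))"
    and continuous_B: "AE \<omega> in M. continuous_on UNIV (\<lambda>t. B t \<omega>)"

definition L2_tendsto :: "'a measure \<Rightarrow> (nat \<Rightarrow> 'a \<Rightarrow> real) \<Rightarrow> ('a \<Rightarrow> real) \<Rightarrow> bool" where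
  "L2_tendsto M f g \<longleftrightarrow>
     (\<forall>k. f k \<in> borel_measurable M) \<and> g \<in> borel_measurable M \<and>
     (\<lambda>k. \<integral>\<^sup>+ x. ennreal ((f k x - g x)\<^sup>2) \<partial>M) \<longlonglongrightarrow> 0"

text \<open>
  Stochastic integrals are random variables determined up to almost sure equality, so they are
  given as relations: \<open>has_wiener_integral M W f Y\<close> says that \<open>Y\<close> is a version of the Wiener
  integral of \<open>f\<close>, and \<open>has_double_wiener_integral M B h Y\<close> that \<open>Y\<close> is a version of \<open>I\<^sub>2(h)\<close>.
  Both are \<open>L\<^sup>2\<close>-limits of integrals of step functions.
\<close>

definition step1 :: "nat \<Rightarrow> (nat \<Rightarrow> real) \<Rightarrow> (nat \<Rightarrow> real) \<Rightarrow> real \<Rightarrow> real" where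
  "step1 n p a y = (\<Sum>i<n. a i * indicator {p i<..p (Suc i)} y)"

definition step1_integral ::
  "(real \<Rightarrow> 'a \<Rightarrow> real) \<Rightarrow> nat \<Rightarrow> (nat \<Rightarrow> real) \<Rightarrow> (nat \<Rightarrow> real) \<Rightarrow> 'a \<Rightarrow> real" where
  "step1_integral W n p a \<omega> = (\<Sum>i<n. a i * (W (p (Suc i)) \<omega> - W (p i) \<omega>))"

definition has_wiener_integral ::
  "'a measure \<Rightarrow> (real \<Rightarrow> 'a \<Rightarrow> real) \<Rightarrow> (real \<Rightarrow> real) \<Rightarrow> ('a \<Rightarrow> real) \<Rightarrow> bool" where
  "has_wiener_integral M W f Y \<longleftrightarrow>
     (\<exists>n p a. (\<forall>k. strict_mono_on {..n k} (p k)) \<and>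
        L2_tendsto lborel (\<lambda>k. step1 (n k) (p k) (a k)) f \<and>
        L2_tendsto M (\<lambda>k. step1_integral W (n k) (p k) (a k)) Y)"

definition step2 ::
  "nat \<Rightarrow> (nat \<Rightarrow> real) \<Rightarrow> (nat \<Rightarrow> nat \<Rightarrow> real) \<Rightarrow> real \<times> real \<Rightarrow> real" where
  "step2 n p a = (\<lambda>(y1, y2). \<Sum>i<n. \<Sum>j<n.
     a i j * indicator {p i<..p (Suc i)} y1 * indicator {p j<..p (Suc j)} y2)"

definition step2_integral ::
  "(real \<Rightarrow> 'a \<Rightarrow> real) \<Rightarrow> nat \<Rightarrow> (nat \<Rightarrow> real) \<Rightarrow> (nat \<Rightarrow> nat \<Rightarrow> real) \<Rightarrow> 'a \<Rightarrow> real" where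
  "step2_integral B n p a \<omega> = (\<Sum>i<n. \<Sum>j<n.
     a i j * (B (p (Suc i)) \<omega> - B (p i) \<omega>) * (B (p (Suc j)) \<omega> - B (p j) \<omega>))"

text \<open>
  The step functions vanish on the diagonal squares (\<open>a i i = 0\<close>).  As each unordered pair of
  cells is counted twice for symmetric \<open>a\<close>, this is the integral with
  \<open>E[I\<^sub>2(h)\<^sup>2] = 2 \<parallel>h\<parallel>\<^sup>2\<close> for symmetric \<open>h\<close>.
\<close>

definition has_double_wiener_integral ::
  "'a measure \<Rightarrow> (real \<Rightarrow> 'a \<Rightarrow> real) \<Rightarrow> (real \<times> real \<Rightarrow> real) \<Rightarrow> ('a \<Rightarrow> real) \<Rightarrow> bool" where
  "has_double_wiener_integral M B h Y \<longleftrightarrow>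
     (\<exists>n p a. (\<forall>k. strict_mono_on {..n k} (p k) \<and> (\<forall>i<n k. a k i i = 0)) \<and>
        L2_tendsto lborel (\<lambda>k. step2 (n k) (p k) (a k)) h \<and>
        L2_tendsto M (\<lambda>k. step2_integral B (n k) (p k) (a k)) Y)"

text \<open>
  \<open>rosenblatt_const H\<close> is \<open>c(H,2)\<close>; for positive arguments \<open>Beta\<close> is the Euler integral, see
  \<open>has_integral_Beta_real\<close>.
\<close>

definition rosenblatt_const :: "real \<Rightarrow> real" where
  "rosenblatt_const H = sqrt (H * (2 * H - 1) / (2 * (Beta (H / 2) (1 - H))\<^sup>2))"

text \<open>
  Since \<open>0 powr x = 0\<close>, the powers below vanish for \<open>u \<le> y\<close>.  On the null set \<open>y1 = y2\<close>, where
  the integral may diverge, the Bochner integral has the default value \<open>0\<close>.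
  For \<open>f\<close> the indicator of \<open>{0..t}\<close> this is the kernel \<open>L\<^sub>t\<close> of the Rosenblatt process.
\<close>

definition rosenblatt_kernel :: "real \<Rightarrow> (real \<Rightarrow> real) \<Rightarrow> real \<times> real \<Rightarrow> real" where
  "rosenblatt_kernel H f = (\<lambda>(y1, y2). rosenblatt_const H *
     (LINT u|lborel. f u * max (u - y1) 0 powr (H / 2 - 1) * max (u - y2) 0 powr (H / 2 - 1)))"

definition has_rosenblatt_integral ::
  "'a measure \<Rightarrow> (real \<Rightarrow> 'a \<Rightarrow> real) \<Rightarrow> real \<Rightarrow> (real \<Rightarrow> real) \<Rightarrow> ('a \<Rightarrow> real) \<Rightarrow> bool" where
  "has_rosenblatt_integral M B H f Y \<longleftrightarrow>
     f \<in> borel_measurable borel \<and>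
     (\<integral>\<^sup>+ u. \<integral>\<^sup>+ v. ennreal (\<bar>f u * f v\<bar> * \<bar>u - v\<bar> powr (2 * H - 2)) \<partial>lborel \<partial>lborel) < \<infinity> \<and>
     has_double_wiener_integral M B (rosenblatt_kernel H f) Y"

text \<open>
  Ornstein-Uhlenbeck processes \<open>X t = \<sigma> \<integral>\<^bsub>-\<infinity>\<^esub>\<^bsup>t\<^esup> exp (-\<lambda> (t - u)) dZ(u)\<close> on \<open>{0..T}\<close>, in a
  modification with continuous paths.
\<close>

definition continuous_modification ::
  "'a measure \<Rightarrow> real \<Rightarrow> (real \<Rightarrow> ('a \<Rightarrow> real) \<Rightarrow> bool) \<Rightarrow> (real \<Rightarrow> 'a \<Rightarrow> real) \<Rightarrow> bool" where
  "continuous_modification M T V X \<longleftrightarrow>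
     (\<forall>t\<in>{0..T}. X t \<in> borel_measurable M \<and> (\<exists>Y. V t Y \<and> (AE \<omega> in M. X t \<omega> = Y \<omega>))) \<and>
     (\<forall>\<omega>\<in>space M. continuous_on {0..T} (\<lambda>t. X t \<omega>))"

definition rosenblatt_OU :: "'a measure \<Rightarrow> (real \<Rightarrow> 'a \<Rightarrow> real) \<Rightarrow>
    real \<Rightarrow> real \<Rightarrow> real \<Rightarrow> real \<Rightarrow> (real \<Rightarrow> 'a \<Rightarrow> real) \<Rightarrow> bool" where
  "rosenblatt_OU M B H lam \<sigma> T X \<longleftrightarrow>
     continuous_modification M T (\<lambda>t V. \<exists>Y.
       has_rosenblatt_integral M B H (\<lambda>u. indicator {..t} u * exp (- lam * (t - u))) Y \<and>
       V = (\<lambda>\<omega>. \<sigma> * Y \<omega>)) X"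

definition wiener_OU :: "'a measure \<Rightarrow> (real \<Rightarrow> 'a \<Rightarrow> real) \<Rightarrow>
    real \<Rightarrow> real \<Rightarrow> real \<Rightarrow> (real \<Rightarrow> 'a \<Rightarrow> real) \<Rightarrow> bool" where
  "wiener_OU M W lam \<sigma> T X \<longleftrightarrow>
     continuous_modification M T (\<lambda>t V. \<exists>Y.
       has_wiener_integral M W (\<lambda>u. indicator {..t} u * exp (- lam * (t - u))) Y \<and>
       V = (\<lambda>\<omega>. \<sigma> * Y \<omega>)) X"

definition borel_of :: "'a topology \<Rightarrow> 'a measure" where
  "borel_of S = sigma (topspace S) {U. openin S U}"

text \<open>
  Weak convergence of probability measures on the Borel sets of a topological space.
\<close>

definition weak_conv_on ::
  "'a topology \<Rightarrow> ('i \<Rightarrow> 'a measure) \<Rightarrow> 'a measure \<Rightarrow> 'i filter \<Rightarrow> bool" where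
  "weak_conv_on S N N0 F \<longleftrightarrow>
     (\<forall>\<^sub>F i in F. prob_space (N i) \<and> sets (N i) = sets (borel_of S)) \<and>
     prob_space N0 \<and> sets N0 = sets (borel_of S) \<and>
     (\<forall>\<phi>. continuous_map S euclideanreal \<phi> \<longrightarrow> bounded (\<phi> ` topspace S) \<longrightarrow>
        ((\<lambda>i. integral\<^sup>L (N i) \<phi>) \<longlongrightarrow> integral\<^sup>L N0 \<phi>) F)"

text \<open>
  The space \<open>C[0,T]\<close> with the supremum metric; its elements are functions restricted to
  (that is, \<open>undefined\<close> outside) \<open>{0..T}\<close>.
\<close>

definition C_interval :: "real \<Rightarrow> (real \<Rightarrow> real) topology" where
  "C_interval T = mtopology_of (cfunspace (top_of_set {0..T}) euclidean_metric)"

definition path_law :: "'a measure \<Rightarrow> real \<Rightarrow> (real \<Rightarrow> 'a \<Rightarrow> real) \<Rightarrow> (real \<Rightarrow> real) measure" where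
  "path_law M T X = distr M (borel_of (C_interval T)) (\<lambda>\<omega>. restrict (\<lambda>t. X t \<omega>) {0..T})"

end

theory Submission
  imports Defs
begin

text \<open>
  The finite-dimensional laws are treated by a quantitative fourth moment argument.  If \<open>Q\<close> is an
  off-diagonal quadratic form in independent Gaussians with variance \<open>v\<close>, Gaussian integration by
  parts gives \<open>E[Q exp (\<i>uQ)] = \<i>u E[G exp (\<i>uQ)]\<close> with \<open>E G = v\<close>, so the characteristic function of
  \<open>Q\<close> almost solves the differential equation of the Gaussian one, the error being the standard
  deviation of \<open>G\<close>, that is, the norm of the contraction of the kernel with itself.  By \<open>L\<^sup>2\<close> limits
  the same bound holds for every double Wiener integral.  For the Rosenblatt kernels the Beta integral
  \<open>\<integral> (u - y)\<^sub>+\<^sup>H\<^sup>/\<^sup>2\<^sup>-\<^sup>1 (v - y)\<^sub>+\<^sup>H\<^sup>/\<^sup>2\<^sup>-\<^sup>1 dy = \<beta> \<bar>u - v\<bar>\<^sup>H\<^sup>-\<^sup>1\<close> shows that the contraction is of order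
  \<open>(2H - 1)\<close>, whereas \<open>H (2H - 1) \<bar>x\<bar>\<^sup>2\<^sup>H\<^sup>-\<^sup>2\<close> is an approximate identity, so that the covariances
  converge to those of the Ornstein-Uhlenbeck process.

  Tightness is replaced by a uniform approximation.  The bound \<open>E Q\<^sup>4 \<le> 81 (E Q\<^sup>2)\<^sup>2\<close> and
  \<open>E (X t - X s)\<^sup>2 \<le> C \<bar>t - s\<bar>\<close>, uniform in \<open>H\<close>, allow dyadic chaining: \<open>X\<close> is close in expected
  supremum norm to its piecewise linear interpolation, uniformly in \<open>H\<close>.  This settles Lipschitz test
  functionals; a bounded continuous functional is an increasing limit of Lipschitz ones
  (inf-convolution), which gives the lower bound of the limit, and applied to its negative the upper bound.
\<close>

subsection \<open>Gaussian quadratic forms\<close>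

text \<open>The Gaussian limit rests on a mismatch of singularities. The squared norm of a kernel is
  H (2H - 1) / 2 times an integral against |u - v|^(2H - 2), which diverges like 1 / (2H - 1) and so
  offsets the vanishing constant. The squared norm of the contraction carries the square of that
  constant, but its integral has four factors of exponent H - 1 along a cycle of four points;
  exponents near -1/2 stay integrable there, uniformly for H \<le> 3/4, and nothing compensates.

  Double integrals are given only as L2 limits of step integrals. Each estimate is therefore proved
  for finite quadratic forms, in terms of quantities that survive an L2 limit of kernels: the norm
  and, through \<open>contr_norm_le\<close>, the contraction norm. Off-diagonal forms are affine in
  each single variable, which permits both the moment induction over the variables and integration
  by parts in one variable at a time.

  The limit process may live on another probability space, so only laws are compared. Linear
  combinations of values of a process are again double integrals, whence one-dimensional
  characteristic functions determine the joint behaviour.\<close>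

lemma (in prob_space) normal_integrable_power:
  fixes X :: "'a \<Rightarrow> real"
  assumes "distributed M lborel X (normal_density 0 s)" "s > 0"
  shows "integrable M (\<lambda>\<omega>. X \<omega> ^ k)"
  using distributed_integrable[OF assms(1), of "\<lambda>x. x ^ k"] integrable_normal_moment[OF assms(2), of 0 k]
  by simp

lemma (in prob_space) normal_moments:
  fixes X :: "'a \<Rightarrow> real"
  assumes "distributed M lborel X (normal_density 0 s)" "s > 0"
  shows "expectation X = 0" "expectation (\<lambda>\<omega>. X \<omega> ^ 2) = s\<^sup>2"
    "expectation (\<lambda>\<omega>. X \<omega> ^ 3) = 0" "expectation (\<lambda>\<omega>. X \<omega> ^ 4) = 3 * s ^ 4"
proof -
  have *: "expectation (\<lambda>\<omega>. X \<omega> ^ k) = (LINT x|lborel. normal_density 0 s x * x ^ k)" for k :: nat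
    using distributed_integral[OF assms(1), of "\<lambda>x. x ^ k"] by simp
  show "expectation X = 0" "expectation (\<lambda>\<omega>. X \<omega> ^ 3) = 0"
    using *[of 1] *[of 3] integral_normal_moment_odd[OF assms(2), of 0 0]
      integral_normal_moment_odd[OF assms(2), of 0 1] by (simp_all add: numeral_3_eq_3)
  show "expectation (\<lambda>\<omega>. X \<omega> ^ 2) = s\<^sup>2" "expectation (\<lambda>\<omega>. X \<omega> ^ 4) = 3 * s ^ 4"
    using *[of 2] *[of 4] integral_normal_moment_even[OF assms(2), of 0 1]
      integral_normal_moment_even[OF assms(2), of 0 2] by (simp_all add: fact_numeral power2_eq_square power4_eq_xxxx)
qed

text \<open>Lets the inductions below carry only the integrability of fourth powers: every mixed
  moment of total degree at most four is dominated by them.\<close>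

lemma power_mult_power_le_fourth:
  fixes a b :: real
  assumes "i + j \<le> 4"
  shows "\<bar>a ^ i * b ^ j\<bar> \<le> 1 + a ^ 4 + b ^ 4"
proof -
  define m where "m = max \<bar>a\<bar> \<bar>b\<bar>"
  have "\<bar>a ^ i * b ^ j\<bar> \<le> m ^ i * m ^ j"
    unfolding abs_mult power_abs by (intro mult_mono power_mono) (auto simp: m_def intro!: zero_le_power)
  also have "\<dots> = m ^ (i + j)" by (simp add: power_add)
  also have "\<dots> \<le> 1 + m ^ 4"
  proof (cases "m \<le> 1")
    case True
    then have "m ^ (i + j) \<le> 1" by (intro power_le_one) (auto simp: m_def)
    then show ?thesis by (simp add: add_increasing2)
  next
    case False
    then have "m ^ (i + j) \<le> m ^ 4" using assms by (intro power_increasing) auto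
    then show ?thesis by simp
  qed
  also have "m ^ 4 \<le> a ^ 4 + b ^ 4"
    by (auto simp: m_def max_def)
  finally show ?thesis by simp
qed

lemma integrable_power_mult_power:
  fixes A B :: "'a \<Rightarrow> real"
  assumes "finite_measure M" "A \<in> borel_measurable M" "B \<in> borel_measurable M"
    "integrable M (\<lambda>\<omega>. A \<omega> ^ 4)" "integrable M (\<lambda>\<omega>. B \<omega> ^ 4)" "i + j \<le> 4"
  shows "integrable M (\<lambda>\<omega>. A \<omega> ^ i * B \<omega> ^ j)"
proof -
  interpret finite_measure M by fact
  show ?thesis
  proof (rule Bochner_Integration.integrable_bound[where f="\<lambda>\<omega>. 1 + A \<omega> ^ 4 + B \<omega> ^ 4"])
    show "AE \<omega> in M. norm (A \<omega> ^ i * B \<omega> ^ j) \<le> norm (1 + A \<omega> ^ 4 + B \<omega> ^ 4)"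
      using power_mult_power_le_fourth[OF assms(6)] by (intro AE_I2) (metis abs_ge_self order_trans real_norm_def)
  qed (use assms in auto)
qed

lemma integral_mult_Cauchy_Schwarz:
  fixes A B :: "'a \<Rightarrow> real"
  assumes [measurable]: "A \<in> borel_measurable M" "B \<in> borel_measurable M"
    and int: "integrable M (\<lambda>\<omega>. (A \<omega>)\<^sup>2)" "integrable M (\<lambda>\<omega>. (B \<omega>)\<^sup>2)"
  shows "(integral\<^sup>L M (\<lambda>\<omega>. \<bar>A \<omega> * B \<omega>\<bar>))\<^sup>2 \<le> integral\<^sup>L M (\<lambda>\<omega>. (A \<omega>)\<^sup>2) * integral\<^sup>L M (\<lambda>\<omega>. (B \<omega>)\<^sup>2)"
proof -
  have i: "integrable M (\<lambda>\<omega>. A \<omega> * B \<omega>)"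
  proof (rule Bochner_Integration.integrable_bound[OF Bochner_Integration.integrable_add[OF int]])
    have "\<bar>A x * B x\<bar> \<le> (A x)\<^sup>2 + (B x)\<^sup>2" for x
      using sum_squares_bound[of "\<bar>A x\<bar>" "\<bar>B x\<bar>"] mult_nonneg_nonneg[of "\<bar>A x\<bar>" "\<bar>B x\<bar>"]
      unfolding power2_abs abs_mult by linarith
    then show "AE x in M. norm (A x * B x) \<le> norm ((A x)\<^sup>2 + (B x)\<^sup>2)" by simp
  qed auto
  have "(\<integral>\<^sup>+x. ennreal \<bar>A x\<bar> * ennreal \<bar>B x\<bar> \<partial>M)\<^sup>2 \<le> (\<integral>\<^sup>+x. (ennreal \<bar>A x\<bar>)\<^sup>2 \<partial>M) * (\<integral>\<^sup>+x. (ennreal \<bar>B x\<bar>)\<^sup>2 \<partial>M)"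
    by (rule Cauchy_Schwarz_nn_integral) auto
  also have "(\<integral>\<^sup>+x. ennreal \<bar>A x\<bar> * ennreal \<bar>B x\<bar> \<partial>M) = ennreal (integral\<^sup>L M (\<lambda>\<omega>. \<bar>A \<omega> * B \<omega>\<bar>))"
    by (subst nn_integral_eq_integral[symmetric]) (use integrable_abs[OF i] in \<open>auto simp: abs_mult ennreal_mult'\<close>)
  also have "(\<integral>\<^sup>+x. (ennreal \<bar>A x\<bar>)\<^sup>2 \<partial>M) = ennreal (integral\<^sup>L M (\<lambda>\<omega>. (A \<omega>)\<^sup>2))"
    by (subst nn_integral_eq_integral[symmetric]) (use int in \<open>auto simp: ennreal_power\<close>)
  also have "(\<integral>\<^sup>+x. (ennreal \<bar>B x\<bar>)\<^sup>2 \<partial>M) = ennreal (integral\<^sup>L M (\<lambda>\<omega>. (B \<omega>)\<^sup>2))"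
    by (subst nn_integral_eq_integral[symmetric]) (use int in \<open>auto simp: ennreal_power\<close>)
  finally show ?thesis
    by (simp add: ennreal_power ennreal_mult'[symmetric] integral_nonneg_AE)
qed

text \<open>One Gaussian variable is added at a time. Independence is asked of monomials only, since
  the expansion of \<open>(A + B * X) ^ k\<close> involves nothing else; the odd moments of
  \<open>X\<close> vanish and leave just the terms shown.\<close>

lemma (in prob_space) indep_normal_step:
  fixes X A B :: "'a \<Rightarrow> real"
  assumes X: "distributed M lborel X (normal_density 0 s)" "s > 0"
    and ind: "\<And>k i j. indep_var borel (\<lambda>\<omega>. X \<omega> ^ k) borel (\<lambda>\<omega>. A \<omega> ^ i * B \<omega> ^ j)"
    and m: "A \<in> borel_measurable M" "B \<in> borel_measurable M"
    and int: "integrable M (\<lambda>\<omega>. A \<omega> ^ 4)" "integrable M (\<lambda>\<omega>. B \<omega> ^ 4)"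
  shows "integrable M (\<lambda>\<omega>. (A \<omega> + B \<omega> * X \<omega>) ^ 4)"
    "expectation (\<lambda>\<omega>. (A \<omega> + B \<omega> * X \<omega>) ^ 2) = expectation (\<lambda>\<omega>. A \<omega> ^ 2) + s\<^sup>2 * expectation (\<lambda>\<omega>. B \<omega> ^ 2)"
    "expectation (\<lambda>\<omega>. (A \<omega> + B \<omega> * X \<omega>) ^ 4) = expectation (\<lambda>\<omega>. A \<omega> ^ 4)
       + 6 * s\<^sup>2 * expectation (\<lambda>\<omega>. A \<omega> ^ 2 * B \<omega> ^ 2) + 3 * s ^ 4 * expectation (\<lambda>\<omega>. B \<omega> ^ 4)"
proof -
  have AB: "integrable M (\<lambda>\<omega>. A \<omega> ^ i * B \<omega> ^ j)" if "i + j \<le> 4" for i j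
    by (rule integrable_power_mult_power) (use m int that finite_measure_axioms in auto)
  note iv = ind
  note nk = normal_integrable_power[OF X]
  have P: "integrable M (\<lambda>\<omega>. X \<omega> ^ k * (A \<omega> ^ i * B \<omega> ^ j))"
    and E: "expectation (\<lambda>\<omega>. X \<omega> ^ k * (A \<omega> ^ i * B \<omega> ^ j)) =
      expectation (\<lambda>\<omega>. X \<omega> ^ k) * expectation (\<lambda>\<omega>. A \<omega> ^ i * B \<omega> ^ j)" if "i + j \<le> 4" for i j k
    using indep_var_integrable[OF iv nk AB[OF that]] indep_var_lebesgue_integral[OF iv nk AB[OF that]] by auto
  have e2: "(A \<omega> + B \<omega> * X \<omega>) ^ 2 = X \<omega> ^ 0 * (A \<omega> ^ 2 * B \<omega> ^ 0) + 2 * (X \<omega> ^ 1 * (A \<omega> ^ 1 * B \<omega> ^ 1)) + X \<omega> ^ 2 * (A \<omega> ^ 0 * B \<omega> ^ 2)" for \<omega>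
    by (simp add: power2_eq_square algebra_simps)
  have e4: "(A \<omega> + B \<omega> * X \<omega>) ^ 4 = X \<omega> ^ 0 * (A \<omega> ^ 4 * B \<omega> ^ 0) + 4 * (X \<omega> ^ 1 * (A \<omega> ^ 3 * B \<omega> ^ 1))
     + 6 * (X \<omega> ^ 2 * (A \<omega> ^ 2 * B \<omega> ^ 2)) + 4 * (X \<omega> ^ 3 * (A \<omega> ^ 1 * B \<omega> ^ 3)) + X \<omega> ^ 4 * (A \<omega> ^ 0 * B \<omega> ^ 4)" for \<omega>
    by (simp add: power2_eq_square power3_eq_cube power4_eq_xxxx algebra_simps)
  show "integrable M (\<lambda>\<omega>. (A \<omega> + B \<omega> * X \<omega>) ^ 4)"
    unfolding e4 by (intro Bochner_Integration.integrable_add integrable_mult_right P) auto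
  have "expectation (\<lambda>\<omega>. (A \<omega> + B \<omega> * X \<omega>) ^ 2) = expectation (\<lambda>\<omega>. X \<omega> ^ 0 * (A \<omega> ^ 2 * B \<omega> ^ 0))
      + 2 * expectation (\<lambda>\<omega>. X \<omega> ^ 1 * (A \<omega> ^ 1 * B \<omega> ^ 1)) + expectation (\<lambda>\<omega>. X \<omega> ^ 2 * (A \<omega> ^ 0 * B \<omega> ^ 2))"
    unfolding e2 using P[of 2 0 0] P[of 1 1 1] P[of 0 2 2] by simp
  then show "expectation (\<lambda>\<omega>. (A \<omega> + B \<omega> * X \<omega>) ^ 2) = expectation (\<lambda>\<omega>. A \<omega> ^ 2) + s\<^sup>2 * expectation (\<lambda>\<omega>. B \<omega> ^ 2)"
    using E[of 1 1 1] E[of 0 2 2] by (simp add: normal_moments[OF X])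
  have "expectation (\<lambda>\<omega>. (A \<omega> + B \<omega> * X \<omega>) ^ 4) = expectation (\<lambda>\<omega>. X \<omega> ^ 0 * (A \<omega> ^ 4 * B \<omega> ^ 0))
      + 4 * expectation (\<lambda>\<omega>. X \<omega> ^ 1 * (A \<omega> ^ 3 * B \<omega> ^ 1)) + 6 * expectation (\<lambda>\<omega>. X \<omega> ^ 2 * (A \<omega> ^ 2 * B \<omega> ^ 2))
      + 4 * expectation (\<lambda>\<omega>. X \<omega> ^ 3 * (A \<omega> ^ 1 * B \<omega> ^ 3)) + expectation (\<lambda>\<omega>. X \<omega> ^ 4 * (A \<omega> ^ 0 * B \<omega> ^ 4))"
    unfolding e4 using P[of 4 0 0] P[of 3 1 1] P[of 2 2 2] P[of 1 3 3] P[of 0 4 4] by simp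
  then show "expectation (\<lambda>\<omega>. (A \<omega> + B \<omega> * X \<omega>) ^ 4) = expectation (\<lambda>\<omega>. A \<omega> ^ 4)
       + 6 * s\<^sup>2 * expectation (\<lambda>\<omega>. A \<omega> ^ 2 * B \<omega> ^ 2) + 3 * s ^ 4 * expectation (\<lambda>\<omega>. B \<omega> ^ 4)"
    using E[of 3 1 1] E[of 2 2 2] E[of 1 3 3] E[of 0 4 4] by (simp add: normal_moments[OF X])
qed

text \<open>Induction step for hypercontractivity in the second chaos, where 81 = 3^4 is the
  classical constant: \<open>A\<close> will be a quadratic form and \<open>B\<close> a linear one
  with the Gaussian constant 3; the mixed moment is controlled by Cauchy-Schwarz.\<close>

lemma (in prob_space) indep_normal_fourth_moment_le:
  fixes X A B :: "'a \<Rightarrow> real"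
  assumes X: "distributed M lborel X (normal_density 0 s)" "s > 0"
    and ind: "\<And>k i j. indep_var borel (\<lambda>\<omega>. X \<omega> ^ k) borel (\<lambda>\<omega>. A \<omega> ^ i * B \<omega> ^ j)"
    and m: "A \<in> borel_measurable M" "B \<in> borel_measurable M"
    and int: "integrable M (\<lambda>\<omega>. A \<omega> ^ 4)" "integrable M (\<lambda>\<omega>. B \<omega> ^ 4)"
    and A: "expectation (\<lambda>\<omega>. A \<omega> ^ 4) \<le> 81 * (expectation (\<lambda>\<omega>. A \<omega> ^ 2))\<^sup>2"
    and B: "expectation (\<lambda>\<omega>. B \<omega> ^ 4) \<le> 3 * (expectation (\<lambda>\<omega>. B \<omega> ^ 2))\<^sup>2"
  shows "expectation (\<lambda>\<omega>. (A \<omega> + B \<omega> * X \<omega>) ^ 4) \<le> 81 * (expectation (\<lambda>\<omega>. (A \<omega> + B \<omega> * X \<omega>) ^ 2))\<^sup>2"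
proof -
  define a b c where "a = expectation (\<lambda>\<omega>. A \<omega> ^ 2)" and "b = expectation (\<lambda>\<omega>. B \<omega> ^ 2)"
    and "c = expectation (\<lambda>\<omega>. A \<omega> ^ 2 * B \<omega> ^ 2)"
  have ab: "a \<ge> 0" "b \<ge> 0" unfolding a_def b_def by auto
  have "c\<^sup>2 \<le> expectation (\<lambda>\<omega>. A \<omega> ^ 4) * expectation (\<lambda>\<omega>. B \<omega> ^ 4)"
    using integral_mult_Cauchy_Schwarz[of "\<lambda>\<omega>. A \<omega> ^ 2" M "\<lambda>\<omega>. B \<omega> ^ 2"] m int
    by (simp add: c_def abs_mult flip: power_mult)
  also have "\<dots> \<le> (81 * a\<^sup>2) * (3 * b\<^sup>2)"
    using A B by (intro mult_mono) (auto simp: a_def b_def)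
  \<comment> \<open>81 * 3 = 243 is rounded up to 256 = 16^2.\<close>
  also have "\<dots> \<le> (16 * a * b)\<^sup>2" by (simp add: power_mult_distrib)
  finally have c: "c \<le> 16 * a * b"
    by (rule power2_le_imp_le) (use ab in auto)
  have "expectation (\<lambda>\<omega>. (A \<omega> + B \<omega> * X \<omega>) ^ 4) \<le> 81 * a\<^sup>2 + 6 * s\<^sup>2 * (16 * a * b) + 3 * s ^ 4 * (3 * b\<^sup>2)"
    unfolding indep_normal_step(3)[OF X ind m int] c_def[symmetric] using A B c
    by (intro add_mono mult_left_mono) (auto simp: a_def b_def)
  \<comment> \<open>The slack: the cross term 6 * 16 = 96 stays below 2 * 81 = 162, and 3 * 3 = 9
    below 81.\<close>
  also have "\<dots> \<le> 81 * (a + s\<^sup>2 * b)\<^sup>2"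
  proof -
    have "81 * (a + s\<^sup>2 * b)\<^sup>2 - (81 * a\<^sup>2 + 6 * s\<^sup>2 * (16 * a * b) + 3 * s ^ 4 * (3 * b\<^sup>2)) = 66 * (s\<^sup>2 * (a * b)) + 72 * (s ^ 4 * b\<^sup>2)"
      by (simp add: power2_eq_square power4_eq_xxxx algebra_simps)
    also have "\<dots> \<ge> 0" using ab by auto
    finally show ?thesis by simp
  qed
  finally show ?thesis
    unfolding indep_normal_step(2)[OF X ind m int] a_def b_def .
qed

lemma (in prob_space) indep_var_coordinate:
  fixes \<xi> :: "'i \<Rightarrow> 'a \<Rightarrow> real"
  assumes "indep_vars (\<lambda>_. borel) \<xi> I" "i \<in> I" "J \<subseteq> I" "i \<notin> J"
    and f: "f \<in> measurable borel N1" and g: "g \<in> measurable (PiM J (\<lambda>_. borel)) N2"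
  shows "indep_var N1 (\<lambda>\<omega>. f (\<xi> i \<omega>)) N2 (\<lambda>\<omega>. g (restrict (\<lambda>j. \<xi> j \<omega>) J))"
proof -
  have I: "indep_var (PiM {i} (\<lambda>_. borel)) (\<lambda>\<omega>. restrict (\<lambda>j. \<xi> j \<omega>) {i}) (PiM J (\<lambda>_. borel)) (\<lambda>\<omega>. restrict (\<lambda>j. \<xi> j \<omega>) J)"
    by (rule indep_var_restrict[OF assms(1)]) (use assms in auto)
  have m: "(\<lambda>x. f (x i)) \<in> measurable (PiM {i} (\<lambda>_. borel)) N1"
    using f by measurable
  have "(\<lambda>x. f (x i)) \<circ> (\<lambda>\<omega>. restrict (\<lambda>j. \<xi> j \<omega>) {i}) = (\<lambda>\<omega>. f (\<xi> i \<omega>))"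
    "g \<circ> (\<lambda>\<omega>. restrict (\<lambda>j. \<xi> j \<omega>) J) = (\<lambda>\<omega>. g (restrict (\<lambda>j. \<xi> j \<omega>) J))"
    by (simp_all add: fun_eq_iff)
  with indep_var_compose[OF I m g] show ?thesis by (simp only:)
qed


locale gaussian_family = prob_space M for M :: "'a measure" +
  fixes \<xi> :: "nat \<Rightarrow> 'a \<Rightarrow> real" and s :: "nat \<Rightarrow> real" and n :: nat
  assumes indep: "indep_vars (\<lambda>_. borel) \<xi> {..<n}"
    and normal: "\<And>i. i < n \<Longrightarrow> distributed M lborel (\<xi> i) (normal_density 0 (s i))"
    and s_pos: "\<And>i. i < n \<Longrightarrow> s i > 0"
begin

lemma measurable_\<xi> [measurable]: "i < n \<Longrightarrow> \<xi> i \<in> borel_measurable M"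
  using distributed_measurable[OF normal] by simp

text \<open>\<open>lin\<close> and \<open>quad\<close> use only the first \<open>k\<close>
  variables, so that variable \<open>k\<close> is independent of them and an induction on
  \<open>k\<close> adds one fresh Gaussian.\<close>

definition lin :: "nat \<Rightarrow> (nat \<Rightarrow> real) \<Rightarrow> 'a \<Rightarrow> real" where
  "lin k c \<omega> = (\<Sum>i<k. c i * \<xi> i \<omega>)"

definition quad :: "nat \<Rightarrow> (nat \<Rightarrow> nat \<Rightarrow> real) \<Rightarrow> 'a \<Rightarrow> real" where
  "quad k a \<omega> = (\<Sum>i<k. \<Sum>j<k. a i j * \<xi> i \<omega> * \<xi> j \<omega>)"

lemma lin_measurable [measurable]: "k \<le> n \<Longrightarrow> lin k c \<in> borel_measurable M"
  unfolding lin_def[abs_def] by (intro borel_measurable_sum borel_measurable_times measurable_const measurable_\<xi>) auto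

lemma quad_measurable [measurable]: "k \<le> n \<Longrightarrow> quad k a \<in> borel_measurable M"
  unfolding quad_def[abs_def] by (intro borel_measurable_sum borel_measurable_times measurable_const measurable_\<xi>) auto

lemma indep_lin_quad:
  assumes "k < n" and g: "g \<in> borel_measurable (borel \<Otimes>\<^sub>M borel)"
  shows "indep_var borel (\<lambda>\<omega>. \<xi> k \<omega> ^ m) borel (\<lambda>\<omega>. g (quad k a \<omega>, lin k c \<omega>))"
proof -
  define G where "G = (\<lambda>x. g (\<Sum>i<k. \<Sum>j<k. a i j * x i * x j, \<Sum>i<k. c i * x i))"
  have "G \<in> borel_measurable (PiM {..<k} (\<lambda>_. borel))"
    unfolding G_def by (intro measurable_compose[OF _ g] measurable_Pair borel_measurable_sum
        borel_measurable_times measurable_const measurable_component_singleton) auto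
  from indep_var_coordinate[OF indep _ _ _ _ this, of k "\<lambda>x. x ^ m" borel]
  have "indep_var borel (\<lambda>\<omega>. \<xi> k \<omega> ^ m) borel (\<lambda>\<omega>. G (restrict (\<lambda>j. \<xi> j \<omega>) {..<k}))"
    using assms(1) by simp
  also have "(\<lambda>\<omega>. G (restrict (\<lambda>j. \<xi> j \<omega>) {..<k})) = (\<lambda>\<omega>. g (quad k a \<omega>, lin k c \<omega>))"
    by (simp add: G_def quad_def lin_def)
  finally show ?thesis .
qed

lemma lin_moments:
  assumes "k \<le> n"
  shows "integrable M (\<lambda>\<omega>. lin k c \<omega> ^ 4)"
    and "expectation (\<lambda>\<omega>. lin k c \<omega> ^ 2) = (\<Sum>i<k. (c i)\<^sup>2 * (s i)\<^sup>2)"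
    and "expectation (\<lambda>\<omega>. lin k c \<omega> ^ 4) \<le> 3 * (expectation (\<lambda>\<omega>. lin k c \<omega> ^ 2))\<^sup>2"
  using assms
proof (induction k)
  case 0
  { case 1 show ?case by (simp add: lin_def) }
  { case 2 show ?case by (simp add: lin_def) }
  { case 3 show ?case by (simp add: lin_def) }
next
  case (Suc k)
  have k: "k < n" "k \<le> n" if "Suc k \<le> n" using that by auto
  have ls: "lin (Suc k) c \<omega> = lin k c \<omega> + c k * \<xi> k \<omega>" for \<omega> by (simp add: lin_def)
  have iv: "indep_var borel (\<lambda>\<omega>. \<xi> k \<omega> ^ m) borel (\<lambda>\<omega>. lin k c \<omega> ^ i * c k ^ j)" if "k < n" for m i j
    using indep_lin_quad[OF that, of "\<lambda>(x, y). y ^ i * c k ^ j"] by simp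
  note st = indep_normal_step[OF normal s_pos, of k "lin k c" "\<lambda>_. c k", OF k(1) k(1) iv]
  { case 1 then show ?case unfolding ls using Suc.IH(1) k by (intro st) auto }
  { case 2
    then show ?case unfolding ls using st(2)[of] Suc.IH(1,2) k by (simp add: prob_space algebra_simps) }
  { case 3
    define e s2 where "e = expectation (\<lambda>\<omega>. lin k c \<omega> ^ 2)" and "s2 = (s k)\<^sup>2 * (c k)\<^sup>2"
    have i2: "integrable M (\<lambda>\<omega>. (lin k c \<omega>)\<^sup>2)"
      using integrable_power_mult_power[OF finite_measure_axioms, of "lin k c" "\<lambda>_. 1" 2 0] Suc.IH(1) k 3 by simp
    have 4: "(s k) ^ 4 * (c k) ^ 4 = s2 * s2" by (simp add: s2_def power2_eq_square power4_eq_xxxx)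
    have "expectation (\<lambda>\<omega>. lin (Suc k) c \<omega> ^ 4) = expectation (\<lambda>\<omega>. lin k c \<omega> ^ 4) + 6 * s2 * e + 3 * (s2 * s2)"
      unfolding ls 4[symmetric] using st(3) Suc.IH(1) k 3 i2 by (simp add: prob_space s2_def e_def)
    also have "\<dots> \<le> 3 * e\<^sup>2 + 6 * s2 * e + 3 * (s2 * s2)"
      using Suc.IH(3) k 3 by (simp add: e_def)
    \<comment> \<open>The constant 3 reproduces itself: the cross term \<open>6 * s2 * e\<close> is
      exactly that of the square.\<close>
    also have "\<dots> = 3 * (e + s2)\<^sup>2" by (simp add: power2_eq_square algebra_simps)
    also have "e + s2 = expectation (\<lambda>\<omega>. lin (Suc k) c \<omega> ^ 2)"
      unfolding ls using st(2) Suc.IH(1) k 3 by (simp add: prob_space s2_def e_def)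
    finally show ?case . }
qed

text \<open>A vanishing diagonal leaves no square of the last variable, so the form is affine in it:
  the shape \<open>A + B * X\<close> of \<open>indep_normal_step\<close>, with the factor 2 from
  symmetry.\<close>

lemma quad_Suc:
  assumes "\<And>i j. a i j = a j i" "\<And>i. a i i = 0"
  shows "quad (Suc k) a \<omega> = quad k a \<omega> + lin k (\<lambda>j. 2 * a k j) \<omega> * \<xi> k \<omega>"
proof -
  have "quad (Suc k) a \<omega> = quad k a \<omega> + (\<Sum>i<k. a i k * \<xi> i \<omega> * \<xi> k \<omega>) + (\<Sum>j<k. a k j * \<xi> k \<omega> * \<xi> j \<omega>)"
    by (simp add: quad_def sum.distrib assms(2))
  also have "(\<Sum>j<k. a k j * \<xi> k \<omega> * \<xi> j \<omega>) = (\<Sum>i<k. a i k * \<xi> i \<omega> * \<xi> k \<omega>)"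
    by (intro sum.cong) (simp_all add: assms(1)[of k] ac_simps)
  finally show ?thesis
    by (simp add: lin_def sum_distrib_right sum_distrib_left assms(1)[of k] mult.assoc)
qed

text \<open>Each unordered pair of variables carries the coefficient \<open>2 * a i j\<close>, so
  the sum over ordered pairs appears with the factor 2 in the second moment.\<close>

lemma quad_moments:
  assumes sym: "\<And>i j. a i j = a j i" and diag: "\<And>i. a i i = 0" and "k \<le> n"
  shows "integrable M (\<lambda>\<omega>. quad k a \<omega> ^ 4)"
    and "expectation (\<lambda>\<omega>. quad k a \<omega> ^ 2) = 2 * (\<Sum>i<k. \<Sum>j<k. (a i j)\<^sup>2 * (s i)\<^sup>2 * (s j)\<^sup>2)"
    and "expectation (\<lambda>\<omega>. quad k a \<omega> ^ 4) \<le> 81 * (expectation (\<lambda>\<omega>. quad k a \<omega> ^ 2))\<^sup>2"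
  using assms(3)
proof (induction k)
  case 0
  { case 1 show ?case by (simp add: quad_def) }
  { case 2 show ?case by (simp add: quad_def) }
  { case 3 show ?case by (simp add: quad_def) }
next
  case (Suc k)
  define L where "L = lin k (\<lambda>j. 2 * a k j)"
  have k: "k < n" "k \<le> n" if "Suc k \<le> n" using that by auto
  have qs: "quad (Suc k) a \<omega> = quad k a \<omega> + L \<omega> * \<xi> k \<omega>" for \<omega>
    unfolding L_def by (rule quad_Suc[OF sym diag])
  have iv: "indep_var borel (\<lambda>\<omega>. \<xi> k \<omega> ^ m) borel (\<lambda>\<omega>. quad k a \<omega> ^ i * L \<omega> ^ j)" if "k < n" for m i j
    using indep_lin_quad[OF that, of "\<lambda>(x, y). x ^ i * y ^ j" m a "\<lambda>j. 2 * a k j"] by (simp add: L_def)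
  have m: "quad k a \<in> borel_measurable M" "L \<in> borel_measurable M" if "k < n"
    unfolding L_def using that by auto
  note Lm = lin_moments[of k "\<lambda>j. 2 * a k j", folded L_def]
  { case 1 then show ?case unfolding qs
      by (intro indep_normal_step[OF normal s_pos] iv m Suc.IH(1) Lm k) }
  { case 2
    have "expectation (\<lambda>\<omega>. quad (Suc k) a \<omega> ^ 2) = expectation (\<lambda>\<omega>. quad k a \<omega> ^ 2) + (s k)\<^sup>2 * expectation (\<lambda>\<omega>. L \<omega> ^ 2)"
      unfolding qs by (rule indep_normal_step[OF normal s_pos]) (intro iv m Suc.IH(1) Lm k 2)+
    also have "\<dots> = 2 * (\<Sum>i<k. \<Sum>j<k. (a i j)\<^sup>2 * (s i)\<^sup>2 * (s j)\<^sup>2) + 4 * (\<Sum>j<k. (a k j)\<^sup>2 * (s k)\<^sup>2 * (s j)\<^sup>2)"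
      using Suc.IH(2) k 2 Lm(2) by (simp add: sum_distrib_left power_mult_distrib ac_simps)
    also have "\<dots> = 2 * (\<Sum>i<Suc k. \<Sum>j<Suc k. (a i j)\<^sup>2 * (s i)\<^sup>2 * (s j)\<^sup>2)"
      by (simp add: sum.distrib diag sym[of _ k] ac_simps)
    finally show ?case . }
  { case 3 show ?case unfolding qs
      by (rule indep_normal_fourth_moment_le[OF normal s_pos]) (intro iv m Suc.IH Lm k 3)+ }
qed

end

section \<open>Characteristic functions and Gaussian integration by parts\<close>

lemma (in prob_space) integrable_iexp_mult:
  assumes "integrable M Z" "X \<in> borel_measurable M"
  shows "integrable M (\<lambda>\<omega>. complex_of_real (Z \<omega>) * iexp (X \<omega>))"
proof (rule Bochner_Integration.integrable_bound[OF assms(1)])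
  show "(\<lambda>\<omega>. complex_of_real (Z \<omega>) * iexp (X \<omega>)) \<in> borel_measurable M"
    using assms by measurable
qed (simp add: norm_mult)

lemma (in prob_space) normal_iexp:
  assumes "distributed M lborel X (normal_density 0 s)" "s > 0"
  shows "expectation (\<lambda>\<omega>. iexp (u * X \<omega>)) = exp (- (u * s)\<^sup>2 / 2)"
proof -
  have d: "distributed M lborel (\<lambda>\<omega>. X \<omega> / s) std_normal_density"
    using assms normal_standard_normal_convert[of s X 0] by simp
  then have "distr M borel (\<lambda>\<omega>. X \<omega> / s) = density lborel std_normal_density"
    unfolding distributed_def by (metis distr_cong sets_lborel)
  then have "char (distr M borel (\<lambda>\<omega>. X \<omega> / s)) (u * s) = exp (- (u * s)\<^sup>2 / 2)"
    using char_std_normal_distribution by (simp add: fun_eq_iff)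
  moreover have "(\<lambda>\<omega>. X \<omega> / s) \<in> borel_measurable M"
    using distributed_measurable[OF d] by simp
  ultimately show ?thesis
    using assms(2) by (simp add: char_def integral_distr)
qed

text \<open>The second moment dominates the quadratic Taylor remainder of \<open>iexp\<close>, so
  the difference quotient is controlled by an explicit bound instead of a limit under the
  expectation.\<close>

lemma (in prob_space) has_vector_derivative_iexp_expectation:
  assumes [measurable]: "X \<in> borel_measurable M" and sq: "integrable M (\<lambda>\<omega>. (X \<omega>)\<^sup>2)"
  shows "((\<lambda>u. expectation (\<lambda>\<omega>. iexp (u * X \<omega>))) has_vector_derivative
           \<i> * expectation (\<lambda>\<omega>. complex_of_real (X \<omega>) * iexp (u * X \<omega>))) (at u within S)"
proof -
  define \<phi> where "\<phi> u = expectation (\<lambda>\<omega>. iexp (u * X \<omega>))" for u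
  define D where "D = \<i> * expectation (\<lambda>\<omega>. complex_of_real (X \<omega>) * iexp (u * X \<omega>))"
  have X: "integrable M X"
    by (rule square_integrable_imp_integrable) (use sq in auto)
  have i1: "integrable M (\<lambda>\<omega>. iexp (v * X \<omega>))" for v
    using integrable_iexp_mult[of "\<lambda>_. 1" "\<lambda>\<omega>. v * X \<omega>"] by simp
  have i2: "integrable M (\<lambda>\<omega>. complex_of_real (X \<omega>) * iexp (v * X \<omega>))" for v
    by (rule integrable_iexp_mult[OF X]) simp
  have bd: "norm (\<phi> v - \<phi> u - (v - u) *\<^sub>R D) \<le> (v - u)\<^sup>2 * expectation (\<lambda>\<omega>. (X \<omega>)\<^sup>2)" for v
  proof -
    have pt: "norm (iexp (v * x) - iexp (u * x) - (v - u) *\<^sub>R (\<i> * (complex_of_real x * iexp (u * x)))) \<le> (v - u)\<^sup>2 * x\<^sup>2" for x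
    proof -
      have "iexp (v * x) - iexp (u * x) - (v - u) *\<^sub>R (\<i> * (complex_of_real x * iexp (u * x)))
        = iexp (u * x) * (iexp ((v - u) * x) - (1 + \<i> * complex_of_real ((v - u) * x)))"
        by (simp add: algebra_simps scaleR_conv_of_real flip: exp_add)
      also have "norm \<dots> \<le> \<bar>(v - u) * x\<bar>\<^sup>2 / 2"
        using iexp_approx1[of "(v - u) * x" 1] by (simp add: norm_mult numeral_2_eq_2)
      also have "\<dots> \<le> (v - u)\<^sup>2 * x\<^sup>2"
        by (simp add: power_mult_distrib)
      finally show ?thesis .
    qed
    have "\<phi> v - \<phi> u - (v - u) *\<^sub>R D =
        expectation (\<lambda>\<omega>. iexp (v * X \<omega>) - iexp (u * X \<omega>) - (v - u) *\<^sub>R (\<i> * (complex_of_real (X \<omega>) * iexp (u * X \<omega>))))"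
      using i1 i2 by (simp add: \<phi>_def D_def)
    also have "norm \<dots> \<le> expectation (\<lambda>\<omega>. (v - u)\<^sup>2 * (X \<omega>)\<^sup>2)"
      by (rule order_trans[OF integral_norm_bound integral_mono]) (use i1 i2 sq pt in \<open>auto intro!: integrable_norm\<close>)
    finally show ?thesis by simp
  qed
  have "(\<phi> has_vector_derivative D) (at u within S)"
    unfolding has_vector_derivative_def has_derivative_iff_norm
  proof
    show "bounded_linear (\<lambda>x. x *\<^sub>R D)" by (rule bounded_linear_scaleR_left)
    show "((\<lambda>y. norm (\<phi> y - \<phi> u - (y - u) *\<^sub>R D) / norm (y - u)) \<longlongrightarrow> 0) (at u within S)"
    proof (rule Lim_null_comparison)
      show "\<forall>\<^sub>F y in at u within S. norm (norm (\<phi> y - \<phi> u - (y - u) *\<^sub>R D) / norm (y - u)) \<le> \<bar>y - u\<bar> * expectation (\<lambda>\<omega>. (X \<omega>)\<^sup>2)"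
        unfolding eventually_at_filter
      proof (intro always_eventually allI impI)
        fix y assume "y \<noteq> u"
        have "norm (\<phi> y - \<phi> u - (y - u) *\<^sub>R D) \<le> \<bar>y - u\<bar> * expectation (\<lambda>\<omega>. (X \<omega>)\<^sup>2) * \<bar>y - u\<bar>"
          using bd[of y] unfolding power2_abs[of "y - u", symmetric] power2_eq_square[of "\<bar>y - u\<bar>"] by (simp only: ac_simps)
        with \<open>y \<noteq> u\<close> show "norm (norm (\<phi> y - \<phi> u - (y - u) *\<^sub>R D) / norm (y - u)) \<le> \<bar>y - u\<bar> * expectation (\<lambda>\<omega>. (X \<omega>)\<^sup>2)"
          by (simp add: divide_le_eq)
      qed
      have "((\<lambda>y. \<bar>y - u\<bar> * expectation (\<lambda>\<omega>. (X \<omega>)\<^sup>2)) \<longlongrightarrow> \<bar>u - u\<bar> * expectation (\<lambda>\<omega>. (X \<omega>)\<^sup>2)) (at u within S)"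
        by (intro tendsto_intros)
      then show "((\<lambda>y. \<bar>y - u\<bar> * expectation (\<lambda>\<omega>. (X \<omega>)\<^sup>2)) \<longlongrightarrow> 0) (at u within S)" by simp
    qed
  qed
  then show ?thesis by (simp add: \<phi>_def[abs_def] D_def)
qed

text \<open>Stein's identity for exponentials, obtained by differentiating the explicit
  characteristic function in \<open>u\<close> and comparing with the derivative under the
  expectation.\<close>

lemma (in prob_space) normal_mult_iexp:
  assumes X: "distributed M lborel X (normal_density 0 s)" "s > 0"
  shows "expectation (\<lambda>\<omega>. complex_of_real (X \<omega>) * iexp (u * X \<omega>)) = \<i> * u * s\<^sup>2 * expectation (\<lambda>\<omega>. iexp (u * X \<omega>))"
proof -
  have [measurable]: "X \<in> borel_measurable M" using distributed_measurable[OF X(1)] by simp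
  have "((\<lambda>u. expectation (\<lambda>\<omega>. iexp (u * X \<omega>))) has_vector_derivative
           \<i> * expectation (\<lambda>\<omega>. complex_of_real (X \<omega>) * iexp (u * X \<omega>))) (at u)"
    by (rule has_vector_derivative_iexp_expectation) (use normal_integrable_power[OF X, of 2] in auto)
  moreover have "((\<lambda>u. complex_of_real (exp (- (u * s)\<^sup>2 / 2))) has_vector_derivative
      complex_of_real (- (u * s\<^sup>2) * exp (- (u * s)\<^sup>2 / 2))) (at u)"
    by (intro has_vector_derivative_of_real)
      (auto intro!: derivative_eq_intros simp: has_real_derivative_iff_has_vector_derivative[symmetric] power2_eq_square)
  ultimately have "\<i> * expectation (\<lambda>\<omega>. complex_of_real (X \<omega>) * iexp (u * X \<omega>)) = complex_of_real (- (u * s\<^sup>2) * exp (- (u * s)\<^sup>2 / 2))"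
    unfolding normal_iexp[OF X] by (rule vector_derivative_unique_at)
  then have "\<i> * (\<i> * expectation (\<lambda>\<omega>. complex_of_real (X \<omega>) * iexp (u * X \<omega>))) = \<i> * complex_of_real (- (u * s\<^sup>2) * exp (- (u * s)\<^sup>2 / 2))"
    by simp
  then show ?thesis
    unfolding normal_iexp[OF X] by (simp add: mult.assoc[symmetric])
qed

text \<open>With \<open>V\<close> frozen the exponent is affine in the Gaussian
  \<open>f (U \<omega>)\<close>, so the identity for a single variable applies; independence makes
  the joint law a product, and Fubini restores the average over \<open>V\<close>.\<close>

lemma (in prob_space) normal_integration_by_parts:
  fixes X :: "'a \<Rightarrow> real" and U V :: "'a \<Rightarrow> 'v"
  assumes ind: "indep_var S U N V"
    and X: "distributed M lborel (\<lambda>\<omega>. f (U \<omega>)) (normal_density 0 s)" "s > 0" and f: "f \<in> borel_measurable S"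
    and [measurable]: "a \<in> borel_measurable N" "b \<in> borel_measurable N" "z \<in> borel_measurable N"
    and int: "integrable M (\<lambda>\<omega>. z (V \<omega>))" "integrable M (\<lambda>\<omega>. z (V \<omega>) * b (V \<omega>))"
  shows "expectation (\<lambda>\<omega>. complex_of_real (f (U \<omega>) * z (V \<omega>)) * iexp (a (V \<omega>) + b (V \<omega>) * f (U \<omega>))) =
     \<i> * s\<^sup>2 * expectation (\<lambda>\<omega>. complex_of_real (z (V \<omega>) * b (V \<omega>)) * iexp (a (V \<omega>) + b (V \<omega>) * f (U \<omega>)))"
proof -
  note f[measurable]
  have [measurable]: "U \<in> measurable M S" "V \<in> measurable M N"
    using ind by (auto simp: indep_var_rv1 indep_var_rv2)
  let ?S = "distr M S U" and ?N = "distr M N V"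
  have eq: "distr M (S \<Otimes>\<^sub>M N) (\<lambda>\<omega>. (U \<omega>, V \<omega>)) = ?S \<Otimes>\<^sub>M ?N"
    using ind by (simp add: indep_var_distribution_eq)
  interpret S: prob_space ?S by (rule prob_space_distr) simp
  interpret N: prob_space ?N by (rule prob_space_distr) simp
  interpret P: pair_prob_space ?S ?N ..
  have fub: "expectation (\<lambda>\<omega>. h (U \<omega>) (V \<omega>)) = (LINT v|?N. expectation (\<lambda>\<omega>. h (U \<omega>) v))"
    if [measurable]: "case_prod h \<in> borel_measurable (S \<Otimes>\<^sub>M N)" and i: "integrable M (\<lambda>\<omega>. h (U \<omega>) (V \<omega>))"
    for h :: "'v \<Rightarrow> 'v \<Rightarrow> complex"
  proof -
    have "integrable (?S \<Otimes>\<^sub>M ?N) (case_prod h)"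
      unfolding eq[symmetric] using i by (subst integrable_distr_eq) auto
    then have "(LINT v|?N. LINT x|?S. h x v) = integral\<^sup>L (?S \<Otimes>\<^sub>M ?N) (case_prod h)"
      by (rule P.integral_snd)
    also have "\<dots> = expectation (\<lambda>\<omega>. h (U \<omega>) (V \<omega>))"
      unfolding eq[symmetric] by (subst integral_distr) auto
    also have "(LINT v|?N. LINT x|?S. h x v) = (LINT v|?N. expectation (\<lambda>\<omega>. h (U \<omega>) v))"
      by (intro Bochner_Integration.integral_cong refl integral_distr) auto
    finally show ?thesis by simp
  qed
  have iX: "integrable M (\<lambda>\<omega>. f (U \<omega>))"
    using normal_integrable_power[OF X, of 1] by simp
  have iv: "indep_var borel (\<lambda>\<omega>. f (U \<omega>)) borel (\<lambda>\<omega>. z (V \<omega>))"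
    using indep_var_compose[OF ind f \<open>z \<in> borel_measurable N\<close>] by (simp only: comp_def)
  have iXz: "integrable M (\<lambda>\<omega>. f (U \<omega>) * z (V \<omega>))"
    by (rule indep_var_integrable[OF iv iX int(1)])
  have "expectation (\<lambda>\<omega>. complex_of_real (f (U \<omega>) * z (V \<omega>)) * iexp (a (V \<omega>) + b (V \<omega>) * f (U \<omega>))) =
     (LINT v|?N. expectation (\<lambda>\<omega>. complex_of_real (f (U \<omega>) * z v) * iexp (a v + b v * f (U \<omega>))))"
  proof (rule fub)
    show "integrable M (\<lambda>\<omega>. complex_of_real (f (U \<omega>) * z (V \<omega>)) * iexp (a (V \<omega>) + b (V \<omega>) * f (U \<omega>)))"
      by (rule integrable_iexp_mult[OF iXz]) measurable
  qed measurable
  also have "\<dots> = (LINT v|?N. \<i> * s\<^sup>2 * expectation (\<lambda>\<omega>. complex_of_real (z v * b v) * iexp (a v + b v * f (U \<omega>))))"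
  proof (intro Bochner_Integration.integral_cong refl)
    fix v
    have "expectation (\<lambda>\<omega>. complex_of_real (f (U \<omega>) * z v) * iexp (a v + b v * f (U \<omega>)))
      = expectation (\<lambda>\<omega>. (z v * iexp (a v)) * (complex_of_real (f (U \<omega>)) * iexp (b v * f (U \<omega>))))"
      by (intro Bochner_Integration.integral_cong) (auto simp: algebra_simps exp_add)
    also have "\<dots> = (z v * iexp (a v)) * (\<i> * b v * s\<^sup>2 * expectation (\<lambda>\<omega>. iexp (b v * f (U \<omega>))))"
      using normal_mult_iexp[OF X, of "b v"] by simp
    also have "\<dots> = \<i> * s\<^sup>2 * ((z v * b v * iexp (a v)) * expectation (\<lambda>\<omega>. iexp (b v * f (U \<omega>))))"
      by simp
    also have "\<dots> = \<i> * s\<^sup>2 * expectation (\<lambda>\<omega>. (z v * b v * iexp (a v)) * iexp (b v * f (U \<omega>)))"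
      by simp
    also have "expectation (\<lambda>\<omega>. (z v * b v * iexp (a v)) * iexp (b v * f (U \<omega>))) = expectation (\<lambda>\<omega>. complex_of_real (z v * b v) * iexp (a v + b v * f (U \<omega>)))"
      by (intro Bochner_Integration.integral_cong) (auto simp: algebra_simps exp_add)
    finally show "expectation (\<lambda>\<omega>. complex_of_real (f (U \<omega>) * z v) * iexp (a v + b v * f (U \<omega>))) =
      \<i> * s\<^sup>2 * expectation (\<lambda>\<omega>. complex_of_real (z v * b v) * iexp (a v + b v * f (U \<omega>)))" .
  qed
  also have "\<dots> = \<i> * s\<^sup>2 * (LINT v|?N. expectation (\<lambda>\<omega>. complex_of_real (z v * b v) * iexp (a v + b v * f (U \<omega>))))"
    by simp
  also have "(LINT v|?N. expectation (\<lambda>\<omega>. complex_of_real (z v * b v) * iexp (a v + b v * f (U \<omega>)))) =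
     expectation (\<lambda>\<omega>. complex_of_real (z (V \<omega>) * b (V \<omega>)) * iexp (a (V \<omega>) + b (V \<omega>) * f (U \<omega>)))"
  proof (rule fub[symmetric])
    show "integrable M (\<lambda>\<omega>. complex_of_real (z (V \<omega>) * b (V \<omega>)) * iexp (a (V \<omega>) + b (V \<omega>) * f (U \<omega>)))"
      by (rule integrable_iexp_mult[OF int(2)]) measurable
  qed measurable
  finally show ?thesis .
qed

text \<open>Variation of constants. The integrating factor \<open>e\<close> turns the approximate
  equation into a bound on the derivative of \<open>\<psi>\<close>. Since \<open>e\<close> is
  largest at the ends of the interval, the mean value estimate produces the factor
  \<open>e u\<close>, which cancels; the symmetric interval serves both signs of
  \<open>u\<close>.\<close>

lemma gaussian_ode_bound:
  fixes \<phi> \<phi>' :: "real \<Rightarrow> complex" and v \<delta> :: real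
  assumes d: "\<And>t. (\<phi> has_vector_derivative \<phi>' t) (at t)"
    and b: "\<And>t. norm (\<phi>' t + t * v * \<phi> t) \<le> \<bar>t\<bar> * \<delta>" and "\<phi> 0 = 1" "v \<ge> 0" "\<delta> \<ge> 0"
  shows "norm (\<phi> u - exp (- (u\<^sup>2 * v / 2))) \<le> u\<^sup>2 * \<delta>"
proof -
  define e where "e t = exp (t\<^sup>2 * v / 2)" for t :: real
  define \<psi> where "\<psi> t = complex_of_real (e t) * \<phi> t" for t
  have de: "((\<lambda>t. complex_of_real (e t)) has_vector_derivative complex_of_real (t * v * e t)) (at t)" for t
    unfolding e_def by (intro has_vector_derivative_of_real)
      (auto intro!: derivative_eq_intros simp: has_real_derivative_iff_has_vector_derivative[symmetric])
  have d\<psi>: "(\<psi> has_vector_derivative e t * (\<phi>' t + t * v * \<phi> t)) (at t within S)" for t S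
  proof (rule has_vector_derivative_at_within)
    have "(\<psi> has_vector_derivative complex_of_real (e t) * \<phi>' t + complex_of_real (t * v * e t) * \<phi> t) (at t)"
      unfolding \<psi>_def by (rule has_vector_derivative_mult[OF de d])
    then show "(\<psi> has_vector_derivative e t * (\<phi>' t + t * v * \<phi> t)) (at t)"
      by (simp add: algebra_simps)
  qed
  have "norm (\<psi> u - \<psi> 0) \<le> (e u * (\<bar>u\<bar> * \<delta>)) * norm (u - 0)"
  proof (rule differentiable_bound[where S = "{-\<bar>u\<bar>..\<bar>u\<bar>}"])
    fix t assume t: "t \<in> {-\<bar>u\<bar>..\<bar>u\<bar>}"
    show "(\<psi> has_derivative (\<lambda>h. h *\<^sub>R (e t * (\<phi>' t + t * v * \<phi> t)))) (at t within {-\<bar>u\<bar>..\<bar>u\<bar>})"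
      using d\<psi> by (simp add: has_vector_derivative_def)
    have tu: "\<bar>t\<bar> \<le> \<bar>u\<bar>" using t by auto
    have "e t \<le> e u"
      unfolding e_def using tu \<open>v \<ge> 0\<close> by (auto intro!: mult_right_mono simp: abs_le_square_iff)
    then have "norm (e t * (\<phi>' t + t * v * \<phi> t)) \<le> e u * (\<bar>u\<bar> * \<delta>)"
      using b[of t] tu \<open>\<delta> \<ge> 0\<close> unfolding norm_mult
      by (intro mult_mono order_trans[OF b[of t]] mult_right_mono) (auto simp: e_def)
    then have "norm (h *\<^sub>R (e t * (\<phi>' t + t * v * \<phi> t))) \<le> e u * (\<bar>u\<bar> * \<delta>) * norm h" for h :: real
      unfolding norm_scaleR real_norm_def by (subst mult.commute) (rule mult_right_mono, auto)
    then show "onorm (\<lambda>h. h *\<^sub>R (e t * (\<phi>' t + t * v * \<phi> t))) \<le> e u * (\<bar>u\<bar> * \<delta>)"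
      by (rule onorm_le)
  qed auto
  then have n: "norm (\<psi> u - 1) \<le> e u * (u\<^sup>2 * \<delta>)"
    using \<open>\<phi> 0 = 1\<close> by (simp add: \<psi>_def e_def power2_eq_square ac_simps)
  have "complex_of_real (e u) * complex_of_real (exp (- (u\<^sup>2 * v / 2))) = 1"
    unfolding of_real_mult[symmetric] by (simp add: e_def flip: exp_add)
  then have "\<psi> u - 1 = complex_of_real (e u) * (\<phi> u - complex_of_real (exp (- (u\<^sup>2 * v / 2))))"
    by (simp add: \<psi>_def right_diff_distrib)
  with n have "e u * norm (\<phi> u - complex_of_real (exp (- (u\<^sup>2 * v / 2)))) \<le> e u * (u\<^sup>2 * \<delta>)"
    by (simp only: norm_mult norm_of_real) (simp add: e_def)
  then show ?thesis by (simp add: e_def)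
qed

section \<open>Normal approximation of off-diagonal quadratic forms\<close>

context gaussian_family
begin

lemma indep_pair:
  assumes "i < n" "j < n" "i \<noteq> j" "f \<in> borel_measurable borel" "g \<in> borel_measurable borel"
  shows "indep_var borel (\<lambda>\<omega>. f (\<xi> i \<omega>) :: real) borel (\<lambda>\<omega>. g (\<xi> j \<omega>) :: real)"
proof -
  note [measurable] = assms(5)
  have "(\<lambda>x. g (x j)) \<in> borel_measurable (PiM {j} (\<lambda>_. borel))"
    by measurable
  from indep_var_coordinate[OF indep _ _ _ assms(4) this, of i] show ?thesis
    using assms by simp
qed

lemma lin_sq_integrable: "k \<le> n \<Longrightarrow> integrable M (\<lambda>\<omega>. (lin k c \<omega>)\<^sup>2)"
  using integrable_power_mult_power[OF finite_measure_axioms, of "lin k c" "\<lambda>_. 1" 2 0] lin_moments(1)[of k c] by simp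

text \<open>The centred squares are uncorrelated by independence, and each has variance 3 s^4 - s^4
  = 2 s^4. They form the diagonal part in \<open>contraction_variance\<close>, which
  \<open>quad_moments\<close> does not cover.\<close>

lemma diag_moment:
  shows "integrable M (\<lambda>\<omega>. (\<Sum>j<n. c j * ((\<xi> j \<omega>)\<^sup>2 - (s j)\<^sup>2))\<^sup>2)"
    and "expectation (\<lambda>\<omega>. (\<Sum>j<n. c j * ((\<xi> j \<omega>)\<^sup>2 - (s j)\<^sup>2))\<^sup>2) = 2 * (\<Sum>j<n. (c j)\<^sup>2 * (s j)\<^sup>2 * (s j)\<^sup>2)"
proof -
  define \<eta> where "\<eta> j \<omega> = (\<xi> j \<omega>)\<^sup>2 - (s j)\<^sup>2" for j \<omega>
  have ip: "integrable M (\<lambda>\<omega>. \<xi> j \<omega> ^ k)" if "j < n" for j k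
    by (rule normal_integrable_power[OF normal s_pos]) (use that in auto)
  note mom = normal_moments[OF normal s_pos]
  have i\<eta>: "integrable M (\<eta> j)" and E\<eta>: "expectation (\<eta> j) = 0" if "j < n" for j
    unfolding \<eta>_def using ip[OF that, of 2] mom(2)[OF that that] by (auto simp: prob_space)
  have sq: "\<eta> j \<omega> * \<eta> j \<omega> = \<xi> j \<omega> ^ 4 - 2 * (s j)\<^sup>2 * \<xi> j \<omega> ^ 2 + (s j) ^ 4" for j \<omega>
    by (simp add: \<eta>_def power2_eq_square power4_eq_xxxx algebra_simps)
  have P: "integrable M (\<lambda>\<omega>. \<eta> i \<omega> * \<eta> j \<omega>)"
      "expectation (\<lambda>\<omega>. \<eta> i \<omega> * \<eta> j \<omega>) = (if i = j then 2 * (s j)\<^sup>2 * (s j)\<^sup>2 else 0)" if "i < n" "j < n" for i j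
  proof -
    show "integrable M (\<lambda>\<omega>. \<eta> i \<omega> * \<eta> j \<omega>)"
    proof (cases "i = j")
      case True
      then show ?thesis using ip[OF that(2), of 4] ip[OF that(2), of 2] by (simp add: sq)
    next
      case False
      show ?thesis
        by (rule indep_var_integrable[OF indep_pair[OF that False] i\<eta>[OF that(1), unfolded \<eta>_def]
              i\<eta>[OF that(2), unfolded \<eta>_def], folded \<eta>_def]) auto
    qed
    show "expectation (\<lambda>\<omega>. \<eta> i \<omega> * \<eta> j \<omega>) = (if i = j then 2 * (s j)\<^sup>2 * (s j)\<^sup>2 else 0)"
    proof (cases "i = j")
      case True
      then show ?thesis
        using ip[OF that(2), of 4] ip[OF that(2), of 2] mom(2,4)[OF that(2) that(2)]
        by (simp add: sq prob_space power2_eq_square power4_eq_xxxx)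
    next
      case False
      have "expectation (\<lambda>\<omega>. \<eta> i \<omega> * \<eta> j \<omega>) = expectation (\<eta> i) * expectation (\<eta> j)"
        by (rule indep_var_lebesgue_integral[OF indep_pair[OF that False] i\<eta>[OF that(1), unfolded \<eta>_def]
              i\<eta>[OF that(2), unfolded \<eta>_def], folded \<eta>_def]) auto
      then show ?thesis using False E\<eta> that by simp
    qed
  qed
  have ex: "(\<Sum>j<n. c j * \<eta> j \<omega>)\<^sup>2 = (\<Sum>i<n. \<Sum>j<n. (c i * c j) * (\<eta> i \<omega> * \<eta> j \<omega>))" for \<omega>
    unfolding power2_eq_square sum_product by (simp add: ac_simps)
  show "integrable M (\<lambda>\<omega>. (\<Sum>j<n. c j * ((\<xi> j \<omega>)\<^sup>2 - (s j)\<^sup>2))\<^sup>2)"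
    unfolding \<eta>_def[symmetric] ex by (intro Bochner_Integration.integrable_sum integrable_mult_right P) auto
  have "expectation (\<lambda>\<omega>. (\<Sum>j<n. c j * \<eta> j \<omega>)\<^sup>2) = (\<Sum>i<n. \<Sum>j<n. (c i * c j) * (if i = j then 2 * (s j)\<^sup>2 * (s j)\<^sup>2 else 0))"
    unfolding ex using P by (subst Bochner_Integration.integral_sum) (auto intro!: Bochner_Integration.integrable_sum sum.cong)
  also have "\<dots> = (\<Sum>i<n. 2 * ((c i)\<^sup>2 * (s i)\<^sup>2 * (s i)\<^sup>2))"
    by (intro sum.cong refl) (simp add: if_distrib[of "\<lambda>x. _ * x"] power2_eq_square cong: if_cong)
  finally show "expectation (\<lambda>\<omega>. (\<Sum>j<n. c j * ((\<xi> j \<omega>)\<^sup>2 - (s j)\<^sup>2))\<^sup>2) = 2 * (\<Sum>j<n. (c j)\<^sup>2 * (s j)\<^sup>2 * (s j)\<^sup>2)"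
    unfolding \<eta>_def by (simp add: sum_distrib_left)
qed

text \<open>Isolates variable \<open>i\<close>: because of the zero diagonal neither the remainder
  nor the slope contains \<open>x i\<close>, so both are functions of the other variables and hence
  independent of it.\<close>

lemma quad_split:
  assumes sym: "\<And>i j. a i j = a j i" and diag: "\<And>i. a i i = 0" and "i < n"
  shows "(\<Sum>j<n. \<Sum>k<n. a j k * x j * x k) =
    (\<Sum>j\<in>{..<n} - {i}. \<Sum>k\<in>{..<n} - {i}. a j k * x j * x k) + 2 * (\<Sum>j\<in>{..<n} - {i}. a i j * x j) * (x i :: real)"
    "(\<Sum>j<n. a i j * x j) = (\<Sum>j\<in>{..<n} - {i}. a i j * x j)"
proof -
  have r: "(\<Sum>j<n. f j) = f i + (\<Sum>j\<in>{..<n} - {i}. f j)" for f :: "nat \<Rightarrow> real"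
    using assms(3) by (intro sum.remove) auto
  show "(\<Sum>j<n. a i j * x j) = (\<Sum>j\<in>{..<n} - {i}. a i j * x j)" by (simp add: r diag)
  define J where "J = {..<n} - {i}"
  have "(\<Sum>j<n. \<Sum>k<n. a j k * x j * x k) = (\<Sum>k<n. a i k * x i * x k) + (\<Sum>j\<in>J. \<Sum>k<n. a j k * x j * x k)"
    unfolding J_def by (rule r)
  also have "(\<Sum>k<n. a i k * x i * x k) = (\<Sum>k\<in>J. a i k * x i * x k)"
    by (subst r) (simp add: diag J_def)
  also have "(\<Sum>j\<in>J. \<Sum>k<n. a j k * x j * x k) = (\<Sum>j\<in>J. a i j * x i * x j + (\<Sum>k\<in>J. a j k * x j * x k))"
    by (subst r) (simp add: J_def sym[of _ i] ac_simps)
  also have "(\<Sum>k\<in>J. a i k * x i * x k) + \<dots> = (\<Sum>j\<in>J. \<Sum>k\<in>J. a j k * x j * x k) + 2 * (\<Sum>j\<in>J. a i j * x i * x j)"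
    by (simp add: sum.distrib)
  also have "(\<Sum>j\<in>J. a i j * x i * x j) = (\<Sum>j\<in>J. a i j * x j) * x i"
    by (subst sum_distrib_right) (simp add: ac_simps)
  finally show "(\<Sum>j<n. \<Sum>k<n. a j k * x j * x k) =
    (\<Sum>j\<in>{..<n} - {i}. \<Sum>k\<in>{..<n} - {i}. a j k * x j * x k) + 2 * (\<Sum>j\<in>{..<n} - {i}. a i j * x j) * (x i :: real)"
    by (simp add: J_def)
qed

text \<open>Write \<open>quad\<close> as the sum of \<open>\<xi> i * lin n (a i)\<close> and
  integrate by parts in each \<open>\<xi> i\<close>, whose coefficient in the form is
  \<open>2 * lin n (a i)\<close>. The resulting variable is half the squared gradient of the form,
  weighted by the variances, as in the Malliavin-Stein method.\<close>

lemma quad_stein: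
  assumes sym: "\<And>i j. a i j = a j i" and diag: "\<And>i. a i i = 0"
  shows "expectation (\<lambda>\<omega>. complex_of_real (quad n a \<omega>) * iexp (u * quad n a \<omega>)) =
    \<i> * u * expectation (\<lambda>\<omega>. complex_of_real (2 * (\<Sum>i<n. (s i)\<^sup>2 * (lin n (a i) \<omega>)\<^sup>2)) * iexp (u * quad n a \<omega>))"
proof -
  have q: "quad n a \<omega> = (\<Sum>i<n. \<xi> i \<omega> * lin n (a i) \<omega>)" for \<omega>
    by (simp add: quad_def lin_def sum_distrib_left sum_distrib_right ac_simps)
  have ibp: "integrable M (\<lambda>\<omega>. \<xi> i \<omega> * lin n (a i) \<omega>) \<and>
      expectation (\<lambda>\<omega>. complex_of_real (\<xi> i \<omega> * lin n (a i) \<omega>) * iexp (u * quad n a \<omega>)) =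
      \<i> * (s i)\<^sup>2 * expectation (\<lambda>\<omega>. complex_of_real (lin n (a i) \<omega> * (2 * u * lin n (a i) \<omega>)) * iexp (u * quad n a \<omega>))"
    if i: "i < n" for i
  proof -
    define J where "J = {..<n} - {i}"
    define U where "U = (\<lambda>\<omega>. restrict (\<lambda>j. \<xi> j \<omega>) {i})"
    define V where "V = (\<lambda>\<omega>. restrict (\<lambda>j. \<xi> j \<omega>) J)"
    define z where "z = (\<lambda>x. \<Sum>j\<in>J. a i j * x j)"
    define A where "A = (\<lambda>x. u * (\<Sum>j\<in>J. \<Sum>k\<in>J. a j k * x j * x k))"
    have ind: "indep_var (PiM {i} (\<lambda>_. borel)) U (PiM J (\<lambda>_. borel)) V"
      unfolding U_def V_def by (rule indep_var_restrict[OF indep]) (use i in \<open>auto simp: J_def\<close>)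
    have m: "A \<in> borel_measurable (PiM J (\<lambda>_. borel))" "z \<in> borel_measurable (PiM J (\<lambda>_. borel))"
        "(\<lambda>x. 2 * u * z x) \<in> borel_measurable (PiM J (\<lambda>_. borel))"
      unfolding A_def z_def by (intro borel_measurable_sum borel_measurable_times measurable_const measurable_component_singleton; simp)+
    have zV: "z (V \<omega>) = lin n (a i) \<omega>" for \<omega>
      using quad_split(2)[of a i, OF sym diag i, where x = "\<lambda>j. \<xi> j \<omega>"] by (simp add: z_def V_def lin_def J_def)
    have AV: "A (V \<omega>) + 2 * u * z (V \<omega>) * \<xi> i \<omega> = u * quad n a \<omega>" for \<omega>
      unfolding quad_def quad_split(1)[of a i, OF sym diag i, where x = "\<lambda>j. \<xi> j \<omega>"]
      by (simp add: A_def z_def V_def J_def algebra_simps)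
    have f: "(\<lambda>x. x i) \<in> borel_measurable (PiM {i} (\<lambda>_. borel))" by simp
    have U: "U \<omega> i = \<xi> i \<omega>" for \<omega> by (simp add: U_def)
    have L2: "integrable M (\<lambda>\<omega>. (lin n (a i) \<omega>)\<^sup>2)" by (rule lin_sq_integrable) simp
    have L1: "integrable M (lin n (a i))"
      by (rule square_integrable_imp_integrable) (use L2 in auto)
    have nd: "distributed M lborel (\<lambda>\<omega>. U \<omega> i) (normal_density 0 (s i))" unfolding U by (rule normal[OF i])
    have "indep_var borel (\<lambda>\<omega>. U \<omega> i) borel (\<lambda>\<omega>. z (V \<omega>))"
      using indep_var_compose[OF ind f m(2)] by (simp only: comp_def)
    then have "indep_var borel (\<xi> i) borel (lin n (a i))" unfolding U zV by simp
    then have "integrable M (\<lambda>\<omega>. \<xi> i \<omega> * lin n (a i) \<omega>)"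
      by (rule indep_var_integrable) (use normal_integrable_power[OF normal[OF i] s_pos[OF i], of 1] L1 in auto)
    moreover have "expectation (\<lambda>\<omega>. complex_of_real (U \<omega> i * z (V \<omega>)) * iexp (A (V \<omega>) + 2 * u * z (V \<omega>) * U \<omega> i)) =
     \<i> * (s i)\<^sup>2 * expectation (\<lambda>\<omega>. complex_of_real (z (V \<omega>) * (2 * u * z (V \<omega>))) * iexp (A (V \<omega>) + 2 * u * z (V \<omega>) * U \<omega> i))"
    proof (rule normal_integration_by_parts[OF ind nd s_pos[OF i] f m(1,3,2)])
      have "integrable M (\<lambda>\<omega>. 2 * u * (lin n (a i) \<omega>)\<^sup>2)" using L2 by simp
      then show "integrable M (\<lambda>\<omega>. z (V \<omega>) * (2 * u * z (V \<omega>)))" unfolding zV by (simp add: power2_eq_square ac_simps)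
      show "integrable M (\<lambda>\<omega>. z (V \<omega>))" unfolding zV by (rule L1)
    qed
    ultimately show ?thesis unfolding U AV unfolding zV by blast
  qed
  have L2: "integrable M (\<lambda>\<omega>. (lin n (a i) \<omega>)\<^sup>2)" for i by (rule lin_sq_integrable) simp
  have "expectation (\<lambda>\<omega>. complex_of_real (quad n a \<omega>) * iexp (u * quad n a \<omega>)) =
    expectation (\<lambda>\<omega>. \<Sum>i<n. complex_of_real (\<xi> i \<omega> * lin n (a i) \<omega>) * iexp (u * quad n a \<omega>))"
    by (subst (1) q) (simp add: sum_distrib_right)
  also have "\<dots> = (\<Sum>i<n. expectation (\<lambda>\<omega>. complex_of_real (\<xi> i \<omega> * lin n (a i) \<omega>) * iexp (u * quad n a \<omega>)))"
    by (intro Bochner_Integration.integral_sum integrable_iexp_mult) (use ibp in auto)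
  also have "\<dots> = (\<Sum>i<n. \<i> * (s i)\<^sup>2 * expectation (\<lambda>\<omega>. (2 * u) * (complex_of_real ((lin n (a i) \<omega>)\<^sup>2) * iexp (u * quad n a \<omega>))))"
    using ibp by (intro sum.cong refl) (simp add: power2_eq_square ac_simps)
  also have "\<dots> = \<i> * u * (\<Sum>i<n. expectation (\<lambda>\<omega>. complex_of_real (2 * ((s i)\<^sup>2 * (lin n (a i) \<omega>)\<^sup>2)) * iexp (u * quad n a \<omega>)))"
    unfolding sum_distrib_left
  proof (intro sum.cong refl)
    fix i
    have "expectation (\<lambda>\<omega>. complex_of_real (2 * ((s i)\<^sup>2 * (lin n (a i) \<omega>)\<^sup>2)) * iexp (u * quad n a \<omega>)) =
      expectation (\<lambda>\<omega>. complex_of_real (2 * (s i)\<^sup>2) * (complex_of_real ((lin n (a i) \<omega>)\<^sup>2) * iexp (u * quad n a \<omega>)))"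
      by (simp add: mult.assoc)
    then show "\<i> * (s i)\<^sup>2 * expectation (\<lambda>\<omega>. (2 * u) * (complex_of_real ((lin n (a i) \<omega>)\<^sup>2) * iexp (u * quad n a \<omega>))) =
      \<i> * u * expectation (\<lambda>\<omega>. complex_of_real (2 * ((s i)\<^sup>2 * (lin n (a i) \<omega>)\<^sup>2)) * iexp (u * quad n a \<omega>))"
      by (simp only: integral_mult_right_zero of_real_mult) simp
  qed
  also have "(\<Sum>i<n. expectation (\<lambda>\<omega>. complex_of_real (2 * ((s i)\<^sup>2 * (lin n (a i) \<omega>)\<^sup>2)) * iexp (u * quad n a \<omega>))) =
     expectation (\<lambda>\<omega>. \<Sum>i<n. complex_of_real (2 * ((s i)\<^sup>2 * (lin n (a i) \<omega>)\<^sup>2)) * iexp (u * quad n a \<omega>))"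
    by (intro Bochner_Integration.integral_sum[symmetric] integrable_iexp_mult) (use L2 in auto)
  also have "\<dots> = expectation (\<lambda>\<omega>. complex_of_real (2 * (\<Sum>i<n. (s i)\<^sup>2 * (lin n (a i) \<omega>)\<^sup>2)) * iexp (u * quad n a \<omega>))"
    by (simp add: sum_distrib_right sum_distrib_left)
  finally show ?thesis .
qed

text \<open>\<open>G\<close> is again a quadratic form, with matrix twice the contraction
  \<open>b\<close> of \<open>a\<close> with itself, and \<open>v\<close> is its mean. The difference
  splits into an off-diagonal form and centred squares, each with a known second moment.\<close>

lemma contraction_variance:
  fixes a :: "nat \<Rightarrow> nat \<Rightarrow> real"
  defines "b j k \<equiv> (\<Sum>i<n. (s i)\<^sup>2 * a i j * a i k)"
  defines "G \<omega> \<equiv> 2 * (\<Sum>i<n. (s i)\<^sup>2 * (lin n (a i) \<omega>)\<^sup>2)"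
    and "v \<equiv> 2 * (\<Sum>i<n. \<Sum>j<n. (a i j)\<^sup>2 * (s i)\<^sup>2 * (s j)\<^sup>2)"
  shows "integrable M (\<lambda>\<omega>. (G \<omega> - v)\<^sup>2)"
    and "expectation (\<lambda>\<omega>. (G \<omega> - v)\<^sup>2) \<le> 16 * (\<Sum>j<n. \<Sum>k<n. (b j k)\<^sup>2 * (s j)\<^sup>2 * (s k)\<^sup>2)"
proof -
  define b' where "b' j k = (if j = k then 0 else b j k)" for j k
  define D where "D \<omega> = (\<Sum>j<n. b j j * ((\<xi> j \<omega>)\<^sup>2 - (s j)\<^sup>2))" for \<omega>
  have b_sym: "b j k = b k j" for j k by (simp add: b_def ac_simps)
  have G1: "G \<omega> = 2 * (\<Sum>j<n. \<Sum>k<n. b j k * \<xi> j \<omega> * \<xi> k \<omega>)" for \<omega>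
  proof -
    have "(\<Sum>i<n. (s i)\<^sup>2 * (lin n (a i) \<omega>)\<^sup>2) = (\<Sum>i<n. \<Sum>j<n. \<Sum>k<n. (s i)\<^sup>2 * a i j * a i k * \<xi> j \<omega> * \<xi> k \<omega>)"
      unfolding lin_def power2_eq_square[of "sum _ _"]
      unfolding sum_product
      unfolding sum_distrib_left by (simp add: ac_simps)
    also have "\<dots> = (\<Sum>j<n. \<Sum>i<n. \<Sum>k<n. (s i)\<^sup>2 * a i j * a i k * \<xi> j \<omega> * \<xi> k \<omega>)"
      by (rule sum.swap)
    also have "\<dots> = (\<Sum>j<n. \<Sum>k<n. \<Sum>i<n. (s i)\<^sup>2 * a i j * a i k * \<xi> j \<omega> * \<xi> k \<omega>)"
      by (intro sum.cong refl sum.swap)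
    finally show ?thesis by (simp add: G_def b_def sum_distrib_right)
  qed
  have v1: "v = 2 * (\<Sum>j<n. b j j * (s j)\<^sup>2)"
  proof -
    have "(\<Sum>i<n. \<Sum>j<n. (a i j)\<^sup>2 * (s i)\<^sup>2 * (s j)\<^sup>2) = (\<Sum>j<n. \<Sum>i<n. (a i j)\<^sup>2 * (s i)\<^sup>2 * (s j)\<^sup>2)"
      by (rule sum.swap)
    then show ?thesis by (simp add: v_def b_def sum_distrib_right sum_distrib_left power2_eq_square ac_simps)
  qed
  have split: "(\<Sum>j<n. \<Sum>k<n. b j k * x j * x k) = (\<Sum>j<n. \<Sum>k<n. b' j k * x j * x k) + (\<Sum>j<n. b j j * (x j)\<^sup>2)" for x :: "nat \<Rightarrow> real"
  proof -
    have "(\<Sum>k<n. b j k * x j * x k) = (\<Sum>k<n. b' j k * x j * x k) + b j j * (x j)\<^sup>2" if "j < n" for j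
    proof -
      have "(\<Sum>k<n. b j k * x j * x k) = (\<Sum>k<n. b' j k * x j * x k + (if k = j then b j j * (x j)\<^sup>2 else 0))"
        by (intro sum.cong) (auto simp: b'_def power2_eq_square)
      then show ?thesis using that by (simp add: sum.distrib)
    qed
    then show ?thesis by (simp flip: sum.distrib)
  qed
  have GQ: "G \<omega> - v = 2 * (quad n b' \<omega> + D \<omega>)" for \<omega>
    unfolding G1 v1 split D_def quad_def by (simp add: sum_subtractf right_diff_distrib)
  \<comment> \<open>The constant 16 arises as 4 from the outer factor 2, times 2 from
    \<open>(x + y)^2 \<le> 2 (x^2 + y^2)\<close>, times 2 from the second moments of the two
    parts.\<close>
  have le: "(G \<omega> - v)\<^sup>2 \<le> 8 * ((quad n b' \<omega>)\<^sup>2 + (D \<omega>)\<^sup>2)" for \<omega>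
    unfolding GQ using sum_squares_bound[of "quad n b' \<omega>" "D \<omega>"] by (simp add: power2_eq_square algebra_simps)
  have q: "integrable M (\<lambda>\<omega>. (quad n b' \<omega>)\<^sup>2)"
    using integrable_power_mult_power[OF finite_measure_axioms, of "quad n b'" "\<lambda>_. 1" 2 0] quad_moments(1)[of b' n] b_sym
    by (auto simp: b'_def)
  have D2: "integrable M (\<lambda>\<omega>. (D \<omega>)\<^sup>2)" unfolding D_def by (rule diag_moment)
  have [measurable]: "D \<in> borel_measurable M" unfolding D_def[abs_def] by (intro borel_measurable_sum) auto
  show i: "integrable M (\<lambda>\<omega>. (G \<omega> - v)\<^sup>2)"
  proof (rule Bochner_Integration.integrable_bound)
    show "integrable M (\<lambda>\<omega>. 8 * ((quad n b' \<omega>)\<^sup>2 + (D \<omega>)\<^sup>2))" using q D2 by simp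
    show "(\<lambda>\<omega>. (G \<omega> - v)\<^sup>2) \<in> borel_measurable M" unfolding GQ by simp
    show "AE \<omega> in M. norm ((G \<omega> - v)\<^sup>2) \<le> norm (8 * ((quad n b' \<omega>)\<^sup>2 + (D \<omega>)\<^sup>2))"
      using le by simp
  qed
  have "expectation (\<lambda>\<omega>. (G \<omega> - v)\<^sup>2) \<le> expectation (\<lambda>\<omega>. 8 * ((quad n b' \<omega>)\<^sup>2 + (D \<omega>)\<^sup>2))"
    by (rule integral_mono[OF i]) (use q D2 le in auto)
  also have "\<dots> = 8 * (expectation (\<lambda>\<omega>. (quad n b' \<omega>)\<^sup>2) + expectation (\<lambda>\<omega>. (D \<omega>)\<^sup>2))"
    using q D2 by simp
  also have "expectation (\<lambda>\<omega>. (quad n b' \<omega>)\<^sup>2) = 2 * (\<Sum>i<n. \<Sum>j<n. (b' i j)\<^sup>2 * (s i)\<^sup>2 * (s j)\<^sup>2)"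
    by (rule quad_moments(2)) (auto simp: b'_def b_sym)
  also have "expectation (\<lambda>\<omega>. (D \<omega>)\<^sup>2) = 2 * (\<Sum>j<n. (b j j)\<^sup>2 * (s j)\<^sup>2 * (s j)\<^sup>2)"
    unfolding D_def by (rule diag_moment)
  also have "8 * (2 * (\<Sum>i<n. \<Sum>j<n. (b' i j)\<^sup>2 * (s i)\<^sup>2 * (s j)\<^sup>2) + 2 * (\<Sum>j<n. (b j j)\<^sup>2 * (s j)\<^sup>2 * (s j)\<^sup>2))
     = 16 * (\<Sum>i<n. (\<Sum>j<n. (b' i j)\<^sup>2 * (s i)\<^sup>2 * (s j)\<^sup>2) + (b i i)\<^sup>2 * (s i)\<^sup>2 * (s i)\<^sup>2)"
    by (simp add: sum.distrib)
  also have "(\<Sum>i<n. (\<Sum>j<n. (b' i j)\<^sup>2 * (s i)\<^sup>2 * (s j)\<^sup>2) + (b i i)\<^sup>2 * (s i)\<^sup>2 * (s i)\<^sup>2) = (\<Sum>j<n. \<Sum>k<n. (b j k)\<^sup>2 * (s j)\<^sup>2 * (s k)\<^sup>2)"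
  proof (intro sum.cong refl)
    fix i assume "i \<in> {..<n}"
    have "(\<Sum>k<n. (b i k)\<^sup>2 * (s i)\<^sup>2 * (s k)\<^sup>2) = (\<Sum>k<n. (b' i k)\<^sup>2 * (s i)\<^sup>2 * (s k)\<^sup>2 + (if k = i then (b i i)\<^sup>2 * (s i)\<^sup>2 * (s i)\<^sup>2 else 0))"
      by (intro sum.cong) (auto simp: b'_def)
    then show "(\<Sum>j<n. (b' i j)\<^sup>2 * (s i)\<^sup>2 * (s j)\<^sup>2) + (b i i)\<^sup>2 * (s i)\<^sup>2 * (s i)\<^sup>2 = (\<Sum>k<n. (b i k)\<^sup>2 * (s i)\<^sup>2 * (s k)\<^sup>2)"
      using \<open>i \<in> {..<n}\<close> by (simp add: sum.distrib)
  qed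
  finally show "expectation (\<lambda>\<omega>. (G \<omega> - v)\<^sup>2) \<le> 16 * (\<Sum>j<n. \<Sum>k<n. (b j k)\<^sup>2 * (s j)\<^sup>2 * (s k)\<^sup>2)" .
qed

text \<open>The double sum in the exponent is half the variance of the form, hence no factor 1/2;
  the 4 is the square root of the 16 in \<open>contraction_variance\<close>.\<close>

theorem quad_char_bound:
  assumes sym: "\<And>i j. a i j = a j i" and diag: "\<And>i. a i i = 0"
  shows "norm (expectation (\<lambda>\<omega>. iexp (u * quad n a \<omega>)) - exp (- (u\<^sup>2 * (\<Sum>i<n. \<Sum>j<n. (a i j)\<^sup>2 * (s i)\<^sup>2 * (s j)\<^sup>2))))
    \<le> u\<^sup>2 * (4 * sqrt (\<Sum>j<n. \<Sum>k<n. (\<Sum>i<n. (s i)\<^sup>2 * a i j * a i k)\<^sup>2 * (s j)\<^sup>2 * (s k)\<^sup>2))"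
proof -
  define G where "G \<omega> = 2 * (\<Sum>i<n. (s i)\<^sup>2 * (lin n (a i) \<omega>)\<^sup>2)" for \<omega>
  define v where "v = 2 * (\<Sum>i<n. \<Sum>j<n. (a i j)\<^sup>2 * (s i)\<^sup>2 * (s j)\<^sup>2)"
  define R where "R = (\<Sum>j<n. \<Sum>k<n. (\<Sum>i<n. (s i)\<^sup>2 * a i j * a i k)\<^sup>2 * (s j)\<^sup>2 * (s k)\<^sup>2)"
  define \<phi> where "\<phi> t = expectation (\<lambda>\<omega>. iexp (t * quad n a \<omega>))" for t
  define \<phi>' where "\<phi>' t = \<i> * expectation (\<lambda>\<omega>. complex_of_real (quad n a \<omega>) * iexp (t * quad n a \<omega>))" for t
  have q2: "integrable M (\<lambda>\<omega>. (quad n a \<omega>)\<^sup>2)"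
    using integrable_power_mult_power[OF finite_measure_axioms, of "quad n a" "\<lambda>_. 1" 2 0] quad_moments(1)[of a, OF sym diag, of n]
    by auto
  have cv: "integrable M (\<lambda>\<omega>. (G \<omega> - v)\<^sup>2)" "expectation (\<lambda>\<omega>. (G \<omega> - v)\<^sup>2) \<le> 16 * R"
    unfolding G_def v_def R_def by (rule contraction_variance)+
  have [measurable]: "G \<in> borel_measurable M"
    unfolding G_def[abs_def] by (intro borel_measurable_times borel_measurable_sum borel_measurable_power lin_measurable) auto
  have Gv1: "integrable M (\<lambda>\<omega>. G \<omega> - v)"
    by (rule square_integrable_imp_integrable) (use cv(1) in auto)
  then have Gi: "integrable M G" using Bochner_Integration.integrable_add[OF Gv1, of "\<lambda>_. v"] by simp
  have R0: "R \<ge> 0" unfolding R_def by (intro sum_nonneg) auto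
  have "(expectation (\<lambda>\<omega>. \<bar>(G \<omega> - v) * 1\<bar>))\<^sup>2 \<le> expectation (\<lambda>\<omega>. (G \<omega> - v)\<^sup>2) * expectation (\<lambda>\<omega>. 1\<^sup>2)"
    by (rule integral_mult_Cauchy_Schwarz) (use cv(1) in auto)
  also have "\<dots> \<le> (4 * sqrt R)\<^sup>2" using cv(2) R0 by (simp add: prob_space power_mult_distrib)
  finally have "expectation (\<lambda>\<omega>. \<bar>(G \<omega> - v) * 1\<bar>) \<le> 4 * sqrt R"
    by (rule power2_le_imp_le) (use R0 in auto)
  then have \<delta>: "expectation (\<lambda>\<omega>. \<bar>G \<omega> - v\<bar>) \<le> 4 * sqrt R" by simp
  have "norm (\<phi> u - exp (- (u\<^sup>2 * v / 2))) \<le> u\<^sup>2 * (4 * sqrt R)"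
  proof (rule gaussian_ode_bound[where \<phi>' = \<phi>'])
    fix t
    show "(\<phi> has_vector_derivative \<phi>' t) (at t)"
      unfolding \<phi>_def \<phi>'_def by (rule has_vector_derivative_iexp_expectation) (use q2 in auto)
    have iG: "integrable M (\<lambda>\<omega>. complex_of_real (G \<omega>) * iexp (t * quad n a \<omega>))"
      by (rule integrable_iexp_mult[OF Gi]) simp
    have i1: "integrable M (\<lambda>\<omega>. iexp (t * quad n a \<omega>))"
      using integrable_iexp_mult[of "\<lambda>_. 1" "\<lambda>\<omega>. t * quad n a \<omega>"] by simp
    have "\<phi>' t + t * v * \<phi> t = - t * (expectation (\<lambda>\<omega>. complex_of_real (G \<omega>) * iexp (t * quad n a \<omega>)) - v * \<phi> t)"
      unfolding \<phi>'_def quad_stein[of a, OF sym diag] G_def by (simp add: algebra_simps)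
    also have "expectation (\<lambda>\<omega>. complex_of_real (G \<omega>) * iexp (t * quad n a \<omega>)) - v * \<phi> t =
       expectation (\<lambda>\<omega>. complex_of_real (G \<omega>) * iexp (t * quad n a \<omega>) - v * iexp (t * quad n a \<omega>))"
      using iG i1 by (simp add: \<phi>_def)
    also have "\<dots> = expectation (\<lambda>\<omega>. complex_of_real (G \<omega> - v) * iexp (t * quad n a \<omega>))"
      by (simp add: algebra_simps)
    finally have "norm (\<phi>' t + t * v * \<phi> t) = \<bar>t\<bar> * norm (expectation (\<lambda>\<omega>. complex_of_real (G \<omega> - v) * iexp (t * quad n a \<omega>)))"
      by (simp add: norm_mult)
    also have "\<dots> \<le> \<bar>t\<bar> * expectation (\<lambda>\<omega>. norm (complex_of_real (G \<omega> - v) * iexp (t * quad n a \<omega>)))"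
      by (intro mult_left_mono integral_norm_bound) auto
    also have "\<dots> = \<bar>t\<bar> * expectation (\<lambda>\<omega>. \<bar>G \<omega> - v\<bar>)"
      by (simp only: norm_mult norm_of_real norm_exp_i_times mult_1_right)
    also have "\<dots> \<le> \<bar>t\<bar> * (4 * sqrt R)" by (intro mult_left_mono \<delta>) auto
    finally show "norm (\<phi>' t + t * v * \<phi> t) \<le> \<bar>t\<bar> * (4 * sqrt R)" .
  qed (auto simp: \<phi>_def prob_space v_def R0 intro!: sum_nonneg)
  then show ?thesis by (simp add: \<phi>_def v_def R_def)
qed

end

subsection \<open>Step functions and the double Wiener integral\<close>

text \<open>Only indices below \<open>card P\<close> are meaningful, hence the
  \<open>card P - 1\<close> cells in the refinements.\<close>

definition grid :: "real set \<Rightarrow> nat \<Rightarrow> real" where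
  "grid P i = sorted_list_of_set P ! i"

lemma strict_mono_on_grid: "finite P \<Longrightarrow> strict_mono_on {..<card P} (grid P)"
  using sorted_wrt_nth_less[OF strict_sorted_list_of_set[of P]]
  by (auto simp: strict_mono_on_def grid_def)

lemma grid_image: "finite P \<Longrightarrow> grid P ` {..<card P} = P"
  using nth_image[of "card P" "sorted_list_of_set P"] by (simp add: grid_def[abs_def] atLeast0LessThan image_def)

text \<open>The points of \<open>p\<close> occur in \<open>P\<close>, so each cell is a run of
  consecutive cells of the finer grid and increments telescope. The identity is for every
  \<open>\<mu>\<close>, hence one choice of \<open>I\<close> serves indicators and paths alike;
  disjointness preserves zero diagonals in \<open>incr2_refine\<close>.\<close>

lemma refine_cells:
  assumes p: "strict_mono_on {..n} p" and P: "finite P" "p ` {..n} \<subseteq> P"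
  obtains I :: "nat \<Rightarrow> nat set" where
    "\<And>i j. i < n \<Longrightarrow> j < n \<Longrightarrow> i \<noteq> j \<Longrightarrow> I i \<inter> I j = {}"
    "\<And>i. i < n \<Longrightarrow> I i \<subseteq> {..<card P - 1}"
    "\<And>i \<mu>. i < n \<Longrightarrow> \<mu> (p (Suc i)) - \<mu> (p i) = (\<Sum>k\<in>I i. \<mu> (grid P (Suc k)) - \<mu> (grid P k) :: real)"
proof -
  have "\<forall>i\<in>{..n}. \<exists>k<card P. p i = grid P k"
  proof
    fix i assume "i \<in> {..n}"
    then have "p i \<in> grid P ` {..<card P}" using grid_image[OF P(1)] P(2) by auto
    then show "\<exists>k<card P. p i = grid P k" by auto
  qed
  then obtain \<kappa> where \<kappa>: "\<And>i. i \<le> n \<Longrightarrow> \<kappa> i < card P" "\<And>i. i \<le> n \<Longrightarrow> p i = grid P (\<kappa> i)"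
    by (metis atMost_iff)
  have mono: "\<kappa> i < \<kappa> j" if "i < j" "j \<le> n" for i j
  proof (rule ccontr)
    assume "\<not> \<kappa> i < \<kappa> j"
    then have "grid P (\<kappa> j) \<le> grid P (\<kappa> i)"
      using strict_mono_on_leD[OF strict_mono_on_grid[OF P(1)], of "\<kappa> j" "\<kappa> i"] \<kappa> that by auto
    moreover have "p i < p j" using p that by (auto simp: strict_mono_on_def)
    ultimately show False using \<kappa> that by simp
  qed
  have mono': "\<kappa> i \<le> \<kappa> j" if "i \<le> j" "j \<le> n" for i j
    using mono[of i j] that by (cases "i = j") auto
  show thesis
  proof (rule that[of "\<lambda>i. {\<kappa> i..<\<kappa> (Suc i)}"])
    fix i j :: nat assume ij: "i < n" "j < n" "i \<noteq> j"
    have "\<kappa> (Suc i) \<le> \<kappa> j \<or> \<kappa> (Suc j) \<le> \<kappa> i"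
      using ij mono'[of "Suc i" j] mono'[of "Suc j" i] by (cases "i < j") auto
    then show "{\<kappa> i..<\<kappa> (Suc i)} \<inter> {\<kappa> j..<\<kappa> (Suc j)} = {}" by auto
  next
    fix i assume "i < n"
    then have "\<kappa> (Suc i) < card P" by (intro \<kappa>) simp
    then show "{\<kappa> i..<\<kappa> (Suc i)} \<subseteq> {..<card P - 1}" by auto
  next
    fix i and \<mu> :: "real \<Rightarrow> real" assume i: "i < n"
    then have "\<kappa> i \<le> \<kappa> (Suc i)" using mono'[of i "Suc i"] by simp
    from sum_Suc_diff'[OF this, of "\<lambda>k. \<mu> (grid P k)"]
    show "\<mu> (p (Suc i)) - \<mu> (p i) = (\<Sum>k\<in>{\<kappa> i..<\<kappa> (Suc i)}. \<mu> (grid P (Suc k)) - \<mu> (grid P k))"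
      using \<kappa>(2)[of i] \<kappa>(2)[of "Suc i"] i by simp
  qed
qed

text \<open>Step functions and their integrals are both values of one algebraic expression in an
  interval function; common refinements can therefore be found for both at the same time.\<close>

definition incr1 :: "nat \<Rightarrow> (nat \<Rightarrow> real) \<Rightarrow> (nat \<Rightarrow> real) \<Rightarrow> (real \<Rightarrow> real) \<Rightarrow> real" where
  "incr1 n p a \<mu> = (\<Sum>i<n. a i * (\<mu> (p (Suc i)) - \<mu> (p i)))"

definition incr2 :: "nat \<Rightarrow> (nat \<Rightarrow> real) \<Rightarrow> (nat \<Rightarrow> nat \<Rightarrow> real) \<Rightarrow> (real \<Rightarrow> real) \<Rightarrow> (real \<Rightarrow> real) \<Rightarrow> real" where
  "incr2 n p a \<mu> \<nu> = (\<Sum>i<n. \<Sum>j<n. a i j * (\<mu> (p (Suc i)) - \<mu> (p i)) * (\<nu> (p (Suc j)) - \<nu> (p j)))"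

lemma strict_mono_on_Suc: "strict_mono_on {..n} p \<Longrightarrow> i < n \<Longrightarrow> p i < (p (Suc i) :: real)"
  by (auto simp: strict_mono_on_def)

text \<open>A half-open cell is the increment over its endpoints of the function
  \<open>indicator {y..}\<close>. Through this a step function evaluates the same expression as its
  integral, with this indicator in place of the path.\<close>

lemma cell_indicator:
  fixes p :: "nat \<Rightarrow> real"
  assumes "strict_mono_on {..n} p" "i < n"
  shows "indicator {p i<..p (Suc i)} y = indicator {y..} (p (Suc i)) - (indicator {y..} (p i) :: real)"
  using strict_mono_on_Suc[OF assms] by (auto simp: indicator_def)

lemma step1_incr1: "strict_mono_on {..n} p \<Longrightarrow> step1 n p a y = incr1 n p a (indicator {y..})"
  unfolding step1_def incr1_def by (intro sum.cong refl) (simp add: cell_indicator)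

lemma step1_integral_incr1: "step1_integral W n p a \<omega> = incr1 n p a (\<lambda>t. W t \<omega>)"
  by (simp add: step1_integral_def incr1_def)

lemma step2_incr2: "strict_mono_on {..n} p \<Longrightarrow> step2 n p a (y, z) = incr2 n p a (indicator {y..}) (indicator {z..})"
  unfolding step2_def incr2_def prod.case by (intro sum.cong refl) (simp add: cell_indicator)

lemma step2_integral_incr2: "step2_integral B n p a \<omega> = incr2 n p a (\<lambda>t. B t \<omega>) (\<lambda>t. B t \<omega>)"
  by (simp add: step2_integral_def incr2_def)

lemma sum_indicator_mult_subset:
  "A \<subseteq> {..<N} \<Longrightarrow> (\<Sum>k<N. indicator A k * d k) = (\<Sum>k\<in>A. d k :: real)" for N :: nat
  by (rule sum.mono_neutral_cong_right) auto

lemma incr1_refine: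
  assumes p: "strict_mono_on {..n} p" and P: "finite P" "p ` {..n} \<subseteq> P"
  obtains a' where "\<And>\<mu>. incr1 n p a \<mu> = incr1 (card P - 1) (grid P) a' \<mu>"
proof -
  obtain I where "\<And>i j. i < n \<Longrightarrow> j < n \<Longrightarrow> i \<noteq> j \<Longrightarrow> I i \<inter> I j = {}"
    and I: "\<And>i. i < n \<Longrightarrow> I i \<subseteq> {..<card P - 1}"
    "\<And>i \<mu>. i < n \<Longrightarrow> \<mu> (p (Suc i)) - \<mu> (p i) = (\<Sum>k\<in>I i. \<mu> (grid P (Suc k)) - \<mu> (grid P k) :: real)"
    by (rule refine_cells[OF assms]) (rule that)
  define N where "N = card P - 1"
  define e :: "nat \<Rightarrow> nat \<Rightarrow> real" where "e i k = indicator (I i) k" for i k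
  have "incr1 n p a \<mu> = incr1 N (grid P) (\<lambda>k. \<Sum>i<n. a i * e i k) \<mu>" for \<mu>
  proof -
    define d where "d k = \<mu> (grid P (Suc k)) - \<mu> (grid P k)" for k
    have "incr1 n p a \<mu> = (\<Sum>i<n. a i * (\<Sum>k<N. e i k * d k))"
      unfolding incr1_def
    proof (intro sum.cong refl)
      fix i assume "i \<in> {..<n}"
      then have "(\<Sum>k<N. e i k * d k) = (\<Sum>k\<in>I i. d k)"
        unfolding e_def using I(1)[of i] by (intro sum_indicator_mult_subset) (auto simp: N_def)
      then show "a i * (\<mu> (p (Suc i)) - \<mu> (p i)) = a i * (\<Sum>k<N. e i k * d k)"
        using I(2)[of i \<mu>] \<open>i \<in> {..<n}\<close> by (simp add: d_def)
    qed
    also have "\<dots> = (\<Sum>i<n. \<Sum>k<N. a i * e i k * d k)"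
      by (simp add: sum_distrib_left mult.assoc)
    also have "\<dots> = (\<Sum>k<N. \<Sum>i<n. a i * e i k * d k)" by (rule sum.swap)
    finally show ?thesis by (simp add: incr1_def d_def sum_distrib_right)
  qed
  then show thesis using that unfolding N_def by blast
qed

text \<open>Old cells occupy disjoint sets of new cells, so a new diagonal coefficient collects only
  old diagonal ones, which vanish.\<close>

lemma incr2_refine:
  assumes p: "strict_mono_on {..n} p" and P: "finite P" "p ` {..n} \<subseteq> P" and diag: "\<And>i. i < n \<Longrightarrow> a i i = 0"
  obtains a' where "\<And>\<mu> \<nu>. incr2 n p a \<mu> \<nu> = incr2 (card P - 1) (grid P) a' \<mu> \<nu>" "\<And>i. a' i i = 0"
proof -
  obtain I where disj: "\<And>i j. i < n \<Longrightarrow> j < n \<Longrightarrow> i \<noteq> j \<Longrightarrow> I i \<inter> I j = {}"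
    and I: "\<And>i. i < n \<Longrightarrow> I i \<subseteq> {..<card P - 1}"
    "\<And>i \<mu>. i < n \<Longrightarrow> \<mu> (p (Suc i)) - \<mu> (p i) = (\<Sum>k\<in>I i. \<mu> (grid P (Suc k)) - \<mu> (grid P k) :: real)"
    by (rule refine_cells[OF p P]) (rule that)
  define N where "N = card P - 1"
  define e :: "nat \<Rightarrow> nat \<Rightarrow> real" where "e i k = indicator (I i) k" for i k
  define a' where "a' k l = (\<Sum>i<n. \<Sum>j<n. a i j * e i k * e j l)" for k l
  have "a' k k = 0" for k
    unfolding a'_def
  proof (intro sum.neutral ballI)
    fix i j assume "i \<in> {..<n}" "j \<in> {..<n}"
    then show "a i j * e i k * e j k = 0"
      using disj[of i j] diag[of i] by (cases "i = j") (auto simp: e_def indicator_def)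
  qed
  moreover have "incr2 n p a \<mu> \<nu> = incr2 N (grid P) a' \<mu> \<nu>" for \<mu> \<nu>
  proof -
    define d where "d \<mu> k = \<mu> (grid P (Suc k)) - \<mu> (grid P k)" for \<mu> :: "real \<Rightarrow> real" and k
    have D: "\<mu> (p (Suc i)) - \<mu> (p i) = (\<Sum>k<N. e i k * d \<mu> k)" if "i < n" for i \<mu>
    proof -
      have "(\<Sum>k<N. e i k * d \<mu> k) = (\<Sum>k\<in>I i. d \<mu> k)"
        unfolding e_def using I(1)[OF that] by (intro sum_indicator_mult_subset) (auto simp: N_def)
      then show ?thesis using I(2)[OF that, of \<mu>] by (simp add: d_def)
    qed
    have "incr2 n p a \<mu> \<nu> = (\<Sum>i<n. \<Sum>j<n. a i j * (\<Sum>k<N. e i k * d \<mu> k) * (\<Sum>l<N. e j l * d \<nu> l))"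
      unfolding incr2_def by (intro sum.cong refl) (simp add: D)
    also have "\<dots> = (\<Sum>i<n. \<Sum>j<n. \<Sum>k<N. \<Sum>l<N. a i j * e i k * e j l * d \<mu> k * d \<nu> l)"
      by (intro sum.cong refl) (simp only: mult.assoc sum_product, simp add: sum_distrib_left ac_simps)
    also have "\<dots> = (\<Sum>i<n. \<Sum>k<N. \<Sum>j<n. \<Sum>l<N. a i j * e i k * e j l * d \<mu> k * d \<nu> l)"
      by (intro sum.cong refl sum.swap)
    also have "\<dots> = (\<Sum>k<N. \<Sum>i<n. \<Sum>j<n. \<Sum>l<N. a i j * e i k * e j l * d \<mu> k * d \<nu> l)"
      by (rule sum.swap)
    also have "\<dots> = (\<Sum>k<N. \<Sum>i<n. \<Sum>l<N. \<Sum>j<n. a i j * e i k * e j l * d \<mu> k * d \<nu> l)"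
      by (intro sum.cong refl sum.swap)
    also have "\<dots> = (\<Sum>k<N. \<Sum>l<N. \<Sum>i<n. \<Sum>j<n. a i j * e i k * e j l * d \<mu> k * d \<nu> l)"
      by (intro sum.cong refl sum.swap)
    finally show ?thesis by (simp add: incr2_def a'_def d_def sum_distrib_right)
  qed
  ultimately show thesis using that unfolding N_def by blast
qed

section \<open>Linearity of the integrals\<close>

text \<open>A step function is kept together with the integral computed from the same partition and
  coefficients; linear combinations can then be formed for both at once, although the representation
  of a step function is not unique.\<close>

definition elem1 :: "(real \<Rightarrow> 'a \<Rightarrow> real) \<Rightarrow> (real \<Rightarrow> real) \<Rightarrow> ('a \<Rightarrow> real) \<Rightarrow> bool" where
  "elem1 W f F \<longleftrightarrow> (\<exists>n p a. strict_mono_on {..n} p \<and> f = step1 n p a \<and> F = step1_integral W n p a)"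

definition elem2 :: "(real \<Rightarrow> 'a \<Rightarrow> real) \<Rightarrow> (real \<times> real \<Rightarrow> real) \<Rightarrow> ('a \<Rightarrow> real) \<Rightarrow> bool" where
  "elem2 B h F \<longleftrightarrow> (\<exists>n p a. strict_mono_on {..n} p \<and> (\<forall>i<n. a i i = 0) \<and> h = step2 n p a \<and> F = step2_integral B n p a)"

lemma has_wiener_integral_iff:
  "has_wiener_integral M W f Y \<longleftrightarrow>
    (\<exists>fs Fs. (\<forall>k. elem1 W (fs k) (Fs k)) \<and> L2_tendsto lborel fs f \<and> L2_tendsto M Fs Y)"
proof
  assume "has_wiener_integral M W f Y"
  then show "\<exists>fs Fs. (\<forall>k. elem1 W (fs k) (Fs k)) \<and> L2_tendsto lborel fs f \<and> L2_tendsto M Fs Y"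
    unfolding has_wiener_integral_def
  proof (elim exE conjE)
    fix n p a
    assume *: "\<forall>k. strict_mono_on {..n k} (p k)" "L2_tendsto lborel (\<lambda>k. step1 (n k) (p k) (a k)) f"
      "L2_tendsto M (\<lambda>k. step1_integral W (n k) (p k) (a k)) Y"
    have "\<forall>k. elem1 W (step1 (n k) (p k) (a k)) (step1_integral W (n k) (p k) (a k))"
      using *(1) unfolding elem1_def by blast
    with * show ?thesis
      by (intro exI[where x="\<lambda>k. step1 (n k) (p k) (a k)"] exI[where x="\<lambda>k. step1_integral W (n k) (p k) (a k)"]) simp
  qed
next
  assume "\<exists>fs Fs. (\<forall>k. elem1 W (fs k) (Fs k)) \<and> L2_tendsto lborel fs f \<and> L2_tendsto M Fs Y"
  then obtain fs Fs where *: "\<forall>k. elem1 W (fs k) (Fs k)" "L2_tendsto lborel fs f" "L2_tendsto M Fs Y" by blast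
  from *(1) have "\<forall>k. \<exists>t. strict_mono_on {..fst t} (fst (snd t)) \<and> fs k = step1 (fst t) (fst (snd t)) (snd (snd t)) \<and>
      Fs k = step1_integral W (fst t) (fst (snd t)) (snd (snd t))"
    unfolding elem1_def by simp
  from choice[OF this] obtain t where t: "\<forall>k. strict_mono_on {..fst (t k)} (fst (snd (t k))) \<and>
      fs k = step1 (fst (t k)) (fst (snd (t k))) (snd (snd (t k))) \<and>
      Fs k = step1_integral W (fst (t k)) (fst (snd (t k))) (snd (snd (t k)))" ..
  define n p a where "n k = fst (t k)" and "p k = fst (snd (t k))" and "a k = snd (snd (t k))" for k
  have "\<forall>k. strict_mono_on {..n k} (p k) \<and> fs k = step1 (n k) (p k) (a k) \<and> Fs k = step1_integral W (n k) (p k) (a k)"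
    using t by (simp add: n_def p_def a_def)
  moreover from this have "fs = (\<lambda>k. step1 (n k) (p k) (a k))" "Fs = (\<lambda>k. step1_integral W (n k) (p k) (a k))" by auto
  ultimately show "has_wiener_integral M W f Y"
    unfolding has_wiener_integral_def using * by blast
qed

lemma has_double_wiener_integral_iff:
  "has_double_wiener_integral M B h Y \<longleftrightarrow>
    (\<exists>hs Fs. (\<forall>k. elem2 B (hs k) (Fs k)) \<and> L2_tendsto lborel hs h \<and> L2_tendsto M Fs Y)"
proof
  assume "has_double_wiener_integral M B h Y"
  then show "\<exists>hs Fs. (\<forall>k. elem2 B (hs k) (Fs k)) \<and> L2_tendsto lborel hs h \<and> L2_tendsto M Fs Y"
    unfolding has_double_wiener_integral_def
  proof (elim exE conjE)
    fix n p a
    assume *: "\<forall>k. strict_mono_on {..n k} (p k) \<and> (\<forall>i<n k. a k i i = 0)" "L2_tendsto lborel (\<lambda>k. step2 (n k) (p k) (a k)) h"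
      "L2_tendsto M (\<lambda>k. step2_integral B (n k) (p k) (a k)) Y"
    have "\<forall>k. elem2 B (step2 (n k) (p k) (a k)) (step2_integral B (n k) (p k) (a k))"
      using *(1) unfolding elem2_def by blast
    with * show ?thesis
      by (intro exI[where x="\<lambda>k. step2 (n k) (p k) (a k)"] exI[where x="\<lambda>k. step2_integral B (n k) (p k) (a k)"]) simp
  qed
next
  assume "\<exists>hs Fs. (\<forall>k. elem2 B (hs k) (Fs k)) \<and> L2_tendsto lborel hs h \<and> L2_tendsto M Fs Y"
  then obtain hs Fs where *: "\<forall>k. elem2 B (hs k) (Fs k)" "L2_tendsto lborel hs h" "L2_tendsto M Fs Y" by blast
  from *(1) have "\<forall>k. \<exists>t. strict_mono_on {..fst t} (fst (snd t)) \<and> (\<forall>i<fst t. snd (snd t) i i = 0) \<and>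
      hs k = step2 (fst t) (fst (snd t)) (snd (snd t)) \<and> Fs k = step2_integral B (fst t) (fst (snd t)) (snd (snd t))"
    unfolding elem2_def by simp
  from choice[OF this] obtain t where t: "\<forall>k. strict_mono_on {..fst (t k)} (fst (snd (t k))) \<and> (\<forall>i<fst (t k). snd (snd (t k)) i i = 0) \<and>
      hs k = step2 (fst (t k)) (fst (snd (t k))) (snd (snd (t k))) \<and>
      Fs k = step2_integral B (fst (t k)) (fst (snd (t k))) (snd (snd (t k)))" ..
  define n p a where "n k = fst (t k)" and "p k = fst (snd (t k))" and "a k = snd (snd (t k))" for k
  have "\<forall>k. strict_mono_on {..n k} (p k) \<and> (\<forall>i<n k. a k i i = 0) \<and> hs k = step2 (n k) (p k) (a k) \<and> Fs k = step2_integral B (n k) (p k) (a k)"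
    using t by (simp add: n_def p_def a_def)
  moreover from this have "hs = (\<lambda>k. step2 (n k) (p k) (a k))" "Fs = (\<lambda>k. step2_integral B (n k) (p k) (a k))" by auto
  ultimately show "has_double_wiener_integral M B h Y"
    unfolding has_double_wiener_integral_def using * by blast
qed

lemma strict_mono_on_grid': "finite P \<Longrightarrow> P \<noteq> {} \<Longrightarrow> strict_mono_on {..card P - 1} (grid P)"
proof -
  assume P: "finite P" "P \<noteq> {}"
  then have "{..card P - 1} = {..<card P}" using card_gt_0_iff[of P] by auto
  then show ?thesis using strict_mono_on_grid[OF P(1)] by simp
qed

lemma elem1_lincomb:
  assumes "elem1 W f F" "elem1 W g G"
  shows "elem1 W (\<lambda>x. \<alpha> * f x + \<beta> * g x) (\<lambda>\<omega>. \<alpha> * F \<omega> + \<beta> * G \<omega>)"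
proof -
  obtain n p a where f: "strict_mono_on {..n} p" "f = step1 n p a" "F = step1_integral W n p a"
    using assms(1) unfolding elem1_def by blast
  obtain m q b where g: "strict_mono_on {..m} q" "g = step1 m q b" "G = step1_integral W m q b"
    using assms(2) unfolding elem1_def by blast
  define P where "P = p ` {..n} \<union> q ` {..m}"
  have P: "finite P" "P \<noteq> {}" "p ` {..n} \<subseteq> P" "q ` {..m} \<subseteq> P" by (auto simp: P_def)
  obtain a' where a': "\<And>\<mu>. incr1 n p a \<mu> = incr1 (card P - 1) (grid P) a' \<mu>"
    using incr1_refine[OF f(1) P(1,3)] by metis
  obtain b' where b': "\<And>\<mu>. incr1 m q b \<mu> = incr1 (card P - 1) (grid P) b' \<mu>"
    using incr1_refine[OF g(1) P(1,4)] by metis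
  note sm = strict_mono_on_grid'[OF P(1,2)]
  have c: "\<alpha> * incr1 (card P - 1) (grid P) a' \<mu> + \<beta> * incr1 (card P - 1) (grid P) b' \<mu> =
      incr1 (card P - 1) (grid P) (\<lambda>i. \<alpha> * a' i + \<beta> * b' i) \<mu>" for \<mu>
    by (simp add: incr1_def sum_distrib_left distrib_right sum.distrib mult.assoc)
  show ?thesis
    unfolding elem1_def f g step1_integral_incr1[abs_def]
    by (rule exI[of _ "card P - 1"], rule exI[of _ "grid P"], rule exI[of _ "\<lambda>i. \<alpha> * a' i + \<beta> * b' i"])
      (simp add: sm[simplified] fun_eq_iff step1_incr1[OF sm, simplified] step1_incr1[OF f(1)] step1_incr1[OF g(1)] a' b' c[simplified])
qed

lemma elem2_lincomb:
  assumes "elem2 B f F" "elem2 B g G"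
  shows "elem2 B (\<lambda>x. \<alpha> * f x + \<beta> * g x) (\<lambda>\<omega>. \<alpha> * F \<omega> + \<beta> * G \<omega>)"
proof -
  obtain n p a where f: "strict_mono_on {..n} p" "\<And>i. i < n \<Longrightarrow> a i i = 0" "f = step2 n p a" "F = step2_integral B n p a"
    using assms(1) unfolding elem2_def by blast
  obtain m q b where g: "strict_mono_on {..m} q" "\<And>i. i < m \<Longrightarrow> b i i = 0" "g = step2 m q b" "G = step2_integral B m q b"
    using assms(2) unfolding elem2_def by blast
  define P where "P = p ` {..n} \<union> q ` {..m}"
  have P: "finite P" "P \<noteq> {}" "p ` {..n} \<subseteq> P" "q ` {..m} \<subseteq> P" by (auto simp: P_def)
  obtain a' where a': "\<And>\<mu> \<nu>. incr2 n p a \<mu> \<nu> = incr2 (card P - 1) (grid P) a' \<mu> \<nu>" "\<And>i. a' i i = 0"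
    using incr2_refine[OF f(1) P(1,3), of a] f(2) by metis
  obtain b' where b': "\<And>\<mu> \<nu>. incr2 m q b \<mu> \<nu> = incr2 (card P - 1) (grid P) b' \<mu> \<nu>" "\<And>i. b' i i = 0"
    using incr2_refine[OF g(1) P(1,4), of b] g(2) by metis
  note sm = strict_mono_on_grid'[OF P(1,2)]
  have c: "\<alpha> * incr2 (card P - 1) (grid P) a' \<mu> \<nu> + \<beta> * incr2 (card P - 1) (grid P) b' \<mu> \<nu> =
      incr2 (card P - 1) (grid P) (\<lambda>i j. \<alpha> * a' i j + \<beta> * b' i j) \<mu> \<nu>" for \<mu> \<nu>
    by (simp add: incr2_def sum_distrib_left distrib_right sum.distrib mult.assoc)
  show ?thesis
    unfolding elem2_def f g step2_integral_incr2[abs_def]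
    by (rule exI[of _ "card P - 1"], rule exI[of _ "grid P"], rule exI[of _ "\<lambda>i j. \<alpha> * a' i j + \<beta> * b' i j"])
      (simp add: sm[simplified] fun_eq_iff step2_incr2[OF sm, simplified] step2_incr2[OF f(1)] step2_incr2[OF g(1)] a' b' c[simplified])
qed

text \<open>Products of increments commute, so symmetrizing the coefficients symmetrizes the kernel
  and leaves the integral unchanged. This brings every step integral into the symmetric form that
  the moment lemmas require.\<close>

lemma elem2_symmetric:
  assumes "elem2 B h F"
  obtains n p a where "strict_mono_on {..n} p" "\<And>i j. a i j = a j i" "\<And>i. a i i = 0"
    "F = step2_integral B n p a" "\<And>x y. (h (x, y) + h (y, x)) / 2 = step2 n p a (x, y)"
proof -
  obtain n p a where h: "strict_mono_on {..n} p" "\<And>i. i < n \<Longrightarrow> a i i = 0" "h = step2 n p a" "F = step2_integral B n p a"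
    using assms unfolding elem2_def by blast
  \<comment> \<open>Outside the index range \<open>a\<close> is arbitrary; the value zero there
    makes symmetry and the zero diagonal hold for all indices.\<close>
  define b where "b i j = (if i < n \<and> j < n then (a i j + a j i) / 2 else 0)" for i j
  have e: "incr2 n p b \<mu> \<nu> = (incr2 n p a \<mu> \<nu> + incr2 n p a \<nu> \<mu>) / 2" for \<mu> \<nu>
  proof -
    have "incr2 n p a \<nu> \<mu> = (\<Sum>j<n. \<Sum>i<n. a j i * (\<nu> (p (Suc j)) - \<nu> (p j)) * (\<mu> (p (Suc i)) - \<mu> (p i)))"
      by (simp add: incr2_def)
    also have "\<dots> = (\<Sum>i<n. \<Sum>j<n. a j i * (\<mu> (p (Suc i)) - \<mu> (p i)) * (\<nu> (p (Suc j)) - \<nu> (p j)))"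
      by (subst sum.swap) (simp add: ac_simps)
    finally have sw: "incr2 n p a \<nu> \<mu> = (\<Sum>i<n. \<Sum>j<n. a j i * (\<mu> (p (Suc i)) - \<mu> (p i)) * (\<nu> (p (Suc j)) - \<nu> (p j)))" .
    have "(incr2 n p a \<mu> \<nu> + incr2 n p a \<nu> \<mu>) / 2 =
        (\<Sum>i<n. \<Sum>j<n. (a i j + a j i) / 2 * (\<mu> (p (Suc i)) - \<mu> (p i)) * (\<nu> (p (Suc j)) - \<nu> (p j)))"
      unfolding sw
      unfolding incr2_def sum.distrib[symmetric] sum_divide_distrib
      by (intro sum.cong refl) (simp add: distrib_right add_divide_distrib)
    then show ?thesis by (simp add: incr2_def b_def)
  qed
  show thesis
    by (rule that[of n p b]) (auto simp: h(1,3,4) b_def[of _ _] step2_integral_incr2 e fun_eq_iff step2_incr2 add.commute intro: h(2))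
qed

section \<open>Norms and contractions of step functions\<close>

lemma lborel_nn_integral_fst:
  fixes f :: "real \<times> real \<Rightarrow> ennreal"
  assumes "f \<in> borel_measurable borel"
  shows "(\<integral>\<^sup>+x. \<integral>\<^sup>+y. f (x, y) \<partial>lborel \<partial>lborel) = (\<integral>\<^sup>+z. f z \<partial>lborel)"
  using lborel.nn_integral_fst[of f lborel] assms by (simp add: lborel_prod)

lemma lborel_nn_integral_snd:
  fixes f :: "real \<times> real \<Rightarrow> ennreal"
  assumes "f \<in> borel_measurable borel"
  shows "(\<integral>\<^sup>+y. \<integral>\<^sup>+x. f (x, y) \<partial>lborel \<partial>lborel) = (\<integral>\<^sup>+z. f z \<partial>lborel)"
  using lborel_pair.nn_integral_snd[of f] assms by (simp add: lborel_prod)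

lemma cells_disjoint:
  fixes p :: "nat \<Rightarrow> real"
  assumes "strict_mono_on {..n} p" "i < n" "j < n" "i \<noteq> j"
  shows "{p i<..p (Suc i)} \<inter> {p j<..p (Suc j)} = {}"
proof -
  have "p (Suc i) \<le> p j" if "i < j" "j < n" for i j
    using strict_mono_on_leD[OF assms(1), of "Suc i" j] that by auto
  then show ?thesis using assms(2-4) by (cases i j rule: linorder_cases) force+
qed

definition cell :: "(nat \<Rightarrow> real) \<Rightarrow> nat \<Rightarrow> real \<Rightarrow> real" where
  "cell p i y = indicator {p i<..p (Suc i)} y"

lemma cell_nonneg [simp]: "cell p i y \<ge> 0"
  by (simp add: cell_def)

lemma cell_measurable [measurable]: "cell p i \<in> borel_measurable borel"
  unfolding cell_def[abs_def] by measurable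

lemma nn_integral_cell:
  "strict_mono_on {..n} p \<Longrightarrow> i < n \<Longrightarrow> (\<integral>\<^sup>+y. ennreal (cell p i y) \<partial>lborel) = ennreal (p (Suc i) - p i)"
  using strict_mono_on_Suc[of n p i] by (simp add: cell_def ennreal_indicator)

text \<open>Disjointness of the cells makes products of step functions on one partition
  coefficientwise.\<close>

lemma sum_cells_mult:
  assumes "strict_mono_on {..n} p"
  shows "(\<Sum>i<n. x i * cell p i y) * (\<Sum>i<n. x' i * cell p i y) = (\<Sum>i<n. x i * x' i * cell p i y)"
proof -
  have "(x i * cell p i y) * (x' j * cell p j y) = (if i = j then x i * x' i * cell p i y else 0)" if "i < n" "j < n" for i j
    using cells_disjoint[OF assms that] by (auto simp: cell_def indicator_def)
  then have "(\<Sum>i<n. \<Sum>j<n. (x i * cell p i y) * (x' j * cell p j y)) = (\<Sum>i<n. \<Sum>j<n. if i = j then x i * x' i * cell p i y else 0)"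
    by (intro sum.cong refl) auto
  then show ?thesis by (simp add: sum_product)
qed

lemma abs_sum_cells:
  assumes "strict_mono_on {..n} p"
  shows "\<bar>\<Sum>i<n. x i * cell p i y\<bar> = (\<Sum>i<n. \<bar>x i\<bar> * cell p i y)"
proof -
  have "\<bar>\<Sum>i<n. x i * cell p i y\<bar>\<^sup>2 = (\<Sum>i<n. \<bar>x i\<bar> * cell p i y)\<^sup>2"
    unfolding power2_abs by (simp add: power2_eq_square sum_cells_mult[OF assms])
  then show ?thesis by (subst (asm) power2_eq_iff_nonneg) (auto intro!: sum_nonneg)
qed

lemma nn_integral_sum_cells:
  assumes "strict_mono_on {..n} p" "\<And>i. i < n \<Longrightarrow> c i \<ge> 0"
  shows "(\<integral>\<^sup>+y. ennreal (\<Sum>i<n. c i * cell p i y) \<partial>lborel) = ennreal (\<Sum>i<n. c i * (p (Suc i) - p i))"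
proof -
  have "(\<integral>\<^sup>+y. ennreal (\<Sum>i<n. c i * cell p i y) \<partial>lborel) = (\<integral>\<^sup>+y. (\<Sum>i<n. ennreal (c i) * ennreal (cell p i y)) \<partial>lborel)"
    using assms(2) by (intro nn_integral_cong, subst sum_ennreal[symmetric]) (auto simp: ennreal_mult')
  also have "\<dots> = (\<Sum>i<n. ennreal (c i) * ennreal (p (Suc i) - p i))"
    by (simp add: nn_integral_sum nn_integral_cmult nn_integral_cell[OF assms(1)])
  also have "\<dots> = (\<Sum>i<n. ennreal (c i * (p (Suc i) - p i)))"
    using assms(2) by (intro sum.cong refl) (simp add: ennreal_mult')
  also have "\<dots> = ennreal (\<Sum>i<n. c i * (p (Suc i) - p i))"
    using assms(2) strict_mono_on_Suc[OF assms(1)] by (intro sum_ennreal mult_nonneg_nonneg) (auto simp: less_imp_le)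
  finally show ?thesis .
qed

lemma step1_eq: "step1 n p a y = (\<Sum>i<n. a i * cell p i y)"
  by (simp only: step1_def cell_def)

lemma step2_eq0: "step2 n p a (y, z) = (\<Sum>i<n. \<Sum>j<n. a i j * cell p i y * cell p j z)"
  by (simp only: step2_def cell_def prod.case)

lemma step2_eq: "step2 n p a (y, z) = (\<Sum>i<n. (\<Sum>j<n. a i j * cell p j z) * cell p i y)"
  by (simp add: step2_eq0 sum_distrib_right sum_distrib_left ac_simps)

lemma step2_measurable [measurable]: "step2 n p a \<in> borel_measurable borel"
  unfolding step2_def borel_prod[symmetric] by measurable

lemma step1_measurable [measurable]: "step1 n p a \<in> borel_measurable borel"
  unfolding step1_def[abs_def] by measurable

lemma step1_norm:
  assumes "strict_mono_on {..n} p"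
  shows "(\<integral>\<^sup>+y. ennreal ((step1 n p a y)\<^sup>2) \<partial>lborel) = ennreal (\<Sum>i<n. (a i)\<^sup>2 * (p (Suc i) - p i))"
  unfolding step1_eq power2_eq_square sum_cells_mult[OF assms]
  by (rule nn_integral_sum_cells[OF assms]) simp

lemma step2_norm:
  assumes "strict_mono_on {..n} p"
  shows "(\<integral>\<^sup>+x. ennreal ((step2 n p a x)\<^sup>2) \<partial>lborel) = ennreal (\<Sum>i<n. \<Sum>j<n. (a i j)\<^sup>2 * (p (Suc i) - p i) * (p (Suc j) - p j))"
proof -
  define D where "D i = p (Suc i) - p i" for i
  have D0: "D i \<ge> 0" if "i < n" for i using strict_mono_on_Suc[OF assms that] by (simp add: D_def)
  have sq: "(step2 n p a (y, z))\<^sup>2 = (\<Sum>j<n. (\<Sum>i<n. (a i j)\<^sup>2 * cell p i y) * cell p j z)" for y z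
  proof -
    have "(step2 n p a (y, z))\<^sup>2 = (\<Sum>i<n. (\<Sum>j<n. a i j * a i j * cell p j z) * cell p i y)"
      unfolding step2_eq power2_eq_square sum_cells_mult[OF assms] by simp
    also have "\<dots> = (\<Sum>i<n. \<Sum>j<n. (a i j)\<^sup>2 * cell p i y * cell p j z)"
      by (simp add: sum_distrib_right sum_distrib_left power2_eq_square ac_simps)
    also have "\<dots> = (\<Sum>j<n. \<Sum>i<n. (a i j)\<^sup>2 * cell p i y * cell p j z)" by (rule sum.swap)
    finally show ?thesis by (simp add: sum_distrib_right)
  qed
  have "(\<integral>\<^sup>+x. ennreal ((step2 n p a x)\<^sup>2) \<partial>lborel) = (\<integral>\<^sup>+y. \<integral>\<^sup>+z. ennreal ((step2 n p a (y, z))\<^sup>2) \<partial>lborel \<partial>lborel)"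
    using lborel_nn_integral_fst[of "\<lambda>x. ennreal ((step2 n p a x)\<^sup>2)"] by simp
  also have "\<dots> = (\<integral>\<^sup>+y. ennreal (\<Sum>j<n. (\<Sum>i<n. (a i j)\<^sup>2 * cell p i y) * D j) \<partial>lborel)"
    unfolding sq D_def by (intro nn_integral_cong nn_integral_sum_cells[OF assms] sum_nonneg) simp
  also have "\<dots> = (\<integral>\<^sup>+y. ennreal (\<Sum>i<n. (\<Sum>j<n. (a i j)\<^sup>2 * D j) * cell p i y) \<partial>lborel)"
  proof (intro nn_integral_cong arg_cong[where f = ennreal])
    fix y
    have "(\<Sum>j<n. (\<Sum>i<n. (a i j)\<^sup>2 * cell p i y) * D j) = (\<Sum>j<n. \<Sum>i<n. (a i j)\<^sup>2 * D j * cell p i y)"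
      by (simp add: sum_distrib_left sum_distrib_right ac_simps)
    also have "\<dots> = (\<Sum>i<n. \<Sum>j<n. (a i j)\<^sup>2 * D j * cell p i y)" by (rule sum.swap)
    finally show "(\<Sum>j<n. (\<Sum>i<n. (a i j)\<^sup>2 * cell p i y) * D j) = (\<Sum>i<n. (\<Sum>j<n. (a i j)\<^sup>2 * D j) * cell p i y)"
      by (simp add: sum_distrib_right)
  qed
  also have "\<dots> = ennreal (\<Sum>i<n. (\<Sum>j<n. (a i j)\<^sup>2 * D j) * (p (Suc i) - p i))"
    by (intro nn_integral_sum_cells[OF assms] sum_nonneg) (simp add: D0)
  finally show ?thesis by (simp add: D_def[symmetric] sum_distrib_left sum_distrib_right ac_simps)
qed

text \<open>The squared norm of the first-order contraction of \<open>\<bar>h\<bar>\<close> with itself.\<close>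

definition contr_norm :: "(real \<times> real \<Rightarrow> real) \<Rightarrow> ennreal" where
  "contr_norm h = (\<integral>\<^sup>+y. \<integral>\<^sup>+z. (\<integral>\<^sup>+x. ennreal \<bar>h (x, y) * h (x, z)\<bar> \<partial>lborel)\<^sup>2 \<partial>lborel \<partial>lborel)"

text \<open>The left side is the squared norm of the contraction of the step function, again a step
  function, with coefficients \<open>b\<close>. It is an inequality because
  \<open>contr_norm\<close> takes absolute values before integrating.\<close>

lemma step2_contr_norm:
  assumes p: "strict_mono_on {..n} p"
  shows "ennreal (\<Sum>j<n. \<Sum>k<n. (\<Sum>i<n. (p (Suc i) - p i) * a i j * a i k)\<^sup>2 * (p (Suc j) - p j) * (p (Suc k) - p k))
    \<le> contr_norm (step2 n p a)"
proof -
  define b where "b j k = (\<Sum>i<n. (p (Suc i) - p i) * a i j * a i k)" for j k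
  define A where "A i y = (\<Sum>j<n. a i j * cell p j y)" for i y
  define D where "D i = p (Suc i) - p i" for i
  have D0: "D i \<ge> 0" if "i < n" for i using strict_mono_on_Suc[OF p that] by (simp add: D_def)
  have "ennreal ((step2 n p b (y, z))\<^sup>2) \<le> (\<integral>\<^sup>+x. ennreal \<bar>step2 n p a (x, y) * step2 n p a (x, z)\<bar> \<partial>lborel)\<^sup>2" for y z
  proof -
    have st: "step2 n p b (y, z) = (\<Sum>i<n. D i * (A i y * A i z))"
    proof -
      have "D i * (A i y * A i z) = (\<Sum>j<n. \<Sum>k<n. D i * a i j * a i k * cell p j y * cell p k z)" for i
        unfolding A_def sum_product
        unfolding sum_distrib_left by (simp add: ac_simps)
      then have "(\<Sum>i<n. D i * (A i y * A i z)) = (\<Sum>i<n. \<Sum>j<n. \<Sum>k<n. D i * a i j * a i k * cell p j y * cell p k z)"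
        by simp
      also have "\<dots> = (\<Sum>j<n. \<Sum>i<n. \<Sum>k<n. D i * a i j * a i k * cell p j y * cell p k z)"
        by (rule sum.swap)
      also have "\<dots> = (\<Sum>j<n. \<Sum>k<n. \<Sum>i<n. D i * a i j * a i k * cell p j y * cell p k z)"
        by (intro sum.cong refl sum.swap)
      also have "\<dots> = step2 n p b (y, z)"
        unfolding step2_eq0 b_def D_def by (simp only: sum_distrib_right)
      finally show ?thesis by simp
    qed
    have "\<bar>step2 n p b (y, z)\<bar> \<le> (\<Sum>i<n. \<bar>A i y * A i z\<bar> * D i)"
      unfolding st by (intro order_trans[OF sum_abs] sum_mono) (simp add: abs_mult D0)
    then have "ennreal \<bar>step2 n p b (y, z)\<bar> \<le> ennreal (\<Sum>i<n. \<bar>A i y * A i z\<bar> * D i)"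
      by (rule ennreal_leI)
    also have "\<dots> = (\<integral>\<^sup>+x. ennreal (\<Sum>i<n. \<bar>A i y * A i z\<bar> * cell p i x) \<partial>lborel)"
      unfolding D_def by (rule nn_integral_sum_cells[OF p, symmetric]) simp
    also have "\<dots> = (\<integral>\<^sup>+x. ennreal \<bar>step2 n p a (x, y) * step2 n p a (x, z)\<bar> \<partial>lborel)"
    proof -
      have "step2 n p a (x, y) * step2 n p a (x, z) = (\<Sum>i<n. A i y * A i z * cell p i x)" for x
        unfolding step2_eq A_def by (rule sum_cells_mult[OF p])
      then show ?thesis by (simp only: abs_sum_cells[OF p])
    qed
    finally have "(ennreal \<bar>step2 n p b (y, z)\<bar>)\<^sup>2 \<le> (\<integral>\<^sup>+x. ennreal \<bar>step2 n p a (x, y) * step2 n p a (x, z)\<bar> \<partial>lborel)\<^sup>2"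
      by (rule power_mono) simp
    then show ?thesis by (simp add: ennreal_power)
  qed
  then have "(\<integral>\<^sup>+y. \<integral>\<^sup>+z. ennreal ((step2 n p b (y, z))\<^sup>2) \<partial>lborel \<partial>lborel) \<le> contr_norm (step2 n p a)"
    unfolding contr_norm_def by (intro nn_integral_mono)
  moreover have "(\<integral>\<^sup>+y. \<integral>\<^sup>+z. ennreal ((step2 n p b (y, z))\<^sup>2) \<partial>lborel \<partial>lborel) = (\<integral>\<^sup>+x. ennreal ((step2 n p b x)\<^sup>2) \<partial>lborel)"
    by (rule lborel_nn_integral_fst) measurable
  ultimately show ?thesis
    unfolding step2_norm[OF p] by (simp only: b_def)
qed

text \<open>Carries a contraction bound from the limit kernel \<open>g\<close> to a nearby kernel
  \<open>h\<close>. With \<open>d = h - g\<close> the tensor square of \<open>h\<close> is that of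
  \<open>g\<close> plus \<open>d \<otimes> h\<close> plus \<open>g \<otimes> d\<close>, and the
  contractions of the last two are bounded by products of norms through Cauchy-Schwarz. The 3 is
  that of \<open>(a + b + c)^2 \<le> 3 (a^2 + b^2 + c^2)\<close>.\<close>

lemma contr_norm_le:
  assumes [measurable]: "h \<in> borel_measurable borel" "g \<in> borel_measurable borel"
  defines "N f \<equiv> (\<integral>\<^sup>+x. ennreal ((f x)\<^sup>2) \<partial>lborel)"
  shows "contr_norm h \<le> 3 * (contr_norm g + N (\<lambda>x. h x - g x) * (N h + N g))"
proof -
  define d where "d x = h x - g x" for x
  have dm [measurable]: "d \<in> borel_measurable borel" unfolding d_def[abs_def] by measurable
  have prod: "f \<in> borel_measurable (lborel \<Otimes>\<^sub>M lborel)" if "f \<in> borel_measurable borel" for f :: "real \<times> real \<Rightarrow> real"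
    using that by (simp add: lborel_prod)
  define I where "I f f' y z = (\<integral>\<^sup>+x. ennreal \<bar>f (x, y)\<bar> * ennreal \<bar>f' (x, z)\<bar> \<partial>lborel)" for f f' :: "real \<times> real \<Rightarrow> real" and y z
  have mI: "(\<lambda>(y, z). I f f' y z) \<in> borel_measurable (lborel \<Otimes>\<^sub>M lborel)"
    if "f \<in> borel_measurable borel" "f' \<in> borel_measurable borel" for f f'
  proof -
    note [measurable] = prod[OF that(1)] prod[OF that(2)]
    show ?thesis unfolding I_def by measurable
  qed
  have mI2: "(\<lambda>z. I f f' y z) \<in> borel_measurable lborel" "(\<lambda>y. \<integral>\<^sup>+z. (I f f' y z)\<^sup>2 \<partial>lborel) \<in> borel_measurable lborel"
    if "f \<in> borel_measurable borel" "f' \<in> borel_measurable borel" for f f' y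
  proof -
    note [measurable] = mI[OF that]
    show "(\<lambda>z. I f f' y z) \<in> borel_measurable lborel" "(\<lambda>y. \<integral>\<^sup>+z. (I f f' y z)\<^sup>2 \<partial>lborel) \<in> borel_measurable lborel" by measurable
  qed
  have bound: "(\<integral>\<^sup>+y. \<integral>\<^sup>+z. (I f f' y z)\<^sup>2 \<partial>lborel \<partial>lborel) \<le> N f * N f'"
    if "f \<in> borel_measurable borel" "f' \<in> borel_measurable borel" for f f'
  proof -
    note [measurable] = prod[OF that(1)] prod[OF that(2)]
    have "(\<integral>\<^sup>+y. \<integral>\<^sup>+z. (I f f' y z)\<^sup>2 \<partial>lborel \<partial>lborel) \<le>
        (\<integral>\<^sup>+y. \<integral>\<^sup>+z. (\<integral>\<^sup>+x. (ennreal \<bar>f (x, y)\<bar>)\<^sup>2 \<partial>lborel) * (\<integral>\<^sup>+x. (ennreal \<bar>f' (x, z)\<bar>)\<^sup>2 \<partial>lborel) \<partial>lborel \<partial>lborel)"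
      unfolding I_def by (intro nn_integral_mono Cauchy_Schwarz_nn_integral) auto
    also have "\<dots> = (\<integral>\<^sup>+y. \<integral>\<^sup>+x. ennreal ((f (x, y))\<^sup>2) \<partial>lborel \<partial>lborel) * (\<integral>\<^sup>+z. \<integral>\<^sup>+x. ennreal ((f' (x, z))\<^sup>2) \<partial>lborel \<partial>lborel)"
      by (simp add: nn_integral_cmult nn_integral_multc ennreal_power)
    also have "\<dots> = N f * N f'"
      unfolding N_def using that lborel_nn_integral_snd[of "\<lambda>x. ennreal ((f x)\<^sup>2)"] lborel_nn_integral_snd[of "\<lambda>x. ennreal ((f' x)\<^sup>2)"]
      by simp
    finally show ?thesis .
  qed
  note [measurable] = prod[OF assms(1)] prod[OF assms(2)] prod[OF dm]
  have pt: "(\<integral>\<^sup>+x. ennreal \<bar>h (x, y) * h (x, z)\<bar> \<partial>lborel)\<^sup>2 \<le> 3 * ((I g g y z)\<^sup>2 + (I d h y z)\<^sup>2 + (I g d y z)\<^sup>2)" for y z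
  proof -
    have "\<bar>h (x, y) * h (x, z)\<bar> \<le> \<bar>g (x, y)\<bar> * \<bar>g (x, z)\<bar> + \<bar>d (x, y)\<bar> * \<bar>h (x, z)\<bar> + \<bar>g (x, y)\<bar> * \<bar>d (x, z)\<bar>" for x
    proof -
      have "h (x, y) * h (x, z) = g (x, y) * g (x, z) + d (x, y) * h (x, z) + g (x, y) * d (x, z)"
        by (simp add: d_def algebra_simps)
      then show ?thesis using abs_triangle_ineq[of "g (x, y) * g (x, z) + d (x, y) * h (x, z)" "g (x, y) * d (x, z)"]
          abs_triangle_ineq[of "g (x, y) * g (x, z)" "d (x, y) * h (x, z)"] by (simp add: abs_mult)
    qed
    then have "(\<integral>\<^sup>+x. ennreal \<bar>h (x, y) * h (x, z)\<bar> \<partial>lborel) \<le>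
        (\<integral>\<^sup>+x. ennreal \<bar>g (x, y)\<bar> * ennreal \<bar>g (x, z)\<bar> + ennreal \<bar>d (x, y)\<bar> * ennreal \<bar>h (x, z)\<bar> + ennreal \<bar>g (x, y)\<bar> * ennreal \<bar>d (x, z)\<bar> \<partial>lborel)"
    proof (intro nn_integral_mono)
      fix x
      assume "\<And>x. \<bar>h (x, y) * h (x, z)\<bar> \<le> \<bar>g (x, y)\<bar> * \<bar>g (x, z)\<bar> + \<bar>d (x, y)\<bar> * \<bar>h (x, z)\<bar> + \<bar>g (x, y)\<bar> * \<bar>d (x, z)\<bar>"
      from ennreal_leI[OF this[of x]]
      show "ennreal \<bar>h (x, y) * h (x, z)\<bar> \<le> ennreal \<bar>g (x, y)\<bar> * ennreal \<bar>g (x, z)\<bar> + ennreal \<bar>d (x, y)\<bar> * ennreal \<bar>h (x, z)\<bar> + ennreal \<bar>g (x, y)\<bar> * ennreal \<bar>d (x, z)\<bar>"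
        by (simp add: ennreal_mult')
    qed
    also have "\<dots> = I g g y z + I d h y z + I g d y z"
      unfolding I_def by (simp add: nn_integral_add)
    finally have "(\<integral>\<^sup>+x. ennreal \<bar>h (x, y) * h (x, z)\<bar> \<partial>lborel)\<^sup>2 \<le> (I g g y z + I d h y z + I g d y z)\<^sup>2"
      by (rule power_mono) simp
    also have "\<dots> \<le> 3 * ((I g g y z)\<^sup>2 + (I d h y z)\<^sup>2 + (I g d y z)\<^sup>2)"
    proof -
      have "(a + b + c)\<^sup>2 \<le> 3 * (a\<^sup>2 + b\<^sup>2 + c\<^sup>2)" if "a \<ge> 0" "b \<ge> 0" "c \<ge> 0" for a b c :: real
        using sum_squares_bound[of a b] sum_squares_bound[of a c] sum_squares_bound[of b c]
        by (simp add: power2_eq_square algebra_simps)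
      note r = this
      have "(ennreal a + ennreal b + ennreal c)\<^sup>2 \<le> 3 * ((ennreal a)\<^sup>2 + (ennreal b)\<^sup>2 + (ennreal c)\<^sup>2)"
        if "a \<ge> 0" "b \<ge> 0" "c \<ge> 0" for a b c :: real
      proof -
        have "(ennreal a + ennreal b + ennreal c)\<^sup>2 = ennreal ((a + b + c)\<^sup>2)"
          using that by (simp add: ennreal_power[symmetric])
        also have "\<dots> \<le> ennreal (3 * (a\<^sup>2 + b\<^sup>2 + c\<^sup>2))"
          by (intro ennreal_leI r that)
        also have "\<dots> = 3 * ((ennreal a)\<^sup>2 + (ennreal b)\<^sup>2 + (ennreal c)\<^sup>2)"
          using that by (simp add: ennreal_mult' ennreal_power)
        finally show ?thesis .
      qed
      moreover have "(a + b + c)\<^sup>2 \<le> 3 * (a\<^sup>2 + b\<^sup>2 + c\<^sup>2)" if "a = top \<or> b = top \<or> c = top" for a b c :: ennreal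
        using that by (elim disjE) (simp_all add: power2_eq_square ennreal_mult_top ennreal_top_mult)
      ultimately have "(a + b + c)\<^sup>2 \<le> 3 * (a\<^sup>2 + b\<^sup>2 + c\<^sup>2)" for a b c :: ennreal
        by (cases a; cases b; cases c) simp_all
      then show ?thesis .
    qed
    finally show ?thesis .
  qed
  have "contr_norm h \<le> (\<integral>\<^sup>+y. \<integral>\<^sup>+z. 3 * ((I g g y z)\<^sup>2 + (I d h y z)\<^sup>2 + (I g d y z)\<^sup>2) \<partial>lborel \<partial>lborel)"
    unfolding contr_norm_def by (intro nn_integral_mono pt)
  also have "\<dots> = 3 * ((\<integral>\<^sup>+y. \<integral>\<^sup>+z. (I g g y z)\<^sup>2 \<partial>lborel \<partial>lborel) + (\<integral>\<^sup>+y. \<integral>\<^sup>+z. (I d h y z)\<^sup>2 \<partial>lborel \<partial>lborel)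
      + (\<integral>\<^sup>+y. \<integral>\<^sup>+z. (I g d y z)\<^sup>2 \<partial>lborel \<partial>lborel))"
    using mI2 by (simp add: nn_integral_cmult nn_integral_add)
  also have "\<dots> \<le> 3 * (contr_norm g + N d * N h + N g * N d)"
    by (intro mult_left_mono add_mono bound) (auto simp: contr_norm_def I_def abs_mult ennreal_mult')
  also have "\<dots> = 3 * (contr_norm g + N (\<lambda>x. h x - g x) * (N h + N g))"
    by (simp add: d_def[abs_def] algebra_simps)
  finally show ?thesis .
qed

section \<open>Passage to L2 limits\<close>

lemma L2_tendsto_measurable:
  assumes "L2_tendsto M f g"
  shows "f k \<in> borel_measurable M" "g \<in> borel_measurable M"
  using assms by (auto simp: L2_tendsto_def)

lemma L2_tendsto_lincomb:
  assumes f: "L2_tendsto M f g" and f': "L2_tendsto M f' g'"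
  shows "L2_tendsto M (\<lambda>k x. \<alpha> * f k x + \<beta> * f' k x) (\<lambda>x. \<alpha> * g x + \<beta> * g' x)"
proof -
  note [measurable] = L2_tendsto_measurable[OF f] L2_tendsto_measurable[OF f']
  define I where "I k = (\<integral>\<^sup>+ x. ennreal ((f k x - g x)\<^sup>2) \<partial>M)" for k
  define I' where "I' k = (\<integral>\<^sup>+ x. ennreal ((f' k x - g' x)\<^sup>2) \<partial>M)" for k
  have le: "(\<integral>\<^sup>+ x. ennreal ((\<alpha> * f k x + \<beta> * f' k x - (\<alpha> * g x + \<beta> * g' x))\<^sup>2) \<partial>M) \<le> ennreal (2 * \<alpha>\<^sup>2) * I k + ennreal (2 * \<beta>\<^sup>2) * I' k" for k
  proof -
    have "(\<integral>\<^sup>+ x. ennreal ((\<alpha> * f k x + \<beta> * f' k x - (\<alpha> * g x + \<beta> * g' x))\<^sup>2) \<partial>M) \<le>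
       (\<integral>\<^sup>+ x. ennreal (2 * \<alpha>\<^sup>2) * ennreal ((f k x - g x)\<^sup>2) + ennreal (2 * \<beta>\<^sup>2) * ennreal ((f' k x - g' x)\<^sup>2) \<partial>M)"
    proof (intro nn_integral_mono)
      fix x
      have "(\<alpha> * f k x + \<beta> * f' k x - (\<alpha> * g x + \<beta> * g' x))\<^sup>2 = (\<alpha> * (f k x - g x) + \<beta> * (f' k x - g' x))\<^sup>2"
        by (simp add: algebra_simps)
      also have "\<dots> \<le> 2 * \<alpha>\<^sup>2 * (f k x - g x)\<^sup>2 + 2 * \<beta>\<^sup>2 * (f' k x - g' x)\<^sup>2"
        using sum_squares_bound[of "\<alpha> * (f k x - g x)" "\<beta> * (f' k x - g' x)"] by (simp add: power2_sum power_mult_distrib)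
      finally have "ennreal ((\<alpha> * f k x + \<beta> * f' k x - (\<alpha> * g x + \<beta> * g' x))\<^sup>2) \<le> ennreal (2 * \<alpha>\<^sup>2 * (f k x - g x)\<^sup>2 + 2 * \<beta>\<^sup>2 * (f' k x - g' x)\<^sup>2)"
        by (rule ennreal_leI)
      then show "ennreal ((\<alpha> * f k x + \<beta> * f' k x - (\<alpha> * g x + \<beta> * g' x))\<^sup>2) \<le> ennreal (2 * \<alpha>\<^sup>2) * ennreal ((f k x - g x)\<^sup>2) + ennreal (2 * \<beta>\<^sup>2) * ennreal ((f' k x - g' x)\<^sup>2)"
        by (subst (asm) ennreal_plus) (simp_all add: ennreal_mult')
    qed
    also have "\<dots> = ennreal (2 * \<alpha>\<^sup>2) * I k + ennreal (2 * \<beta>\<^sup>2) * I' k"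
      by (simp add: nn_integral_add nn_integral_cmult I_def I'_def)
    finally show ?thesis .
  qed
  have "I \<longlonglongrightarrow> 0" "I' \<longlonglongrightarrow> 0" using f f' unfolding I_def I'_def L2_tendsto_def by auto
  then have "(\<lambda>k. ennreal (2 * \<alpha>\<^sup>2) * I k + ennreal (2 * \<beta>\<^sup>2) * I' k) \<longlonglongrightarrow> ennreal (2 * \<alpha>\<^sup>2) * 0 + ennreal (2 * \<beta>\<^sup>2) * 0"
    by (intro tendsto_add tendsto_mult_ennreal tendsto_const) auto
  then have lim: "(\<lambda>k. ennreal (2 * \<alpha>\<^sup>2) * I k + ennreal (2 * \<beta>\<^sup>2) * I' k) \<longlonglongrightarrow> 0" by simp
  have "(\<lambda>k. \<integral>\<^sup>+ x. ennreal ((\<alpha> * f k x + \<beta> * f' k x - (\<alpha> * g x + \<beta> * g' x))\<^sup>2) \<partial>M) \<longlonglongrightarrow> 0"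
    by (rule tendsto_sandwich[OF _ _ tendsto_const lim]) (use le in auto)
  then show ?thesis unfolding L2_tendsto_def by (intro conjI allI) auto
qed

lemma has_wiener_integral_lincomb:
  assumes "has_wiener_integral M W f Y" "has_wiener_integral M W g Z"
  shows "has_wiener_integral M W (\<lambda>x. \<alpha> * f x + \<beta> * g x) (\<lambda>\<omega>. \<alpha> * Y \<omega> + \<beta> * Z \<omega>)"
proof -
  from assms obtain fs Fs sing_bound Gs where *: "\<forall>k. elem1 W (fs k) (Fs k)" "L2_tendsto lborel fs f" "L2_tendsto M Fs Y"
    "\<forall>k. elem1 W (sing_bound k) (Gs k)" "L2_tendsto lborel sing_bound g" "L2_tendsto M Gs Z"
    unfolding has_wiener_integral_iff by blast
  have "\<forall>k. elem1 W (\<lambda>x. \<alpha> * fs k x + \<beta> * sing_bound k x) (\<lambda>\<omega>. \<alpha> * Fs k \<omega> + \<beta> * Gs k \<omega>)"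
    using * by (intro allI elem1_lincomb) auto
  with L2_tendsto_lincomb[OF *(2,5)] L2_tendsto_lincomb[OF *(3,6)] show ?thesis
    unfolding has_wiener_integral_iff
    by (intro exI[where x="\<lambda>k x. \<alpha> * fs k x + \<beta> * sing_bound k x"] exI[where x="\<lambda>k \<omega>. \<alpha> * Fs k \<omega> + \<beta> * Gs k \<omega>"]) simp
qed

lemma has_double_wiener_integral_lincomb:
  assumes "has_double_wiener_integral M W f Y" "has_double_wiener_integral M W g Z"
  shows "has_double_wiener_integral M W (\<lambda>x. \<alpha> * f x + \<beta> * g x) (\<lambda>\<omega>. \<alpha> * Y \<omega> + \<beta> * Z \<omega>)"
proof -
  from assms obtain fs Fs sing_bound Gs where *: "\<forall>k. elem2 W (fs k) (Fs k)" "L2_tendsto lborel fs f" "L2_tendsto M Fs Y"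
    "\<forall>k. elem2 W (sing_bound k) (Gs k)" "L2_tendsto lborel sing_bound g" "L2_tendsto M Gs Z"
    unfolding has_double_wiener_integral_iff by blast
  have "\<forall>k. elem2 W (\<lambda>x. \<alpha> * fs k x + \<beta> * sing_bound k x) (\<lambda>\<omega>. \<alpha> * Fs k \<omega> + \<beta> * Gs k \<omega>)"
    using * by (intro allI elem2_lincomb) auto
  with L2_tendsto_lincomb[OF *(2,5)] L2_tendsto_lincomb[OF *(3,6)] show ?thesis
    unfolding has_double_wiener_integral_iff
    by (intro exI[where x="\<lambda>k x. \<alpha> * fs k x + \<beta> * sing_bound k x"] exI[where x="\<lambda>k \<omega>. \<alpha> * Fs k \<omega> + \<beta> * Gs k \<omega>"]) simp
qed

lemma has_wiener_integral_sum:
  assumes "finite I" "\<And>i. i \<in> I \<Longrightarrow> has_wiener_integral M W (f i) (Y i)"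
  shows "has_wiener_integral M W (\<lambda>x. \<Sum>i\<in>I. \<theta> i * f i x) (\<lambda>\<omega>. \<Sum>i\<in>I. \<theta> i * Y i \<omega>)"
  using assms
proof (induction I)
  case empty
  have "elem1 W (\<lambda>_. 0) (\<lambda>_. 0)"
    unfolding elem1_def by (intro exI[where x = "0::nat"] exI[where x = real]) (auto simp: step1_def fun_eq_iff step1_integral_def strict_mono_on_def)
  then show ?case
    unfolding has_wiener_integral_iff by (intro exI[where x = "\<lambda>_ _. 0"]) (simp add: L2_tendsto_def)
next
  case (insert i I)
  have "has_wiener_integral M W (\<lambda>x. \<theta> i * f i x + 1 * (\<Sum>i\<in>I. \<theta> i * f i x)) (\<lambda>\<omega>. \<theta> i * Y i \<omega> + 1 * (\<Sum>i\<in>I. \<theta> i * Y i \<omega>))"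
    using insert by (intro has_wiener_integral_lincomb) auto
  then show ?case using insert by simp
qed

lemma has_double_wiener_integral_sum:
  assumes "finite I" "\<And>i. i \<in> I \<Longrightarrow> has_double_wiener_integral M W (f i) (Y i)"
  shows "has_double_wiener_integral M W (\<lambda>x. \<Sum>i\<in>I. \<theta> i * f i x) (\<lambda>\<omega>. \<Sum>i\<in>I. \<theta> i * Y i \<omega>)"
  using assms
proof (induction I)
  case empty
  have "elem2 W (\<lambda>_. 0) (\<lambda>_. 0)"
    unfolding elem2_def by (intro exI[where x = "0::nat"] exI[where x = real]) (auto simp: step2_def fun_eq_iff step2_integral_def strict_mono_on_def)
  then show ?case
    unfolding has_double_wiener_integral_iff by (intro exI[where x = "\<lambda>_ _. 0"]) (simp add: L2_tendsto_def)
next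
  case (insert i I)
  have "has_double_wiener_integral M W (\<lambda>x. \<theta> i * f i x + 1 * (\<Sum>i\<in>I. \<theta> i * f i x)) (\<lambda>\<omega>. \<theta> i * Y i \<omega> + 1 * (\<Sum>i\<in>I. \<theta> i * Y i \<omega>))"
    using insert by (intro has_double_wiener_integral_lincomb) auto
  then show ?case using insert by simp
qed

lemma integrable_iff_nn_integral_square:
  "f \<in> borel_measurable M \<Longrightarrow> integrable M (\<lambda>x. (f x)\<^sup>2) \<longleftrightarrow> (\<integral>\<^sup>+x. ennreal ((f x)\<^sup>2) \<partial>M) < \<infinity>" for f :: "'a \<Rightarrow> real"
  by (subst integrable_iff_bounded) auto

text \<open>\<open>L2_tendsto\<close> speaks only of differences; square integrability of the limit,
  and with it convergence of the norms, is recovered from that of the approximants.\<close>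

lemma L2_tendsto_square:
  assumes L2: "L2_tendsto M f g" and f: "\<And>k. integrable M (\<lambda>x. (f k x)\<^sup>2)"
  shows "integrable M (\<lambda>x. (g x)\<^sup>2)"
    and "\<And>k. integrable M (\<lambda>x. (f k x - g x)\<^sup>2)"
    and "(\<lambda>k. LINT x|M. (f k x - g x)\<^sup>2) \<longlonglongrightarrow> 0"
    and "(\<lambda>k. LINT x|M. (f k x)\<^sup>2) \<longlonglongrightarrow> (LINT x|M. (g x)\<^sup>2)"
proof -
  note [measurable] = L2_tendsto_measurable[OF L2]
  have lim: "(\<lambda>k. \<integral>\<^sup>+ x. ennreal ((f k x - g x)\<^sup>2) \<partial>M) \<longlonglongrightarrow> 0"
    using L2 by (simp add: L2_tendsto_def)
  then have "\<forall>\<^sub>F k in sequentially. (\<integral>\<^sup>+ x. ennreal ((f k x - g x)\<^sup>2) \<partial>M) < 1"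
    by (rule order_tendstoD) simp
  then obtain K where "(\<integral>\<^sup>+ x. ennreal ((f K x - g x)\<^sup>2) \<partial>M) < 1"
    by (auto simp: eventually_sequentially)
  then have "integrable M (\<lambda>x. (f K x - g x)\<^sup>2)"
    by (subst integrable_iff_nn_integral_square) (auto elim: less_trans)
  then have i: "integrable M (\<lambda>x. 2 * (f K x)\<^sup>2 + 2 * (f K x - g x)\<^sup>2)" using f[of K] by simp
  have "(g x)\<^sup>2 \<le> 2 * (f K x)\<^sup>2 + 2 * (f K x - g x)\<^sup>2" for x
  proof -
    have "2 * (f K x)\<^sup>2 + 2 * (f K x - g x)\<^sup>2 - (g x)\<^sup>2 = (2 * f K x - g x)\<^sup>2" by (simp add: power2_eq_square algebra_simps)
    then show ?thesis using zero_le_power2[of "2 * f K x - g x"] by linarith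
  qed
  then show g: "integrable M (\<lambda>x. (g x)\<^sup>2)"
    by (intro Bochner_Integration.integrable_bound[OF i]) auto
  show d: "integrable M (\<lambda>x. (f k x - g x)\<^sup>2)" for k
  proof (rule Bochner_Integration.integrable_bound)
    show "integrable M (\<lambda>x. 2 * (f k x)\<^sup>2 + 2 * (g x)\<^sup>2)" using f[of k] g by simp
    have "(f k x - g x)\<^sup>2 \<le> 2 * (f k x)\<^sup>2 + 2 * (g x)\<^sup>2" for x
      using zero_le_power2[of "f k x + g x"] by (simp add: power2_eq_square algebra_simps)
    then show "AE x in M. norm ((f k x - g x)\<^sup>2) \<le> norm (2 * (f k x)\<^sup>2 + 2 * (g x)\<^sup>2)" by simp
  qed simp
  define D where "D k = (LINT x|M. (f k x - g x)\<^sup>2)" for k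
  have "(\<lambda>k. ennreal (D k)) \<longlonglongrightarrow> ennreal 0"
    using lim nn_integral_eq_integral[OF d] by (simp add: D_def)
  then have D: "D \<longlonglongrightarrow> 0"
    by (rule tendsto_ennrealD) (auto simp: D_def)
  then show "(\<lambda>k. LINT x|M. (f k x - g x)\<^sup>2) \<longlonglongrightarrow> 0" by (simp only: D_def[abs_def])
  define G where "G = (LINT x|M. (g x)\<^sup>2)"
  have i2: "integrable M (\<lambda>x. g x * (f k x - g x))" for k
  proof (rule Bochner_Integration.integrable_bound)
    show "integrable M (\<lambda>x. (g x)\<^sup>2 + (f k x - g x)\<^sup>2)" using d g by simp
    have "\<bar>g x * (f k x - g x)\<bar> \<le> (g x)\<^sup>2 + (f k x - g x)\<^sup>2" for x
      using sum_squares_bound[of "\<bar>g x\<bar>" "\<bar>f k x - g x\<bar>"] mult_nonneg_nonneg[of "\<bar>g x\<bar>" "\<bar>f k x - g x\<bar>"]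
      unfolding power2_abs abs_mult by linarith
    then show "AE x in M. norm (g x * (f k x - g x)) \<le> norm ((g x)\<^sup>2 + (f k x - g x)\<^sup>2)" by simp
  qed simp
  have "norm ((LINT x|M. (f k x)\<^sup>2) - G) \<le> D k + 2 * sqrt (G * D k)" for k
  proof -
    have "(f k x)\<^sup>2 = (f k x - g x)\<^sup>2 + 2 * (g x * (f k x - g x)) + (g x)\<^sup>2" for x
      by (simp add: power2_eq_square algebra_simps)
    then have "(LINT x|M. (f k x)\<^sup>2) = D k + 2 * (LINT x|M. g x * (f k x - g x)) + G"
      unfolding D_def G_def using d g i2 by simp
    moreover have "\<bar>LINT x|M. g x * (f k x - g x)\<bar> \<le> sqrt (G * D k)"
    proof -
      have "(LINT x|M. \<bar>g x * (f k x - g x)\<bar>)\<^sup>2 \<le> G * D k"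
        unfolding G_def D_def by (rule integral_mult_Cauchy_Schwarz) (use d g in auto)
      then have "(LINT x|M. \<bar>g x * (f k x - g x)\<bar>) \<le> sqrt (G * D k)" by (rule real_le_rsqrt)
      then show ?thesis using integral_abs_bound[of M "\<lambda>x. g x * (f k x - g x)"] by linarith
    qed
    moreover have "D k \<ge> 0" by (simp add: D_def)
    ultimately show ?thesis by simp
  qed
  moreover have "(\<lambda>k. D k + 2 * sqrt (G * D k)) \<longlonglongrightarrow> 0 + 2 * sqrt (G * 0)"
    by (intro tendsto_intros D)
  ultimately have "(\<lambda>k. (LINT x|M. (f k x)\<^sup>2) - G) \<longlonglongrightarrow> 0"
    by (auto intro: Lim_null_comparison[where g="\<lambda>k. D k + 2 * sqrt (G * D k)", OF always_eventually])
  then show "(\<lambda>k. LINT x|M. (f k x)\<^sup>2) \<longlonglongrightarrow> (LINT x|M. (g x)\<^sup>2)"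
    unfolding G_def by (rule LIM_zero_cancel)
qed

lemma norm_iexp_diff_le: "norm (iexp a - iexp b) \<le> \<bar>a - b\<bar>"
proof -
  have "iexp a - iexp b = iexp b * (iexp (a - b) - 1)"
    by (simp add: algebra_simps flip: exp_add)
  then show ?thesis using iexp_approx1[of "a - b" 0] by (simp add: norm_mult)
qed

lemma (in prob_space) L2_tendsto_iexp:
  assumes L2: "L2_tendsto M F Y" and F: "\<And>k. integrable M (\<lambda>x. (F k x)\<^sup>2)"
  shows "(\<lambda>k. expectation (\<lambda>\<omega>. iexp (u * F k \<omega>))) \<longlonglongrightarrow> expectation (\<lambda>\<omega>. iexp (u * Y \<omega>))"
proof (rule LIM_zero_cancel, rule Lim_null_comparison)
  note [measurable] = L2_tendsto_measurable[OF L2]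
  note sq = L2_tendsto_square[OF L2 F]
  have i: "integrable M (\<lambda>\<omega>. iexp (X \<omega>))" if "X \<in> borel_measurable M" for X
    using integrable_iexp_mult[of "\<lambda>_. 1" X] that by simp
  show "\<forall>\<^sub>F k in sequentially. norm (expectation (\<lambda>\<omega>. iexp (u * F k \<omega>)) - expectation (\<lambda>\<omega>. iexp (u * Y \<omega>))) \<le> \<bar>u\<bar> * sqrt (expectation (\<lambda>\<omega>. (F k \<omega> - Y \<omega>)\<^sup>2))"
  proof (intro always_eventually allI)
    fix k
    have d: "integrable M (\<lambda>\<omega>. F k \<omega> - Y \<omega>)"
      by (rule square_integrable_imp_integrable) (use sq in auto)
    have "expectation (\<lambda>\<omega>. iexp (u * F k \<omega>)) - expectation (\<lambda>\<omega>. iexp (u * Y \<omega>)) = expectation (\<lambda>\<omega>. iexp (u * F k \<omega>) - iexp (u * Y \<omega>))"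
      by (intro Bochner_Integration.integral_diff[symmetric] i) auto
    also have "norm \<dots> \<le> expectation (\<lambda>\<omega>. norm (iexp (u * F k \<omega>) - iexp (u * Y \<omega>)))"
      by (rule integral_norm_bound)
    also have "\<dots> \<le> expectation (\<lambda>\<omega>. \<bar>u\<bar> * \<bar>(F k \<omega> - Y \<omega>) * 1\<bar>)"
    proof (rule integral_mono)
      show "integrable M (\<lambda>\<omega>. norm (iexp (u * F k \<omega>) - iexp (u * Y \<omega>)))"
        by (intro integrable_norm Bochner_Integration.integrable_diff i) auto
      show "integrable M (\<lambda>\<omega>. \<bar>u\<bar> * \<bar>(F k \<omega> - Y \<omega>) * 1\<bar>)" using integrable_abs[OF d] by simp
      show "norm (iexp (u * F k \<omega>) - iexp (u * Y \<omega>)) \<le> \<bar>u\<bar> * \<bar>(F k \<omega> - Y \<omega>) * 1\<bar>" for \<omega>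
        using norm_iexp_diff_le[of "u * F k \<omega>" "u * Y \<omega>"] by (simp add: abs_mult flip: right_diff_distrib)
    qed
    also have "\<dots> = \<bar>u\<bar> * expectation (\<lambda>\<omega>. \<bar>(F k \<omega> - Y \<omega>) * 1\<bar>)" by simp
    also have "\<dots> \<le> \<bar>u\<bar> * sqrt (expectation (\<lambda>\<omega>. (F k \<omega> - Y \<omega>)\<^sup>2))"
    proof -
      have "(expectation (\<lambda>\<omega>. \<bar>(F k \<omega> - Y \<omega>) * 1\<bar>))\<^sup>2 \<le> expectation (\<lambda>\<omega>. (F k \<omega> - Y \<omega>)\<^sup>2) * expectation (\<lambda>\<omega>. 1\<^sup>2)"
        by (rule integral_mult_Cauchy_Schwarz) (use sq in auto)
      then show ?thesis by (intro mult_left_mono real_le_rsqrt) (auto simp: prob_space)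
    qed
    finally show "norm (expectation (\<lambda>\<omega>. iexp (u * F k \<omega>)) - expectation (\<lambda>\<omega>. iexp (u * Y \<omega>))) \<le> \<bar>u\<bar> * sqrt (expectation (\<lambda>\<omega>. (F k \<omega> - Y \<omega>)\<^sup>2))" .
  qed
  have "(\<lambda>k. \<bar>u\<bar> * sqrt (expectation (\<lambda>\<omega>. (F k \<omega> - Y \<omega>)\<^sup>2))) \<longlonglongrightarrow> \<bar>u\<bar> * sqrt 0"
    by (intro tendsto_intros sq(3))
  then show "(\<lambda>k. \<bar>u\<bar> * sqrt (expectation (\<lambda>\<omega>. (F k \<omega> - Y \<omega>)\<^sup>2))) \<longlonglongrightarrow> 0" by simp
qed

text \<open>L2 convergence gives L1 convergence and so an almost surely convergent subsequence;
  Fatou's lemma along it passes the bound to the limit.\<close>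

lemma (in prob_space) L2_tendsto_fourth_moment_le:
  assumes L2: "L2_tendsto M F Y" and F4: "\<And>k. integrable M (\<lambda>x. (F k x) ^ 4)"
    and le: "\<And>k. expectation (\<lambda>\<omega>. F k \<omega> ^ 4) \<le> C k" and C: "C \<longlonglongrightarrow> c"
  shows "(\<integral>\<^sup>+\<omega>. ennreal (Y \<omega> ^ 4) \<partial>M) \<le> ennreal c"
proof -
  note m[measurable] = L2_tendsto_measurable[OF L2]
  have F: "integrable M (\<lambda>x. (F k x)\<^sup>2)" for k
    using integrable_power_mult_power[OF finite_measure_axioms, of "F k" "\<lambda>_. 1" 2 0] F4[of k] by simp
  note sq = L2_tendsto_square[OF L2 F]
  have d: "integrable M (\<lambda>\<omega>. F k \<omega> - Y \<omega>)" for k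
    by (rule square_integrable_imp_integrable) (use sq in auto)
  have "(\<lambda>k. expectation (\<lambda>\<omega>. norm (F k \<omega> - Y \<omega>))) \<longlonglongrightarrow> 0"
  proof (rule Lim_null_comparison)
    show "\<forall>\<^sub>F k in sequentially. norm (expectation (\<lambda>\<omega>. norm (F k \<omega> - Y \<omega>))) \<le> sqrt (expectation (\<lambda>\<omega>. (F k \<omega> - Y \<omega>)\<^sup>2))"
    proof (intro always_eventually allI)
      fix k
      have "(expectation (\<lambda>\<omega>. \<bar>(F k \<omega> - Y \<omega>) * 1\<bar>))\<^sup>2 \<le> expectation (\<lambda>\<omega>. (F k \<omega> - Y \<omega>)\<^sup>2) * expectation (\<lambda>\<omega>. 1\<^sup>2)"
        by (rule integral_mult_Cauchy_Schwarz) (use sq in auto)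
      then show "norm (expectation (\<lambda>\<omega>. norm (F k \<omega> - Y \<omega>))) \<le> sqrt (expectation (\<lambda>\<omega>. (F k \<omega> - Y \<omega>)\<^sup>2))"
        by (auto simp: prob_space intro!: real_le_rsqrt)
    qed
    have "(\<lambda>k. sqrt (expectation (\<lambda>\<omega>. (F k \<omega> - Y \<omega>)\<^sup>2))) \<longlonglongrightarrow> sqrt 0"
      by (intro tendsto_intros sq(3))
    then show "(\<lambda>k. sqrt (expectation (\<lambda>\<omega>. (F k \<omega> - Y \<omega>)\<^sup>2))) \<longlonglongrightarrow> 0" by simp
  qed
  from tendsto_L1_AE_subseq[OF d this] obtain r where r: "strict_mono r" "AE \<omega> in M. (\<lambda>k. F (r k) \<omega> - Y \<omega>) \<longlonglongrightarrow> 0"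
    by blast
  have "(\<integral>\<^sup>+\<omega>. ennreal (Y \<omega> ^ 4) \<partial>M) = (\<integral>\<^sup>+\<omega>. liminf (\<lambda>k. ennreal (F (r k) \<omega> ^ 4)) \<partial>M)"
  proof (rule nn_integral_cong_AE)
    show "AE \<omega> in M. ennreal (Y \<omega> ^ 4) = liminf (\<lambda>k. ennreal (F (r k) \<omega> ^ 4))"
      using r(2)
    proof eventually_elim
      case (elim \<omega>)
      then have "(\<lambda>k. F (r k) \<omega>) \<longlonglongrightarrow> Y \<omega>" by (rule LIM_zero_cancel)
      then have "(\<lambda>k. ennreal (F (r k) \<omega> ^ 4)) \<longlonglongrightarrow> ennreal (Y \<omega> ^ 4)"
        by (intro tendsto_ennrealI tendsto_intros)
      then show ?case by (intro lim_imp_Liminf[symmetric]) auto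
    qed
  qed
  also have "\<dots> \<le> liminf (\<lambda>k. \<integral>\<^sup>+\<omega>. ennreal (F (r k) \<omega> ^ 4) \<partial>M)"
    by (rule nn_integral_liminf) simp
  also have "\<dots> \<le> liminf (\<lambda>k. ennreal (C (r k)))"
  proof (intro Liminf_mono always_eventually allI)
    fix k
    have "(\<integral>\<^sup>+\<omega>. ennreal (F (r k) \<omega> ^ 4) \<partial>M) = ennreal (expectation (\<lambda>\<omega>. F (r k) \<omega> ^ 4))"
      by (rule nn_integral_eq_integral[OF F4]) auto
    also have "\<dots> \<le> ennreal (C (r k))" by (rule ennreal_leI[OF le])
    finally show "(\<integral>\<^sup>+\<omega>. ennreal (F (r k) \<omega> ^ 4) \<partial>M) \<le> ennreal (C (r k))" .
  qed
  also have "\<dots> = ennreal c"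
    by (intro lim_imp_Liminf tendsto_ennrealI LIMSEQ_subseq_LIMSEQ[OF C r(1), unfolded comp_def]) auto
  finally show ?thesis .
qed

section \<open>Bounds for Wiener and double Wiener integrals\<close>

context wiener_process
begin

lemma gaussian_increments:
  assumes "strict_mono_on {..n} p"
  shows "gaussian_family M (\<lambda>i \<omega>. B (p (Suc i)) \<omega> - B (p i) \<omega>) (\<lambda>i. sqrt (p (Suc i) - p i)) n"
proof
  show "indep_vars (\<lambda>_. borel) (\<lambda>i \<omega>. B (p (Suc i)) \<omega> - B (p i) \<omega>) {..<n}"
    by (rule indep_increments[OF assms])
  fix i assume "i < n"
  then have "p i < p (Suc i)" by (rule strict_mono_on_Suc[OF assms])
  then show "distributed M lborel (\<lambda>\<omega>. B (p (Suc i)) \<omega> - B (p i) \<omega>) (normal_density 0 (sqrt (p (Suc i) - p i)))"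
    "0 < sqrt (p (Suc i) - p i)"
    by (auto intro: normal_increments)
qed

lemma step1_integral_iexp:
  assumes p: "strict_mono_on {..n} p"
  shows "integrable M (\<lambda>\<omega>. (step1_integral B n p a \<omega>)\<^sup>2)"
    and "expectation (\<lambda>\<omega>. iexp (u * step1_integral B n p a \<omega>)) = exp (- (u\<^sup>2 * (\<Sum>i<n. (a i)\<^sup>2 * (p (Suc i) - p i)) / 2))"
proof -
  define \<xi> where "\<xi> i \<omega> = B (p (Suc i)) \<omega> - B (p i) \<omega>" for i \<omega>
  define s where "s i = sqrt (p (Suc i) - p i)" for i
  interpret G: gaussian_family M \<xi> s n
    unfolding \<xi>_def s_def by (rule gaussian_increments[OF p])
  have st: "step1_integral B n p a = G.lin n a"
    by (simp add: fun_eq_iff step1_integral_def G.lin_def \<xi>_def)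
  have s2: "(s i)\<^sup>2 = p (Suc i) - p i" if "i < n" for i
    using strict_mono_on_Suc[OF p that] by (simp add: s_def)
  show "integrable M (\<lambda>\<omega>. (step1_integral B n p a \<omega>)\<^sup>2)"
    unfolding st by (rule G.lin_sq_integrable) simp
  have ind: "indep_vars (\<lambda>_. borel) (\<lambda>i \<omega>. iexp (u * (a i * \<xi> i \<omega>))) {..<n}"
    by (rule indep_vars_compose2[OF G.indep]) measurable
  have "expectation (\<lambda>\<omega>. iexp (u * G.lin n a \<omega>)) = expectation (\<lambda>\<omega>. \<Prod>i<n. iexp (u * (a i * \<xi> i \<omega>)))"
    by (simp add: G.lin_def sum_distrib_left exp_sum)
  also have "\<dots> = (\<Prod>i<n. expectation (\<lambda>\<omega>. iexp (u * (a i * \<xi> i \<omega>))))"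
  proof (rule indep_vars_lebesgue_integral[OF _ ind])
    fix i assume "i \<in> {..<n}"
    then have [measurable]: "\<xi> i \<in> borel_measurable M" by auto
    show "integrable M (\<lambda>\<omega>. iexp (u * (a i * \<xi> i \<omega>)))"
      using integrable_iexp_mult[of "\<lambda>_. 1" "\<lambda>\<omega>. u * (a i * \<xi> i \<omega>)"] by simp
  qed simp
  also have "\<dots> = (\<Prod>i<n. complex_of_real (exp (- (u\<^sup>2 * ((a i)\<^sup>2 * (p (Suc i) - p i)) / 2))))"
  proof (intro prod.cong refl)
    fix i assume "i \<in> {..<n}"
    then have i: "i < n" by simp
    have "expectation (\<lambda>\<omega>. iexp (u * (a i * \<xi> i \<omega>))) = expectation (\<lambda>\<omega>. iexp ((u * a i) * \<xi> i \<omega>))"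
      by (simp add: mult.assoc)
    also have "\<dots> = exp (- ((u * a i) * s i)\<^sup>2 / 2)"
      by (rule normal_iexp[OF G.normal[OF i] G.s_pos[OF i]])
    also have "- ((u * a i) * s i)\<^sup>2 / 2 = - (u\<^sup>2 * ((a i)\<^sup>2 * (p (Suc i) - p i)) / 2)"
      using s2[OF i] by (simp add: power_mult_distrib)
    finally show "expectation (\<lambda>\<omega>. iexp (u * (a i * \<xi> i \<omega>))) = complex_of_real (exp (- (u\<^sup>2 * ((a i)\<^sup>2 * (p (Suc i) - p i)) / 2)))" .
  qed
  also have "\<dots> = complex_of_real (exp (- (u\<^sup>2 * (\<Sum>i<n. (a i)\<^sup>2 * (p (Suc i) - p i)) / 2)))"
  proof -
    have "(\<Sum>i<n. - (u\<^sup>2 * ((a i)\<^sup>2 * (p (Suc i) - p i)) / 2)) = - (u\<^sup>2 * (\<Sum>i<n. (a i)\<^sup>2 * (p (Suc i) - p i)) / 2)"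
      by (simp add: sum_negf sum_divide_distrib sum_distrib_left)
    then show ?thesis by (simp only: of_real_prod[symmetric] exp_sum[symmetric] finite_lessThan)
  qed
  finally show "expectation (\<lambda>\<omega>. iexp (u * step1_integral B n p a \<omega>)) = exp (- (u\<^sup>2 * (\<Sum>i<n. (a i)\<^sup>2 * (p (Suc i) - p i)) / 2))"
    by (simp add: st)
qed

theorem wiener_integral_iexp:
  assumes "has_wiener_integral M B f Y"
  shows "integrable lborel (\<lambda>x. (f x)\<^sup>2)"
    and "expectation (\<lambda>\<omega>. iexp (u * Y \<omega>)) = exp (- (u\<^sup>2 * (LINT x|lborel. (f x)\<^sup>2) / 2))"
proof -
  obtain fs Fs where *: "\<And>k. elem1 B (fs k) (Fs k)" "L2_tendsto lborel fs f" "L2_tendsto M Fs Y"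
    using assms unfolding has_wiener_integral_iff by blast
  have **: "integrable M (\<lambda>\<omega>. (Fs k \<omega>)\<^sup>2) \<and> integrable lborel (\<lambda>x. (fs k x)\<^sup>2) \<and>
    expectation (\<lambda>\<omega>. iexp (u * Fs k \<omega>)) = exp (- (u\<^sup>2 * (LINT x|lborel. (fs k x)\<^sup>2) / 2))" for k
  proof -
    obtain n p a where p: "strict_mono_on {..n} p" "fs k = step1 n p a" "Fs k = step1_integral B n p a"
      using *(1)[of k] unfolding elem1_def by blast
    define N where "N = (\<Sum>i<n. (a i)\<^sup>2 * (p (Suc i) - p i))"
    have "N \<ge> 0"
      unfolding N_def using strict_mono_on_Suc[OF p(1)] by (intro sum_nonneg mult_nonneg_nonneg) (auto simp: less_imp_le)
    have nn: "(\<integral>\<^sup>+x. ennreal ((fs k x)\<^sup>2) \<partial>lborel) = ennreal N"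
      unfolding p(2) N_def by (rule step1_norm[OF p(1)])
    then have i: "integrable lborel (\<lambda>x. (fs k x)\<^sup>2)"
      by (intro iffD2[OF integrable_iff_nn_integral_square]) (auto simp: p(2))
    have "(LINT x|lborel. (fs k x)\<^sup>2) = N"
      using \<open>N \<ge> 0\<close> nn by (intro integral_eq_nn_integral[THEN trans]) (auto simp: p(2))
    with i step1_integral_iexp(1)[OF p(1), where a = a] step1_integral_iexp(2)[OF p(1), where a = a and u = u] show ?thesis by (simp add: p(3) N_def)
  qed
  have Fs2: "\<And>k. integrable M (\<lambda>\<omega>. (Fs k \<omega>)\<^sup>2)" and fs2: "\<And>k. integrable lborel (\<lambda>x. (fs k x)\<^sup>2)" using ** by auto
  note sq = L2_tendsto_square[OF *(2) fs2]
  show "integrable lborel (\<lambda>x. (f x)\<^sup>2)" by (rule sq(1))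
  have "(\<lambda>k. complex_of_real (exp (- (u\<^sup>2 * (LINT x|lborel. (fs k x)\<^sup>2) / 2)))) \<longlonglongrightarrow> exp (- (u\<^sup>2 * (LINT x|lborel. (f x)\<^sup>2) / 2))"
    by (intro tendsto_intros sq(4)) simp
  moreover have "(\<lambda>k. complex_of_real (exp (- (u\<^sup>2 * (LINT x|lborel. (fs k x)\<^sup>2) / 2)))) \<longlonglongrightarrow> expectation (\<lambda>\<omega>. iexp (u * Y \<omega>))"
    using L2_tendsto_iexp[OF *(3) Fs2, of u] ** by simp
  ultimately show "expectation (\<lambda>\<omega>. iexp (u * Y \<omega>)) = exp (- (u\<^sup>2 * (LINT x|lborel. (f x)\<^sup>2) / 2))"
    by (rule LIMSEQ_unique[rotated])
qed

text \<open>\<open>N\<close> is the squared norm of the symmetrized kernel and \<open>2 * N\<close>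
  the variance of \<open>F\<close>: hence 324 = 81 * 2^2, and \<open>u\<^sup>2 * N\<close> in the
  exponent without a factor 1/2.\<close>

lemma elem2_bounds:
  assumes "elem2 B h F"
  defines "hs \<equiv> (\<lambda>z. (h z + h (prod.swap z)) / 2)"
  obtains N R where "N \<ge> 0" "R \<ge> 0" "(\<integral>\<^sup>+x. ennreal ((hs x)\<^sup>2) \<partial>lborel) = ennreal N" "ennreal R \<le> contr_norm hs"
    "hs \<in> borel_measurable borel" "integrable M (\<lambda>\<omega>. F \<omega> ^ 4)" "F \<in> borel_measurable M"
    "expectation (\<lambda>\<omega>. F \<omega> ^ 4) \<le> 324 * N\<^sup>2"
    "\<And>u. norm (expectation (\<lambda>\<omega>. iexp (u * F \<omega>)) - exp (- (u\<^sup>2 * N))) \<le> u\<^sup>2 * (4 * sqrt R)"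
proof -
  obtain n p a where p: "strict_mono_on {..n} p" and a: "\<And>i j. a i j = a j i" "\<And>i. a i i = 0"
    and F: "F = step2_integral B n p a" and h: "\<And>x y. (h (x, y) + h (y, x)) / 2 = step2 n p a (x, y)"
    by (rule elem2_symmetric[OF assms(1)]) (rule that)
  have hs: "hs = step2 n p a"
  proof
    show "hs z = step2 n p a z" for z by (cases z) (simp only: hs_def swap_simp h)
  qed
  define \<xi> where "\<xi> i \<omega> = B (p (Suc i)) \<omega> - B (p i) \<omega>" for i \<omega>
  define s where "s i = sqrt (p (Suc i) - p i)" for i
  interpret G: gaussian_family M \<xi> s n
    unfolding \<xi>_def s_def by (rule gaussian_increments[OF p])
  have st: "F = G.quad n a"
    by (simp add: F fun_eq_iff step2_integral_def G.quad_def \<xi>_def)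
  have s2: "(s i)\<^sup>2 = p (Suc i) - p i" if "i < n" for i
    using strict_mono_on_Suc[OF p that] by (simp add: s_def)
  define N where "N = (\<Sum>i<n. \<Sum>j<n. (a i j)\<^sup>2 * (s i)\<^sup>2 * (s j)\<^sup>2)"
  define R where "R = (\<Sum>j<n. \<Sum>k<n. (\<Sum>i<n. (s i)\<^sup>2 * a i j * a i k)\<^sup>2 * (s j)\<^sup>2 * (s k)\<^sup>2)"
  show thesis
  proof (rule that[of N R])
    show "N \<ge> 0" "R \<ge> 0" unfolding N_def R_def by (intro sum_nonneg; simp)+
    show "(\<integral>\<^sup>+x. ennreal ((hs x)\<^sup>2) \<partial>lborel) = ennreal N"
      unfolding hs step2_norm[OF p] N_def by (intro arg_cong[where f = ennreal] sum.cong refl) (simp add: s2)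
    have "R = (\<Sum>j<n. \<Sum>k<n. (\<Sum>i<n. (p (Suc i) - p i) * a i j * a i k)\<^sup>2 * (p (Suc j) - p j) * (p (Suc k) - p k))"
      unfolding R_def by (intro sum.cong refl arg_cong2[where f = "(*)"] arg_cong[where f = "\<lambda>x. x\<^sup>2"]) (simp_all add: s2)
    then show "ennreal R \<le> contr_norm hs" unfolding hs using step2_contr_norm[OF p, of a] by simp
    show "hs \<in> borel_measurable borel" unfolding hs by simp
    show "integrable M (\<lambda>\<omega>. F \<omega> ^ 4)" "F \<in> borel_measurable M"
      unfolding st using G.quad_moments(1)[of a, OF a] by auto
    have "expectation (\<lambda>\<omega>. F \<omega> ^ 4) \<le> 81 * (2 * N)\<^sup>2"
      unfolding st N_def using G.quad_moments(2,3)[of a n, OF a] by simp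
    then show "expectation (\<lambda>\<omega>. F \<omega> ^ 4) \<le> 324 * N\<^sup>2" by (simp add: power_mult_distrib)
    show "norm (expectation (\<lambda>\<omega>. iexp (u * F \<omega>)) - exp (- (u\<^sup>2 * N))) \<le> u\<^sup>2 * (4 * sqrt R)" for u
      unfolding st N_def R_def by (rule G.quad_char_bound[OF a])
  qed
qed

lemma nn_integral_swap:
  fixes g :: "real \<times> real \<Rightarrow> ennreal"
  assumes [measurable]: "g \<in> borel_measurable borel"
  shows "(\<integral>\<^sup>+z. g (prod.swap z) \<partial>lborel) = (\<integral>\<^sup>+z. g z \<partial>lborel)"
proof -
  have "(\<integral>\<^sup>+z. g (prod.swap z) \<partial>lborel) = (\<integral>\<^sup>+x. \<integral>\<^sup>+y. g (y, x) \<partial>lborel \<partial>lborel)"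
  proof -
    have "prod.swap \<in> measurable (borel :: (real \<times> real) measure) (borel :: (real \<times> real) measure)"
      by (intro borel_measurable_continuous_onI continuous_on_swap)
    from measurable_compose[OF this assms] have "(\<lambda>z. g (prod.swap z)) \<in> borel_measurable borel" .
    from lborel_nn_integral_fst[OF this] show ?thesis by simp
  qed
  also have "\<dots> = (\<integral>\<^sup>+z. g z \<partial>lborel)" by (rule lborel_nn_integral_snd) simp
  finally show ?thesis .
qed

text \<open>The approximating step kernels need not be symmetric, and nothing is known of their
  contractions. Symmetrizing them leaves the integrals unchanged and, \<open>h\<close> being
  symmetric, does not increase the L2 error; \<open>contr_norm_le\<close> then compares their
  contractions with that of \<open>h\<close>, which produces the factor 3 under the root.\<close>

theorem double_wiener_integral_bounds:
  assumes I: "has_double_wiener_integral M B h Y" and sym: "\<And>x y. h (x, y) = h (y, x)"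
    and c: "contr_norm h \<le> ennreal c" "c \<ge> 0"
  shows "integrable lborel (\<lambda>x. (h x)\<^sup>2)"
    and "(\<integral>\<^sup>+\<omega>. ennreal (Y \<omega> ^ 4) \<partial>M) \<le> ennreal (324 * (LINT x|lborel. (h x)\<^sup>2)\<^sup>2)"
    and "norm (expectation (\<lambda>\<omega>. iexp (u * Y \<omega>)) - exp (- (u\<^sup>2 * (LINT x|lborel. (h x)\<^sup>2)))) \<le> u\<^sup>2 * (4 * sqrt (3 * c))"
proof -
  obtain hk Fk where *: "\<And>k. elem2 B (hk k) (Fk k)" "L2_tendsto lborel hk h" "L2_tendsto M Fk Y"
    using I unfolding has_double_wiener_integral_iff by blast
  define hs where "hs k z = (hk k z + hk k (prod.swap z)) / 2" for k z
  have "\<forall>k. \<exists>N R. N \<ge> 0 \<and> R \<ge> 0 \<and> (\<integral>\<^sup>+x. ennreal ((hs k x)\<^sup>2) \<partial>lborel) = ennreal N \<and> ennreal R \<le> contr_norm (hs k) \<and>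
    hs k \<in> borel_measurable borel \<and> integrable M (\<lambda>\<omega>. Fk k \<omega> ^ 4) \<and> Fk k \<in> borel_measurable M \<and>
    expectation (\<lambda>\<omega>. Fk k \<omega> ^ 4) \<le> 324 * N\<^sup>2 \<and>
    (\<forall>u. norm (expectation (\<lambda>\<omega>. iexp (u * Fk k \<omega>)) - exp (- (u\<^sup>2 * N))) \<le> u\<^sup>2 * (4 * sqrt R))"
    (is "\<forall>k. \<exists>N R. ?P k N R")
  proof
    fix k
    show "\<exists>N R. ?P k N R"
      unfolding hs_def[abs_def] by (rule elem2_bounds[OF *(1)[of k]]) blast
  qed
  then obtain N R where NR: "\<And>k. ?P k (N k) (R k)" by metis
  have [measurable]: "h \<in> borel_measurable borel" "hk k \<in> borel_measurable borel" for k
    using L2_tendsto_measurable[OF *(2)] by auto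
  have hsm[measurable]: "hs k \<in> borel_measurable borel" for k using NR by blast
  have L2: "L2_tendsto lborel hs h"
  proof -
    define d where "d k z = ennreal ((hk k z - h z)\<^sup>2)" for k z
    have dm: "d k \<in> borel_measurable borel" for k unfolding d_def[abs_def] by measurable
    have dsm: "(\<lambda>z. d k (prod.swap z)) \<in> borel_measurable lborel" for k
    proof -
      have "prod.swap \<in> measurable (borel :: (real \<times> real) measure) (borel :: (real \<times> real) measure)"
        by (intro borel_measurable_continuous_onI continuous_on_swap)
      from measurable_compose[OF this dm] show ?thesis by simp
    qed
    have "(\<integral>\<^sup>+z. ennreal ((hs k z - h z)\<^sup>2) \<partial>lborel) \<le> (\<integral>\<^sup>+z. d k z \<partial>lborel)" for k
    proof -
      have "(\<integral>\<^sup>+z. ennreal ((hs k z - h z)\<^sup>2) \<partial>lborel) \<le> (\<integral>\<^sup>+z. ennreal (1/2) * (d k z + d k (prod.swap z)) \<partial>lborel)"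
      proof (intro nn_integral_mono)
        fix z :: "real \<times> real"
        have "h (prod.swap z) = h z" using sym by (cases z) auto
        then have e: "hs k z - h z = ((hk k z - h z) + (hk k (prod.swap z) - h (prod.swap z))) / 2"
          by (simp add: hs_def field_simps)
        have "(hs k z - h z)\<^sup>2 \<le> 1/2 * ((hk k z - h z)\<^sup>2 + (hk k (prod.swap z) - h (prod.swap z))\<^sup>2)"
          unfolding e using sum_squares_bound[of "hk k z - h z" "hk k (prod.swap z) - h (prod.swap z)"]
          by (simp add: power_divide power2_sum)
        then have "ennreal ((hs k z - h z)\<^sup>2) \<le> ennreal (1/2 * ((hk k z - h z)\<^sup>2 + (hk k (prod.swap z) - h (prod.swap z))\<^sup>2))"
          by (rule ennreal_leI)
        also have "\<dots> = ennreal (1/2) * (d k z + d k (prod.swap z))"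
          unfolding d_def by (subst ennreal_mult') simp_all
        finally show "ennreal ((hs k z - h z)\<^sup>2) \<le> ennreal (1/2) * (d k z + d k (prod.swap z))" .
      qed
      also have "\<dots> = ennreal (1/2) * ((\<integral>\<^sup>+z. d k z \<partial>lborel) + (\<integral>\<^sup>+z. d k (prod.swap z) \<partial>lborel))"
        using dm dsm by (simp add: nn_integral_cmult nn_integral_add)
      also have "(\<integral>\<^sup>+z. d k (prod.swap z) \<partial>lborel) = (\<integral>\<^sup>+z. d k z \<partial>lborel)"
        by (rule nn_integral_swap[OF dm])
      also have "ennreal (1/2) * ((\<integral>\<^sup>+z. d k z \<partial>lborel) + (\<integral>\<^sup>+z. d k z \<partial>lborel)) = (\<integral>\<^sup>+z. d k z \<partial>lborel)"
      proof -
        have one: "ennreal (1/2) * ennreal 2 = 1"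
          by (subst ennreal_mult[symmetric]) auto
        have "ennreal (1/2) * (x + x) = (ennreal (1/2) * ennreal 2) * x" for x
          by (simp only: mult.assoc ennreal_numeral mult_2[symmetric])
        then show ?thesis by (simp only: one mult_1_left)
      qed
      finally show ?thesis .
    qed
    note le = this
    have lim: "(\<lambda>k. \<integral>\<^sup>+z. d k z \<partial>lborel) \<longlonglongrightarrow> 0"
      using *(2) by (simp add: L2_tendsto_def d_def)
    have "(\<lambda>k. \<integral>\<^sup>+z. ennreal ((hs k z - h z)\<^sup>2) \<partial>lborel) \<longlonglongrightarrow> 0"
      by (rule tendsto_sandwich[OF _ _ tendsto_const lim]) (use le in auto)
    then show ?thesis unfolding L2_tendsto_def by auto
  qed
  have hs2: "integrable lborel (\<lambda>x. (hs k x)\<^sup>2)" for k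
    using NR[of k] by (intro iffD2[OF integrable_iff_nn_integral_square]) auto
  have Nk: "(LINT x|lborel. (hs k x)\<^sup>2) = N k" for k
    using NR[of k] by (intro integral_eq_nn_integral[THEN trans]) auto
  note sq = L2_tendsto_square[OF L2 hs2]
  show hi: "integrable lborel (\<lambda>x. (h x)\<^sup>2)" by (rule sq(1))
  define N0 where "N0 = (LINT x|lborel. (h x)\<^sup>2)"
  have "N0 \<ge> 0" by (simp add: N0_def)
  have N: "N \<longlonglongrightarrow> N0" using sq(4) by (simp add: Nk N0_def)
  have F4: "integrable M (\<lambda>\<omega>. Fk k \<omega> ^ 4)" for k using NR by blast
  have F2: "integrable M (\<lambda>\<omega>. (Fk k \<omega>)\<^sup>2)" for k
    using integrable_power_mult_power[OF finite_measure_axioms, of "Fk k" "\<lambda>_. 1" 2 0] NR[of k] by simp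
  show "(\<integral>\<^sup>+\<omega>. ennreal (Y \<omega> ^ 4) \<partial>M) \<le> ennreal (324 * (LINT x|lborel. (h x)\<^sup>2)\<^sup>2)"
  proof (rule L2_tendsto_fourth_moment_le[OF *(3) F4])
    show "expectation (\<lambda>\<omega>. Fk k \<omega> ^ 4) \<le> 324 * (N k)\<^sup>2" for k using NR by blast
    show "(\<lambda>k. 324 * (N k)\<^sup>2) \<longlonglongrightarrow> 324 * (LINT x|lborel. (h x)\<^sup>2)\<^sup>2"
      unfolding N0_def[symmetric] by (intro tendsto_intros N)
  qed
  define D where "D k = (LINT x|lborel. (hs k x - h x)\<^sup>2)" for k
  have D0: "D k \<ge> 0" for k by (simp add: D_def)
  have Dl: "D \<longlonglongrightarrow> 0" using sq(3) by (simp only: D_def[abs_def])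
  have Rk: "R k \<le> 3 * (c + D k * (N k + N0))" for k
  proof -
    have N0e: "(\<integral>\<^sup>+x. ennreal ((h x)\<^sup>2) \<partial>lborel) = ennreal N0"
      unfolding N0_def by (rule nn_integral_eq_integral[OF hi]) simp
    have De: "(\<integral>\<^sup>+x. ennreal ((hs k x - h x)\<^sup>2) \<partial>lborel) = ennreal (D k)"
      unfolding D_def by (rule nn_integral_eq_integral[OF sq(2)]) simp
    have Nke: "(\<integral>\<^sup>+x. ennreal ((hs k x)\<^sup>2) \<partial>lborel) = ennreal (N k)" and Nk0: "N k \<ge> 0" using NR by auto
    have "ennreal (R k) \<le> contr_norm (hs k)" using NR by blast
    also have "\<dots> \<le> 3 * (contr_norm h + ennreal (D k) * (ennreal (N k) + ennreal N0))"
      using contr_norm_le[of "hs k" h] by (simp add: N0e De Nke)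
    also have "\<dots> \<le> 3 * (ennreal c + ennreal (D k) * (ennreal (N k) + ennreal N0))"
      by (intro mult_left_mono add_mono c) auto
    also have "\<dots> = ennreal (3 * (c + D k * (N k + N0)))"
      using c(2) D0[of k] Nk0 \<open>N0 \<ge> 0\<close> by (simp add: ennreal_mult')
    finally show ?thesis
      using c(2) D0[of k] Nk0 \<open>N0 \<ge> 0\<close> by (subst (asm) ennreal_le_iff) auto
  qed
  have "norm (expectation (\<lambda>\<omega>. iexp (u * Y \<omega>)) - exp (- (u\<^sup>2 * N0))) \<le> u\<^sup>2 * (4 * sqrt (3 * (c + 0 * (N0 + N0))))"
  proof (rule LIMSEQ_le)
    show "(\<lambda>k. norm (expectation (\<lambda>\<omega>. iexp (u * Fk k \<omega>)) - complex_of_real (exp (- (u\<^sup>2 * N k))))) \<longlonglongrightarrow>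
        norm (expectation (\<lambda>\<omega>. iexp (u * Y \<omega>)) - complex_of_real (exp (- (u\<^sup>2 * N0))))"
      by (intro tendsto_intros L2_tendsto_iexp[OF *(3) F2] N)
    show "(\<lambda>k. u\<^sup>2 * (4 * sqrt (3 * (c + D k * (N k + N0))))) \<longlonglongrightarrow> u\<^sup>2 * (4 * sqrt (3 * (c + 0 * (N0 + N0))))"
      by (intro tendsto_intros N Dl)
    have "norm (expectation (\<lambda>\<omega>. iexp (u * Fk k \<omega>)) - complex_of_real (exp (- (u\<^sup>2 * N k)))) \<le> u\<^sup>2 * (4 * sqrt (3 * (c + D k * (N k + N0))))" for k
    proof -
      have "norm (expectation (\<lambda>\<omega>. iexp (u * Fk k \<omega>)) - complex_of_real (exp (- (u\<^sup>2 * N k)))) \<le> u\<^sup>2 * (4 * sqrt (R k))"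
        using NR by blast
      also have "\<dots> \<le> u\<^sup>2 * (4 * sqrt (3 * (c + D k * (N k + N0))))"
        using Rk[of k] by (intro mult_left_mono) auto
      finally show ?thesis .
    qed
    then show "\<exists>K. \<forall>k\<ge>K. norm (expectation (\<lambda>\<omega>. iexp (u * Fk k \<omega>)) - complex_of_real (exp (- (u\<^sup>2 * N k)))) \<le> u\<^sup>2 * (4 * sqrt (3 * (c + D k * (N k + N0))))"
      by blast
  qed
  then show "norm (expectation (\<lambda>\<omega>. iexp (u * Y \<omega>)) - exp (- (u\<^sup>2 * (LINT x|lborel. (h x)\<^sup>2)))) \<le> u\<^sup>2 * (4 * sqrt (3 * c))"
    by (simp add: N0_def)
qed

end

subsection \<open>Rosenblatt kernels\<close>

text \<open>Used to evaluate Gamma integrals and, read backwards, to write a negative power of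
  \<open>b\<close> as a mixture of exponentials.\<close>

lemma nn_integral_powr_exp:
  assumes "p > 0" "b > (0::real)"
  shows "(\<integral>\<^sup>+r. ennreal (indicator {0<..} r * r powr (p - 1) * exp (- (b * r))) \<partial>lborel) = ennreal (Gamma p * b powr (- p))"
proof -
  define f where "f r = ennreal (indicator {0<..} r * r powr (p - 1) * exp (- (b * r)))" for r :: real
  have [measurable]: "f \<in> borel_measurable borel" unfolding f_def[abs_def] by measurable
  have "(\<integral>\<^sup>+r. f r \<partial>lborel) = ennreal \<bar>1/b\<bar> * (\<integral>\<^sup>+t. f (0 + (1/b) * t) \<partial>lborel)"
    by (rule nn_integral_real_affine) (use assms in auto)
  also have "(\<integral>\<^sup>+t. f (0 + (1/b) * t) \<partial>lborel) = (\<integral>\<^sup>+t. ennreal (b powr (1 - p)) * ennreal (indicator {0..} t * t powr (p - 1) / exp t) \<partial>lborel)"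
  proof (rule nn_integral_cong_AE)
    have "AE t in lborel. t \<noteq> (0::real)" by (rule AE_lborel_singleton)
    then show "AE t in lborel. f (0 + (1/b) * t) = ennreal (b powr (1 - p)) * ennreal (indicator {0..} t * t powr (p - 1) / exp t)"
    proof eventually_elim
      case (elim t)
      show ?case
      proof (cases "t > 0")
        case True
        have "(t / b) powr (p - 1) = b powr (1 - p) * t powr (p - 1)"
          using True assms by (simp add: powr_divide powr_minus[symmetric] powr_diff powr_minus field_simps)
        then show ?thesis using True assms
          by (simp add: f_def exp_minus field_simps flip: ennreal_mult')
      next
        case False
        then have "t < 0" using elim by simp
        then show ?thesis using assms by (auto simp: f_def indicator_def zero_less_divide_iff)
      qed
    qed
  qed
  also have "\<dots> = ennreal (b powr (1 - p)) * ennreal (Gamma p)"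
    by (simp add: nn_integral_cmult Gamma_conv_nn_integral_real[OF assms(1)])
  also have "ennreal \<bar>1/b\<bar> * (ennreal (b powr (1 - p)) * ennreal (Gamma p)) = ennreal (Gamma p * b powr (- p))"
  proof -
    have "(1/b) * (b powr (1 - p) * Gamma p) = Gamma p * b powr (- p)"
      using assms by (simp add: powr_diff powr_minus field_simps)
    moreover have "Gamma p > 0" using assms(1) by (rule Gamma_real_pos)
    ultimately show ?thesis using assms by (simp add: less_imp_le flip: ennreal_mult)
  qed
  finally show ?thesis by (simp only: f_def)
qed

definition frac_kernel :: "real \<Rightarrow> real \<Rightarrow> real \<Rightarrow> real" where
  "frac_kernel H u y = max (u - y) 0 powr (H / 2 - 1)"

lemma frac_kernel_nonneg [simp]: "frac_kernel H u y \<ge> 0" by (simp add: frac_kernel_def)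

lemma frac_kernel_measurable [measurable]:
  "(\<lambda>(u, y). frac_kernel H u y) \<in> borel_measurable (borel \<Otimes>\<^sub>M borel)"
  unfolding frac_kernel_def by measurable

text \<open>The Gram kernel of the fractional kernels, see
  \<open>nn_integral_frac_kernel\<close>.\<close>

definition beta_kernel :: "real \<Rightarrow> real \<Rightarrow> real \<Rightarrow> real" where
  "beta_kernel H u v = Beta (H / 2) (1 - H) * \<bar>u - v\<bar> powr (H - 1)"

lemma Beta_pos: "a > 0 \<Longrightarrow> b > 0 \<Longrightarrow> Beta a b > (0::real)"
  unfolding Beta_def by (intro divide_pos_pos mult_pos_pos Gamma_real_pos) auto

text \<open>With \<open>d = v - u\<close> this is the integral of
  \<open>s powr a * (s + d) powr a\<close> over s > 0. Writing \<open>(s + d) powr a\<close> as a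
  Gamma integral and exchanging the order leaves two Gamma integrals, and
  \<open>Gamma (a + 1) * Gamma (- 2 * a - 1) / Gamma (- a)\<close> is the Beta value.\<close>

lemma nn_integral_frac_kernel_less:
  assumes H: "1/2 < H" "H < 1" and uv: "u < v"
  shows "(\<integral>\<^sup>+y. ennreal (frac_kernel H u y * frac_kernel H v y) \<partial>lborel) = ennreal (beta_kernel H u v)"
proof -
  define a where "a = H / 2 - 1"
  define d where "d = v - u"
  have d: "d > 0" using uv by (simp add: d_def)
  \<comment> \<open>Convergence of the three Gamma integrals; the last quantity is 1 - H.\<close>
  have a: "- a > 0" "a + 1 > 0" "- 2 * a - 1 > 0" using H by (auto simp: a_def)
  define I where "I = (\<integral>\<^sup>+s. ennreal (indicator {0<..} s * s powr a * (s + d) powr a) \<partial>lborel)"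
  have "(\<integral>\<^sup>+y. ennreal (frac_kernel H u y * frac_kernel H v y) \<partial>lborel) = ennreal \<bar>-1\<bar> * (\<integral>\<^sup>+s. ennreal (frac_kernel H u (u + (-1) * s) * frac_kernel H v (u + (-1) * s)) \<partial>lborel)"
    by (rule nn_integral_real_affine) (auto simp: frac_kernel_def)
  also have "(\<integral>\<^sup>+s. ennreal (frac_kernel H u (u + (-1) * s) * frac_kernel H v (u + (-1) * s)) \<partial>lborel) = I"
    unfolding I_def
  proof (intro nn_integral_cong)
    fix s :: real
    have "frac_kernel H u (u + (-1) * s) * frac_kernel H v (u + (-1) * s) = indicator {0<..} s * s powr a * (s + d) powr a"
      using d by (cases "s > 0") (auto simp: frac_kernel_def a_def d_def max_def algebra_simps)
    then show "ennreal (frac_kernel H u (u + (-1) * s) * frac_kernel H v (u + (-1) * s)) = ennreal (indicator {0<..} s * s powr a * (s + d) powr a)" by simp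
  qed
  finally have 1: "(\<integral>\<^sup>+y. ennreal (frac_kernel H u y * frac_kernel H v y) \<partial>lborel) = I" by simp
  have "ennreal (Gamma (-a)) * I = (\<integral>\<^sup>+s. ennreal (indicator {0<..} s * s powr a) * ennreal (Gamma (-a) * (s + d) powr (- (- a))) \<partial>lborel)"
    unfolding I_def using Gamma_real_pos[OF a(1)]
    by (subst nn_integral_cmult[symmetric]) (auto intro!: nn_integral_cong simp: less_imp_le ac_simps simp flip: ennreal_mult')
  also have "\<dots> = (\<integral>\<^sup>+s. \<integral>\<^sup>+r. ennreal (indicator {0<..} s * s powr a) * ennreal (indicator {0<..} r * r powr (- a - 1) * exp (- ((s + d) * r))) \<partial>lborel \<partial>lborel)"
  proof (intro nn_integral_cong)
    fix s :: real
    show "ennreal (indicator {0<..} s * s powr a) * ennreal (Gamma (-a) * (s + d) powr (- (- a))) =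
      (\<integral>\<^sup>+r. ennreal (indicator {0<..} s * s powr a) * ennreal (indicator {0<..} r * r powr (- a - 1) * exp (- ((s + d) * r))) \<partial>lborel)"
    proof (cases "s > 0")
      case True
      then have "s + d > 0" using d by simp
      from nn_integral_powr_exp[OF a(1) this] show ?thesis by (simp add: nn_integral_cmult)
    qed simp
  qed
  also have "\<dots> = (\<integral>\<^sup>+r. \<integral>\<^sup>+s. ennreal (indicator {0<..} s * s powr a) * ennreal (indicator {0<..} r * r powr (- a - 1) * exp (- ((s + d) * r))) \<partial>lborel \<partial>lborel)"
    by (rule lborel_pair.Fubini') measurable
  also have "\<dots> = (\<integral>\<^sup>+r. ennreal (Gamma (a + 1)) * ennreal (indicator {0<..} r * r powr ((- 2 * a - 1) - 1) * exp (- (d * r))) \<partial>lborel)"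
  proof (intro nn_integral_cong)
    fix r :: real
    show "(\<integral>\<^sup>+s. ennreal (indicator {0<..} s * s powr a) * ennreal (indicator {0<..} r * r powr (- a - 1) * exp (- ((s + d) * r))) \<partial>lborel) =
      ennreal (Gamma (a + 1)) * ennreal (indicator {0<..} r * r powr ((- 2 * a - 1) - 1) * exp (- (d * r)))"
    proof (cases "r > 0")
      case True
      have "(\<integral>\<^sup>+s. ennreal (indicator {0<..} s * s powr a) * ennreal (indicator {0<..} r * r powr (- a - 1) * exp (- ((s + d) * r))) \<partial>lborel) =
        (\<integral>\<^sup>+s. ennreal (r powr (- a - 1) * exp (- (d * r))) * ennreal (indicator {0<..} s * s powr ((a + 1) - 1) * exp (- (r * s))) \<partial>lborel)"
        using True by (intro nn_integral_cong) (simp add: algebra_simps exp_add[symmetric] flip: ennreal_mult')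
      also have "\<dots> = ennreal (r powr (- a - 1) * exp (- (d * r))) * ennreal (Gamma (a + 1) * r powr (- (a + 1)))"
        using nn_integral_powr_exp[OF a(2) True] by (subst nn_integral_cmult) simp_all
      also have "\<dots> = ennreal (Gamma (a + 1) * ((r powr (- a - 1) * r powr (- (a + 1))) * exp (- (d * r))))"
        by (subst ennreal_mult'[symmetric]) (simp_all add: ac_simps)
      also have "r powr (- a - 1) * r powr (- (a + 1)) = r powr ((- 2 * a - 1) - 1)"
        by (subst powr_add[symmetric]) (rule arg_cong[where f = "(powr) r"], simp)
      finally show ?thesis using True Gamma_real_pos[OF a(2)] by (simp add: less_imp_le ennreal_mult')
    qed simp
  qed
  also have "\<dots> = ennreal (Gamma (a + 1)) * ennreal (Gamma (- 2 * a - 1) * d powr (- (- 2 * a - 1)))"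
    using nn_integral_powr_exp[OF a(3) d] by (subst nn_integral_cmult) simp_all
  finally have 2: "ennreal (Gamma (-a)) * I = ennreal (Gamma (a + 1)) * ennreal (Gamma (- 2 * a - 1) * d powr (- (- 2 * a - 1)))" .
  have G: "Gamma (-a) > 0" "Gamma (a + 1) > 0" "Gamma (- 2 * a - 1) > 0" using a by (auto intro: Gamma_real_pos)
  have "I = ennreal (1 / Gamma (-a)) * (ennreal (Gamma (-a)) * I)"
  proof -
    have "ennreal (1 / Gamma (-a)) * ennreal (Gamma (-a)) = 1"
      using G by (subst ennreal_mult'[symmetric]) auto
    then show ?thesis by (simp add: mult.assoc[symmetric])
  qed
  also have "\<dots> = ennreal (1 / Gamma (-a) * (Gamma (a + 1) * (Gamma (- 2 * a - 1) * d powr (- (- 2 * a - 1)))))"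
    unfolding 2 using G by (simp add: less_imp_le flip: ennreal_mult')
  also have "1 / Gamma (-a) * (Gamma (a + 1) * (Gamma (- 2 * a - 1) * d powr (- (- 2 * a - 1)))) = beta_kernel H u v"
  proof -
    have e: "a + 1 = H / 2" "- 2 * a - 1 = 1 - H" "- a = H / 2 + (1 - H)" by (auto simp: a_def field_simps)
    have "d = \<bar>u - v\<bar>" using uv by (simp add: d_def)
    then show ?thesis by (simp only: e beta_kernel_def Beta_def) simp
  qed
  finally show ?thesis using 1 by simp
qed

text \<open>For \<open>u = v\<close> the equality would fail: the integral diverges, whereas
  \<open>0 powr (H - 1) = 0\<close> on the right.\<close>

lemma nn_integral_frac_kernel:
  assumes H: "1/2 < H" "H < 1" and uv: "u \<noteq> v"
  shows "(\<integral>\<^sup>+y. ennreal (frac_kernel H u y) * ennreal (frac_kernel H v y) \<partial>lborel) = ennreal (beta_kernel H u v)"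
proof -
  have "(\<integral>\<^sup>+y. ennreal (frac_kernel H u y * frac_kernel H v y) \<partial>lborel) = ennreal (beta_kernel H u v)"
  proof (cases "u < v")
    case True then show ?thesis by (rule nn_integral_frac_kernel_less[OF H])
  next
    case False
    then have "v < u" using uv by simp
    from nn_integral_frac_kernel_less[OF H this] show ?thesis by (simp add: mult.commute beta_kernel_def abs_minus_commute)
  qed
  then show ?thesis by (simp add: ennreal_mult')
qed

lemma beta_kernel_nonneg: "1/2 < H \<Longrightarrow> H < 1 \<Longrightarrow> beta_kernel H u v \<ge> 0"
  unfolding beta_kernel_def using Beta_pos[of "H/2" "1 - H"] by simp

lemma beta_kernel_measurable [measurable]:
  "(\<lambda>(u, v). beta_kernel H u v) \<in> borel_measurable (borel \<Otimes>\<^sub>M borel)"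
  unfolding beta_kernel_def by measurable

section \<open>Contractions of fractional kernels\<close>

text \<open>The elimination rule for the variable \<open>y\<close>: two fractional kernels meeting
  at \<open>y\<close> are replaced by one \<open>beta_kernel\<close> between their other ends. The
  contraction and inner product formulas below are repeated uses of it.\<close>

lemma kernel_pairing:
  fixes A B :: "real \<Rightarrow> ennreal"
  assumes H: "1/2 < H" "H < 1" and [measurable]: "A \<in> borel_measurable borel" "B \<in> borel_measurable borel"
  shows "(\<integral>\<^sup>+y. (\<integral>\<^sup>+u. A u * ennreal (frac_kernel H u y) \<partial>lborel) * (\<integral>\<^sup>+v. B v * ennreal (frac_kernel H v y) \<partial>lborel) \<partial>lborel) =
    (\<integral>\<^sup>+u. \<integral>\<^sup>+v. A u * B v * ennreal (beta_kernel H u v) \<partial>lborel \<partial>lborel)"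
proof -
  have "(\<integral>\<^sup>+y. (\<integral>\<^sup>+u. A u * ennreal (frac_kernel H u y) \<partial>lborel) * (\<integral>\<^sup>+v. B v * ennreal (frac_kernel H v y) \<partial>lborel) \<partial>lborel) =
    (\<integral>\<^sup>+y. \<integral>\<^sup>+u. A u * ennreal (frac_kernel H u y) * (\<integral>\<^sup>+v. B v * ennreal (frac_kernel H v y) \<partial>lborel) \<partial>lborel \<partial>lborel)"
    by (intro nn_integral_cong nn_integral_multc[symmetric]) measurable
  also have "\<dots> = (\<integral>\<^sup>+u. \<integral>\<^sup>+y. A u * ennreal (frac_kernel H u y) * (\<integral>\<^sup>+v. B v * ennreal (frac_kernel H v y) \<partial>lborel) \<partial>lborel \<partial>lborel)"
    by (rule lborel_pair.Fubini') measurable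
  also have "\<dots> = (\<integral>\<^sup>+u. \<integral>\<^sup>+y. \<integral>\<^sup>+v. A u * ennreal (frac_kernel H u y) * (B v * ennreal (frac_kernel H v y)) \<partial>lborel \<partial>lborel \<partial>lborel)"
    by (intro nn_integral_cong nn_integral_cmult[symmetric]) measurable
  also have "\<dots> = (\<integral>\<^sup>+u. \<integral>\<^sup>+v. \<integral>\<^sup>+y. A u * ennreal (frac_kernel H u y) * (B v * ennreal (frac_kernel H v y)) \<partial>lborel \<partial>lborel \<partial>lborel)"
    by (intro nn_integral_cong lborel_pair.Fubini') measurable
  also have "\<dots> = (\<integral>\<^sup>+u. \<integral>\<^sup>+v. A u * B v * ennreal (beta_kernel H u v) \<partial>lborel \<partial>lborel)"
  proof (rule nn_integral_cong)
    fix u :: real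
    show "(\<integral>\<^sup>+v. \<integral>\<^sup>+y. A u * ennreal (frac_kernel H u y) * (B v * ennreal (frac_kernel H v y)) \<partial>lborel \<partial>lborel) = (\<integral>\<^sup>+v. A u * B v * ennreal (beta_kernel H u v) \<partial>lborel)"
    proof (rule nn_integral_cong_AE)
      have "AE v in lborel. v \<noteq> u" by (rule AE_lborel_singleton)
      then show "AE v in lborel. (\<integral>\<^sup>+y. A u * ennreal (frac_kernel H u y) * (B v * ennreal (frac_kernel H v y)) \<partial>lborel) = A u * B v * ennreal (beta_kernel H u v)"
      proof eventually_elim
        case (elim v)
        have "(\<integral>\<^sup>+y. A u * ennreal (frac_kernel H u y) * (B v * ennreal (frac_kernel H v y)) \<partial>lborel) = (\<integral>\<^sup>+y. (A u * B v) * (ennreal (frac_kernel H u y) * ennreal (frac_kernel H v y)) \<partial>lborel)"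
          by (simp add: ac_simps)
        also have "\<dots> = (A u * B v) * (\<integral>\<^sup>+y. ennreal (frac_kernel H u y) * ennreal (frac_kernel H v y) \<partial>lborel)"
          by (rule nn_integral_cmult) measurable
        finally show ?case using nn_integral_frac_kernel[OF H, of u v] elim by simp
      qed
    qed
  qed
  finally show ?thesis .
qed

text \<open>Eliminating \<open>x\<close> (once in each factor of the square), then \<open>z\<close>
  and \<open>y\<close>, leaves four points joined in a cycle by \<open>beta_kernel\<close>. Between
  two opposite corners the cycle consists of two paths of length two, which gives the square of
  \<open>m\<close>.\<close>

lemma contraction_quadruple:
  fixes F :: "real \<Rightarrow> ennreal"
  assumes H: "1/2 < H" "H < 1" and F[measurable]: "F \<in> borel_measurable borel"
  defines "K \<equiv> \<lambda>x y. \<integral>\<^sup>+u. F u * ennreal (frac_kernel H u x) * ennreal (frac_kernel H u y) \<partial>lborel"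
    and "m \<equiv> \<lambda>p q. \<integral>\<^sup>+v. F v * ennreal (beta_kernel H p v) * ennreal (beta_kernel H v q) \<partial>lborel"
  shows "(\<integral>\<^sup>+y. \<integral>\<^sup>+z. (\<integral>\<^sup>+x. K x y * K x z \<partial>lborel)\<^sup>2 \<partial>lborel \<partial>lborel) = (\<integral>\<^sup>+q. \<integral>\<^sup>+p. F q * F p * (m p q)\<^sup>2 \<partial>lborel \<partial>lborel)"
proof -
  define b where "b u v = ennreal (beta_kernel H u v)" for u v
  define k where "k u y = ennreal (frac_kernel H u y)" for u y
  have bm[measurable]: "(\<lambda>(u, v). b u v) \<in> borel_measurable (borel \<Otimes>\<^sub>M borel)" unfolding b_def by measurable
  have km[measurable]: "(\<lambda>(u, v). k u v) \<in> borel_measurable (borel \<Otimes>\<^sub>M borel)" unfolding k_def by measurable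
  define E where "E y v = F v * (\<integral>\<^sup>+u. F u * b u v * k u y \<partial>lborel)" for y v
  have Em[measurable]: "(\<lambda>(y, v). E y v) \<in> borel_measurable (borel \<Otimes>\<^sub>M borel)" unfolding E_def by measurable
  note pair = kernel_pairing[OF H, folded b_def k_def]
  have 1: "(\<integral>\<^sup>+x. K x y * K x z \<partial>lborel) = (\<integral>\<^sup>+v. E y v * k v z \<partial>lborel)" for y z
  proof -
    have "(\<integral>\<^sup>+x. K x y * K x z \<partial>lborel) = (\<integral>\<^sup>+x. (\<integral>\<^sup>+u. (F u * k u y) * k u x \<partial>lborel) * (\<integral>\<^sup>+v. (F v * k v z) * k v x \<partial>lborel) \<partial>lborel)"
      by (simp add: K_def k_def ac_simps)
    also have "\<dots> = (\<integral>\<^sup>+u. \<integral>\<^sup>+v. (F u * k u y) * (F v * k v z) * b u v \<partial>lborel \<partial>lborel)"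
      by (rule pair) measurable
    also have "\<dots> = (\<integral>\<^sup>+v. \<integral>\<^sup>+u. (F u * k u y) * (F v * k v z) * b u v \<partial>lborel \<partial>lborel)"
      by (rule lborel_pair.Fubini') measurable
    also have "\<dots> = (\<integral>\<^sup>+v. \<integral>\<^sup>+u. (F v * k v z) * (F u * b u v * k u y) \<partial>lborel \<partial>lborel)"
      by (simp add: ac_simps)
    also have "\<dots> = (\<integral>\<^sup>+v. (F v * k v z) * (\<integral>\<^sup>+u. F u * b u v * k u y \<partial>lborel) \<partial>lborel)"
      by (rule nn_integral_cong, rule nn_integral_cmult) measurable
    finally show ?thesis by (simp add: E_def ac_simps)
  qed
  have 2: "(\<integral>\<^sup>+z. (\<integral>\<^sup>+x. K x y * K x z \<partial>lborel)\<^sup>2 \<partial>lborel) = (\<integral>\<^sup>+v. \<integral>\<^sup>+v'. E y v * E y v' * b v v' \<partial>lborel \<partial>lborel)" for y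
    unfolding 1 power2_eq_square by (rule pair) measurable
  have 3: "(\<integral>\<^sup>+y. E y v * E y v' \<partial>lborel) = (\<integral>\<^sup>+u. \<integral>\<^sup>+u'. F v * F v' * (F u * b u v * (F u' * b u' v') * b u u') \<partial>lborel \<partial>lborel)" for v v'
  proof -
    have "(\<integral>\<^sup>+y. E y v * E y v' \<partial>lborel) = (\<integral>\<^sup>+y. (F v * F v') * ((\<integral>\<^sup>+u. F u * b u v * k u y \<partial>lborel) * (\<integral>\<^sup>+u. F u * b u v' * k u y \<partial>lborel)) \<partial>lborel)"
      by (simp add: E_def ac_simps)
    also have "\<dots> = (F v * F v') * (\<integral>\<^sup>+y. (\<integral>\<^sup>+u. F u * b u v * k u y \<partial>lborel) * (\<integral>\<^sup>+u. F u * b u v' * k u y \<partial>lborel) \<partial>lborel)"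
      by (rule nn_integral_cmult) measurable
    also have "(\<integral>\<^sup>+y. (\<integral>\<^sup>+u. F u * b u v * k u y \<partial>lborel) * (\<integral>\<^sup>+u. F u * b u v' * k u y \<partial>lborel) \<partial>lborel) =
       (\<integral>\<^sup>+u. \<integral>\<^sup>+u'. F u * b u v * (F u' * b u' v') * b u u' \<partial>lborel \<partial>lborel)"
      by (rule pair) measurable
    also have "(F v * F v') * \<dots> = (\<integral>\<^sup>+u. (F v * F v') * (\<integral>\<^sup>+u'. F u * b u v * (F u' * b u' v') * b u u' \<partial>lborel) \<partial>lborel)"
      by (rule nn_integral_cmult[symmetric]) measurable
    also have "\<dots> = (\<integral>\<^sup>+u. \<integral>\<^sup>+u'. F v * F v' * (F u * b u v * (F u' * b u' v') * b u u') \<partial>lborel \<partial>lborel)"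
      by (rule nn_integral_cong, rule nn_integral_cmult[symmetric]) measurable
    finally show ?thesis .
  qed
  have "(\<integral>\<^sup>+y. \<integral>\<^sup>+z. (\<integral>\<^sup>+x. K x y * K x z \<partial>lborel)\<^sup>2 \<partial>lborel \<partial>lborel) = (\<integral>\<^sup>+y. \<integral>\<^sup>+v. \<integral>\<^sup>+v'. E y v * E y v' * b v v' \<partial>lborel \<partial>lborel \<partial>lborel)"
    unfolding 2 ..
  also have "\<dots> = (\<integral>\<^sup>+v. \<integral>\<^sup>+y. \<integral>\<^sup>+v'. E y v * E y v' * b v v' \<partial>lborel \<partial>lborel \<partial>lborel)"
    by (rule lborel_pair.Fubini') measurable
  also have "\<dots> = (\<integral>\<^sup>+v. \<integral>\<^sup>+v'. \<integral>\<^sup>+y. E y v * E y v' * b v v' \<partial>lborel \<partial>lborel \<partial>lborel)"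
    by (rule nn_integral_cong, rule lborel_pair.Fubini') measurable
  also have "\<dots> = (\<integral>\<^sup>+v. \<integral>\<^sup>+v'. (\<integral>\<^sup>+y. E y v * E y v' \<partial>lborel) * b v v' \<partial>lborel \<partial>lborel)"
    by (rule nn_integral_cong, rule nn_integral_cong, rule nn_integral_multc) measurable
  also have "\<dots> = (\<integral>\<^sup>+v'. \<integral>\<^sup>+v. (\<integral>\<^sup>+y. E y v * E y v' \<partial>lborel) * b v v' \<partial>lborel \<partial>lborel)"
    by (rule lborel_pair.Fubini') measurable
  also have "\<dots> = (\<integral>\<^sup>+v'. \<integral>\<^sup>+v. \<integral>\<^sup>+u. \<integral>\<^sup>+u'. F v * F v' * (F u * b u v * (F u' * b u' v') * b u u') * b v v' \<partial>lborel \<partial>lborel \<partial>lborel \<partial>lborel)"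
    unfolding 3
  proof (rule nn_integral_cong, rule nn_integral_cong)
    fix v' v :: real
    have "(\<integral>\<^sup>+u. \<integral>\<^sup>+u'. F v * F v' * (F u * b u v * (F u' * b u' v') * b u u') \<partial>lborel \<partial>lborel) * b v v' =
       (\<integral>\<^sup>+u. (\<integral>\<^sup>+u'. F v * F v' * (F u * b u v * (F u' * b u' v') * b u u') \<partial>lborel) * b v v' \<partial>lborel)"
      by (rule nn_integral_multc[symmetric]) measurable
    also have "\<dots> = (\<integral>\<^sup>+u. \<integral>\<^sup>+u'. F v * F v' * (F u * b u v * (F u' * b u' v') * b u u') * b v v' \<partial>lborel \<partial>lborel)"
      by (rule nn_integral_cong, rule nn_integral_multc[symmetric]) measurable
    finally show "(\<integral>\<^sup>+u. \<integral>\<^sup>+u'. F v * F v' * (F u * b u v * (F u' * b u' v') * b u u') \<partial>lborel \<partial>lborel) * b v v' = \<dots>" .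
  qed
  also have "\<dots> = (\<integral>\<^sup>+v'. \<integral>\<^sup>+u. \<integral>\<^sup>+v. \<integral>\<^sup>+u'. F v * F v' * (F u * b u v * (F u' * b u' v') * b u u') * b v v' \<partial>lborel \<partial>lborel \<partial>lborel \<partial>lborel)"
    by (rule nn_integral_cong, rule lborel_pair.Fubini') measurable
  also have "\<dots> = (\<integral>\<^sup>+v'. \<integral>\<^sup>+u. F v' * F u * (m u v')\<^sup>2 \<partial>lborel \<partial>lborel)"
  proof (rule nn_integral_cong, rule nn_integral_cong)
    fix v' u :: real
    have "(\<integral>\<^sup>+v. \<integral>\<^sup>+u'. F v * F v' * (F u * b u v * (F u' * b u' v') * b u u') * b v v' \<partial>lborel \<partial>lborel) =
      (\<integral>\<^sup>+v. \<integral>\<^sup>+u'. (F v' * F u * (F v * b u v * b v v')) * (F u' * b u u' * b u' v') \<partial>lborel \<partial>lborel)"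
      by (simp add: ac_simps)
    also have "\<dots> = (\<integral>\<^sup>+v. (F v' * F u * (F v * b u v * b v v')) * (\<integral>\<^sup>+u'. F u' * b u u' * b u' v' \<partial>lborel) \<partial>lborel)"
      by (rule nn_integral_cong, rule nn_integral_cmult) measurable
    also have "\<dots> = (\<integral>\<^sup>+v. F v' * F u * (F v * b u v * b v v') \<partial>lborel) * (\<integral>\<^sup>+u'. F u' * b u u' * b u' v' \<partial>lborel)"
      by (rule nn_integral_multc) measurable
    also have "(\<integral>\<^sup>+v. F v' * F u * (F v * b u v * b v v') \<partial>lborel) = F v' * F u * (\<integral>\<^sup>+v. F v * b u v * b v v' \<partial>lborel)"
      by (rule nn_integral_cmult) measurable
    finally show "(\<integral>\<^sup>+v. \<integral>\<^sup>+u'. F v * F v' * (F u * b u v * (F u' * b u' v') * b u u') * b v v' \<partial>lborel \<partial>lborel) = F v' * F u * (m u v')\<^sup>2"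
      by (simp add: m_def b_def power2_eq_square mult.assoc)
  qed
  finally show ?thesis .
qed

section \<open>Singular integrals, uniformly in the index\<close>

text \<open>A majorant free of \<open>H\<close>, integrable near zero, of all powers with exponent
  between -3/4 and 0, see \<open>powr_le_sing_bound\<close>.\<close>

definition sing_bound :: "real \<Rightarrow> real" where
  "sing_bound x = \<bar>x\<bar> powr (-3/4) * indicator {-1..1} x + 1"

lemma sing_bound_nonneg [simp]: "sing_bound x \<ge> 0" by (simp add: sing_bound_def)

lemma sing_bound_measurable [measurable]: "sing_bound \<in> borel_measurable borel"
  unfolding sing_bound_def[abs_def] by measurable

lemma powr_le_sing_bound:
  assumes "- 3/4 \<le> e" "e \<le> 0" "x \<noteq> 0"
  shows "\<bar>x\<bar> powr e \<le> sing_bound x"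
proof (cases "\<bar>x\<bar> \<le> 1")
  case True
  then have "\<bar>x\<bar> powr e \<le> \<bar>x\<bar> powr (-3/4)" using assms by (intro powr_mono') auto
  then show ?thesis using True by (auto simp: sing_bound_def indicator_def)
next
  case False
  then have "\<bar>x\<bar> powr e \<le> \<bar>x\<bar> powr 0" using assms by (intro powr_mono) auto
  then show ?thesis using False assms by (auto simp: sing_bound_def indicator_def)
qed

text \<open>The farther of \<open>p\<close> and \<open>q\<close> lies at distance at least |p - q| /
  2 from \<open>v\<close>. A power -1/4 of that distance is split off; the remaining exponent H -
  3/4 \<le> 0 moves to the nearer point, where it adds up to 2H - 7/4, still at least -3/4. This is
  where H \<le> 3/4 enters.\<close>

lemma singular_product_le:
  assumes H: "1/2 < H" "H \<le> 3/4" and ne: "v \<noteq> p" "v \<noteq> q" "p \<noteq> q"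
  shows "\<bar>v - p\<bar> powr (H - 1) * \<bar>v - q\<bar> powr (H - 1) \<le> (sing_bound (v - p) + sing_bound (v - q)) * (\<bar>p - q\<bar> / 2) powr (-1/4)"
proof -
  have main: "a powr (H - 1) * b powr (H - 1) \<le> a powr (2 * H - 7/4) * (D / 2) powr (-1/4)"
    if "0 < a" "a \<le> b" "0 < D" "D \<le> a + b" for a b D
  proof -
    have "b powr (H - 1) = b powr (H - 3/4) * b powr (-1/4)" by (simp add: powr_add[symmetric])
    also have "\<dots> \<le> a powr (H - 3/4) * (D / 2) powr (-1/4)"
      using that H by (intro mult_mono powr_mono2') auto
    finally have "a powr (H - 1) * b powr (H - 1) \<le> a powr (H - 1) * (a powr (H - 3/4) * (D / 2) powr (-1/4))"
      by (intro mult_left_mono) auto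
    also have "\<dots> = a powr (2 * H - 7/4) * (D / 2) powr (-1/4)"
      by (simp add: powr_add[symmetric] mult.assoc[symmetric])
    finally show ?thesis .
  qed
  have e: "- 3/4 \<le> 2 * H - 7/4" "2 * H - 7/4 \<le> 0" using H by auto
  have tri: "\<bar>p - q\<bar> \<le> \<bar>v - p\<bar> + \<bar>v - q\<bar>" by linarith
  show ?thesis
  proof (cases "\<bar>v - p\<bar> \<le> \<bar>v - q\<bar>")
    case True
    have "\<bar>v - p\<bar> powr (H - 1) * \<bar>v - q\<bar> powr (H - 1) \<le> \<bar>v - p\<bar> powr (2 * H - 7/4) * (\<bar>p - q\<bar> / 2) powr (-1/4)"
      using main[of "\<bar>v - p\<bar>" "\<bar>v - q\<bar>" "\<bar>p - q\<bar>"] True tri ne by auto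
    also have "\<dots> \<le> (sing_bound (v - p) + sing_bound (v - q)) * (\<bar>p - q\<bar> / 2) powr (-1/4)"
      using powr_le_sing_bound[OF e, of "v - p"] ne by (intro mult_right_mono) (auto intro: add_increasing2)
    finally show ?thesis .
  next
    case False
    have "\<bar>v - q\<bar> powr (H - 1) * \<bar>v - p\<bar> powr (H - 1) \<le> \<bar>v - q\<bar> powr (2 * H - 7/4) * (\<bar>p - q\<bar> / 2) powr (-1/4)"
      using main[of "\<bar>v - q\<bar>" "\<bar>v - p\<bar>" "\<bar>p - q\<bar>"] False tri ne by auto
    also have "\<dots> \<le> (sing_bound (v - p) + sing_bound (v - q)) * (\<bar>p - q\<bar> / 2) powr (-1/4)"
      using powr_le_sing_bound[OF e, of "v - q"] ne by (intro mult_right_mono) (auto intro: add_increasing)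
    finally show ?thesis by (simp add: mult.commute)
  qed
qed

lemma nn_integral_abs_powr:
  assumes "e > -1"
  shows "(\<integral>\<^sup>+x. ennreal (\<bar>x\<bar> powr e * indicator {-1..1} x) \<partial>lborel) = ennreal (2 / (e + 1))"
proof -
  define f where "f x = ennreal (\<bar>x\<bar> powr e * indicator {0..1} x)" for x :: real
  have [measurable]: "f \<in> borel_measurable borel" unfolding f_def[abs_def] by measurable
  have "((\<lambda>x. x powr e) has_integral (1 powr (e + 1) / (e + 1))) {0..1}"
    by (rule has_integral_powr_from_0) (use assms in auto)
  then have "(\<integral>\<^sup>+x. ennreal (indicator {0..1} x * x powr e) \<partial>lborel) = ennreal (1 / (e + 1))"
    using assms by (intro nn_integral_has_integral_lebesgue) auto
  then have f: "(\<integral>\<^sup>+x. f x \<partial>lborel) = ennreal (1 / (e + 1))"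
    by (rule trans[rotated]) (auto intro!: nn_integral_cong simp: f_def indicator_def)
  have "(\<integral>\<^sup>+x. f x \<partial>lborel) = ennreal \<bar>-1\<bar> * (\<integral>\<^sup>+x. f (0 + (-1) * x) \<partial>lborel)"
    by (rule nn_integral_real_affine) auto
  then have f': "(\<integral>\<^sup>+x. f (- x) \<partial>lborel) = ennreal (1 / (e + 1))" using f by simp
  have "(\<integral>\<^sup>+x. ennreal (\<bar>x\<bar> powr e * indicator {-1..1} x) \<partial>lborel) = (\<integral>\<^sup>+x. f x + f (- x) \<partial>lborel)"
    by (rule nn_integral_cong) (auto simp: f_def indicator_def)
  also have "\<dots> = ennreal (1 / (e + 1)) + ennreal (1 / (e + 1))"
    by (subst nn_integral_add) (auto simp: f f')
  also have "\<dots> = ennreal (2 / (e + 1))"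
    using assms by (subst ennreal_plus[symmetric]) auto
  finally show ?thesis .
qed

lemma nn_integral_shift:
  fixes f :: "real \<Rightarrow> ennreal"
  assumes [measurable]: "f \<in> borel_measurable borel"
  shows "(\<integral>\<^sup>+x. f (x - p) \<partial>lborel) = (\<integral>\<^sup>+x. f x \<partial>lborel)"
  using nn_integral_real_affine[of f 1 "- p"] by (simp add: add.commute)

text \<open>8 = 2 / (1 - 3/4) is the integral of the singular part, where \<open>F \<le> 1\<close>
  is used; the constant part of \<open>sing_bound\<close> yields the integral of
  \<open>F\<close>.\<close>

lemma nn_integral_mult_sing_bound_le:
  fixes F :: "real \<Rightarrow> ennreal"
  assumes [measurable]: "F \<in> borel_measurable borel" and F1: "\<And>x. F x \<le> 1"
  shows "(\<integral>\<^sup>+v. F v * ennreal (sing_bound (v - p)) \<partial>lborel) \<le> 8 + (\<integral>\<^sup>+v. F v \<partial>lborel)"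
proof -
  define g where "g x = ennreal (\<bar>x\<bar> powr (-3/4) * indicator {-1..1} x)" for x :: real
  have [measurable]: "g \<in> borel_measurable borel" unfolding g_def[abs_def] by measurable
  have "(\<integral>\<^sup>+v. F v * ennreal (sing_bound (v - p)) \<partial>lborel) \<le> (\<integral>\<^sup>+v. g (v - p) + F v \<partial>lborel)"
  proof (rule nn_integral_mono)
    fix v
    have "F v * ennreal (sing_bound (v - p)) = F v * g (v - p) + F v"
      by (simp add: sing_bound_def g_def distrib_left)
    also have "\<dots> \<le> 1 * g (v - p) + F v" by (intro add_mono mult_right_mono F1) auto
    finally show "F v * ennreal (sing_bound (v - p)) \<le> g (v - p) + F v" by simp
  qed
  also have "\<dots> = (\<integral>\<^sup>+v. g v \<partial>lborel) + (\<integral>\<^sup>+v. F v \<partial>lborel)"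
    by (subst nn_integral_add) (auto simp: nn_integral_shift)
  also have "(\<integral>\<^sup>+v. g v \<partial>lborel) = 8"
    unfolding g_def using nn_integral_abs_powr[of "-3/4"] by simp
  finally show ?thesis .
qed

text \<open>The bound is uniform in \<open>H \<le> 3/4\<close> apart from the Beta factor, which the normalizing constant
  of the Rosenblatt kernel turns into \<open>(2H - 1)\<^sup>2\<close>.\<close>

lemma contraction_bound:
  fixes F :: "real \<Rightarrow> ennreal"
  assumes H: "1/2 < H" "H \<le> 3/4" and F[measurable]: "F \<in> borel_measurable borel" and F1: "\<And>x. F x \<le> 1"
    and I: "(\<integral>\<^sup>+v. F v \<partial>lborel) \<le> ennreal I" "I \<ge> 0"
  defines "K \<equiv> \<lambda>x y. \<integral>\<^sup>+u. F u * ennreal (frac_kernel H u x) * ennreal (frac_kernel H u y) \<partial>lborel"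
  shows "(\<integral>\<^sup>+y. \<integral>\<^sup>+z. (\<integral>\<^sup>+x. K x y * K x z \<partial>lborel)\<^sup>2 \<partial>lborel \<partial>lborel) \<le> ennreal (8 * (8 + I) ^ 3 * I * (Beta (H / 2) (1 - H)) ^ 4)"
proof -
  define \<beta> where "\<beta> = Beta (H / 2) (1 - H)"
  have \<beta>: "\<beta> > 0" unfolding \<beta>_def using H by (intro Beta_pos) auto
  define m where "m p q = (\<integral>\<^sup>+v. F v * ennreal (beta_kernel H p v) * ennreal (beta_kernel H v q) \<partial>lborel)" for p q
  have g8: "(\<integral>\<^sup>+v. F v * ennreal (sing_bound (v - p)) \<partial>lborel) \<le> ennreal (8 + I)" for p
  proof -
    have "(\<integral>\<^sup>+v. F v * ennreal (sing_bound (v - p)) \<partial>lborel) \<le> 8 + ennreal I"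
      by (rule order_trans[OF nn_integral_mult_sing_bound_le[OF F F1]]) (intro add_left_mono I)
    then show ?thesis using I by simp
  qed
  have mb: "m p q \<le> ennreal (\<beta>\<^sup>2 * (2 * (8 + I)) * (\<bar>p - q\<bar> / 2) powr (-1/4))" if "p \<noteq> q" for p q
  proof -
    define R where "R = \<beta>\<^sup>2 * (\<bar>p - q\<bar> / 2) powr (-1/4)"
    have "R \<ge> 0" by (simp add: R_def)
    have "m p q \<le> (\<integral>\<^sup>+v. ennreal R * (F v * ennreal (sing_bound (v - p)) + F v * ennreal (sing_bound (v - q))) \<partial>lborel)"
      unfolding m_def
    proof (rule nn_integral_mono_AE)
      have "AE v in lborel. v \<noteq> p \<and> v \<noteq> q" using AE_lborel_singleton[of p] AE_lborel_singleton[of q] by auto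
      then show "AE v in lborel. F v * ennreal (beta_kernel H p v) * ennreal (beta_kernel H v q) \<le> ennreal R * (F v * ennreal (sing_bound (v - p)) + F v * ennreal (sing_bound (v - q)))"
      proof eventually_elim
        case (elim v)
        have "beta_kernel H p v * beta_kernel H v q = \<beta>\<^sup>2 * (\<bar>v - p\<bar> powr (H - 1) * \<bar>v - q\<bar> powr (H - 1))"
          by (simp add: beta_kernel_def \<beta>_def power2_eq_square abs_minus_commute[of p v])
        also have "\<dots> \<le> \<beta>\<^sup>2 * ((sing_bound (v - p) + sing_bound (v - q)) * (\<bar>p - q\<bar> / 2) powr (-1/4))"
          using elim that by (intro mult_left_mono singular_product_le[OF H]) auto
        also have "\<dots> = R * (sing_bound (v - p) + sing_bound (v - q))" by (simp add: R_def)
        finally have "ennreal (beta_kernel H p v) * ennreal (beta_kernel H v q) \<le> ennreal (R * (sing_bound (v - p) + sing_bound (v - q)))"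
          using beta_kernel_nonneg[of H] H by (subst ennreal_mult'[symmetric]) (auto intro: ennreal_leI)
        then have "F v * (ennreal (beta_kernel H p v) * ennreal (beta_kernel H v q)) \<le> F v * ennreal (R * (sing_bound (v - p) + sing_bound (v - q)))"
          by (rule mult_left_mono) simp
        also have "ennreal (R * (sing_bound (v - p) + sing_bound (v - q))) = ennreal R * (ennreal (sing_bound (v - p)) + ennreal (sing_bound (v - q)))"
          using \<open>R \<ge> 0\<close> by (simp add: ennreal_mult')
        finally show ?case by (simp only: distrib_left ac_simps)
      qed
    qed
    also have "\<dots> = ennreal R * ((\<integral>\<^sup>+v. F v * ennreal (sing_bound (v - p)) \<partial>lborel) + (\<integral>\<^sup>+v. F v * ennreal (sing_bound (v - q)) \<partial>lborel))"
      by (simp add: nn_integral_cmult nn_integral_add)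
    also have "\<dots> \<le> ennreal R * (ennreal (8 + I) + ennreal (8 + I))"
      by (intro mult_left_mono add_mono g8) auto
    also have "\<dots> = ennreal (R * ((8 + I) + (8 + I)))"
      using \<open>R \<ge> 0\<close> I(2) by (simp only: ennreal_mult'[OF \<open>R \<ge> 0\<close>], subst ennreal_plus) auto
    also have "R * ((8 + I) + (8 + I)) = \<beta>\<^sup>2 * (2 * (8 + I)) * (\<bar>p - q\<bar> / 2) powr (-1/4)" by (simp add: R_def algebra_simps)
    finally show ?thesis .
  qed
  \<comment> \<open>Squaring \<open>mb\<close> doubles the exponent -1/4 to -1/2, again within reach
    of \<open>sing_bound\<close>; the 8 is 4 from the square times 2 as a bound for
    \<open>2 powr (1/2)\<close>.\<close>
  define S where "S = 8 * (8 + I)\<^sup>2 * \<beta> ^ 4"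
  have S0: "S \<ge> 0" by (simp add: S_def)
  have m2: "(m p q)\<^sup>2 \<le> ennreal S * ennreal (sing_bound (p - q))" if "p \<noteq> q" for p q
  proof -
    have "(m p q)\<^sup>2 \<le> (ennreal (\<beta>\<^sup>2 * (2 * (8 + I)) * (\<bar>p - q\<bar> / 2) powr (-1/4)))\<^sup>2"
      by (rule power_mono[OF mb[OF that]]) simp
    also have "\<dots> = ennreal ((\<beta>\<^sup>2 * (2 * (8 + I)) * (\<bar>p - q\<bar> / 2) powr (-1/4))\<^sup>2)"
      using I by (intro ennreal_power) auto
    also have "\<dots> \<le> ennreal (S * sing_bound (p - q))"
    proof (rule ennreal_leI)
    have "((\<bar>p - q\<bar> / 2) powr (-1/4))\<^sup>2 = (\<bar>p - q\<bar> / 2) powr (-1/2)"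
      unfolding power2_eq_square by (subst powr_add[symmetric]) simp
    then have "(\<beta>\<^sup>2 * (2 * (8 + I)) * (\<bar>p - q\<bar> / 2) powr (-1/4))\<^sup>2 = \<beta> ^ 4 * (4 * (8 + I)\<^sup>2) * (\<bar>p - q\<bar> / 2) powr (-1/2)"
      by (simp only: power_mult_distrib) simp
    also have "\<dots> \<le> \<beta> ^ 4 * (4 * (8 + I)\<^sup>2) * (2 * sing_bound (p - q))"
    proof (intro mult_left_mono)
      have "(\<bar>p - q\<bar> / 2) powr (-1/2) = \<bar>p - q\<bar> powr (-1/2) * 2 powr (1/2)"
        by (simp add: powr_divide powr_minus field_simps)
      also have "\<dots> \<le> sing_bound (p - q) * 2"
      proof (intro mult_mono)
        show "\<bar>p - q\<bar> powr (-1/2) \<le> sing_bound (p - q)" by (rule powr_le_sing_bound) (use that in auto)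
        have "(2::real) powr (1/2) \<le> 2 powr 1" by (intro powr_mono) auto
        then show "(2::real) powr (1/2) \<le> 2" by simp
      qed auto
      finally show "(\<bar>p - q\<bar> / 2) powr (-1/2) \<le> 2 * sing_bound (p - q)" by simp
    qed auto
    also have "\<dots> = S * sing_bound (p - q)" by (simp add: S_def)
    finally show "(\<beta>\<^sup>2 * (2 * (8 + I)) * (\<bar>p - q\<bar> / 2) powr (-1/4))\<^sup>2 \<le> S * sing_bound (p - q)" .
    qed
    finally show ?thesis using S0 by (simp add: ennreal_mult')
  qed
  have "(\<integral>\<^sup>+y. \<integral>\<^sup>+z. (\<integral>\<^sup>+x. K x y * K x z \<partial>lborel)\<^sup>2 \<partial>lborel \<partial>lborel) = (\<integral>\<^sup>+q. \<integral>\<^sup>+p. F q * F p * (m p q)\<^sup>2 \<partial>lborel \<partial>lborel)"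
    unfolding K_def m_def by (rule contraction_quadruple[OF _ _ F]) (use H in auto)
  also have "\<dots> \<le> (\<integral>\<^sup>+q. F q * ennreal S * ennreal (8 + I) \<partial>lborel)"
  proof (rule nn_integral_mono)
    fix q :: real
    have "(\<integral>\<^sup>+p. F q * F p * (m p q)\<^sup>2 \<partial>lborel) \<le> (\<integral>\<^sup>+p. (F q * ennreal S) * (F p * ennreal (sing_bound (p - q))) \<partial>lborel)"
    proof (rule nn_integral_mono_AE)
      have "AE p in lborel. p \<noteq> q" by (rule AE_lborel_singleton)
      then show "AE p in lborel. F q * F p * (m p q)\<^sup>2 \<le> (F q * ennreal S) * (F p * ennreal (sing_bound (p - q)))"
      proof eventually_elim
        case (elim p)
        have "F q * F p * (m p q)\<^sup>2 \<le> F q * F p * (ennreal S * ennreal (sing_bound (p - q)))"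
          by (intro mult_left_mono m2 elim) auto
        then show ?case by (simp only: ac_simps)
      qed
    qed
    also have "\<dots> = (F q * ennreal S) * (\<integral>\<^sup>+p. F p * ennreal (sing_bound (p - q)) \<partial>lborel)"
      by (rule nn_integral_cmult) measurable
    also have "\<dots> \<le> (F q * ennreal S) * ennreal (8 + I)"
      by (intro mult_left_mono g8) auto
    finally show "(\<integral>\<^sup>+p. F q * F p * (m p q)\<^sup>2 \<partial>lborel) \<le> F q * ennreal S * ennreal (8 + I)" .
  qed
  also have "\<dots> = (\<integral>\<^sup>+q. F q \<partial>lborel) * (ennreal S * ennreal (8 + I))"
    unfolding mult.assoc by (rule nn_integral_multc) measurable
  also have "\<dots> \<le> ennreal I * (ennreal S * ennreal (8 + I))"
    by (intro mult_right_mono I) auto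
  also have "\<dots> = ennreal (I * (S * (8 + I)))"
    using I S0 by (simp only: ennreal_mult' mult_nonneg_nonneg)
  also have "I * (S * (8 + I)) = 8 * (8 + I) ^ 3 * I * \<beta> ^ 4"
    by (simp add: S_def power2_eq_square power3_eq_cube)
  finally show ?thesis by (simp only: \<beta>_def)
qed

subsection \<open>The Ornstein-Uhlenbeck covariances\<close>

definition fOU :: "real \<Rightarrow> real \<Rightarrow> real \<Rightarrow> real" where
  "fOU lam t u = indicator {..t} u * exp (- lam * (t - u))"

lemma fOU_nonneg [simp]: "fOU lam t u \<ge> 0" by (simp add: fOU_def)

lemma fOU_measurable [measurable]: "fOU lam t \<in> borel_measurable borel"
  unfolding fOU_def[abs_def] by measurable

text \<open>A reflection at \<open>m\<close> turns this into the Gamma integral with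
  \<open>p = 1\<close>.\<close>

lemma nn_integral_exp_atMost:
  assumes "b > (0::real)"
  shows "(\<integral>\<^sup>+v. ennreal (indicator {..m} v * exp (b * v)) \<partial>lborel) = ennreal (exp (b * m) / b)"
proof -
  define f where "f v = ennreal (indicator {..m} v * exp (b * v))" for v :: real
  have [measurable]: "f \<in> borel_measurable borel" unfolding f_def[abs_def] by measurable
  have "(\<integral>\<^sup>+v. f v \<partial>lborel) = ennreal \<bar>-1\<bar> * (\<integral>\<^sup>+r. f (m + (-1) * r) \<partial>lborel)"
    by (rule nn_integral_real_affine) auto
  also have "(\<integral>\<^sup>+r. f (m + (-1) * r) \<partial>lborel) = (\<integral>\<^sup>+r. ennreal (exp (b * m)) * ennreal (indicator {0<..} r * r powr (1 - 1) * exp (- (b * r))) \<partial>lborel)"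
  proof (rule nn_integral_cong_AE)
    have "AE r in lborel. r \<noteq> (0::real)" by (rule AE_lborel_singleton)
    then show "AE r in lborel. f (m + (-1) * r) = ennreal (exp (b * m)) * ennreal (indicator {0<..} r * r powr (1 - 1) * exp (- (b * r)))"
      by eventually_elim (auto simp: f_def indicator_def exp_diff right_diff_distrib exp_minus field_simps simp flip: ennreal_mult')
  qed
  also have "\<dots> = ennreal (exp (b * m)) * ennreal (Gamma 1 * b powr (- 1))"
    using nn_integral_powr_exp[of 1 b] assms by (subst nn_integral_cmult) simp_all
  also have "\<dots> = ennreal (exp (b * m) / b)"
    using assms by (subst ennreal_mult'[symmetric]) (auto simp: powr_minus divide_inverse)
  finally show ?thesis by (simp add: f_def)
qed

lemma nn_integral_fOU:
  assumes "lam > 0"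
  shows "(\<integral>\<^sup>+v. ennreal (fOU lam t v) \<partial>lborel) = ennreal (1 / lam)"
proof -
  have "(\<integral>\<^sup>+v. ennreal (fOU lam t v) \<partial>lborel) = (\<integral>\<^sup>+v. ennreal (exp (- lam * t)) * ennreal (indicator {..t} v * exp (lam * v)) \<partial>lborel)"
    by (rule nn_integral_cong) (simp add: fOU_def right_diff_distrib exp_diff exp_minus field_simps flip: ennreal_mult')
  also have "\<dots> = ennreal (exp (- lam * t)) * ennreal (exp (lam * t) / lam)"
    using nn_integral_exp_atMost[OF assms] by (subst nn_integral_cmult) simp_all
  also have "\<dots> = ennreal (1 / lam)"
    by (subst ennreal_mult'[symmetric]) (auto simp: exp_minus)
  finally show ?thesis .
qed

text \<open>The correlation of two exponential weights \<open>fOU\<close> at shift \<open>x\<close>,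
  with lag \<open>\<tau> = t - s\<close>, see \<open>nn_integral_fOU_mult\<close>; at
  \<open>x = 0\<close> it is the covariance of the Gaussian limit for \<sigma> = 1.\<close>

definition cov_OU :: "real \<Rightarrow> real \<Rightarrow> real \<Rightarrow> real" where
  "cov_OU lam \<tau> x = exp (- lam * \<bar>x - \<tau>\<bar>) / (2 * lam)"

lemma cov_OU_measurable [measurable]: "cov_OU lam \<tau> \<in> borel_measurable borel"
  unfolding cov_OU_def[abs_def] by measurable

lemma nn_integral_fOU_mult:
  assumes "lam > 0"
  shows "(\<integral>\<^sup>+v. ennreal (fOU lam t (x + v) * fOU lam s v) \<partial>lborel) = ennreal (cov_OU lam (t - s) x)"
proof -
  define m where "m = min s (t - x)"
  have "(\<integral>\<^sup>+v. ennreal (fOU lam t (x + v) * fOU lam s v) \<partial>lborel) =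
      (\<integral>\<^sup>+v. ennreal (exp (- lam * (t + s - x))) * ennreal (indicator {..m} v * exp ((2 * lam) * v)) \<partial>lborel)"
  proof (rule nn_integral_cong)
    fix v
    have "exp (- lam * (t - (x + v))) * exp (- lam * (s - v)) = exp (- lam * (t + s - x)) * exp ((2 * lam) * v)"
      unfolding exp_add[symmetric] by (simp add: algebra_simps)
    then have "fOU lam t (x + v) * fOU lam s v = exp (- lam * (t + s - x)) * (indicator {..m} v * exp ((2 * lam) * v))"
      by (auto simp: fOU_def m_def indicator_def)
    then show "ennreal (fOU lam t (x + v) * fOU lam s v) = ennreal (exp (- lam * (t + s - x))) * ennreal (indicator {..m} v * exp ((2 * lam) * v))"
      by (simp add: ennreal_mult')
  qed
  also have "\<dots> = ennreal (exp (- lam * (t + s - x))) * ennreal (exp ((2 * lam) * m) / (2 * lam))"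
    using nn_integral_exp_atMost[of "2 * lam" m] assms by (subst nn_integral_cmult) simp_all
  also have "\<dots> = ennreal (exp (- lam * (t + s - x)) * exp ((2 * lam) * m) / (2 * lam))"
    by (subst ennreal_mult'[symmetric]) auto
  also have "exp (- lam * (t + s - x)) * exp ((2 * lam) * m) = exp (- lam * \<bar>x - (t - s)\<bar>)"
    unfolding exp_add[symmetric] by (auto simp: m_def min_def abs_if algebra_simps)
  finally show ?thesis by (simp add: cov_OU_def)
qed

text \<open>The substitution u = x + v makes the singular factor depend on \<open>x\<close> alone,
  and integrating out \<open>v\<close> leaves the correlation function.\<close>

lemma nn_integral_fOU_kernel:
  assumes "lam > 0"
  shows "(\<integral>\<^sup>+u. \<integral>\<^sup>+v. ennreal (fOU lam t u) * ennreal (fOU lam s v) * ennreal (\<bar>u - v\<bar> powr e) \<partial>lborel \<partial>lborel) =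
    (\<integral>\<^sup>+x. ennreal (\<bar>x\<bar> powr e) * ennreal (cov_OU lam (t - s) x) \<partial>lborel)"
proof -
  define g where "g u v = ennreal (fOU lam t u) * ennreal (fOU lam s v) * ennreal (\<bar>u - v\<bar> powr e)" for u v
  have [measurable]: "(\<lambda>(u, v). g u v) \<in> borel_measurable (borel \<Otimes>\<^sub>M borel)" unfolding g_def by measurable
  have "(\<integral>\<^sup>+u. \<integral>\<^sup>+v. g u v \<partial>lborel \<partial>lborel) = (\<integral>\<^sup>+v. \<integral>\<^sup>+u. g u v \<partial>lborel \<partial>lborel)"
    by (rule lborel_pair.Fubini') measurable
  also have "\<dots> = (\<integral>\<^sup>+v. \<integral>\<^sup>+x. g (x + v) v \<partial>lborel \<partial>lborel)"
  proof (rule nn_integral_cong)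
    fix v :: real
    show "(\<integral>\<^sup>+u. g u v \<partial>lborel) = (\<integral>\<^sup>+x. g (x + v) v \<partial>lborel)"
      using nn_integral_shift[of "\<lambda>u. g u v" "- v"] by simp
  qed
  also have "\<dots> = (\<integral>\<^sup>+x. \<integral>\<^sup>+v. g (x + v) v \<partial>lborel \<partial>lborel)"
    by (rule lborel_pair.Fubini') measurable
  also have "\<dots> = (\<integral>\<^sup>+x. \<integral>\<^sup>+v. ennreal (\<bar>x\<bar> powr e) * ennreal (fOU lam t (x + v) * fOU lam s v) \<partial>lborel \<partial>lborel)"
    by (intro nn_integral_cong) (simp add: g_def ennreal_mult' ac_simps)
  also have "\<dots> = (\<integral>\<^sup>+x. ennreal (\<bar>x\<bar> powr e) * ennreal (cov_OU lam (t - s) x) \<partial>lborel)"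
  proof (rule nn_integral_cong)
    fix x :: real
    show "(\<integral>\<^sup>+v. ennreal (\<bar>x\<bar> powr e) * ennreal (fOU lam t (x + v) * fOU lam s v) \<partial>lborel) = ennreal (\<bar>x\<bar> powr e) * ennreal (cov_OU lam (t - s) x)"
      unfolding nn_integral_fOU_mult[OF assms, symmetric] by (rule nn_integral_cmult) measurable
  qed
  finally show ?thesis by (simp only: g_def)
qed

section \<open>Inner products of Rosenblatt kernels\<close>

text \<open>The kernel without its constant and with values in \<open>ennreal\<close>, so that
  Tonelli's theorem applies unconditionally; for nonnegative \<open>f\<close>,
  \<open>rosenblatt_kernel\<close> is the Bochner version, with the default value 0 where this one
  is infinite.\<close>

definition nn_kernel :: "real \<Rightarrow> (real \<Rightarrow> real) \<Rightarrow> real \<Rightarrow> real \<Rightarrow> ennreal" where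
  "nn_kernel H f x y = (\<integral>\<^sup>+u. ennreal (f u) * ennreal (frac_kernel H u x) * ennreal (frac_kernel H u y) \<partial>lborel)"

lemma nn_kernel_measurable [measurable]:
  "f \<in> borel_measurable borel \<Longrightarrow> (\<lambda>(x, y). nn_kernel H f x y) \<in> borel_measurable (borel \<Otimes>\<^sub>M borel)"
proof -
  assume [measurable]: "f \<in> borel_measurable borel"
  show ?thesis unfolding nn_kernel_def by measurable
qed

text \<open>Eliminating \<open>x\<close> and \<open>y\<close> gives \<open>beta_kernel\<close>
  twice, whence the squared Beta value and the exponent 2 (H - 1).\<close>

lemma nn_kernel_pairing:
  assumes H: "1/2 < H" "H < 1" and [measurable]: "f \<in> borel_measurable borel" "g \<in> borel_measurable borel"
  shows "(\<integral>\<^sup>+x. \<integral>\<^sup>+y. nn_kernel H f x y * nn_kernel H g x y \<partial>lborel \<partial>lborel) =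
    ennreal ((Beta (H / 2) (1 - H))\<^sup>2) * (\<integral>\<^sup>+u. \<integral>\<^sup>+v. ennreal (f u) * ennreal (g v) * ennreal (\<bar>u - v\<bar> powr (2 * H - 2)) \<partial>lborel \<partial>lborel)"
proof -
  define \<beta> where "\<beta> = Beta (H / 2) (1 - H)"
  have "(\<integral>\<^sup>+x. \<integral>\<^sup>+y. nn_kernel H f x y * nn_kernel H g x y \<partial>lborel \<partial>lborel) =
    (\<integral>\<^sup>+x. \<integral>\<^sup>+u. \<integral>\<^sup>+v. (ennreal (f u) * ennreal (frac_kernel H u x)) * (ennreal (g v) * ennreal (frac_kernel H v x)) * ennreal (beta_kernel H u v) \<partial>lborel \<partial>lborel \<partial>lborel)"
    unfolding nn_kernel_def by (rule nn_integral_cong, rule kernel_pairing[OF H]) measurable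
  also have "\<dots> = (\<integral>\<^sup>+u. \<integral>\<^sup>+x. \<integral>\<^sup>+v. (ennreal (f u) * ennreal (frac_kernel H u x)) * (ennreal (g v) * ennreal (frac_kernel H v x)) * ennreal (beta_kernel H u v) \<partial>lborel \<partial>lborel \<partial>lborel)"
    by (rule lborel_pair.Fubini') measurable
  also have "\<dots> = (\<integral>\<^sup>+u. \<integral>\<^sup>+v. \<integral>\<^sup>+x. (ennreal (f u) * ennreal (frac_kernel H u x)) * (ennreal (g v) * ennreal (frac_kernel H v x)) * ennreal (beta_kernel H u v) \<partial>lborel \<partial>lborel \<partial>lborel)"
    by (rule nn_integral_cong, rule lborel_pair.Fubini') measurable
  also have "\<dots> = (\<integral>\<^sup>+u. \<integral>\<^sup>+v. ennreal (\<beta>\<^sup>2) * (ennreal (f u) * ennreal (g v) * ennreal (\<bar>u - v\<bar> powr (2 * H - 2))) \<partial>lborel \<partial>lborel)"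
  proof (rule nn_integral_cong, rule nn_integral_cong_AE)
    fix u :: real
    have "AE v in lborel. v \<noteq> u" by (rule AE_lborel_singleton)
    then show "AE v in lborel. (\<integral>\<^sup>+x. (ennreal (f u) * ennreal (frac_kernel H u x)) * (ennreal (g v) * ennreal (frac_kernel H v x)) * ennreal (beta_kernel H u v) \<partial>lborel) =
       ennreal (\<beta>\<^sup>2) * (ennreal (f u) * ennreal (g v) * ennreal (\<bar>u - v\<bar> powr (2 * H - 2)))"
    proof eventually_elim
      case (elim v)
      have "(\<integral>\<^sup>+x. (ennreal (f u) * ennreal (frac_kernel H u x)) * (ennreal (g v) * ennreal (frac_kernel H v x)) * ennreal (beta_kernel H u v) \<partial>lborel) =
         (\<integral>\<^sup>+x. (ennreal (f u) * ennreal (g v) * ennreal (beta_kernel H u v)) * (ennreal (frac_kernel H u x) * ennreal (frac_kernel H v x)) \<partial>lborel)"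
        by (simp only: ac_simps)
      also have "\<dots> = (ennreal (f u) * ennreal (g v) * ennreal (beta_kernel H u v)) * (\<integral>\<^sup>+x. ennreal (frac_kernel H u x) * ennreal (frac_kernel H v x) \<partial>lborel)"
        by (rule nn_integral_cmult) measurable
      also have "(\<integral>\<^sup>+x. ennreal (frac_kernel H u x) * ennreal (frac_kernel H v x) \<partial>lborel) = ennreal (beta_kernel H u v)"
        using elim by (intro nn_integral_frac_kernel[OF H]) auto
      also have "(ennreal (f u) * ennreal (g v) * ennreal (beta_kernel H u v)) * ennreal (beta_kernel H u v) = (ennreal (f u) * ennreal (g v)) * ennreal (beta_kernel H u v * beta_kernel H u v)"
        using beta_kernel_nonneg[OF H] by (simp add: ennreal_mult' mult.assoc)
      also have "beta_kernel H u v * beta_kernel H u v = \<beta>\<^sup>2 * \<bar>u - v\<bar> powr (2 * H - 2)"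
        by (simp add: beta_kernel_def \<beta>_def power2_eq_square powr_add[symmetric])
      finally show ?case by (simp add: ennreal_mult' ac_simps)
    qed
  qed
  also have "\<dots> = (\<integral>\<^sup>+u. ennreal (\<beta>\<^sup>2) * (\<integral>\<^sup>+v. (ennreal (f u) * ennreal (g v) * ennreal (\<bar>u - v\<bar> powr (2 * H - 2))) \<partial>lborel) \<partial>lborel)"
    by (rule nn_integral_cong, rule nn_integral_cmult) measurable
  also have "\<dots> = ennreal (\<beta>\<^sup>2) * (\<integral>\<^sup>+u. \<integral>\<^sup>+v. ennreal (f u) * ennreal (g v) * ennreal (\<bar>u - v\<bar> powr (2 * H - 2)) \<partial>lborel \<partial>lborel)"
    by (rule nn_integral_cmult) measurable
  finally show ?thesis by (simp only: \<beta>_def)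
qed

lemma rosenblatt_const_nonneg: "rosenblatt_const H \<ge> 0" if "1/2 < H"
  using that by (simp add: rosenblatt_const_def)

lemma rosenblatt_const_square:
  assumes "1/2 < H" "H < 1"
  shows "(rosenblatt_const H)\<^sup>2 * (Beta (H / 2) (1 - H))\<^sup>2 = H * (2 * H - 1) / 2"
proof -
  have "Beta (H / 2) (1 - H) > 0" using assms by (intro Beta_pos) auto
  moreover have "(rosenblatt_const H)\<^sup>2 = H * (2 * H - 1) / (2 * (Beta (H / 2) (1 - H))\<^sup>2)"
    unfolding rosenblatt_const_def using assms by (intro real_sqrt_pow2) auto
  ultimately show ?thesis by simp
qed

text \<open>Upper estimates can ignore the points where the integral diverges, because the default
  value 0 lies below any bound; equality needs finiteness.\<close>

lemma rosenblatt_kernel_props: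
  assumes H: "1/2 < H" and [measurable]: "f \<in> borel_measurable borel" and f: "\<And>u. f u \<ge> 0"
  shows "rosenblatt_kernel H f (x, y) \<ge> 0"
    and "ennreal (rosenblatt_kernel H f (x, y)) \<le> ennreal (rosenblatt_const H) * nn_kernel H f x y"
    and "nn_kernel H f x y < \<infinity> \<Longrightarrow> ennreal (rosenblatt_kernel H f (x, y)) = ennreal (rosenblatt_const H) * nn_kernel H f x y"
    and "rosenblatt_kernel H f (x, y) = rosenblatt_kernel H f (y, x)"
proof -
  define L where "L = (LINT u|lborel. f u * frac_kernel H u x * frac_kernel H u y)"
  have J: "rosenblatt_kernel H f (x, y) = rosenblatt_const H * L"
    by (simp add: rosenblatt_kernel_def L_def frac_kernel_def)
  have [measurable]: "(\<lambda>u. f u * frac_kernel H u x * frac_kernel H u y) \<in> borel_measurable lborel" by measurable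
  have K: "nn_kernel H f x y = (\<integral>\<^sup>+u. ennreal (f u * frac_kernel H u x * frac_kernel H u y) \<partial>lborel)"
    unfolding nn_kernel_def by (rule nn_integral_cong) (simp add: f ennreal_mult')
  have L: "L = enn2real (nn_kernel H f x y)"
    unfolding K L_def by (rule integral_eq_nn_integral) (auto simp: f)
  note c = rosenblatt_const_nonneg[OF H]
  show "rosenblatt_kernel H f (x, y) \<ge> 0" unfolding J L using c by simp
  show "ennreal (rosenblatt_kernel H f (x, y)) = ennreal (rosenblatt_const H) * nn_kernel H f x y" if "nn_kernel H f x y < \<infinity>"
    unfolding J L using c that by (simp add: ennreal_mult')
  show "ennreal (rosenblatt_kernel H f (x, y)) \<le> ennreal (rosenblatt_const H) * nn_kernel H f x y"
    unfolding J L using c by (cases "nn_kernel H f x y") (auto simp: ennreal_mult' intro!: mult_left_mono)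
  show "rosenblatt_kernel H f (x, y) = rosenblatt_kernel H f (y, x)"
    by (simp add: rosenblatt_kernel_def ac_simps)
qed

section \<open>Limit of the covariances\<close>

text \<open>The weight \<open>\<bar>x\<bar> powr (2 * H - 2)\<close> has mass 2 / (2H - 1) on
  [-1, 1], which blows up at H = 1/2 and marks the point where the correlation is evaluated in the
  limit.\<close>

definition riesz_OU :: "real \<Rightarrow> real \<Rightarrow> real \<Rightarrow> ennreal" where
  "riesz_OU H lam \<tau> = (\<integral>\<^sup>+x. ennreal (\<bar>x\<bar> powr (2 * H - 2)) * ennreal (cov_OU lam \<tau> x) \<partial>lborel)"

text \<open>The covariance at lag \<open>\<tau>\<close> of the Rosenblatt Ornstein-Uhlenbeck process with \<open>\<sigma> = 1\<close>,
  see \<open>kernel_fOU_inner\<close>.\<close>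

definition cov_ROU :: "real \<Rightarrow> real \<Rightarrow> real \<Rightarrow> real" where
  "cov_ROU H lam \<tau> = H * (2 * H - 1) * enn2real (riesz_OU H lam \<tau>)"

lemma cov_OU_nonneg: "lam > 0 \<Longrightarrow> cov_OU lam \<tau> x \<ge> 0"
  by (simp add: cov_OU_def)

lemma abs_exp_diff_le:
  assumes "a \<ge> 0" "b \<ge> (0::real)"
  shows "\<bar>exp (- a) - exp (- b)\<bar> \<le> \<bar>a - b\<bar>"
proof -
  have *: "exp (- a) - exp (- b) \<le> b - a" if "a \<ge> 0" "a \<le> b" for a b :: real
  proof -
    have "1 - exp (- (b - a)) \<le> b - a" using exp_ge_add_one_self[of "- (b - a)"] by linarith
    then have "exp (- a) * (1 - exp (- (b - a))) \<le> 1 * (b - a)"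
      using that by (intro mult_mono) auto
    moreover have "exp (- a) * exp (- (b - a)) = exp (- b)" unfolding exp_add[symmetric] by simp
    ultimately show ?thesis by (simp add: right_diff_distrib)
  qed
  show ?thesis
  proof (cases "a \<le> b")
    case True
    then show ?thesis using *[of a b] assms by (simp add: abs_if)
  next
    case False
    then show ?thesis using *[of b a] assms by (simp add: abs_if)
  qed
qed

lemma cov_OU_lipschitz:
  assumes "lam > 0"
  shows "\<bar>cov_OU lam \<tau> x - cov_OU lam \<tau> 0\<bar> \<le> \<bar>x\<bar> / 2"
proof -
  have "\<bar>exp (- (lam * \<bar>x - \<tau>\<bar>)) - exp (- (lam * \<bar>0 - \<tau>\<bar>))\<bar> \<le> \<bar>lam * \<bar>x - \<tau>\<bar> - lam * \<bar>0 - \<tau>\<bar>\<bar>"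
    by (rule abs_exp_diff_le) (use assms in auto)
  also have "\<dots> = lam * \<bar>\<bar>x - \<tau>\<bar> - \<bar>0 - \<tau>\<bar>\<bar>"
    using assms by (simp add: abs_mult flip: right_diff_distrib)
  also have "\<dots> \<le> lam * \<bar>x\<bar>" using assms by (intro mult_left_mono) auto
  finally show ?thesis using assms by (simp add: cov_OU_def field_simps flip: diff_divide_distrib)
qed

lemma nn_integral_cov_OU_le:
  assumes "lam > 0"
  shows "(\<integral>\<^sup>+x. ennreal (cov_OU lam \<tau> x) \<partial>lborel) \<le> ennreal (1 / lam\<^sup>2)"
proof -
  define h where "h x = ennreal (fOU lam 0 x)" for x
  have [measurable]: "h \<in> borel_measurable borel" unfolding h_def[abs_def] by measurable
  have "(\<integral>\<^sup>+x. h x \<partial>lborel) = ennreal \<bar>-1\<bar> * (\<integral>\<^sup>+x. h (0 + (-1) * x) \<partial>lborel)"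
    by (rule nn_integral_real_affine) auto
  then have h': "(\<integral>\<^sup>+x. h (- x) \<partial>lborel) = ennreal (1 / lam)" and h: "(\<integral>\<^sup>+x. h x \<partial>lborel) = ennreal (1 / lam)"
    using nn_integral_fOU[OF assms, of 0] by (simp_all add: h_def)
  define e where "e x = ennreal (cov_OU lam 0 x)" for x
  have [measurable]: "e \<in> borel_measurable borel" unfolding e_def[abs_def] by measurable
  have "(\<integral>\<^sup>+x. ennreal (cov_OU lam \<tau> x) \<partial>lborel) = (\<integral>\<^sup>+x. e (x - \<tau>) \<partial>lborel)"
    by (simp add: e_def cov_OU_def)
  also have "\<dots> = (\<integral>\<^sup>+x. e x \<partial>lborel)" by (rule nn_integral_shift) simp
  also have "\<dots> \<le> (\<integral>\<^sup>+x. ennreal (1 / (2 * lam)) * (h x + h (- x)) \<partial>lborel)"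
  proof (rule nn_integral_mono)
    fix x
    have "exp (- lam * \<bar>x\<bar>) \<le> fOU lam 0 x + fOU lam 0 (- x)"
      by (cases "x \<le> 0") (auto simp: fOU_def abs_if indicator_def)
    then have "cov_OU lam 0 x \<le> 1 / (2 * lam) * (fOU lam 0 x + fOU lam 0 (- x))"
      using assms by (simp add: cov_OU_def divide_right_mono)
    then have "e x \<le> ennreal (1 / (2 * lam) * (fOU lam 0 x + fOU lam 0 (- x)))"
      unfolding e_def by (rule ennreal_leI)
    also have "\<dots> = ennreal (1 / (2 * lam)) * (h x + h (- x))"
      using assms unfolding h_def by (subst ennreal_mult') simp_all
    finally show "e x \<le> ennreal (1 / (2 * lam)) * (h x + h (- x))" .
  qed
  also have "\<dots> = ennreal (1 / (2 * lam)) * (ennreal (1 / lam) + ennreal (1 / lam))"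
    by (simp add: nn_integral_cmult nn_integral_add h h')
  also have "ennreal (1 / lam) + ennreal (1 / lam) = ennreal (1 / lam + 1 / lam)"
    using assms by (subst ennreal_plus) auto
  also have "ennreal (1 / (2 * lam)) * ennreal (1 / lam + 1 / lam) = ennreal (1 / (2 * lam) * (1 / lam + 1 / lam))"
    using assms by (intro ennreal_mult'[symmetric]) auto
  also have "1 / (2 * lam) * (1 / lam + 1 / lam) = 1 / lam\<^sup>2"
    using assms by (simp add: power2_eq_square)
  finally show ?thesis .
qed

text \<open>On [-1, 1] the correlation is replaced by its value at 0. The Lipschitz error
  \<open>\<bar>x\<bar> / 2\<close> absorbs the singularity, as
  \<open>\<bar>x\<bar> powr (2 * H - 1) \<le> 1\<close> there, and costs at most 1. Outside, the
  weight is at most 1 and the total mass \<open>1 / lam\<^sup>2\<close> of the correlation suffices.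
  The error does not depend on \<open>H\<close>.\<close>

lemma riesz_OU_bounds:
  assumes lam: "lam > 0" and H: "1/2 < H" "H < 1"
  shows "riesz_OU H lam \<tau> \<le> ennreal (2 / (2 * H - 1) * cov_OU lam \<tau> 0 + (1 + 1 / lam\<^sup>2))"
    and "ennreal (2 / (2 * H - 1) * cov_OU lam \<tau> 0) \<le> riesz_OU H lam \<tau> + 1"
proof -
  define A where "A = 2 / (2 * H - 1)"
  have A0: "A \<ge> 0" using H by (simp add: A_def)
  define w where "w x = \<bar>x\<bar> powr (2 * H - 2) * indicator {-1..1} x" for x :: real
  define i where "i x = (indicator {-1..1} x :: real)" for x :: real
  have [measurable]: "w \<in> borel_measurable borel" "i \<in> borel_measurable borel" unfolding w_def[abs_def] i_def[abs_def] by measurable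
  have i0: "i x \<ge> 0" "w x \<ge> 0" for x by (auto simp: w_def i_def)
  have W: "(\<integral>\<^sup>+x. ennreal (w x) \<partial>lborel) = ennreal A"
    using nn_integral_abs_powr[of "2 * H - 2"] H by (simp add: w_def A_def)
  have Ii: "(\<integral>\<^sup>+x. ennreal (1/2 * i x) \<partial>lborel) = 1"
  proof -
    have "(\<integral>\<^sup>+x. ennreal (1/2 * i x) \<partial>lborel) = (\<integral>\<^sup>+x. ennreal (1/2) * indicator {-1..1::real} x \<partial>lborel)"
      by (rule nn_integral_cong) (simp add: i_def indicator_def)
    also have "\<dots> = ennreal (1/2) * emeasure lborel {-1..1::real}"
      by (rule nn_integral_cmult_indicator) simp
    also have "emeasure lborel {-1..1::real} = ennreal 2" by simp
    also have "ennreal (1/2) * ennreal 2 = 1" by (subst ennreal_mult[symmetric]) auto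
    finally show ?thesis .
  qed
  have p0: "cov_OU lam \<tau> x \<ge> 0" for x by (rule cov_OU_nonneg[OF lam])
  have wx: "w x * \<bar>x\<bar> \<le> i x" if "x \<noteq> 0" for x
  proof (cases "x \<in> {-1..1}")
    case True
    have "\<bar>x\<bar> powr (2 * H - 2) * \<bar>x\<bar> = \<bar>x\<bar> powr (2 * H - 2) * \<bar>x\<bar> powr 1" using that by simp
    also have "\<dots> = \<bar>x\<bar> powr (2 * H - 1)" by (simp only: powr_add[symmetric]) (simp add: algebra_simps)
    also have "\<dots> \<le> 1 powr (2 * H - 1)" using True H by (intro powr_mono2) auto
    finally show ?thesis using True by (simp add: w_def i_def)
  qed (simp add: w_def i_def)
  have "riesz_OU H lam \<tau> \<le> (\<integral>\<^sup>+x. ennreal (cov_OU lam \<tau> 0) * ennreal (w x) + ennreal (1/2 * i x) + ennreal (cov_OU lam \<tau> x) \<partial>lborel)"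
    unfolding riesz_OU_def
  proof (rule nn_integral_mono_AE)
    have "AE x in lborel. x \<noteq> (0::real)" by (rule AE_lborel_singleton)
    then show "AE x in lborel. ennreal (\<bar>x\<bar> powr (2 * H - 2)) * ennreal (cov_OU lam \<tau> x) \<le> ennreal (cov_OU lam \<tau> 0) * ennreal (w x) + ennreal (1/2 * i x) + ennreal (cov_OU lam \<tau> x)"
    proof eventually_elim
      case (elim x)
      have "\<bar>x\<bar> powr (2 * H - 2) * cov_OU lam \<tau> x \<le> cov_OU lam \<tau> 0 * w x + 1/2 * i x + cov_OU lam \<tau> x"
      proof (cases "x \<in> {-1..1}")
        case True
        have "w x * cov_OU lam \<tau> x \<le> w x * (cov_OU lam \<tau> 0 + \<bar>x\<bar> / 2)"
          using abs_le_D1[OF cov_OU_lipschitz[OF lam, of \<tau> x]] i0 by (intro mult_left_mono) linarith+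
        also have "\<dots> \<le> cov_OU lam \<tau> 0 * w x + 1/2 * i x"
          using wx[OF elim] by (simp add: algebra_simps)
        finally show ?thesis using True p0[of x] by (simp add: w_def)
      next
        case False
        have "\<bar>x\<bar> powr (2 * H - 2) \<le> \<bar>x\<bar> powr 0" using False H by (intro powr_mono) auto
        then have "\<bar>x\<bar> powr (2 * H - 2) \<le> 1" using elim by simp
        then have "\<bar>x\<bar> powr (2 * H - 2) * cov_OU lam \<tau> x \<le> 1 * cov_OU lam \<tau> x"
          using p0 by (intro mult_right_mono) auto
        then show ?thesis using False by (simp add: w_def i_def)
      qed
      then have "ennreal (\<bar>x\<bar> powr (2 * H - 2) * cov_OU lam \<tau> x) \<le> ennreal (cov_OU lam \<tau> 0 * w x + 1/2 * i x + cov_OU lam \<tau> x)"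
        by (rule ennreal_leI)
      then show ?case using i0[of x] p0[of x] p0[of 0] by (simp add: ennreal_mult')
    qed
  qed
  also have "\<dots> = ennreal (cov_OU lam \<tau> 0) * ennreal (A) + 1 + (\<integral>\<^sup>+x. ennreal (cov_OU lam \<tau> x) \<partial>lborel)"
    using W Ii by (simp add: nn_integral_add nn_integral_cmult)
  also have "\<dots> \<le> ennreal (cov_OU lam \<tau> 0) * ennreal (A) + 1 + ennreal (1 / lam\<^sup>2)"
    by (intro add_left_mono nn_integral_cov_OU_le lam)
  also have "\<dots> = ennreal (A * cov_OU lam \<tau> 0 + (1 + 1 / lam\<^sup>2))"
    using A0 p0[of 0] by (simp add: ennreal_mult' ac_simps)
  finally show "riesz_OU H lam \<tau> \<le> ennreal (2 / (2 * H - 1) * cov_OU lam \<tau> 0 + (1 + 1 / lam\<^sup>2))"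
    by (simp only: A_def)
  have "ennreal (A * cov_OU lam \<tau> 0) = (\<integral>\<^sup>+x. ennreal (cov_OU lam \<tau> 0) * ennreal (w x) \<partial>lborel)"
    using p0[of 0] A0 by (subst nn_integral_cmult) (simp_all add: W ennreal_mult' mult.commute)
  also have "\<dots> \<le> (\<integral>\<^sup>+x. ennreal (\<bar>x\<bar> powr (2 * H - 2)) * ennreal (cov_OU lam \<tau> x) + ennreal (1/2 * i x) \<partial>lborel)"
  proof (rule nn_integral_mono_AE)
    have "AE x in lborel. x \<noteq> (0::real)" by (rule AE_lborel_singleton)
    then show "AE x in lborel. ennreal (cov_OU lam \<tau> 0) * ennreal (w x) \<le> ennreal (\<bar>x\<bar> powr (2 * H - 2)) * ennreal (cov_OU lam \<tau> x) + ennreal (1/2 * i x)"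
    proof eventually_elim
      case (elim x)
      have "cov_OU lam \<tau> 0 * w x \<le> \<bar>x\<bar> powr (2 * H - 2) * cov_OU lam \<tau> x + 1/2 * i x"
      proof -
        have "w x * cov_OU lam \<tau> 0 \<le> w x * (cov_OU lam \<tau> x + \<bar>x\<bar> / 2)"
          using abs_le_D2[OF cov_OU_lipschitz[OF lam, of \<tau> x]] i0 by (intro mult_left_mono) linarith+
        also have "\<dots> \<le> w x * cov_OU lam \<tau> x + 1/2 * i x"
          using wx[OF elim] by (simp add: algebra_simps)
        also have "w x * cov_OU lam \<tau> x \<le> \<bar>x\<bar> powr (2 * H - 2) * cov_OU lam \<tau> x"
          using p0[of x] by (intro mult_right_mono) (auto simp: w_def indicator_def)
        finally show ?thesis by (simp add: mult.commute)
      qed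
      then have "ennreal (cov_OU lam \<tau> 0 * w x) \<le> ennreal (\<bar>x\<bar> powr (2 * H - 2) * cov_OU lam \<tau> x + 1/2 * i x)"
        by (rule ennreal_leI)
      then show ?case using i0[of x] p0[of x] p0[of 0] by (simp add: ennreal_mult')
    qed
  qed
  also have "\<dots> = riesz_OU H lam \<tau> + 1"
    unfolding riesz_OU_def using Ii by (simp add: nn_integral_add)
  finally show "ennreal (2 / (2 * H - 1) * cov_OU lam \<tau> 0) \<le> riesz_OU H lam \<tau> + 1" by (simp only: A_def)
qed

lemma riesz_OU_finite:
  assumes "lam > 0" "1/2 < H" "H < 1"
  shows "riesz_OU H lam \<tau> < \<infinity>"
  using riesz_OU_bounds(1)[OF assms, of \<tau>] by (rule le_less_trans) simp

text \<open>Multiplication by \<open>H * (2 * H - 1)\<close> turns the main term 2 / (2H - 1) of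
  \<open>riesz_OU_bounds\<close> into 2H and its bounded error into one that vanishes as H tends to
  1/2.\<close>

lemma cov_ROU_bound:
  assumes lam: "lam > 0" and H: "1/2 < H" "H < 1"
  shows "\<bar>cov_ROU H lam \<tau> - 2 * H * cov_OU lam \<tau> 0\<bar> \<le> H * (2 * H - 1) * (1 + 1 / lam\<^sup>2)"
proof -
  define V where "V = enn2real (riesz_OU H lam \<tau>)"
  have V: "riesz_OU H lam \<tau> = ennreal V" "V \<ge> 0" using riesz_OU_finite[OF assms, of \<tau>] by (auto simp: V_def)
  define A where "A = 2 / (2 * H - 1) * cov_OU lam \<tau> 0"
  have A0: "A \<ge> 0" unfolding A_def using H cov_OU_nonneg[OF lam] by simp
  have u: "V \<le> A + (1 + 1 / lam\<^sup>2)"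
    using riesz_OU_bounds(1)[OF assms, of \<tau>] A0 unfolding V A_def[symmetric] by (subst (asm) ennreal_le_iff) auto
  have "ennreal A \<le> ennreal (V + 1)"
    using riesz_OU_bounds(2)[OF assms, of \<tau>] V unfolding A_def[symmetric] by simp
  then have l: "A \<le> V + 1" using V by (subst (asm) ennreal_le_iff) auto
  define q where "q = H * (2 * H - 1)"
  have q: "q > 0" using H by (simp add: q_def)
  have qA: "2 * H * cov_OU lam \<tau> 0 = q * A" using H by (simp add: A_def q_def)
  have "cov_ROU H lam \<tau> - 2 * H * cov_OU lam \<tau> 0 = q * (V - A)"
    unfolding qA by (simp add: cov_ROU_def V_def q_def right_diff_distrib)
  then have "\<bar>cov_ROU H lam \<tau> - 2 * H * cov_OU lam \<tau> 0\<bar> = q * \<bar>V - A\<bar>"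
    using q by (simp add: abs_mult)
  moreover have "\<bar>V - A\<bar> \<le> 1 + 1 / lam\<^sup>2"
  proof -
    have "1 / lam\<^sup>2 \<ge> 0" by simp
    with u l show ?thesis by (intro abs_leI) linarith+
  qed
  ultimately show ?thesis using q unfolding q_def[symmetric] by (simp add: mult_left_mono)
qed

lemma cov_ROU_tendsto:
  assumes "lam > 0"
  shows "((\<lambda>H. cov_ROU H lam \<tau>) \<longlongrightarrow> exp (- lam * \<bar>\<tau>\<bar>) / (2 * lam)) (at_right (1/2))"
proof -
  have ev: "\<forall>\<^sub>F H in at_right (1/2). 1/2 < H \<and> H < (1::real)"
    using eventually_at_right_real[of "1/2" 1] by (auto elim: eventually_mono)
  have "((\<lambda>H. cov_ROU H lam \<tau> - 2 * H * cov_OU lam \<tau> 0) \<longlongrightarrow> 0) (at_right (1/2))"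
  proof (rule Lim_null_comparison)
    show "\<forall>\<^sub>F H in at_right (1/2). norm (cov_ROU H lam \<tau> - 2 * H * cov_OU lam \<tau> 0) \<le> H * (2 * H - 1) * (1 + 1 / lam\<^sup>2)"
      using ev by eventually_elim (use cov_ROU_bound[OF assms] in simp)
    have "((\<lambda>H. H * (2 * H - 1) * (1 + 1 / lam\<^sup>2)) \<longlongrightarrow> 1/2 * (2 * (1/2) - 1) * (1 + 1 / lam\<^sup>2)) (at_right (1/2))"
      by (intro tendsto_intros)
    then show "((\<lambda>H. H * (2 * H - 1) * (1 + 1 / lam\<^sup>2)) \<longlongrightarrow> 0) (at_right (1/2))" by simp
  qed
  moreover have "((\<lambda>H. 2 * H * cov_OU lam \<tau> 0) \<longlongrightarrow> 2 * (1/2) * cov_OU lam \<tau> 0) (at_right (1/2))"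
    by (intro tendsto_intros)
  ultimately have "((\<lambda>H. (cov_ROU H lam \<tau> - 2 * H * cov_OU lam \<tau> 0) + 2 * H * cov_OU lam \<tau> 0) \<longlongrightarrow> 0 + 2 * (1/2) * cov_OU lam \<tau> 0) (at_right (1/2))"
    by (rule tendsto_add)
  then show ?thesis by (simp add: cov_OU_def)
qed

text \<open>Pointwise, \<open>exp (- lam * \<bar>x - \<tau>\<bar>) \<ge> exp (- lam * \<bar>x\<bar>)
  * (1 - lam * \<bar>\<tau>\<bar>)\<close>. The loss is relative to the correlation itself, so it
  survives integration against the singular weight with no constant that degenerates in
  \<open>H\<close>.\<close>

lemma cov_ROU_diff_le:
  assumes lam: "lam > 0" and H: "1/2 < H" "H < 1"
  shows "cov_ROU H lam 0 - cov_ROU H lam \<tau> \<le> lam * \<bar>\<tau>\<bar> * cov_ROU H lam 0"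
proof -
  have "riesz_OU H lam 0 \<le> (\<integral>\<^sup>+x. ennreal (\<bar>x\<bar> powr (2 * H - 2)) * ennreal (cov_OU lam \<tau> x) +
      ennreal (lam * \<bar>\<tau>\<bar>) * (ennreal (\<bar>x\<bar> powr (2 * H - 2)) * ennreal (cov_OU lam 0 x)) \<partial>lborel)"
    unfolding riesz_OU_def
  proof (rule nn_integral_mono)
    fix x
    have "exp (- lam * \<bar>x\<bar>) * (1 - lam * \<bar>\<tau>\<bar>) \<le> exp (- lam * \<bar>x\<bar>) * exp (- lam * \<bar>\<tau>\<bar>)"
      using exp_ge_add_one_self[of "- lam * \<bar>\<tau>\<bar>"] by (intro mult_left_mono) auto
    also have "\<dots> \<le> exp (- lam * \<bar>x - \<tau>\<bar>)"
      unfolding exp_add[symmetric] using lam mult_left_mono[OF abs_triangle_ineq4[of x \<tau>], of lam] by (simp add: algebra_simps)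
    finally have "exp (- lam * \<bar>x\<bar>) \<le> exp (- lam * \<bar>x - \<tau>\<bar>) + lam * \<bar>\<tau>\<bar> * exp (- lam * \<bar>x\<bar>)"
      by (simp add: algebra_simps)
    then have "exp (- lam * \<bar>x\<bar>) / (2 * lam) \<le> (exp (- lam * \<bar>x - \<tau>\<bar>) + lam * \<bar>\<tau>\<bar> * exp (- lam * \<bar>x\<bar>)) / (2 * lam)"
      using lam by (intro divide_right_mono) auto
    then have "cov_OU lam 0 x \<le> cov_OU lam \<tau> x + lam * \<bar>\<tau>\<bar> * cov_OU lam 0 x"
      by (simp add: cov_OU_def add_divide_distrib)
    then have "\<bar>x\<bar> powr (2 * H - 2) * cov_OU lam 0 x \<le> \<bar>x\<bar> powr (2 * H - 2) * (cov_OU lam \<tau> x + lam * \<bar>\<tau>\<bar> * cov_OU lam 0 x)"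
      by (intro mult_left_mono) auto
    also have "\<dots> = \<bar>x\<bar> powr (2 * H - 2) * cov_OU lam \<tau> x + lam * \<bar>\<tau>\<bar> * (\<bar>x\<bar> powr (2 * H - 2) * cov_OU lam 0 x)"
      by (simp add: algebra_simps)
    finally have "ennreal (\<bar>x\<bar> powr (2 * H - 2) * cov_OU lam 0 x) \<le> ennreal (\<bar>x\<bar> powr (2 * H - 2) * cov_OU lam \<tau> x + lam * \<bar>\<tau>\<bar> * (\<bar>x\<bar> powr (2 * H - 2) * cov_OU lam 0 x))"
      by (rule ennreal_leI)
    then show "ennreal (\<bar>x\<bar> powr (2 * H - 2)) * ennreal (cov_OU lam 0 x) \<le> ennreal (\<bar>x\<bar> powr (2 * H - 2)) * ennreal (cov_OU lam \<tau> x) +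
      ennreal (lam * \<bar>\<tau>\<bar>) * (ennreal (\<bar>x\<bar> powr (2 * H - 2)) * ennreal (cov_OU lam 0 x))"
      using cov_OU_nonneg[OF lam] lam by (simp add: ennreal_mult')
  qed
  also have "\<dots> = riesz_OU H lam \<tau> + ennreal (lam * \<bar>\<tau>\<bar>) * riesz_OU H lam 0"
    unfolding riesz_OU_def by (simp add: nn_integral_add nn_integral_cmult)
  finally have "enn2real (riesz_OU H lam 0) \<le> enn2real (riesz_OU H lam \<tau>) + lam * \<bar>\<tau>\<bar> * enn2real (riesz_OU H lam 0)"
  proof -
    assume le: "riesz_OU H lam 0 \<le> riesz_OU H lam \<tau> + ennreal (lam * \<bar>\<tau>\<bar>) * riesz_OU H lam 0"
    define a b where "a = enn2real (riesz_OU H lam 0)" and "b = enn2real (riesz_OU H lam \<tau>)"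
    have ab: "riesz_OU H lam 0 = ennreal a" "riesz_OU H lam \<tau> = ennreal b" "a \<ge> 0" "b \<ge> 0"
      using riesz_OU_finite[OF assms] by (auto simp: a_def b_def)
    have "ennreal a \<le> ennreal (b + lam * \<bar>\<tau>\<bar> * a)"
      using le ab lam by (simp add: ennreal_mult')
    then show ?thesis using ab lam unfolding a_def[symmetric] b_def[symmetric] by (subst (asm) ennreal_le_iff) auto
  qed
  then have "enn2real (riesz_OU H lam 0) - enn2real (riesz_OU H lam \<tau>) \<le> lam * \<bar>\<tau>\<bar> * enn2real (riesz_OU H lam 0)" by simp
  then have "H * (2 * H - 1) * (enn2real (riesz_OU H lam 0) - enn2real (riesz_OU H lam \<tau>)) \<le> H * (2 * H - 1) * (lam * \<bar>\<tau>\<bar> * enn2real (riesz_OU H lam 0))"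
    using H by (intro mult_left_mono) auto
  then show ?thesis by (simp only: cov_ROU_def right_diff_distrib ac_simps)
qed

section \<open>Norms and contractions of combinations of kernels\<close>

lemma rosenblatt_kernel_measurable [measurable]:
  assumes [measurable]: "f \<in> borel_measurable borel"
  shows "rosenblatt_kernel H f \<in> borel_measurable borel"
  unfolding rosenblatt_kernel_def borel_prod[symmetric] by measurable

lemma nn_kernel_fOU_pairing:
  assumes lam: "lam > 0" and H: "1/2 < H" "H < 1"
  shows "ennreal (rosenblatt_const H) * ennreal (rosenblatt_const H) * (\<integral>\<^sup>+x. \<integral>\<^sup>+y. nn_kernel H (fOU lam t) x y * nn_kernel H (fOU lam s) x y \<partial>lborel \<partial>lborel)
    = ennreal (cov_ROU H lam (t - s) / 2)"
proof -
  have "(\<integral>\<^sup>+x. \<integral>\<^sup>+y. nn_kernel H (fOU lam t) x y * nn_kernel H (fOU lam s) x y \<partial>lborel \<partial>lborel) = ennreal ((Beta (H / 2) (1 - H))\<^sup>2) * riesz_OU H lam (t - s)"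
    unfolding riesz_OU_def nn_integral_fOU_kernel[OF lam, symmetric] by (rule nn_kernel_pairing[OF H]) simp_all
  moreover have "ennreal (rosenblatt_const H) * ennreal (rosenblatt_const H) * (ennreal ((Beta (H / 2) (1 - H))\<^sup>2) * riesz_OU H lam (t - s)) = ennreal (cov_ROU H lam (t - s) / 2)"
  proof -
    define c b V where "c = rosenblatt_const H" and "b = (Beta (H / 2) (1 - H))\<^sup>2" and "V = enn2real (riesz_OU H lam (t - s))"
    have c0: "c \<ge> 0" "c * c \<ge> 0" and b0: "b \<ge> 0" using rosenblatt_const_nonneg[OF H(1)] by (auto simp: c_def b_def)
    have "riesz_OU H lam (t - s) = ennreal V" using riesz_OU_finite[OF lam H] by (simp add: V_def)
    moreover have "c * c * b = H * (2 * H - 1) / 2"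
      using rosenblatt_const_square[OF H] by (simp add: c_def b_def power2_eq_square)
    then have "cov_ROU H lam (t - s) / 2 = (c * c) * (b * V)"
      by (simp add: cov_ROU_def V_def flip: mult.assoc)
    ultimately show ?thesis
      unfolding c_def[symmetric] b_def[symmetric]
      by (simp only: ennreal_mult'[OF c0(1)] ennreal_mult'[OF c0(2)] ennreal_mult'[OF b0])
  qed
  ultimately show ?thesis by simp
qed

lemma cov_ROU_nonneg: "1/2 < H \<Longrightarrow> cov_ROU H lam \<tau> \<ge> 0"
  by (simp add: cov_ROU_def)

text \<open>The half reflects that the variance of a double integral is twice the squared norm of
  its symmetric kernel.\<close>

lemma kernel_fOU_inner:
  assumes lam: "lam > 0" and H: "1/2 < H" "H < 1"
  shows "(\<integral>\<^sup>+z. ennreal (rosenblatt_kernel H (fOU lam t) z * rosenblatt_kernel H (fOU lam s) z) \<partial>lborel) = ennreal (cov_ROU H lam (t - s) / 2)"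
proof -
  define c where "c = rosenblatt_const H"
  define J where "J t = rosenblatt_kernel H (fOU lam t)" for t
  have c0: "c \<ge> 0" unfolding c_def by (rule rosenblatt_const_nonneg[OF H(1)])
  define K where "K t z = (case z of (x, y) \<Rightarrow> nn_kernel H (fOU lam t) x y)" for t and z :: "real \<times> real"
  have Km[measurable]: "K t \<in> borel_measurable borel" for t
    unfolding K_def[abs_def] borel_prod[symmetric] by (rule nn_kernel_measurable) simp
  have Jm[measurable]: "J t \<in> borel_measurable borel" for t unfolding J_def by simp
  have J0: "J t z \<ge> 0" for t z
    unfolding J_def by (cases z) (use rosenblatt_kernel_props(1)[OF H(1), of "fOU lam t"] in simp)
  have KK: "(\<integral>\<^sup>+z. K t z * K s z \<partial>lborel) = (\<integral>\<^sup>+x. \<integral>\<^sup>+y. nn_kernel H (fOU lam t) x y * nn_kernel H (fOU lam s) x y \<partial>lborel \<partial>lborel)" for t s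
  proof -
    have "(\<lambda>z. K t z * K s z) \<in> borel_measurable borel" by measurable
    from lborel_nn_integral_fst[OF this, symmetric] show ?thesis by (simp only: K_def prod.case)
  qed
  \<comment> \<open>Finiteness almost everywhere comes from the finite square integral. The constant
    is known here to be nonnegative only, hence the separate case \<open>c = 0\<close>, in which
    both sides of the identity vanish.\<close>
  have AE: "AE z in lborel. K t z < \<infinity> \<or> c = 0" for t
  proof (cases "c = 0")
    case False
    then have c: "c > 0" using c0 by simp
    have "ennreal c * ennreal c * (\<integral>\<^sup>+z. K t z * K t z \<partial>lborel) < top"
      unfolding KK c_def nn_kernel_fOU_pairing[OF lam H] by simp
    then have "(\<integral>\<^sup>+z. K t z * K t z \<partial>lborel) \<noteq> \<infinity>" using c by (auto simp: ennreal_mult_less_top)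
    then have "AE z in lborel. K t z * K t z \<noteq> \<infinity>" by (rule nn_integral_PInf_AE[rotated]) simp
    then show ?thesis by eventually_elim (auto simp: ennreal_mult_less_top less_top)
  qed simp
  have "AE z in lborel. ennreal (J t z * J s z) = (ennreal c * ennreal c) * (K t z * K s z)"
    using AE[of t] AE[of s]
  proof eventually_elim
    case (elim z)
    have *: "ennreal (J r z) = ennreal c * K r z" if "K r z < \<infinity> \<or> c = 0" for r
    proof (cases "c = 0")
      case True
      then show ?thesis by (cases z) (simp add: J_def rosenblatt_kernel_def c_def[symmetric])
    next
      case False
      then show ?thesis using that rosenblatt_kernel_props(3)[OF H(1), of "fOU lam r"]
        by (cases z) (simp add: J_def K_def c_def)
    qed
    show ?case using *[OF elim(1)] *[OF elim(2)] J0 by (simp add: ennreal_mult' ac_simps)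
  qed
  then have "(\<integral>\<^sup>+z. ennreal (J t z * J s z) \<partial>lborel) = (\<integral>\<^sup>+z. (ennreal c * ennreal c) * (K t z * K s z) \<partial>lborel)"
    by (rule nn_integral_cong_AE)
  also have "\<dots> = (ennreal c * ennreal c) * (\<integral>\<^sup>+z. K t z * K s z \<partial>lborel)"
    by (rule nn_integral_cmult) simp
  finally show ?thesis unfolding KK c_def nn_kernel_fOU_pairing[OF lam H] by (simp add: J_def)
qed

lemma kernel_fOU_inner_real:
  assumes lam: "lam > 0" and H: "1/2 < H" "H < 1"
  shows "integrable lborel (\<lambda>z. rosenblatt_kernel H (fOU lam t) z * rosenblatt_kernel H (fOU lam s) z)"
    and "(LINT z|lborel. rosenblatt_kernel H (fOU lam t) z * rosenblatt_kernel H (fOU lam s) z) = cov_ROU H lam (t - s) / 2"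
proof -
  define g where "g z = rosenblatt_kernel H (fOU lam t) z * rosenblatt_kernel H (fOU lam s) z" for z
  have [measurable]: "g \<in> borel_measurable borel" unfolding g_def[abs_def] by measurable
  have J0: "rosenblatt_kernel H (fOU lam t) z \<ge> 0" for t z
    by (cases z) (use rosenblatt_kernel_props(1)[OF H(1), of "fOU lam t"] in simp)
  then have g0: "g z \<ge> 0" for z by (simp add: g_def)
  have nn: "(\<integral>\<^sup>+z. ennreal (g z) \<partial>lborel) = ennreal (cov_ROU H lam (t - s) / 2)"
    unfolding g_def by (rule kernel_fOU_inner[OF assms])
  show "integrable lborel (\<lambda>z. rosenblatt_kernel H (fOU lam t) z * rosenblatt_kernel H (fOU lam s) z)"
    unfolding g_def[symmetric] by (rule integrableI_bounded) (use nn g0 in \<open>simp_all add: abs_of_nonneg\<close>)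
  have "(LINT z|lborel. g z) = cov_ROU H lam (t - s) / 2"
    using nn g0 cov_ROU_nonneg[OF H(1)] by (subst integral_eq_nn_integral) auto
  then show "(LINT z|lborel. rosenblatt_kernel H (fOU lam t) z * rosenblatt_kernel H (fOU lam s) z) = cov_ROU H lam (t - s) / 2"
    by (simp add: g_def)
qed

lemma kernel_sum_square:
  assumes lam: "lam > 0" and H: "1/2 < H" "H < 1" and "finite I"
  shows "(LINT z|lborel. (\<Sum>i\<in>I. \<theta> i * rosenblatt_kernel H (fOU lam (t i)) z)\<^sup>2) = (\<Sum>i\<in>I. \<Sum>j\<in>I. \<theta> i * \<theta> j * cov_ROU H lam (t i - t j)) / 2"
proof -
  define J where "J t = rosenblatt_kernel H (fOU lam t)" for t
  note J = kernel_fOU_inner_real[OF lam H, folded J_def]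
  have "(\<Sum>i\<in>I. \<theta> i * J (t i) z)\<^sup>2 = (\<Sum>i\<in>I. \<Sum>j\<in>I. (\<theta> i * \<theta> j) * (J (t i) z * J (t j) z))" for z
    unfolding power2_eq_square sum_product by (simp add: ac_simps)
  then have "(LINT z|lborel. (\<Sum>i\<in>I. \<theta> i * J (t i) z)\<^sup>2) = (\<Sum>i\<in>I. \<Sum>j\<in>I. (\<theta> i * \<theta> j) * (cov_ROU H lam (t i - t j) / 2))"
    by (simp add: Bochner_Integration.integral_sum J)
  then show ?thesis by (simp add: J_def sum_divide_distrib)
qed

lemma fOU_le:
  assumes "lam > 0" "t \<le> T"
  shows "fOU lam t u \<le> exp (lam * (T - t)) * fOU lam T u"
proof -
  have "exp (lam * (T - t)) * exp (- lam * (T - u)) = exp (- lam * (t - u))"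
    unfolding exp_add[symmetric] by (simp add: algebra_simps)
  then show ?thesis using assms by (auto simp: fOU_def indicator_def)
qed

text \<open>For \<open>t i \<le> T\<close> each weight is at most
  \<open>exp (lam * (T - t i))\<close> times the weight at \<open>T\<close> (\<open>fOU_le\<close>),
  so a combination is dominated by a multiple of a single kernel and no mixed contractions arise.
  The constant enters as \<open>c ^ 4 * \<beta> ^ 4\<close>, the square of
  \<open>H * (2 * H - 1) / 2\<close>.\<close>

lemma kernel_sum_contr_norm:
  assumes lam: "lam > 0" and H: "1/2 < H" "H \<le> 3/4" and I: "finite I" "\<And>i. i \<in> I \<Longrightarrow> t i \<le> T"
  shows "contr_norm (\<lambda>z. \<Sum>i\<in>I. \<theta> i * rosenblatt_kernel H (fOU lam (t i)) z) \<le>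
    ennreal ((\<Sum>i\<in>I. \<bar>\<theta> i\<bar> * exp (lam * (T - t i))) ^ 4 * (8 * (8 + 1 / lam) ^ 3 * (1 / lam)) * (H * (2 * H - 1) / 2)\<^sup>2)"
proof -
  define c where "c = rosenblatt_const H"
  define C where "C = (\<Sum>i\<in>I. \<bar>\<theta> i\<bar> * exp (lam * (T - t i)))"
  define \<beta> where "\<beta> = Beta (H / 2) (1 - H)"
  define K where "K x y = nn_kernel H (fOU lam T) x y" for x y
  define h where "h z = (\<Sum>i\<in>I. \<theta> i * rosenblatt_kernel H (fOU lam (t i)) z)" for z
  have c0: "c \<ge> 0" unfolding c_def by (rule rosenblatt_const_nonneg[OF H(1)])
  have C0: "C \<ge> 0" unfolding C_def by (intro sum_nonneg) auto
  have K2: "(\<lambda>(x, y). K x y) \<in> borel_measurable (borel \<Otimes>\<^sub>M borel)" unfolding K_def by (rule nn_kernel_measurable) simp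
  note [measurable] = K2
  have h: "ennreal \<bar>h (x, y)\<bar> \<le> ennreal (C * c) * K x y" for x y
  proof -
    have "nn_kernel H (fOU lam (t i)) x y \<le> ennreal (exp (lam * (T - t i))) * K x y" if "i \<in> I" for i
    proof -
      have "nn_kernel H (fOU lam (t i)) x y \<le> (\<integral>\<^sup>+u. ennreal (exp (lam * (T - t i))) * (ennreal (fOU lam T u) * ennreal (frac_kernel H u x) * ennreal (frac_kernel H u y)) \<partial>lborel)"
        unfolding nn_kernel_def
      proof (rule nn_integral_mono)
        fix u
        have "ennreal (fOU lam (t i) u) \<le> ennreal (exp (lam * (T - t i))) * ennreal (fOU lam T u)"
          using ennreal_leI[OF fOU_le[OF lam I(2)[OF that], of u]] by (simp add: ennreal_mult')
        then have "ennreal (fOU lam (t i) u) * (ennreal (frac_kernel H u x) * ennreal (frac_kernel H u y)) \<le> (ennreal (exp (lam * (T - t i))) * ennreal (fOU lam T u)) * (ennreal (frac_kernel H u x) * ennreal (frac_kernel H u y))"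
          by (rule mult_right_mono) simp
        then show "ennreal (fOU lam (t i) u) * ennreal (frac_kernel H u x) * ennreal (frac_kernel H u y) \<le> ennreal (exp (lam * (T - t i))) * (ennreal (fOU lam T u) * ennreal (frac_kernel H u x) * ennreal (frac_kernel H u y))"
          by (simp only: mult.assoc)
      qed
      also have "\<dots> = ennreal (exp (lam * (T - t i))) * K x y"
        unfolding K_def nn_kernel_def by (rule nn_integral_cmult) measurable
      finally show ?thesis .
    qed
    then have J: "ennreal (rosenblatt_kernel H (fOU lam (t i)) (x, y)) \<le> ennreal c * (ennreal (exp (lam * (T - t i))) * K x y)" if "i \<in> I" for i
      unfolding c_def by (intro order_trans[OF rosenblatt_kernel_props(2)[OF H(1)]] mult_left_mono) (use that in auto)
    have J0: "rosenblatt_kernel H (fOU lam (t i)) (x, y) \<ge> 0" for i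
      by (rule rosenblatt_kernel_props(1)[OF H(1)]) auto
    have "\<bar>h (x, y)\<bar> \<le> (\<Sum>i\<in>I. \<bar>\<theta> i\<bar> * rosenblatt_kernel H (fOU lam (t i)) (x, y))"
      unfolding h_def by (rule order_trans[OF sum_abs]) (simp add: abs_mult J0)
    then have "ennreal \<bar>h (x, y)\<bar> \<le> ennreal (\<Sum>i\<in>I. \<bar>\<theta> i\<bar> * rosenblatt_kernel H (fOU lam (t i)) (x, y))"
      by (rule ennreal_leI)
    also have "\<dots> = (\<Sum>i\<in>I. ennreal \<bar>\<theta> i\<bar> * ennreal (rosenblatt_kernel H (fOU lam (t i)) (x, y)))"
      using J0 by (subst sum_ennreal[symmetric]) (auto simp: ennreal_mult')
    also have "\<dots> \<le> (\<Sum>i\<in>I. ennreal \<bar>\<theta> i\<bar> * (ennreal c * (ennreal (exp (lam * (T - t i))) * K x y)))"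
      by (intro sum_mono mult_left_mono J) auto
    also have "\<dots> = (\<Sum>i\<in>I. ennreal (\<bar>\<theta> i\<bar> * exp (lam * (T - t i)))) * (ennreal c * K x y)"
      unfolding sum_distrib_right by (simp add: ennreal_mult' ac_simps)
    also have "(\<Sum>i\<in>I. ennreal (\<bar>\<theta> i\<bar> * exp (lam * (T - t i)))) = ennreal C"
      unfolding C_def by (intro sum_ennreal) auto
    also have "ennreal C * (ennreal c * K x y) = ennreal (C * c) * K x y"
      using C0 by (simp add: ennreal_mult' mult.assoc)
    finally show ?thesis .
  qed
  define B where "B = (C * c)\<^sup>2"
  have B0: "B \<ge> 0" by (simp add: B_def)
  have "contr_norm h \<le> (\<integral>\<^sup>+y. \<integral>\<^sup>+z. ennreal (B\<^sup>2) * (\<integral>\<^sup>+x. K x y * K x z \<partial>lborel)\<^sup>2 \<partial>lborel \<partial>lborel)"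
    unfolding contr_norm_def
  proof (rule nn_integral_mono, rule nn_integral_mono)
    fix y z :: real
    have "(\<integral>\<^sup>+x. ennreal \<bar>h (x, y) * h (x, z)\<bar> \<partial>lborel) \<le> (\<integral>\<^sup>+x. ennreal B * (K x y * K x z) \<partial>lborel)"
    proof (rule nn_integral_mono)
      fix x
      have "ennreal \<bar>h (x, y) * h (x, z)\<bar> = ennreal \<bar>h (x, y)\<bar> * ennreal \<bar>h (x, z)\<bar>" by (simp add: abs_mult ennreal_mult')
      also have "\<dots> \<le> (ennreal (C * c) * K x y) * (ennreal (C * c) * K x z)" by (intro mult_mono h) auto
      also have "\<dots> = (ennreal (C * c) * ennreal (C * c)) * (K x y * K x z)" by (simp only: ac_simps)
      also have "ennreal (C * c) * ennreal (C * c) = ennreal B"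
        using C0 c0 by (simp add: B_def power2_eq_square flip: ennreal_mult)
      finally show "ennreal \<bar>h (x, y) * h (x, z)\<bar> \<le> ennreal B * (K x y * K x z)" .
    qed
    also have "\<dots> = ennreal B * (\<integral>\<^sup>+x. K x y * K x z \<partial>lborel)"
      by (rule nn_integral_cmult) measurable
    finally have "(\<integral>\<^sup>+x. ennreal \<bar>h (x, y) * h (x, z)\<bar> \<partial>lborel)\<^sup>2 \<le> (ennreal B * (\<integral>\<^sup>+x. K x y * K x z \<partial>lborel))\<^sup>2"
      by (rule power_mono) simp
    also have "\<dots> = ennreal (B\<^sup>2) * (\<integral>\<^sup>+x. K x y * K x z \<partial>lborel)\<^sup>2"
      using B0 by (simp add: power_mult_distrib ennreal_power)
    finally show "(\<integral>\<^sup>+x. ennreal \<bar>h (x, y) * h (x, z)\<bar> \<partial>lborel)\<^sup>2 \<le> ennreal (B\<^sup>2) * (\<integral>\<^sup>+x. K x y * K x z \<partial>lborel)\<^sup>2" .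
  qed
  also have "\<dots> = (\<integral>\<^sup>+y. ennreal (B\<^sup>2) * (\<integral>\<^sup>+z. (\<integral>\<^sup>+x. K x y * K x z \<partial>lborel)\<^sup>2 \<partial>lborel) \<partial>lborel)"
    by (rule nn_integral_cong, rule nn_integral_cmult) measurable
  also have "\<dots> = ennreal (B\<^sup>2) * (\<integral>\<^sup>+y. \<integral>\<^sup>+z. (\<integral>\<^sup>+x. K x y * K x z \<partial>lborel)\<^sup>2 \<partial>lborel \<partial>lborel)"
    by (rule nn_integral_cmult) measurable
  also have "\<dots> \<le> ennreal (B\<^sup>2) * ennreal (8 * (8 + 1 / lam) ^ 3 * (1 / lam) * \<beta> ^ 4)"
    unfolding K_def nn_kernel_def \<beta>_def
  proof (intro mult_left_mono contraction_bound[OF H])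
    show "ennreal (fOU lam T x) \<le> 1" for x
      using lam by (auto simp: fOU_def indicator_def intro!: ennreal_leI[of _ 1, simplified])
    show "(\<integral>\<^sup>+ v. ennreal (fOU lam T v) \<partial>lborel) \<le> ennreal (1 / lam)" using nn_integral_fOU[OF lam] by simp
  qed (use lam in auto)
  also have "\<dots> = ennreal (B\<^sup>2 * (8 * (8 + 1 / lam) ^ 3 * (1 / lam) * \<beta> ^ 4))"
    by (rule ennreal_mult'[symmetric]) simp
  also have "B\<^sup>2 * (8 * (8 + 1 / lam) ^ 3 * (1 / lam) * \<beta> ^ 4) = C ^ 4 * (8 * (8 + 1 / lam) ^ 3 * (1 / lam)) * (c\<^sup>2 * \<beta>\<^sup>2)\<^sup>2"
    by (simp add: B_def power_mult_distrib)
  also have "c\<^sup>2 * \<beta>\<^sup>2 = H * (2 * H - 1) / 2"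
    unfolding c_def \<beta>_def by (rule rosenblatt_const_square) (use H in auto)
  finally show ?thesis by (simp only: h_def[abs_def] C_def)
qed

lemma fOU_inner:
  assumes "lam > 0"
  shows "integrable lborel (\<lambda>u. fOU lam t u * fOU lam s u)"
    and "(LINT u|lborel. fOU lam t u * fOU lam s u) = exp (- lam * \<bar>t - s\<bar>) / (2 * lam)"
proof -
  have nn: "(\<integral>\<^sup>+u. ennreal (fOU lam t u * fOU lam s u) \<partial>lborel) = ennreal (exp (- lam * \<bar>t - s\<bar>) / (2 * lam))"
    using nn_integral_fOU_mult[OF assms, of t 0 s] by (simp add: cov_OU_def abs_minus_commute)
  show "integrable lborel (\<lambda>u. fOU lam t u * fOU lam s u)"
    by (rule integrableI_bounded) (use nn in \<open>simp_all add: abs_of_nonneg\<close>)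
  show "(LINT u|lborel. fOU lam t u * fOU lam s u) = exp (- lam * \<bar>t - s\<bar>) / (2 * lam)"
    using nn assms by (subst integral_eq_nn_integral) auto
qed

lemma fOU_sum_square:
  assumes "lam > 0" "finite I"
  shows "(LINT u|lborel. (\<Sum>i\<in>I. \<theta> i * fOU lam (t i) u)\<^sup>2) = (\<Sum>i\<in>I. \<Sum>j\<in>I. \<theta> i * \<theta> j * (exp (- lam * \<bar>t i - t j\<bar>) / (2 * lam)))"
proof -
  have "(\<Sum>i\<in>I. \<theta> i * fOU lam (t i) z)\<^sup>2 = (\<Sum>i\<in>I. \<Sum>j\<in>I. (\<theta> i * \<theta> j) * (fOU lam (t i) z * fOU lam (t j) z))" for z
    unfolding power2_eq_square sum_product by (simp add: ac_simps)
  then show ?thesis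
    using fOU_inner[OF assms(1)] by (simp add: Bochner_Integration.integral_sum)
qed

subsection \<open>Joint convergence from characteristic functions\<close>

text \<open>After normalization the weights are densities: the claim is the one-dimensional continuity theorem
  for the laws of \<open>X n\<close> under \<open>W n \<cdot> M\<close>.\<close>

lemma weighted_levy_aux:
  fixes X :: "nat \<Rightarrow> 'a \<Rightarrow> real" and W :: "nat \<Rightarrow> 'a \<Rightarrow> real" and Y V :: "'b \<Rightarrow> real"
  assumes M: "prob_space M" "prob_space M'"
    and m: "\<And>n. X n \<in> borel_measurable M" "\<And>n. W n \<in> borel_measurable M" "Y \<in> borel_measurable M'" "V \<in> borel_measurable M'"
    and bd: "\<And>n \<omega>. 1 \<le> W n \<omega>" "\<And>n \<omega>. W n \<omega> \<le> D" "\<And>\<omega>. 1 \<le> V \<omega>" "\<And>\<omega>. V \<omega> \<le> D"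
    and c: "\<And>u. (\<lambda>n. LINT \<omega>|M. complex_of_real (W n \<omega>) * iexp (u * X n \<omega>)) \<longlonglongrightarrow> (LINT \<omega>|M'. complex_of_real (V \<omega>) * iexp (u * Y \<omega>))"
    and f: "continuous_on UNIV f" "\<And>x. \<bar>f x\<bar> \<le> (b::real)"
  shows "(\<lambda>n. LINT \<omega>|M. W n \<omega> * f (X n \<omega>)) \<longlonglongrightarrow> (LINT \<omega>|M'. V \<omega> * f (Y \<omega>))"
proof -
  \<comment> \<open>The same normalization is used on both spaces; \<open>1 \<le> R\<close> keeps
    the total mass away from zero, so that quotients by it converge.\<close>
  have dens: "prob_space N \<Longrightarrow> Z \<in> borel_measurable N \<Longrightarrow> R \<in> borel_measurable N \<Longrightarrow> (\<And>\<omega>. 1 \<le> R \<omega>) \<Longrightarrow> (\<And>\<omega>. R \<omega> \<le> D) \<Longrightarrow>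
    real_distribution (distr (density N (\<lambda>\<omega>. ennreal (R \<omega> / (LINT \<omega>|N. R \<omega>)))) borel Z) \<and>
    (LINT \<omega>|N. R \<omega>) \<ge> 1 \<and>
    (\<forall>u. char (distr (density N (\<lambda>\<omega>. ennreal (R \<omega> / (LINT \<omega>|N. R \<omega>)))) borel Z) u = (LINT \<omega>|N. complex_of_real (R \<omega>) * iexp (u * Z \<omega>)) / (LINT \<omega>|N. R \<omega>)) \<and>
    (LINT x|distr (density N (\<lambda>\<omega>. ennreal (R \<omega> / (LINT \<omega>|N. R \<omega>)))) borel Z. f x) = (LINT \<omega>|N. R \<omega> * f (Z \<omega>)) / (LINT \<omega>|N. R \<omega>)"
    for N :: "'c measure" and Z R
  proof -
    assume N: "prob_space N" and [measurable]: "Z \<in> borel_measurable N" "R \<in> borel_measurable N"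
      and R: "\<And>\<omega>. 1 \<le> R \<omega>" "\<And>\<omega>. R \<omega> \<le> D"
    interpret N: prob_space N by fact
    define r where "r = (LINT \<omega>|N. R \<omega>)"
    have R0: "R \<omega> \<ge> 0" for \<omega> using R(1)[of \<omega>] by simp
    have iR: "integrable N R"
      by (rule N.integrable_const_bound[of _ D]) (use R R0 in auto)
    have r: "r \<ge> 1"
    proof -
      have "(LINT \<omega>|N. 1) \<le> r" unfolding r_def by (rule integral_mono) (use iR R in auto)
      then show ?thesis by (simp add: N.prob_space)
    qed
    define Q where "Q = density N (\<lambda>\<omega>. ennreal (R \<omega> / r))"
    have "emeasure Q (space Q) = (\<integral>\<^sup>+\<omega>. ennreal (R \<omega> / r) \<partial>N)"
      unfolding Q_def by (simp add: emeasure_density cong: nn_integral_cong)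
    also have "\<dots> = ennreal (LINT \<omega>|N. R \<omega> / r)"
      by (rule nn_integral_eq_integral) (use iR R0 r in auto)
    also have "(LINT \<omega>|N. R \<omega> / r) = 1" using r by (simp add: r_def)
    finally have "prob_space Q" by (intro prob_spaceI) simp
    then interpret Q: prob_space Q .
    have [measurable]: "Z \<in> borel_measurable Q" unfolding Q_def by simp
    have fm: "f \<in> borel_measurable borel" by (rule borel_measurable_continuous_onI[OF f(1)])
    note [measurable] = fm
    have 1: "real_distribution (distr Q borel Z)" by (intro Q.real_distribution_distr) simp
    have 2: "char (distr Q borel Z) u = (LINT \<omega>|N. complex_of_real (R \<omega>) * iexp (u * Z \<omega>)) / r" for u
    proof -
      have "char (distr Q borel Z) u = (LINT \<omega>|Q. iexp (u * Z \<omega>))"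
        unfolding char_def by (rule integral_distr) simp_all
      also have "\<dots> = (LINT \<omega>|N. (R \<omega> / r) *\<^sub>R iexp (u * Z \<omega>))"
        unfolding Q_def by (rule integral_density) (use R0 r in auto)
      also have "\<dots> = (LINT \<omega>|N. complex_of_real (1 / r) * (complex_of_real (R \<omega>) * iexp (u * Z \<omega>)))"
        by (simp add: scaleR_conv_of_real)
      also have "\<dots> = complex_of_real (1 / r) * (LINT \<omega>|N. complex_of_real (R \<omega>) * iexp (u * Z \<omega>))"
        by (rule integral_mult_right_zero)
      finally show ?thesis by simp
    qed
    have 3: "(LINT x|distr Q borel Z. f x) = (LINT \<omega>|N. R \<omega> * f (Z \<omega>)) / r"
    proof -
      have "(LINT x|distr Q borel Z. f x) = (LINT \<omega>|Q. f (Z \<omega>))"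
        by (rule integral_distr) simp_all
      also have "\<dots> = (LINT \<omega>|N. (R \<omega> / r) *\<^sub>R f (Z \<omega>))"
        unfolding Q_def by (rule integral_density) (use R0 r in auto)
      also have "\<dots> = (LINT \<omega>|N. (1 / r) * (R \<omega> * f (Z \<omega>)))" by simp
      also have "\<dots> = (1 / r) * (LINT \<omega>|N. R \<omega> * f (Z \<omega>))" by (rule integral_mult_right_zero)
      finally show ?thesis by simp
    qed
    show ?thesis using 1 2 3 r unfolding Q_def r_def by blast
  qed
  define w where "w n = (LINT \<omega>|M. W n \<omega>)" for n
  define v where "v = (LINT \<omega>|M'. V \<omega>)"
  define \<nu> where "\<nu> n = distr (density M (\<lambda>\<omega>. ennreal (W n \<omega> / w n))) borel (X n)" for n
  define \<nu>' where "\<nu>' = distr (density M' (\<lambda>\<omega>. ennreal (V \<omega> / v))) borel Y"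
  note A = dens[OF M(1) m(1,2) bd(1,2), folded w_def]
  note A' = dens[OF M(2) m(3,4) bd(3,4), folded v_def]
  have nu: "real_distribution (\<nu> n)" "w n \<ge> 1" "char (\<nu> n) u = (LINT \<omega>|M. complex_of_real (W n \<omega>) * iexp (u * X n \<omega>)) / w n"
    "(LINT x|\<nu> n. f x) = (LINT \<omega>|M. W n \<omega> * f (X n \<omega>)) / w n" for n u
    using A[of n n] unfolding \<nu>_def w_def by blast+
  have nu': "real_distribution \<nu>'" "v \<ge> 1" "char \<nu>' u = (LINT \<omega>|M'. complex_of_real (V \<omega>) * iexp (u * Y \<omega>)) / v"
    "(LINT x|\<nu>'. f x) = (LINT \<omega>|M'. V \<omega> * f (Y \<omega>)) / v" for u
    using A' unfolding \<nu>'_def v_def by blast+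
  \<comment> \<open>The frequency \<open>u = 0\<close> gives convergence of the total
    masses.\<close>
  have "(\<lambda>n. complex_of_real (w n)) \<longlonglongrightarrow> complex_of_real v"
    using c[of 0] by (simp add: w_def v_def)
  then have wv: "w \<longlonglongrightarrow> v" by (simp add: tendsto_of_real_iff)
  have "weak_conv_m \<nu> \<nu>'"
  proof (rule levy_continuity)
    show "(\<lambda>n. char (\<nu> n) t) \<longlonglongrightarrow> char \<nu>' t" for t
      unfolding nu nu' using nu'(2) by (intro tendsto_divide c tendsto_of_real wv) auto
  qed (use nu(1) nu'(1) in auto)
  then have "(\<lambda>n. LINT x|\<nu> n. f x) \<longlonglongrightarrow> (LINT x|\<nu>'. f x)"
    by (rule weak_conv_imp_integral_bdd_continuous_conv[OF nu(1) nu'(1), where B = b])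
      (use f in \<open>auto simp: continuous_on_eq_continuous_at\<close>)
  then have "(\<lambda>n. w n * (LINT x|\<nu> n. f x)) \<longlonglongrightarrow> v * (LINT x|\<nu>'. f x)"
    by (intro tendsto_mult wv)
  moreover have "w n * (LINT x|\<nu> n. f x) = (LINT \<omega>|M. W n \<omega> * f (X n \<omega>))" for n
    unfolding nu(4) using nu(2)[of n] by simp
  moreover have "v * (LINT x|\<nu>'. f x) = (LINT \<omega>|M'. V \<omega> * f (Y \<omega>))"
    unfolding nu'(4) using nu'(2) by simp
  ultimately show ?thesis by simp
qed

lemma complex_integral_conv_iff:
  fixes Z :: "nat \<Rightarrow> 'a \<Rightarrow> real" and V :: "'b \<Rightarrow> real"
  assumes M: "prob_space M" "prob_space M'"
    and m: "\<And>n. X n \<in> borel_measurable M" "\<And>n. Z n \<in> borel_measurable M" "Y \<in> borel_measurable M'" "V \<in> borel_measurable M'"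
    and bd: "\<And>n \<omega>. \<bar>Z n \<omega>\<bar> \<le> C" "\<And>\<omega>. \<bar>V \<omega>\<bar> \<le> C"
    and c: "(\<lambda>n. LINT \<omega>|M. Z n \<omega> * cos (X n \<omega>)) \<longlonglongrightarrow> (LINT \<omega>|M'. V \<omega> * cos (Y \<omega>))"
      "(\<lambda>n. LINT \<omega>|M. Z n \<omega> * sin (X n \<omega>)) \<longlonglongrightarrow> (LINT \<omega>|M'. V \<omega> * sin (Y \<omega>))"
  shows "(\<lambda>n. LINT \<omega>|M. complex_of_real (Z n \<omega>) * iexp (X n \<omega>)) \<longlonglongrightarrow> (LINT \<omega>|M'. complex_of_real (V \<omega>) * iexp (Y \<omega>))"
proof -
  have *: "(LINT \<omega>|N. complex_of_real (R \<omega>) * iexp (S \<omega>)) = Complex (LINT \<omega>|N. R \<omega> * cos (S \<omega>)) (LINT \<omega>|N. R \<omega> * sin (S \<omega>))"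
    if N: "prob_space N" and [measurable]: "R \<in> borel_measurable N" "S \<in> borel_measurable N" and R: "\<And>\<omega>. \<bar>R \<omega>\<bar> \<le> C"
    for N :: "'c measure" and R S
  proof -
    interpret N: prob_space N by fact
    have iR: "integrable N (\<lambda>\<omega>. complex_of_real (R \<omega>) * iexp (S \<omega>))"
      by (rule N.integrable_const_bound[of _ C]) (use R in \<open>auto simp: norm_mult\<close>)
    have e: "complex_of_real (R \<omega>) * iexp (S \<omega>) = Complex (R \<omega> * cos (S \<omega>)) (R \<omega> * sin (S \<omega>))" for \<omega>
      by (simp add: complex_eq_iff Re_exp Im_exp)
    show ?thesis
      using integral_Re[OF iR] integral_Im[OF iR] by (simp add: e complex_eq_iff)
  qed
  show ?thesis
    unfolding *[OF M(1) m(2,1) bd(1)] *[OF M(2) m(4,3) bd(2)] using c by (intro tendsto_Complex)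
qed

text \<open>Adding \<open>C + 1\<close> to the signed weights makes them at least 1, as
  \<open>weighted_levy_aux\<close> requires; the shift is removed again by the unweighted
  convergence, which \<open>c0\<close> provides.\<close>

lemma weighted_levy:
  fixes X Z :: "nat \<Rightarrow> 'a \<Rightarrow> real" and Y V :: "'b \<Rightarrow> real"
  assumes M: "prob_space M" "prob_space M'"
    and m: "\<And>n. X n \<in> borel_measurable M" "\<And>n. Z n \<in> borel_measurable M" "Y \<in> borel_measurable M'" "V \<in> borel_measurable M'"
    and bd: "\<And>n \<omega>. \<bar>Z n \<omega>\<bar> \<le> C" "\<And>\<omega>. \<bar>V \<omega>\<bar> \<le> C"
    and c: "\<And>u. (\<lambda>n. LINT \<omega>|M. Z n \<omega> * cos (u * X n \<omega>)) \<longlonglongrightarrow> (LINT \<omega>|M'. V \<omega> * cos (u * Y \<omega>))"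
      "\<And>u. (\<lambda>n. LINT \<omega>|M. Z n \<omega> * sin (u * X n \<omega>)) \<longlonglongrightarrow> (LINT \<omega>|M'. V \<omega> * sin (u * Y \<omega>))"
    and c0: "\<And>u. (\<lambda>n. LINT \<omega>|M. iexp (u * X n \<omega>)) \<longlonglongrightarrow> (LINT \<omega>|M'. iexp (u * Y \<omega>))"
    and f: "continuous_on UNIV f" "\<And>x. \<bar>f x\<bar> \<le> (b::real)"
  shows "(\<lambda>n. LINT \<omega>|M. Z n \<omega> * f (X n \<omega>)) \<longlonglongrightarrow> (LINT \<omega>|M'. V \<omega> * f (Y \<omega>))"
proof -
  interpret M: prob_space M by fact
  interpret M': prob_space M' by fact
  note [measurable] = m
  have fm[measurable]: "f \<in> borel_measurable borel" by (rule borel_measurable_continuous_onI[OF f(1)])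
  have C0: "C \<ge> 0" using bd(2)[of undefined] by linarith
  have iZ: "integrable M (\<lambda>\<omega>. complex_of_real (Z n \<omega>) * iexp (u * X n \<omega>))" for n u
    by (rule M.integrable_const_bound[of _ C]) (use bd in \<open>auto simp: norm_mult\<close>)
  have iV: "integrable M' (\<lambda>\<omega>. complex_of_real (V \<omega>) * iexp (u * Y \<omega>))" for u
    by (rule M'.integrable_const_bound[of _ C]) (use bd in \<open>auto simp: norm_mult\<close>)
  have i1: "integrable M (\<lambda>\<omega>. iexp (u * X n \<omega>))" for n u
    by (rule M.integrable_const_bound[of _ 1]) auto
  have i1': "integrable M' (\<lambda>\<omega>. iexp (u * Y \<omega>))" for u
    by (rule M'.integrable_const_bound[of _ 1]) auto
  have cZ: "(\<lambda>n. LINT \<omega>|M. complex_of_real (Z n \<omega>) * iexp (u * X n \<omega>)) \<longlonglongrightarrow> (LINT \<omega>|M'. complex_of_real (V \<omega>) * iexp (u * Y \<omega>))" for u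
    by (rule complex_integral_conv_iff[OF M _ m(2) _ m(4) bd c]) simp_all
  have 1: "(\<lambda>n. LINT \<omega>|M. (Z n \<omega> + (C + 1)) * f (X n \<omega>)) \<longlonglongrightarrow> (LINT \<omega>|M'. (V \<omega> + (C + 1)) * f (Y \<omega>))"
  proof (rule weighted_levy_aux[OF M, where D = "2 * C + 1" and b = b and f = f and X = X and Y = Y])
    fix u
    have "(\<lambda>n. (LINT \<omega>|M. complex_of_real (Z n \<omega>) * iexp (u * X n \<omega>)) + complex_of_real (C + 1) * (LINT \<omega>|M. iexp (u * X n \<omega>))) \<longlonglongrightarrow>
       (LINT \<omega>|M'. complex_of_real (V \<omega>) * iexp (u * Y \<omega>)) + complex_of_real (C + 1) * (LINT \<omega>|M'. iexp (u * Y \<omega>))"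
      by (intro tendsto_intros cZ c0)
    moreover have "(LINT \<omega>|M. complex_of_real (Z n \<omega> + (C + 1)) * iexp (u * X n \<omega>)) = (LINT \<omega>|M. complex_of_real (Z n \<omega>) * iexp (u * X n \<omega>)) + complex_of_real (C + 1) * (LINT \<omega>|M. iexp (u * X n \<omega>))" for n
      using iZ i1 by (subst integral_mult_right_zero[symmetric], subst Bochner_Integration.integral_add[symmetric]) (auto simp: distrib_right)
    moreover have "(LINT \<omega>|M'. complex_of_real (V \<omega> + (C + 1)) * iexp (u * Y \<omega>)) = (LINT \<omega>|M'. complex_of_real (V \<omega>) * iexp (u * Y \<omega>)) + complex_of_real (C + 1) * (LINT \<omega>|M'. iexp (u * Y \<omega>))"
      using iV i1' by (subst integral_mult_right_zero[symmetric], subst Bochner_Integration.integral_add[symmetric]) (auto simp: distrib_right)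
    ultimately show "(\<lambda>n. LINT \<omega>|M. complex_of_real (Z n \<omega> + (C + 1)) * iexp (u * X n \<omega>)) \<longlonglongrightarrow> (LINT \<omega>|M'. complex_of_real (V \<omega> + (C + 1)) * iexp (u * Y \<omega>))"
      by simp
  next
    show "1 \<le> Z n \<omega> + (C + 1)" "Z n \<omega> + (C + 1) \<le> 2 * C + 1" for n \<omega> using bd(1)[of n \<omega>] by linarith+
    show "1 \<le> V \<omega> + (C + 1)" "V \<omega> + (C + 1) \<le> 2 * C + 1" for \<omega> using bd(2)[of \<omega>] by linarith+
  qed (use f in auto)
  have 2: "(\<lambda>n. LINT \<omega>|M. 1 * f (X n \<omega>)) \<longlonglongrightarrow> (LINT \<omega>|M'. 1 * f (Y \<omega>))"
    by (rule weighted_levy_aux[OF M, where D = 1 and b = b and f = f and X = X and Y = Y]) (use f c0 in auto)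
  have if1: "integrable M (\<lambda>\<omega>. Z n \<omega> * f (X n \<omega>))" "integrable M (\<lambda>\<omega>. f (X n \<omega>))" for n
    by (rule M.integrable_const_bound[of _ "C * b"], use bd f C0 in \<open>auto simp: abs_mult intro!: mult_mono\<close>)
      (rule M.integrable_const_bound[of _ b], use f in auto)
  have if2: "integrable M' (\<lambda>\<omega>. V \<omega> * f (Y \<omega>))" "integrable M' (\<lambda>\<omega>. f (Y \<omega>))"
    by (rule M'.integrable_const_bound[of _ "C * b"], use bd f C0 in \<open>auto simp: abs_mult intro!: mult_mono\<close>)
      (rule M'.integrable_const_bound[of _ b], use f in auto)
  have "(\<lambda>n. (LINT \<omega>|M. (Z n \<omega> + (C + 1)) * f (X n \<omega>)) - (C + 1) * (LINT \<omega>|M. 1 * f (X n \<omega>))) \<longlonglongrightarrow>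
      (LINT \<omega>|M'. (V \<omega> + (C + 1)) * f (Y \<omega>)) - (C + 1) * (LINT \<omega>|M'. 1 * f (Y \<omega>))"
    by (intro tendsto_diff tendsto_mult tendsto_const 1 2)
  then show ?thesis using if1 if2 by (simp add: distrib_right)
qed

text \<open>The coordinates are exchanged one at a time: the factors already treated are bounded weights for
  the next coordinate.\<close>

lemma char_conv_imp_prod_conv:
  fixes X :: "nat \<Rightarrow> nat \<Rightarrow> 'a \<Rightarrow> real" and Y :: "nat \<Rightarrow> 'b \<Rightarrow> real"
  assumes M: "prob_space M" "prob_space M'"
    and m: "\<And>n j. j < d \<Longrightarrow> X n j \<in> borel_measurable M" "\<And>j. j < d \<Longrightarrow> Y j \<in> borel_measurable M'"
    and c: "\<And>\<theta>. (\<lambda>n. LINT \<omega>|M. iexp (\<Sum>j<d. \<theta> j * X n j \<omega>)) \<longlonglongrightarrow> (LINT \<omega>|M'. iexp (\<Sum>j<d. \<theta> j * Y j \<omega>))"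
    and f: "\<And>j. j < d \<Longrightarrow> continuous_on UNIV (f j)" "\<And>j x. \<bar>f j x\<bar> \<le> (1::real)"
  shows "(\<lambda>n. LINT \<omega>|M. (\<Prod>j<d. f j (X n j \<omega>))) \<longlonglongrightarrow> (LINT \<omega>|M'. (\<Prod>j<d. f j (Y j \<omega>)))"
proof -
  interpret M: prob_space M by fact
  interpret M': prob_space M' by fact
  have fm: "f j \<in> borel_measurable borel" if "j < d" for j using that by (intro borel_measurable_continuous_onI f)
  have pm: "(\<lambda>\<omega>. \<Prod>j<k. f j (X n j \<omega>)) \<in> borel_measurable M" "(\<lambda>\<omega>. \<Prod>j<k. f j (Y j \<omega>)) \<in> borel_measurable M'" if "k \<le> d" for k n
    using that by (auto intro!: borel_measurable_prod measurable_compose[OF _ fm] m)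
  have pb: "\<bar>\<Prod>j<k. f j (x j)\<bar> \<le> 1" for k x
    unfolding abs_prod by (intro prod_le_1) (auto simp: f)
  have sm: "(\<lambda>\<omega>. \<Sum>j\<in>{k..<d}. \<theta> j * X n j \<omega>) \<in> borel_measurable M" "(\<lambda>\<omega>. \<Sum>j\<in>{k..<d}. \<theta> j * Y j \<omega>) \<in> borel_measurable M'" for k n \<theta>
    by (auto intro!: borel_measurable_sum borel_measurable_times m)
  \<comment> \<open>The phase \<open>a\<close> strengthens the induction: shifting it by pi / 2
    turns cosines into sines, so one real statement carries both parts of the exponential.\<close>
  have "\<forall>\<theta> a. (\<lambda>n. LINT \<omega>|M. (\<Prod>j<k. f j (X n j \<omega>)) * cos ((\<Sum>j\<in>{k..<d}. \<theta> j * X n j \<omega>) + a)) \<longlonglongrightarrow>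
        (LINT \<omega>|M'. (\<Prod>j<k. f j (Y j \<omega>)) * cos ((\<Sum>j\<in>{k..<d}. \<theta> j * Y j \<omega>) + a))" if "k \<le> d" for k
    using that
  proof (induction k)
    case 0
    show ?case
    proof (intro allI)
      fix \<theta> :: "nat \<Rightarrow> real" and a :: real
      have e: "(LINT \<omega>|N. cos (S \<omega> + a)) = Re (iexp a * (LINT \<omega>|N. iexp (S \<omega>)))"
        if "prob_space N" and S: "S \<in> borel_measurable N" for N :: "'c measure" and S
      proof -
        interpret N: prob_space N by fact
        have i: "integrable N (\<lambda>\<omega>. iexp a * iexp (S \<omega>))"
          by (rule N.integrable_const_bound[of _ 1]) (use S in \<open>auto simp: norm_mult\<close>)
        have "iexp a * (LINT \<omega>|N. iexp (S \<omega>)) = (LINT \<omega>|N. iexp a * iexp (S \<omega>))" by (rule integral_mult_right_zero[symmetric])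
        also have "Re \<dots> = (LINT \<omega>|N. Re (iexp a * iexp (S \<omega>)))" by (rule integral_Re[OF i, symmetric])
        also have "\<dots> = (LINT \<omega>|N. cos (S \<omega> + a))"
          by (intro Bochner_Integration.integral_cong refl) (simp add: Re_exp Im_exp cos_add)
        finally show ?thesis by simp
      qed
      have "(\<lambda>n. Re (iexp a * (LINT \<omega>|M. iexp (\<Sum>j<d. \<theta> j * X n j \<omega>)))) \<longlonglongrightarrow> Re (iexp a * (LINT \<omega>|M'. iexp (\<Sum>j<d. \<theta> j * Y j \<omega>)))"
        by (intro tendsto_Re tendsto_mult tendsto_const c)
      then show "(\<lambda>n. LINT \<omega>|M. (\<Prod>j<0. f j (X n j \<omega>)) * cos ((\<Sum>j\<in>{0..<d}. \<theta> j * X n j \<omega>) + a)) \<longlonglongrightarrow>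
        (LINT \<omega>|M'. (\<Prod>j<0. f j (Y j \<omega>)) * cos ((\<Sum>j\<in>{0..<d}. \<theta> j * Y j \<omega>) + a))"
      proof -
        have "(\<lambda>\<omega>. \<Sum>j<d. \<theta> j * X n j \<omega>) \<in> borel_measurable M" for n
          by (intro borel_measurable_sum borel_measurable_times m measurable_const) auto
        note eX = e[OF M(1) this]
        have "(\<lambda>\<omega>. \<Sum>j<d. \<theta> j * Y j \<omega>) \<in> borel_measurable M'"
          by (intro borel_measurable_sum borel_measurable_times m measurable_const) auto
        note eY = e[OF M(2) this]
        assume "(\<lambda>n. Re (iexp a * (LINT \<omega>|M. iexp (\<Sum>j<d. \<theta> j * X n j \<omega>)))) \<longlonglongrightarrow> Re (iexp a * (LINT \<omega>|M'. iexp (\<Sum>j<d. \<theta> j * Y j \<omega>)))"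
        then show ?thesis
          by (simp only: atLeast0LessThan lessThan_0 prod.empty mult_1 eX eY)
      qed
    qed
  next
    case (Suc k)
    then have k: "k < d" "k \<le> d" by auto
    have IH: "(\<lambda>n. LINT \<omega>|M. (\<Prod>j<k. f j (X n j \<omega>)) * cos ((\<Sum>j\<in>{k..<d}. \<theta> j * X n j \<omega>) + a)) \<longlonglongrightarrow>
        (LINT \<omega>|M'. (\<Prod>j<k. f j (Y j \<omega>)) * cos ((\<Sum>j\<in>{k..<d}. \<theta> j * Y j \<omega>) + a))" for \<theta> a
      using Suc.IH k by blast
    have split: "(\<Sum>j\<in>{k..<d}. (\<theta>(k := u)) j * x j) = u * x k + (\<Sum>j\<in>{Suc k..<d}. \<theta> j * x j)" for \<theta> u and x :: "nat \<Rightarrow> real"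
      using k by (simp add: sum.atLeast_Suc_lessThan)
    show ?case
    proof (intro allI)
      fix \<theta> :: "nat \<Rightarrow> real" and a :: real
      define P where "P n \<omega> = (\<Prod>j<k. f j (X n j \<omega>))" for n \<omega>
      define P' where "P' \<omega> = (\<Prod>j<k. f j (Y j \<omega>))" for \<omega>
      define S where "S n \<omega> = (\<Sum>j\<in>{Suc k..<d}. \<theta> j * X n j \<omega>)" for n \<omega>
      define S' where "S' \<omega> = (\<Sum>j\<in>{Suc k..<d}. \<theta> j * Y j \<omega>)" for \<omega>
      have [measurable]: "P n \<in> borel_measurable M" "P' \<in> borel_measurable M'" "S n \<in> borel_measurable M" "S' \<in> borel_measurable M'"
         "X n k \<in> borel_measurable M" "Y k \<in> borel_measurable M'" for n
        unfolding P_def[abs_def] P'_def[abs_def] S_def[abs_def] S'_def[abs_def] using pm[OF k(2)] sm m k by auto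
      have Pb: "\<bar>P n \<omega>\<bar> \<le> 1" "\<bar>P' \<omega>'\<bar> \<le> 1" for n \<omega> \<omega>' unfolding P_def P'_def by (rule pb)+
      have PC: "\<bar>P n \<omega> * cos z\<bar> \<le> 1" "\<bar>P' \<omega>' * cos z\<bar> \<le> 1" for n \<omega> \<omega>' z
        using Pb abs_cos_le_one[of z] by (auto simp: abs_mult intro!: mult_le_one)
      \<comment> \<open>Coordinate \<open>k\<close> gets the free coefficient \<open>u\<close>, the
        variable of its one-dimensional characteristic function.\<close>
      have IH': "(\<lambda>n. LINT \<omega>|M. P n \<omega> * cos (u * X n k \<omega> + S n \<omega> + a)) \<longlonglongrightarrow> (LINT \<omega>|M'. P' \<omega> * cos (u * Y k \<omega> + S' \<omega> + a))" for u a
        using IH[of "\<theta>(k := u)" a] unfolding split P_def P'_def S_def S'_def .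
      have ii: "integrable M (\<lambda>\<omega>. P n \<omega> * cos (u * X n k \<omega> + S n \<omega> + a))" for n u a
        by (rule M.integrable_const_bound[of _ 1]) (use PC in auto)
      have ii': "integrable M' (\<lambda>\<omega>. P' \<omega> * cos (u * Y k \<omega> + S' \<omega> + a))" for u a
        by (rule M'.integrable_const_bound[of _ 1]) (use PC in auto)
      \<comment> \<open>Product-to-sum formulas express the weighted transforms of coordinate
        \<open>k\<close> through the induction hypothesis at the coefficients \<open>u\<close> and
        \<open>- u\<close>.\<close>
      have cc: "p * cos (s + a) * cos y = (p * cos (y + s + a) + p * cos (- y + s + a)) / 2" for p s a y :: real
        by (simp only: add.assoc cos_add[of y] cos_add[of "- y"] cos_minus sin_minus) (simp add: algebra_simps)
      have h: "cos (z + (a - pi/2)) = sin (z + a)" for z a :: real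
        by (simp add: add_diff_eq cos_diff)
      have cs: "p * cos (s + a) * sin y = (p * cos (y + s + (a - pi/2)) - p * cos (- y + s + (a - pi/2))) / 2" for p s a y :: real
        by (simp only: h) (simp only: add.assoc sin_add[of y] sin_add[of "- y"] cos_minus sin_minus, simp add: algebra_simps)
      have "(\<lambda>n. LINT \<omega>|M. (P n \<omega> * cos (S n \<omega> + a)) * f k (X n k \<omega>)) \<longlonglongrightarrow> (LINT \<omega>|M'. (P' \<omega> * cos (S' \<omega> + a)) * f k (Y k \<omega>))"
      proof (rule weighted_levy[OF M, where C = 1 and b = 1 and f = "f k" and X = "\<lambda>n. X n k" and Y = "Y k"])
        fix u
        show "(\<lambda>n. LINT \<omega>|M. P n \<omega> * cos (S n \<omega> + a) * cos (u * X n k \<omega>)) \<longlonglongrightarrow> (LINT \<omega>|M'. P' \<omega> * cos (S' \<omega> + a) * cos (u * Y k \<omega>))"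
          unfolding cc minus_mult_left using ii ii' by (simp only: integral_divide_zero Bochner_Integration.integral_add) (intro tendsto_intros IH', simp)
        show "(\<lambda>n. LINT \<omega>|M. P n \<omega> * cos (S n \<omega> + a) * sin (u * X n k \<omega>)) \<longlonglongrightarrow> (LINT \<omega>|M'. P' \<omega> * cos (S' \<omega> + a) * sin (u * Y k \<omega>))"
          unfolding cs minus_mult_left using ii ii' by (simp only: integral_divide_zero Bochner_Integration.integral_diff) (intro tendsto_intros IH', simp)
        show "(\<lambda>n. LINT \<omega>|M. iexp (u * X n k \<omega>)) \<longlonglongrightarrow> (LINT \<omega>|M'. iexp (u * Y k \<omega>))"
        proof -
          have "(\<Sum>j<d. (if j = k then u else 0) * x j) = u * x k" for x :: "nat \<Rightarrow> real"
            using k by (simp add: if_distrib[of "\<lambda>z. z * _"] cong: if_cong)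
          then show ?thesis using c[of "\<lambda>j. if j = k then u else 0"] by simp
        qed
      qed (use PC f k in auto)
      then show "(\<lambda>n. LINT \<omega>|M. (\<Prod>j<Suc k. f j (X n j \<omega>)) * cos ((\<Sum>j\<in>{Suc k..<d}. \<theta> j * X n j \<omega>) + a)) \<longlonglongrightarrow>
        (LINT \<omega>|M'. (\<Prod>j<Suc k. f j (Y j \<omega>)) * cos ((\<Sum>j\<in>{Suc k..<d}. \<theta> j * Y j \<omega>) + a))"
        by (simp add: P_def P'_def S_def S'_def ac_simps)
    qed
  qed
  from this[of d, OF order_refl, rule_format, of "\<lambda>_. 0" 0] show ?thesis by simp
qed

section \<open>Lipschitz functions of finitely many coordinates\<close>

definition tent :: "real \<Rightarrow> real" where
  "tent x = max 0 (1 - \<bar>x\<bar>)"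

lemma tent_bounds: "0 \<le> tent x" "tent x \<le> 1" "\<bar>tent x\<bar> \<le> 1"
  by (auto simp: tent_def)

lemma tent_pos_imp: "tent x \<noteq> 0 \<Longrightarrow> \<bar>x\<bar> \<le> 1"
  by (auto simp: tent_def)

lemma continuous_on_tent [continuous_intros]:
  "continuous_on S f \<Longrightarrow> continuous_on S (\<lambda>x. tent (f x))"
  unfolding tent_def by (intro continuous_intros)

text \<open>At most the hats at the floor of \<open>y\<close> and at the next integer are nonzero,
  and they add up to 1. At an integer \<open>y\<close> the first alone suffices, which admits the
  right end of a grid.\<close>

lemma tent_sum:
  fixes y :: real and A :: "int set"
  assumes "finite A"
  shows "(\<Sum>g\<in>A. tent (y - of_int g)) \<le> 1"
    and "\<lfloor>y\<rfloor> \<in> A \<Longrightarrow> \<lfloor>y\<rfloor> + 1 \<in> A \<or> y = of_int \<lfloor>y\<rfloor> \<Longrightarrow> (\<Sum>g\<in>A. tent (y - of_int g)) = 1"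
proof -
  define k where "k = \<lfloor>y\<rfloor>"
  have k: "of_int k \<le> y" "y < of_int k + 1" unfolding k_def by linarith+
  have z: "tent (y - of_int g) = 0" if "g \<notin> {k, k + 1}" for g
  proof (cases "g < k")
    case True
    then have "of_int g + 1 \<le> (of_int k :: real)" by linarith
    then show ?thesis using k by (simp add: tent_def)
  next
    case False
    then have "g \<ge> k + 2" using that by auto
    then have "of_int g \<ge> (of_int k + 2 :: real)" by linarith
    then show ?thesis using k by (simp add: tent_def)
  qed
  have t: "tent (y - of_int k) = 1 - (y - of_int k)" "tent (y - of_int (k + 1)) = y - of_int k"
    using k by (simp_all add: tent_def)
  have s: "(\<Sum>g\<in>A. tent (y - of_int g)) = (\<Sum>g\<in>A \<inter> {k, k + 1}. tent (y - of_int g))"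
    using assms z by (intro sum.mono_neutral_right) auto
  also have "\<dots> \<le> (\<Sum>g\<in>{k, k + 1}. tent (y - of_int g))"
    by (intro sum_mono2) (auto simp: tent_bounds)
  also have "\<dots> = 1" using t by simp
  finally show "(\<Sum>g\<in>A. tent (y - of_int g)) \<le> 1" .
  assume *: "\<lfloor>y\<rfloor> \<in> A" "\<lfloor>y\<rfloor> + 1 \<in> A \<or> y = of_int \<lfloor>y\<rfloor>"
  show "(\<Sum>g\<in>A. tent (y - of_int g)) = 1"
  proof (cases "k + 1 \<in> A")
    case True
    then have "A \<inter> {k, k + 1} = {k, k + 1}" using * by (auto simp: k_def)
    then show ?thesis unfolding s using t by simp
  next
    case False
    then have "A \<inter> {k, k + 1} = {k}" "y = of_int k" using * by (auto simp: k_def)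
    then show ?thesis unfolding s using t by simp
  qed
qed

text \<open>Multilinear interpolation of \<open>\<Psi>\<close> on the grid of mesh
  \<open>\<delta>\<close> with indices up to \<open>N\<close> in absolute value: a finite
  combination of products of one-variable functions, to which \<open>char_conv_imp_prod_conv\<close>
  applies. \<open>tmass\<close> is the part of the partition of unity that this finite grid
  retains.\<close>

definition tapprox :: "nat \<Rightarrow> real \<Rightarrow> int \<Rightarrow> ((nat \<Rightarrow> real) \<Rightarrow> real) \<Rightarrow> (nat \<Rightarrow> real) \<Rightarrow> real" where
  "tapprox d \<delta> N \<Psi> x = (\<Sum>g\<in>PiE {..<d} (\<lambda>_. {- N..N}). \<Psi> (\<lambda>j. \<delta> * of_int (g j)) * (\<Prod>j<d. tent (x j / \<delta> - of_int (g j))))"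

definition tmass :: "nat \<Rightarrow> real \<Rightarrow> int \<Rightarrow> (nat \<Rightarrow> real) \<Rightarrow> real" where
  "tmass d \<delta> N x = (\<Prod>j<d. \<Sum>g\<in>{- N..N}. tent (x j / \<delta> - of_int g))"

lemma tmass_bounds: "0 \<le> tmass d \<delta> N x" "tmass d \<delta> N x \<le> 1"
  unfolding tmass_def by (auto intro!: prod_nonneg prod_le_1 sum_nonneg simp: tent_bounds tent_sum)

lemma tmass_eq_1:
  assumes "\<delta> > 0" "\<And>j. j < d \<Longrightarrow> \<bar>x j\<bar> < of_int N * \<delta>"
  shows "tmass d \<delta> N x = 1"
  unfolding tmass_def
proof (rule prod.neutral, rule ballI)
  fix j assume "j \<in> {..<d}"
  then have "\<bar>x j / \<delta>\<bar> < of_int N" using assms by (simp add: divide_less_eq)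
  then have "- of_int N < x j / \<delta>" "x j / \<delta> < of_int N" by linarith+
  then have "\<lfloor>x j / \<delta>\<rfloor> \<in> {- N..N}" "\<lfloor>x j / \<delta>\<rfloor> + 1 \<in> {- N..N}"
    by (auto simp: le_floor_iff floor_less_iff floor_le_iff) linarith+
  then show "(\<Sum>g\<in>{- N..N}. tent (x j / \<delta> - of_int g)) = 1"
    by (intro tent_sum(2)) auto
qed

text \<open>A grid point with nonzero weight lies within \<open>\<delta>\<close> of \<open>x\<close>
  in each coordinate, so the retained weights err by at most \<open>L * \<delta>\<close>; the
  missing weight costs at most \<open>b\<close> per unit.\<close>

lemma tapprox_bound:
  assumes lip: "\<And>x y e. (\<And>j. j < d \<Longrightarrow> \<bar>x j - y j\<bar> \<le> e) \<Longrightarrow> e \<ge> 0 \<Longrightarrow> \<bar>\<Psi> x - \<Psi> y\<bar> \<le> L * e"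
    and b: "\<And>x. \<bar>\<Psi> x\<bar> \<le> b" and \<delta>: "\<delta> > 0" and L: "L \<ge> 0"
  shows "\<bar>\<Psi> x - tapprox d \<delta> N \<Psi> x\<bar> \<le> L * \<delta> + b * (1 - tmass d \<delta> N x)"
proof -
  define A where "A = PiE {..<d} (\<lambda>_. {- N..N})"
  define w where "w g = (\<Prod>j<d. tent (x j / \<delta> - of_int (g j)))" for g
  have w0: "w g \<ge> 0" for g unfolding w_def by (intro prod_nonneg) (simp add: tent_bounds)
  have m: "tmass d \<delta> N x = (\<Sum>g\<in>A. w g)"
    unfolding tmass_def A_def w_def by (rule prod_sum_PiE) auto
  have t: "\<bar>(\<Psi> x - \<Psi> (\<lambda>j. \<delta> * of_int (g j))) * w g\<bar> \<le> L * \<delta> * w g" for g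
  proof (cases "w g = 0")
    case False
    then have "\<forall>j<d. tent (x j / \<delta> - of_int (g j)) \<noteq> 0" by (auto simp: w_def)
    then have 1: "\<bar>x j / \<delta> - of_int (g j)\<bar> \<le> 1" if "j < d" for j using that tent_pos_imp by blast
    have "\<bar>x j - \<delta> * of_int (g j)\<bar> \<le> \<delta>" if "j < d" for j
    proof -
      have "\<bar>x j - \<delta> * of_int (g j)\<bar> = \<delta> * \<bar>x j / \<delta> - of_int (g j)\<bar>"
        using \<delta> by (simp add: abs_mult_pos' right_diff_distrib)
      also have "\<dots> \<le> \<delta> * 1" using \<delta> 1[OF that] by (intro mult_left_mono) auto
      finally show ?thesis by simp
    qed
    then have "\<bar>\<Psi> x - \<Psi> (\<lambda>j. \<delta> * of_int (g j))\<bar> \<le> L * \<delta>" using \<delta> by (intro lip) auto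
    then show ?thesis using w0[of g] by (simp add: abs_mult mult_right_mono)
  qed simp
  have "\<Psi> x - tapprox d \<delta> N \<Psi> x = \<Psi> x * (1 - tmass d \<delta> N x) + (\<Sum>g\<in>A. (\<Psi> x - \<Psi> (\<lambda>j. \<delta> * of_int (g j))) * w g)"
    unfolding m by (simp add: tapprox_def A_def[symmetric] w_def[symmetric] left_diff_distrib right_diff_distrib sum_subtractf sum_distrib_left)
  also have "\<bar>\<dots>\<bar> \<le> \<bar>\<Psi> x * (1 - tmass d \<delta> N x)\<bar> + \<bar>\<Sum>g\<in>A. (\<Psi> x - \<Psi> (\<lambda>j. \<delta> * of_int (g j))) * w g\<bar>"
    by (rule abs_triangle_ineq)
  also have "\<dots> \<le> b * (1 - tmass d \<delta> N x) + L * \<delta> * 1"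
  proof (rule add_mono)
    show "\<bar>\<Psi> x * (1 - tmass d \<delta> N x)\<bar> \<le> b * (1 - tmass d \<delta> N x)"
      using tmass_bounds[of d \<delta> N x] b by (simp add: abs_mult mult_right_mono)
    have "\<bar>\<Sum>g\<in>A. (\<Psi> x - \<Psi> (\<lambda>j. \<delta> * of_int (g j))) * w g\<bar> \<le> (\<Sum>g\<in>A. L * \<delta> * w g)"
      by (rule order_trans[OF sum_abs]) (intro sum_mono t)
    also have "\<dots> = L * \<delta> * tmass d \<delta> N x" by (simp add: m sum_distrib_left)
    also have "\<dots> \<le> L * \<delta> * 1" using tmass_bounds[of d \<delta> N x] L \<delta> by (intro mult_left_mono) auto
    finally show "\<bar>\<Sum>g\<in>A. (\<Psi> x - \<Psi> (\<lambda>j. \<delta> * of_int (g j))) * w g\<bar> \<le> L * \<delta> * 1" .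
  qed
  finally show ?thesis by simp
qed

lemma tent_measurable [measurable]: "tent \<in> borel_measurable borel"
  unfolding tent_def[abs_def] by measurable

lemma tapprox_measurable:
  assumes "\<And>j. j < d \<Longrightarrow> X j \<in> borel_measurable M"
  shows "(\<lambda>\<omega>. tapprox d \<delta> N \<Psi> (\<lambda>j. X j \<omega>)) \<in> borel_measurable M" "(\<lambda>\<omega>. tmass d \<delta> N (\<lambda>j. X j \<omega>)) \<in> borel_measurable M"
proof -
  have t: "(\<lambda>\<omega>. tent (X j \<omega> / \<delta> - c)) \<in> borel_measurable M" if "j < d" for j c
    using assms[OF that] by measurable
  show "(\<lambda>\<omega>. tapprox d \<delta> N \<Psi> (\<lambda>j. X j \<omega>)) \<in> borel_measurable M"
    unfolding tapprox_def
    by (rule borel_measurable_sum, rule borel_measurable_times, simp, rule borel_measurable_prod, rule t, simp)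
  show "(\<lambda>\<omega>. tmass d \<delta> N (\<lambda>j. X j \<omega>)) \<in> borel_measurable M"
    unfolding tmass_def by (rule borel_measurable_prod, rule borel_measurable_sum, rule t, simp)
qed

text \<open>Mesh 1 / (k + 1) with (k + 1)^2 points on each side covers a box of half-width k + 1:
  the grid becomes finer and larger at once.\<close>

lemma tmass_limit:
  "\<exists>K. \<forall>k\<ge>K. tmass d (1 / real (Suc k)) (int (Suc k) ^ 2) x = 1"
proof -
  define B where "B = Max (insert 0 ((\<lambda>j. \<bar>x j\<bar>) ` {..<d}))"
  have B: "\<bar>x j\<bar> \<le> B" if "j < d" for j
    unfolding B_def using that by (intro Max_ge) auto
  obtain K :: nat where K: "real K > B" using reals_Archimedean2 by blast
  show ?thesis
  proof (intro exI allI impI tmass_eq_1)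
    fix k j assume k: "K \<le> k" and j: "j < d"
    have "\<bar>x j\<bar> < real (Suc k)" using B[OF j] K k by linarith
    also have "real (Suc k) = of_int (int (Suc k) ^ 2) * (1 / real (Suc k))" by (simp add: power2_eq_square)
    finally show "\<bar>x j\<bar> < of_int (int (Suc k) ^ 2) * (1 / real (Suc k))" .
  qed simp
qed

text \<open>\<open>\<Psi>\<close> takes whole sequences, with a Lipschitz bound in the first
  \<open>d\<close> coordinates; measurability follows because the composition is a pointwise limit
  of interpolations.\<close>

lemma lipschitz_measurable:
  fixes X :: "nat \<Rightarrow> 'a \<Rightarrow> real" and \<Psi> :: "(nat \<Rightarrow> real) \<Rightarrow> real"
  assumes lip: "\<And>x y e. (\<And>j. j < d \<Longrightarrow> \<bar>x j - y j\<bar> \<le> e) \<Longrightarrow> e \<ge> 0 \<Longrightarrow> \<bar>\<Psi> x - \<Psi> y\<bar> \<le> L * e"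
    and b: "\<And>x. \<bar>\<Psi> x\<bar> \<le> b" and L: "L \<ge> 0"
    and X: "\<And>j. j < d \<Longrightarrow> X j \<in> borel_measurable M"
  shows "(\<lambda>\<omega>. \<Psi> (\<lambda>j. X j \<omega>)) \<in> borel_measurable M"
proof (rule borel_measurable_LIMSEQ_real)
  fix \<omega>
  define x where "x j = X j \<omega>" for j
  show "(\<lambda>k. tapprox d (1 / real (Suc k)) (int (Suc k) ^ 2) \<Psi> (\<lambda>j. X j \<omega>)) \<longlonglongrightarrow> \<Psi> (\<lambda>j. X j \<omega>)"
    unfolding x_def[symmetric]
  proof (rule LIM_zero_cancel, rule Lim_null_comparison)
    obtain K where K: "\<forall>k\<ge>K. tmass d (1 / real (Suc k)) (int (Suc k) ^ 2) x = 1" using tmass_limit by blast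
    show "\<forall>\<^sub>F k in sequentially. norm (tapprox d (1 / real (Suc k)) (int (Suc k) ^ 2) \<Psi> x - \<Psi> x) \<le> L * (1 / real (Suc k))"
      unfolding eventually_sequentially
    proof (intro exI allI impI)
      fix k assume "K \<le> k"
      then show "norm (tapprox d (1 / real (Suc k)) (int (Suc k) ^ 2) \<Psi> x - \<Psi> x) \<le> L * (1 / real (Suc k))"
        using tapprox_bound[of d \<Psi> L b "1 / real (Suc k)" x "int (Suc k) ^ 2", OF lip b _ L] K
        by (simp add: abs_minus_commute)
    qed
    have "(\<lambda>k. L * (1 / real (Suc k))) \<longlonglongrightarrow> L * 0"
      by (intro tendsto_intros LIMSEQ_Suc lim_1_over_n)
    then show "(\<lambda>k. L * (1 / real (Suc k))) \<longlonglongrightarrow> 0" by simp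
  qed
qed (rule tapprox_measurable[OF X])

text \<open>Interpolation is uniformly accurate only where \<open>tmass\<close> is 1. The retained
  mass is itself an interpolation, that of the constant 1, so its expectation converges too: if
  little mass is lost under the limit law, then little is lost under the laws of \<open>X n\<close>
  for large \<open>n\<close>. This takes the place of a tightness argument in finite
  dimension.\<close>

theorem char_conv_imp_lipschitz_conv:
  fixes X :: "nat \<Rightarrow> nat \<Rightarrow> 'a \<Rightarrow> real" and Y :: "nat \<Rightarrow> 'b \<Rightarrow> real"
  assumes M: "prob_space M" "prob_space M'"
    and m: "\<And>n j. j < d \<Longrightarrow> X n j \<in> borel_measurable M" "\<And>j. j < d \<Longrightarrow> Y j \<in> borel_measurable M'"
    and c: "\<And>\<theta>. (\<lambda>n. LINT \<omega>|M. iexp (\<Sum>j<d. \<theta> j * X n j \<omega>)) \<longlonglongrightarrow> (LINT \<omega>|M'. iexp (\<Sum>j<d. \<theta> j * Y j \<omega>))"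
    and lip: "\<And>x y e. (\<And>j. j < d \<Longrightarrow> \<bar>x j - y j\<bar> \<le> e) \<Longrightarrow> e \<ge> 0 \<Longrightarrow> \<bar>\<Psi> x - \<Psi> y\<bar> \<le> L * e"
    and b: "\<And>x. \<bar>\<Psi> x\<bar> \<le> b" and L: "L \<ge> 0"
  shows "(\<lambda>n. LINT \<omega>|M. \<Psi> (\<lambda>j. X n j \<omega>)) \<longlonglongrightarrow> (LINT \<omega>|M'. \<Psi> (\<lambda>j. Y j \<omega>))"
proof -
  interpret M: prob_space M by fact
  interpret M': prob_space M' by fact
  define a where "a k = tapprox d (1 / real (Suc k)) (int (Suc k) ^ 2) \<Psi>" for k
  define s where "s k = tmass d (1 / real (Suc k)) (int (Suc k) ^ 2)" for k
  have b0: "b \<ge> 0" using b[of undefined] by linarith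
  have bnd: "\<bar>\<Psi> x - a k x\<bar> \<le> L * (1 / real (Suc k)) + b * (1 - s k x)" for k x
    unfolding a_def s_def by (rule tapprox_bound[OF lip b _ L]) auto
  have s01: "0 \<le> s k x" "s k x \<le> 1" for k x unfolding s_def by (rule tmass_bounds)+
  have meas: "(\<lambda>\<omega>. a k (\<lambda>j. Z j \<omega>)) \<in> borel_measurable N" "(\<lambda>\<omega>. s k (\<lambda>j. Z j \<omega>)) \<in> borel_measurable N" "(\<lambda>\<omega>. \<Psi> (\<lambda>j. Z j \<omega>)) \<in> borel_measurable N"
    if "\<And>j. j < d \<Longrightarrow> Z j \<in> borel_measurable N" for N :: "'c measure" and Z k
    unfolding a_def s_def using tapprox_measurable[of d Z N] lipschitz_measurable[of d \<Psi> L b Z N, OF lip b L] that by auto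
  have est: "\<bar>(LINT \<omega>|N. \<Psi> (\<lambda>j. Z j \<omega>)) - (LINT \<omega>|N. a k (\<lambda>j. Z j \<omega>))\<bar> \<le> L * (1 / real (Suc k)) + b * (1 - (LINT \<omega>|N. s k (\<lambda>j. Z j \<omega>)))
     \<and> integrable N (\<lambda>\<omega>. s k (\<lambda>j. Z j \<omega>))"
    if N: "prob_space N" and Z: "\<And>j. j < d \<Longrightarrow> Z j \<in> borel_measurable N" for N :: "'c measure" and Z k
  proof -
    interpret N: prob_space N by fact
    note [measurable] = meas[OF Z]
    have i1: "integrable N (\<lambda>\<omega>. \<Psi> (\<lambda>j. Z j \<omega>))" by (rule N.integrable_const_bound[of _ b]) (use b Z in auto)
    have i3: "integrable N (\<lambda>\<omega>. s k (\<lambda>j. Z j \<omega>))" by (rule N.integrable_const_bound[of _ 1]) (use s01 Z in auto)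
    have i2: "integrable N (\<lambda>\<omega>. a k (\<lambda>j. Z j \<omega>))"
    proof (rule N.integrable_const_bound[of _ "L + b + b"])
      have "norm (a k x) \<le> L + b + b" for x
      proof -
        have "L * (1 / real (Suc k)) \<le> L * 1" using L by (intro mult_left_mono) auto
        moreover have "b * (1 - s k x) \<le> b * 1" using b0 s01 by (intro mult_left_mono) auto
        ultimately show ?thesis using bnd[of x k] b[of x] unfolding real_norm_def mult_1_right by linarith
      qed
      then show "AE \<omega> in N. norm (a k (\<lambda>j. Z j \<omega>)) \<le> L + b + b" by simp
    qed (use Z in auto)
    have "\<bar>(LINT \<omega>|N. \<Psi> (\<lambda>j. Z j \<omega>)) - (LINT \<omega>|N. a k (\<lambda>j. Z j \<omega>))\<bar> = \<bar>LINT \<omega>|N. \<Psi> (\<lambda>j. Z j \<omega>) - a k (\<lambda>j. Z j \<omega>)\<bar>"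
      using i1 i2 by simp
    also have "\<dots> \<le> (LINT \<omega>|N. \<bar>\<Psi> (\<lambda>j. Z j \<omega>) - a k (\<lambda>j. Z j \<omega>)\<bar>)" by (rule integral_abs_bound)
    also have "\<dots> \<le> (LINT \<omega>|N. L * (1 / real (Suc k)) + b * (1 - s k (\<lambda>j. Z j \<omega>)))"
      by (rule integral_mono) (use i1 i2 i3 bnd in auto)
    also have "\<dots> = L * (1 / real (Suc k)) + b * (1 - (LINT \<omega>|N. s k (\<lambda>j. Z j \<omega>)))"
      using i3 by (simp add: N.prob_space)
    finally show ?thesis using i3 by blast
  qed
  have prod: "(\<lambda>n. LINT \<omega>|M. (\<Prod>j<d. tent (X n j \<omega> / \<delta> - of_int (g j)))) \<longlonglongrightarrow> (LINT \<omega>|M'. (\<Prod>j<d. tent (Y j \<omega> / \<delta> - of_int (g j))))" for \<delta> and g :: "nat \<Rightarrow> int"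
    by (rule char_conv_imp_prod_conv[OF M m c, where f = "\<lambda>j x. tent (x / \<delta> - of_int (g j))"])
      (auto intro!: continuous_intros simp: tent_bounds divide_inverse)
  have pint: "integrable N (\<lambda>\<omega>. (\<Prod>j<d. tent (Z j \<omega> / \<delta> - of_int (g j))))"
    if N: "prob_space N" and Z: "\<And>j. j < d \<Longrightarrow> Z j \<in> borel_measurable N" for N :: "'c measure" and Z \<delta> and g :: "nat \<Rightarrow> int"
  proof -
    interpret N: prob_space N by fact
    have "(\<lambda>\<omega>. tent (Z j \<omega> / \<delta> - of_int (g j))) \<in> borel_measurable N" if "j < d" for j using Z[OF that] by measurable
    moreover have "\<bar>\<Prod>j<d. tent (z j / \<delta> - of_int (g j))\<bar> \<le> 1" for z
      unfolding abs_prod by (intro prod_le_1) (auto simp: tent_bounds)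
    ultimately show ?thesis by (intro N.integrable_const_bound[of _ 1]) (auto intro!: borel_measurable_prod)
  qed
  have tc: "(\<lambda>n. LINT \<omega>|M. tapprox d \<delta> N \<Psi>' (\<lambda>j. X n j \<omega>)) \<longlonglongrightarrow> (LINT \<omega>|M'. tapprox d \<delta> N \<Psi>' (\<lambda>j. Y j \<omega>))" for \<delta> N \<Psi>'
    unfolding tapprox_def
    by (subst (1 2) Bochner_Integration.integral_sum) (auto intro!: pint M m tendsto_sum tendsto_mult prod)
  have sm: "s k x = tapprox d (1 / real (Suc k)) (int (Suc k) ^ 2) (\<lambda>_. 1) x" for k x
    unfolding s_def tmass_def tapprox_def by (simp add: prod_sum_PiE)
  have sc: "(\<lambda>n. LINT \<omega>|M. s k (\<lambda>j. X n j \<omega>)) \<longlonglongrightarrow> (LINT \<omega>|M'. s k (\<lambda>j. Y j \<omega>))" for k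
    unfolding sm by (rule tc)
  have ac: "(\<lambda>n. LINT \<omega>|M. a k (\<lambda>j. X n j \<omega>)) \<longlonglongrightarrow> (LINT \<omega>|M'. a k (\<lambda>j. Y j \<omega>))" for k
    unfolding a_def by (rule tc)
  define e where "e k = 2 * (L * (1 / real (Suc k)) + b * (1 - (LINT \<omega>|M'. s k (\<lambda>j. Y j \<omega>))))" for k
  have "(\<lambda>k. LINT \<omega>|M'. s k (\<lambda>j. Y j \<omega>)) \<longlonglongrightarrow> (LINT \<omega>|M'. 1)"
  proof (rule integral_dominated_convergence[where w = "\<lambda>_. 1"])
    show "AE \<omega> in M'. (\<lambda>k. s k (\<lambda>j. Y j \<omega>)) \<longlonglongrightarrow> 1"
    proof (rule AE_I2)
      fix \<omega>
      obtain K where "\<forall>k\<ge>K. tmass d (1 / real (Suc k)) (int (Suc k) ^ 2) (\<lambda>j. Y j \<omega>) = 1"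
        using tmass_limit[of d "\<lambda>j. Y j \<omega>"] by blast
      then have "\<forall>\<^sub>F k in sequentially. s k (\<lambda>j. Y j \<omega>) = 1" unfolding s_def eventually_sequentially by blast
      then show "(\<lambda>k. s k (\<lambda>j. Y j \<omega>)) \<longlonglongrightarrow> 1" by (rule tendsto_eventually)
    qed
  qed (use s01 meas(2)[of Y M'] m in auto)
  then have "(\<lambda>k. LINT \<omega>|M'. s k (\<lambda>j. Y j \<omega>)) \<longlonglongrightarrow> 1" by (simp add: M'.prob_space)
  then have "e \<longlonglongrightarrow> 2 * (L * 0 + b * (1 - 1))"
    unfolding e_def by (intro tendsto_intros LIMSEQ_Suc lim_1_over_n)
  then have e0: "e \<longlonglongrightarrow> 0" by simp
  show ?thesis
  proof (rule LIMSEQ_I)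
    fix r :: real assume "r > 0"
    then have "\<forall>\<^sub>F k in sequentially. e k < r / 2" using e0 by (intro order_tendstoD(2)) auto
    then obtain k where k: "e k < r / 2" by (auto simp: eventually_sequentially)
    define q where "q n = \<bar>(LINT \<omega>|M. a k (\<lambda>j. X n j \<omega>)) - (LINT \<omega>|M'. a k (\<lambda>j. Y j \<omega>))\<bar> + b * \<bar>(LINT \<omega>|M. s k (\<lambda>j. X n j \<omega>)) - (LINT \<omega>|M'. s k (\<lambda>j. Y j \<omega>))\<bar>" for n
    have "q \<longlonglongrightarrow> \<bar>(LINT \<omega>|M'. a k (\<lambda>j. Y j \<omega>)) - (LINT \<omega>|M'. a k (\<lambda>j. Y j \<omega>))\<bar> + b * \<bar>(LINT \<omega>|M'. s k (\<lambda>j. Y j \<omega>)) - (LINT \<omega>|M'. s k (\<lambda>j. Y j \<omega>))\<bar>"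
      unfolding q_def by (intro tendsto_intros ac sc)
    then have "q \<longlonglongrightarrow> 0" by simp
    then have "\<forall>\<^sub>F n in sequentially. q n < r / 2" using \<open>r > 0\<close> by (intro order_tendstoD(2)) auto
    then obtain n0 where n0: "\<And>n. n \<ge> n0 \<Longrightarrow> q n < r / 2" by (auto simp: eventually_sequentially)
    show "\<exists>no. \<forall>n\<ge>no. norm ((LINT \<omega>|M. \<Psi> (\<lambda>j. X n j \<omega>)) - (LINT \<omega>|M'. \<Psi> (\<lambda>j. Y j \<omega>))) < r"
    proof (intro exI allI impI)
      fix n assume n: "n0 \<le> n"
      define eX SX eY SY PX PY where "eX = (LINT \<omega>|M. a k (\<lambda>j. X n j \<omega>))" and "SX = (LINT \<omega>|M. s k (\<lambda>j. X n j \<omega>))"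
        and "eY = (LINT \<omega>|M'. a k (\<lambda>j. Y j \<omega>))" and "SY = (LINT \<omega>|M'. s k (\<lambda>j. Y j \<omega>))"
        and "PX = (LINT \<omega>|M. \<Psi> (\<lambda>j. X n j \<omega>))" and "PY = (LINT \<omega>|M'. \<Psi> (\<lambda>j. Y j \<omega>))"
      define l where "l = L * (1 / real (Suc k))"
      have 1: "\<bar>PX - eX\<bar> \<le> l + b * (1 - SX)"
        using est[OF M(1), of "X n" k] m unfolding PX_def eX_def SX_def l_def by blast
      have 2: "\<bar>PY - eY\<bar> \<le> l + b * (1 - SY)"
        using est[OF M(2), of Y k] m unfolding PY_def eY_def SY_def l_def by blast
      have 3: "\<bar>eX - eY\<bar> + b * \<bar>SX - SY\<bar> < r / 2" using n0[OF n] by (simp add: q_def eX_def eY_def SX_def SY_def)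
      have 4: "2 * (l + b * (1 - SY)) < r / 2" using k by (simp add: e_def SY_def l_def)
      have "b * (1 - SX) \<le> b * (1 - SY) + b * \<bar>SX - SY\<bar>"
        unfolding distrib_left[symmetric] using b0 by (intro mult_left_mono) auto
      moreover have "\<bar>PX - PY\<bar> \<le> \<bar>PX - eX\<bar> + \<bar>eX - eY\<bar> + \<bar>PY - eY\<bar>" by linarith
      moreover have "2 * (l + b * (1 - SY)) = 2 * l + 2 * (b * (1 - SY))" by simp
      moreover have "\<bar>PX - PY\<bar> < r"
        if "u \<le> v + w" "p1 \<le> l + u" "p2 \<le> l + v" "p3 + w < r / 2" "2 * l + 2 * v < r / 2" "\<bar>PX - PY\<bar> \<le> p1 + p3 + p2" for u v w p1 p2 p3
        using that by linarith
      ultimately have "\<bar>PX - PY\<bar> < r" using 1 2 3 4 by metis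
      then show "norm ((LINT \<omega>|M. \<Psi> (\<lambda>j. X n j \<omega>)) - (LINT \<omega>|M'. \<Psi> (\<lambda>j. Y j \<omega>))) < r"
        by (simp add: PX_def PY_def)
    qed
  qed
qed

subsection \<open>Weak convergence in the space of continuous functions\<close>

context Metric_space
begin

text \<open>The Pasch-Hausdorff envelope: for \<open>\<phi>\<close> bounded below and
  \<open>j \<ge> 0\<close>, the largest \<open>j\<close>-Lipschitz function below
  \<open>\<phi>\<close>.\<close>

definition infconv :: "('a \<Rightarrow> real) \<Rightarrow> real \<Rightarrow> 'a \<Rightarrow> real" where
  "infconv \<phi> j f = (INF g\<in>M. \<phi> g + j * d f g)"

lemma infconv_bounds:
  assumes \<phi>: "\<And>g. g \<in> M \<Longrightarrow> 0 \<le> \<phi> g" and j: "j \<ge> 0" and f: "f \<in> M"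
  shows "0 \<le> infconv \<phi> j f" "infconv \<phi> j f \<le> \<phi> f" "\<And>g. g \<in> M \<Longrightarrow> infconv \<phi> j f \<le> \<phi> g + j * d f g"
proof -
  have nn: "0 \<le> \<phi> g + j * d f g" if "g \<in> M" for g using \<phi>[OF that] j by simp
  show "0 \<le> infconv \<phi> j f" unfolding infconv_def using f nn by (intro cINF_greatest) auto
  show le: "infconv \<phi> j f \<le> \<phi> g + j * d f g" if "g \<in> M" for g
    unfolding infconv_def by (rule cINF_lower[OF _ that]) (use nn in \<open>auto simp: bdd_below_def\<close>)
  show "infconv \<phi> j f \<le> \<phi> f" using le[OF f] f by simp
qed

lemma infconv_lipschitz:
  assumes \<phi>: "\<And>g. g \<in> M \<Longrightarrow> 0 \<le> \<phi> g" and j: "j \<ge> 0" and f: "f \<in> M" and h: "h \<in> M"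
  shows "\<bar>infconv \<phi> j f - infconv \<phi> j h\<bar> \<le> j * d f h"
proof -
  have *: "infconv \<phi> j f \<le> infconv \<phi> j h + j * d f h" if f: "f \<in> M" and h: "h \<in> M" for f h
  proof -
    have "infconv \<phi> j f - j * d f h \<le> infconv \<phi> j h"
      unfolding infconv_def[of \<phi> j h]
    proof (rule cINF_greatest)
      fix g assume g: "g \<in> M"
      have "j * d f g \<le> j * (d f h + d h g)" using triangle[OF f h g] j by (intro mult_left_mono) auto
      then show "infconv \<phi> j f - j * d f h \<le> \<phi> g + j * d h g"
        using infconv_bounds(3)[where \<phi>=\<phi> and j=j and f=f and g=g, OF _ j f g] \<phi> by (simp add: distrib_left)
    qed (use h in auto)
    then show ?thesis by simp
  qed
  show ?thesis using *[OF f h] *[OF h f] commute[of f h] by (simp add: abs_le_iff)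
qed

text \<open>Near \<open>f\<close>, lower semicontinuity bounds \<open>\<phi>\<close> from below; at
  distance at least \<open>r\<close> the penalty \<open>j * r\<close> exceeds
  \<open>\<phi> f\<close> once \<open>j\<close> is large.\<close>

lemma infconv_tendsto:
  assumes \<phi>: "\<And>g. g \<in> M \<Longrightarrow> 0 \<le> \<phi> g" and f: "f \<in> M"
    and lsc: "\<And>e. e > 0 \<Longrightarrow> \<exists>r>0. \<forall>g\<in>M. d f g < r \<longrightarrow> \<phi> g \<ge> \<phi> f - e"
  shows "(\<lambda>j. infconv \<phi> (real j) f) \<longlonglongrightarrow> \<phi> f"
proof (rule LIMSEQ_I)
  fix e :: real assume e: "e > 0"
  then obtain r where r: "r > 0" "\<And>g. g \<in> M \<Longrightarrow> d f g < r \<Longrightarrow> \<phi> g \<ge> \<phi> f - e / 2"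
    using lsc[of "e / 2"] by auto
  obtain J :: nat where J: "real J > \<phi> f / r" using reals_Archimedean2 by blast
  show "\<exists>no. \<forall>j\<ge>no. norm (infconv \<phi> (real j) f - \<phi> f) < e"
  proof (intro exI allI impI)
    fix j assume j: "J \<le> j"
    have "\<phi> f - e / 2 \<le> infconv \<phi> (real j) f"
      unfolding infconv_def
    proof (rule cINF_greatest)
      fix g assume g: "g \<in> M"
      show "\<phi> f - e / 2 \<le> \<phi> g + real j * d f g"
      proof (cases "d f g < r")
        case True
        then show ?thesis using r(2)[OF g] by (simp add: add_increasing2)
      next
        case False
        have "\<phi> f / r < real j" using J j by linarith
        then have "\<phi> f < real j * r" using r(1) by (simp add: divide_less_eq)
        also have "real j * r \<le> real j * d f g" using False by (intro mult_left_mono) auto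
        finally show ?thesis using \<phi>[OF g] e by linarith
      qed
    qed (use f in auto)
    then show "norm (infconv \<phi> (real j) f - \<phi> f) < e"
      using infconv_bounds(2)[where \<phi>=\<phi> and j="real j" and f=f, OF _ _ f] \<phi> e by (simp add: abs_if)
  qed
qed

end

section \<open>Piecewise linear interpolation of paths\<close>

abbreviation C_space :: "real \<Rightarrow> (real \<Rightarrow> real) set" where
  "C_space T \<equiv> mspace (cfunspace (top_of_set {0..T}) euclidean_metric)"

abbreviation C_dist :: "real \<Rightarrow> (real \<Rightarrow> real) \<Rightarrow> (real \<Rightarrow> real) \<Rightarrow> real" where
  "C_dist T \<equiv> mdist (cfunspace (top_of_set {0..T}) euclidean_metric)"

lemma C_space_iff: "f \<in> C_space T \<longleftrightarrow> f \<in> extensional {0..T} \<and> continuous_on {0..T} f"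
  by (subst compactin_mspace_cfunspace) (auto simp: compactin_subtopology)

lemma restrict_C_space: "continuous_on {0..T} x \<Longrightarrow> restrict x {0..T} \<in> C_space T"
  unfolding C_space_iff using continuous_on_cong[of "{0..T}" "{0..T}" x "restrict x {0..T}"] by (simp del: restrict_apply) simp

lemma C_dist_le_iff:
  "T \<ge> 0 \<Longrightarrow> f \<in> C_space T \<Longrightarrow> g \<in> C_space T \<Longrightarrow> C_dist T f g \<le> e \<longleftrightarrow> (\<forall>t\<in>{0..T}. \<bar>f t - g t\<bar> \<le> e)"
  by (subst cfunspace_mdist_le) (auto simp: dist_real_def)

interpretation CM: Metric_space "C_space T" "C_dist T" for T
  by (rule Metric_space_mspace_mdist)

lemma C_interval_eq: "C_interval T = CM.mtopology T"
  by (simp add: C_interval_def mtopology_of_def)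

lemma tent_sum_nat:
  assumes "0 \<le> y" "y \<le> real n"
  shows "(\<Sum>i\<le>n. tent (y - real i)) = 1"
proof -
  have "(\<Sum>i\<le>n. tent (y - real i)) = (\<Sum>g\<in>{0..int n}. tent (y - of_int g))"
    by (rule sum.reindex_bij_witness[of _ nat int]) auto
  also have "\<dots> = 1"
  proof (rule tent_sum(2))
    show "\<lfloor>y\<rfloor> \<in> {0..int n}" using assms by (auto simp: floor_le_iff)
    \<comment> \<open>At the right end \<open>y = n\<close> the hat centred at n + 1 is missing, but
      it vanishes there.\<close>
    show "\<lfloor>y\<rfloor> + 1 \<in> {0..int n} \<or> y = of_int \<lfloor>y\<rfloor>"
    proof (cases "\<lfloor>y\<rfloor> = int n")
      case True
      then have "real n \<le> y" by (metis of_int_floor_le of_int_of_nat_eq)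
      then have "y = real n" using assms by simp
      then show ?thesis by simp
    next
      case False
      then have "\<lfloor>y\<rfloor> < int n" using assms by (auto simp: floor_less_iff floor_le_iff) linarith
      then show ?thesis using assms by auto
    qed
  qed simp
  finally show ?thesis .
qed

text \<open>Hats at the 2^k + 1 nodes \<open>gridpt T k i\<close> make this the piecewise linear
  function with nodal values \<open>v i\<close>; as a sum it is visibly a convex combination of
  nodal values at each point. The restriction puts it into \<open>C_space T\<close>.\<close>

definition plin :: "real \<Rightarrow> nat \<Rightarrow> (nat \<Rightarrow> real) \<Rightarrow> real \<Rightarrow> real" where
  "plin T k v = restrict (\<lambda>t. \<Sum>i\<le>2 ^ k. v i * tent (2 ^ k * t / T - real i)) {0..T}"

lemma plin_C_space: "T > 0 \<Longrightarrow> plin T k v \<in> C_space T"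
  unfolding plin_def by (intro restrict_C_space continuous_intros) auto

lemma plin_tent_sum:
  assumes "T > 0" "t \<in> {0..T}"
  shows "(\<Sum>i\<le>2 ^ k. tent (2 ^ k * t / T - real i)) = 1"
proof -
  have "2 ^ k * t / T \<le> real (2 ^ k)" using assms by (simp add: divide_le_eq mult_left_mono)
  then show ?thesis using assms by (intro tent_sum_nat) auto
qed

lemma plin_diff:
  assumes T: "T > 0" "t \<in> {0..T}" and b: "\<And>i. i \<le> 2 ^ k \<Longrightarrow> tent (2 ^ k * t / T - real i) \<noteq> 0 \<Longrightarrow> \<bar>c - v i\<bar> \<le> e"
  shows "\<bar>c - plin T k v t\<bar> \<le> e"
proof -
  define w where "w i = tent (2 ^ k * t / T - real i)" for i
  have w: "(\<Sum>i\<le>2 ^ k. w i) = 1" unfolding w_def by (rule plin_tent_sum[OF T])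
  have "c - plin T k v t = c * (\<Sum>i\<le>2 ^ k. w i) - (\<Sum>i\<le>2 ^ k. v i * w i)"
    using T unfolding w by (simp add: plin_def w_def)
  also have "\<dots> = (\<Sum>i\<le>2 ^ k. (c - v i) * w i)"
    by (simp add: sum_distrib_left left_diff_distrib sum_subtractf)
  also have "\<bar>\<dots>\<bar> \<le> (\<Sum>i\<le>2 ^ k. e * w i)"
  proof (rule order_trans[OF sum_abs], rule sum_mono)
    fix i assume "i \<in> {..(2::nat) ^ k}"
    then show "\<bar>(c - v i) * w i\<bar> \<le> e * w i"
      using b[of i] tent_bounds(1)[of "2 ^ k * t / T - real i"] by (cases "w i = 0") (auto simp: w_def abs_mult intro!: mult_right_mono)
  qed
  also have "\<dots> = e" by (simp add: w flip: sum_distrib_left)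
  finally show ?thesis .
qed

lemma plin_lipschitz:
  assumes T: "T > 0" and b: "\<And>i. i < 2 ^ k + 1 \<Longrightarrow> \<bar>v i - w i\<bar> \<le> e"
  shows "C_dist T (plin T k v) (plin T k w) \<le> e"
proof (subst C_dist_le_iff)
  show "\<forall>t\<in>{0..T}. \<bar>plin T k v t - plin T k w t\<bar> \<le> e"
  proof
    fix t assume t: "t \<in> {0..T}"
    have "plin T k v t - plin T k w t = (\<Sum>i\<le>2 ^ k. (v i - w i) * tent (2 ^ k * t / T - real i))"
      using t by (simp add: plin_def left_diff_distrib sum_subtractf)
    also have "\<bar>\<dots>\<bar> \<le> (\<Sum>i\<le>2 ^ k. e * tent (2 ^ k * t / T - real i))"
      by (rule order_trans[OF sum_abs], rule sum_mono) (use b in \<open>auto simp: abs_mult tent_bounds intro!: mult_right_mono\<close>)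
    also have "\<dots> = e" by (simp add: plin_tent_sum[OF T t] flip: sum_distrib_left)
    finally show "\<bar>plin T k v t - plin T k w t\<bar> \<le> e" .
  qed
qed (use T in \<open>auto intro: plin_C_space simp del: mspace_cfunspace\<close>)

definition gridpt :: "real \<Rightarrow> nat \<Rightarrow> nat \<Rightarrow> real" where
  "gridpt T k i = T * real i / 2 ^ k"

lemma gridpt_in: "T > 0 \<Longrightarrow> i \<le> 2 ^ k \<Longrightarrow> gridpt T k i \<in> {0..T}"
proof -
  assume T: "T > 0" "i \<le> 2 ^ k"
  then have "real i \<le> 2 ^ k" by (metis of_nat_le_iff of_nat_numeral of_nat_power)
  then show ?thesis using T by (auto simp: gridpt_def divide_le_eq)
qed

lemma plin_tendsto:
  assumes T: "T > 0" and x: "continuous_on {0..T} x"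
  shows "(\<lambda>k. C_dist T (restrict x {0..T}) (plin T k (\<lambda>i. x (gridpt T k i)))) \<longlonglongrightarrow> 0"
proof (rule LIMSEQ_I)
  fix e :: real assume e: "e > 0"
  have "uniformly_continuous_on {0..T} x" by (rule compact_uniformly_continuous[OF x]) simp
  then obtain r where r: "r > 0" "\<And>s t. s \<in> {0..T} \<Longrightarrow> t \<in> {0..T} \<Longrightarrow> dist s t < r \<Longrightarrow> dist (x s) (x t) < e / 2"
    using e unfolding uniformly_continuous_on_def by (metis half_gt_zero)
  obtain K :: nat where K: "T / r < real K" using reals_Archimedean2 by blast
  show "\<exists>no. \<forall>k\<ge>no. norm (C_dist T (restrict x {0..T}) (plin T k (\<lambda>i. x (gridpt T k i))) - 0) < e"
  proof (intro exI allI impI)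
    fix k assume k: "K \<le> k"
    have "real K \<le> 2 ^ k"
      using k by (metis (no_types, lifting) less_exp less_imp_le of_nat_le_iff of_nat_numeral of_nat_power order_trans)
    then have "T / r < 2 ^ k" using K by linarith
    then have Tr: "T / 2 ^ k < r" using r(1) by (simp add: divide_less_eq mult.commute)
    have "C_dist T (restrict x {0..T}) (plin T k (\<lambda>i. x (gridpt T k i))) \<le> e / 2"
    proof (subst C_dist_le_iff)
      show "\<forall>t\<in>{0..T}. \<bar>restrict x {0..T} t - plin T k (\<lambda>i. x (gridpt T k i)) t\<bar> \<le> e / 2"
      proof
        fix t assume t: "t \<in> {0..T}"
        show "\<bar>restrict x {0..T} t - plin T k (\<lambda>i. x (gridpt T k i)) t\<bar> \<le> e / 2"
        proof (rule plin_diff[OF T t])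
          fix i :: nat assume i: "i \<le> 2 ^ k" "tent (2 ^ k * t / T - real i) \<noteq> 0"
          have "\<bar>2 ^ k * t / T - real i\<bar> \<le> 1" by (rule tent_pos_imp[OF i(2)])
          then have "T / 2 ^ k * \<bar>2 ^ k * t / T - real i\<bar> \<le> T / 2 ^ k * 1" using T by (intro mult_left_mono) auto
          moreover have "T / 2 ^ k * \<bar>2 ^ k * t / T - real i\<bar> = \<bar>t - gridpt T k i\<bar>"
          proof -
            have "t - gridpt T k i = T / 2 ^ k * (2 ^ k * t / T - real i)" using T by (simp add: gridpt_def field_simps)
            then show ?thesis using T by (simp add: abs_mult)
          qed
          ultimately have "\<bar>t - gridpt T k i\<bar> < r" using Tr by simp
          then show "\<bar>restrict x {0..T} t - x (gridpt T k i)\<bar> \<le> e / 2"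
            using r(2)[OF t gridpt_in[OF T i(1)]] t by (simp add: dist_real_def)
        qed
      qed
    qed (use T x in \<open>auto intro: plin_C_space restrict_C_space simp del: mspace_cfunspace\<close>)
    then show "norm (C_dist T (restrict x {0..T}) (plin T k (\<lambda>i. x (gridpt T k i))) - 0) < e"
      using e by simp
  qed
qed

section \<open>Dyadic chaining\<close>

definition osc :: "real \<Rightarrow> (real \<Rightarrow> real) \<Rightarrow> nat \<Rightarrow> real" where
  "osc T x j = Max ((\<lambda>i. \<bar>x (gridpt T j (Suc i)) - x (gridpt T j i)\<bar>) ` {..<2 ^ j})"

lemma osc_ge: "i < 2 ^ j \<Longrightarrow> \<bar>x (gridpt T j (Suc i)) - x (gridpt T j i)\<bar> \<le> osc T x j"
  unfolding osc_def by (intro Max_ge) auto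

lemma osc_nonneg: "osc T x j \<ge> 0"
  using osc_ge[of 0 j x T] by (simp add: order_trans[OF abs_ge_zero])

lemma osc_attained: "\<exists>i<2 ^ j. osc T x j = \<bar>x (gridpt T j (Suc i)) - x (gridpt T j i)\<bar>"
proof -
  have "osc T x j \<in> (\<lambda>i. \<bar>x (gridpt T j (Suc i)) - x (gridpt T j i)\<bar>) ` {..<2 ^ j}"
    unfolding osc_def by (intro Max_in) (auto simp: lessThan_empty_iff)
  then show ?thesis by auto
qed

text \<open>\<open>\<tau> j\<close> is the last dyadic point of level \<open>j\<close> not beyond
  \<open>t\<close>. Passing to level \<open>j + 1\<close> moves it by at most one step there, so by
  continuity \<open>x t\<close> differs from \<open>x (\<tau> k)\<close> by at most the sum of
  \<open>osc\<close> over the levels beyond \<open>k\<close>; comparing \<open>x (\<tau> k)\<close>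
  with the interpolation costs one \<open>osc\<close> at level \<open>k\<close>. In
  \<open>ennreal\<close> the series may diverge.\<close>

lemma plin_chain:
  assumes T: "T > 0" and x: "continuous_on {0..T} x"
  shows "ennreal (C_dist T (restrict x {0..T}) (plin T k (\<lambda>i. x (gridpt T k i)))) \<le> (\<Sum>j. ennreal (osc T x (k + j)))"
proof (cases "(\<Sum>j. ennreal (osc T x (k + j))) = top")
  case False
  define s where "s = enn2real (\<Sum>j. ennreal (osc T x (k + j)))"
  have s: "(\<Sum>j. ennreal (osc T x (k + j))) = ennreal s" "s \<ge> 0"
    using False by (auto simp: s_def less_top)
  have part: "(\<Sum>j<n. osc T x (k + j)) \<le> s" for n
  proof -
    have "ennreal (\<Sum>j<n. osc T x (k + j)) = (\<Sum>j<n. ennreal (osc T x (k + j)))"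
      by (rule sum_ennreal[symmetric]) (simp add: osc_nonneg)
    also have "\<dots> \<le> ennreal s" unfolding s(1)[symmetric] by (rule sum_le_suminf) auto
    finally show ?thesis using s(2) by (subst (asm) ennreal_le_iff) auto
  qed
  have "C_dist T (restrict x {0..T}) (plin T k (\<lambda>i. x (gridpt T k i))) \<le> s"
  proof (subst C_dist_le_iff)
    show "\<forall>t\<in>{0..T}. \<bar>restrict x {0..T} t - plin T k (\<lambda>i. x (gridpt T k i)) t\<bar> \<le> s"
    proof
      fix t assume t: "t \<in> {0..T}"
      \<comment> \<open>For \<open>t = T\<close> this is \<open>2 ^ j\<close>, the index of the last
        node, so the bound below is \<open>m j \<le> 2 ^ j\<close> and not strict.\<close>
      define m where "m j = nat \<lfloor>2 ^ j * t / T\<rfloor>" for j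
      define \<tau> where "\<tau> j = gridpt T j (m j)" for j
      have nn: "0 \<le> 2 ^ j * t / T" for j using t T by simp
      have m: "real (m j) \<le> 2 ^ j * t / T" "2 ^ j * t / T < real (m j) + 1" for j
        using nn[of j] unfolding m_def by (auto simp: of_nat_nat)
      have mle: "m j \<le> 2 ^ j" for j
      proof -
        have "2 ^ j * t / T \<le> 2 ^ j" using t T by (simp add: divide_le_eq mult_left_mono)
        then have "real (m j) \<le> real (2 ^ j)" using m(1)[of j] by (simp only: of_nat_power of_nat_numeral)
        then show ?thesis by (simp only: of_nat_le_iff)
      qed
      have \<tau>in: "\<tau> j \<in> {0..T}" for j unfolding \<tau>_def by (rule gridpt_in[OF T mle])
      have dbl: "gridpt T (Suc j) (2 * i) = gridpt T j i" for i j by (simp add: gridpt_def)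
      have step: "\<bar>x (\<tau> (Suc j)) - x (\<tau> j)\<bar> \<le> osc T x (Suc j)" for j
      proof -
        \<comment> \<open>Doubling a number doubles its integer part, possibly adding 1; in either
          case the move is at most one cell of the finer level.\<close>
        have "real (m (Suc j)) < real (2 * m j + 2)" "real (2 * m j) < real (m (Suc j) + 1)"
          using m[of j] m[of "Suc j"] by simp_all
        then have "m (Suc j) = 2 * m j \<or> m (Suc j) = Suc (2 * m j)"
          by (simp only: of_nat_less_iff) linarith
        then show ?thesis
        proof
          assume "m (Suc j) = 2 * m j"
          then show ?thesis by (simp add: \<tau>_def dbl osc_nonneg)
        next
          assume e: "m (Suc j) = Suc (2 * m j)"
          then have "2 * m j < 2 ^ Suc j" using mle[of "Suc j"] by simp
          from osc_ge[OF this, of x T] show ?thesis by (simp add: \<tau>_def e dbl)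
        qed
      qed
      have chain: "\<bar>x (\<tau> (k + n)) - x (\<tau> k)\<bar> \<le> (\<Sum>j<n. osc T x (k + Suc j))" for n
      proof (induction n)
        case (Suc n)
        have "\<bar>x (\<tau> (k + Suc n)) - x (\<tau> k)\<bar> \<le> \<bar>x (\<tau> (Suc (k + n))) - x (\<tau> (k + n))\<bar> + \<bar>x (\<tau> (k + n)) - x (\<tau> k)\<bar>"
          by simp
        also have "\<dots> \<le> osc T x (Suc (k + n)) + (\<Sum>j<n. osc T x (k + Suc j))"
          by (intro add_mono step Suc.IH)
        finally show ?case by simp
      qed simp
      \<comment> \<open>The bound \<open>s\<close> holds back the oscillation at level
        \<open>k\<close> for the interpolation error at the end.\<close>
      have bd: "\<bar>x (\<tau> (k + n)) - x (\<tau> k)\<bar> \<le> s - osc T x k" for n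
      proof -
        have "osc T x k + (\<Sum>j<n. osc T x (k + Suc j)) = (\<Sum>j<Suc n. osc T x (k + j))"
          by (simp add: sum.lessThan_Suc_shift del: sum.lessThan_Suc)
        then show ?thesis using chain[of n] part[of "Suc n"] by linarith
      qed
      have "\<tau> \<longlonglongrightarrow> t"
      proof (rule LIM_zero_cancel, rule Lim_null_comparison)
        show "\<forall>\<^sub>F j in sequentially. norm (\<tau> j - t) \<le> T * (1/2) ^ j"
        proof (intro always_eventually allI)
          fix j
          have "\<tau> j - t = T / 2 ^ j * (real (m j) - 2 ^ j * t / T)"
            using T by (simp add: \<tau>_def gridpt_def right_diff_distrib)
          then have "\<bar>\<tau> j - t\<bar> = T / 2 ^ j * \<bar>real (m j) - 2 ^ j * t / T\<bar>"
            using T by (simp add: abs_mult)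
          also have "\<dots> \<le> T / 2 ^ j * 1" using m[of j] T by (intro mult_left_mono) auto
          finally show "norm (\<tau> j - t) \<le> T * (1/2) ^ j" by (simp add: power_one_over)
        qed
        have "(\<lambda>j. T * (1/2) ^ j) \<longlonglongrightarrow> T * 0" by (intro tendsto_intros LIMSEQ_realpow_zero) auto
        then show "(\<lambda>j. T * (1/2) ^ j) \<longlonglongrightarrow> 0" by simp
      qed
      then have "(\<lambda>n. \<tau> (n + k)) \<longlonglongrightarrow> t" by (rule LIMSEQ_ignore_initial_segment)
      then have "(\<lambda>n. x (\<tau> (n + k))) \<longlonglongrightarrow> x t"
        by (rule continuous_on_tendsto_compose[OF x _ t]) (intro always_eventually allI \<tau>in)
      then have "(\<lambda>n. \<bar>x (\<tau> (n + k)) - x (\<tau> k)\<bar>) \<longlonglongrightarrow> \<bar>x t - x (\<tau> k)\<bar>" by (intro tendsto_intros)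
      then have xt: "\<bar>x t - x (\<tau> k)\<bar> \<le> s - osc T x k"
        by (rule LIMSEQ_le_const2) (use bd in \<open>auto simp: add.commute\<close>)
      show "\<bar>restrict x {0..T} t - plin T k (\<lambda>i. x (gridpt T k i)) t\<bar> \<le> s"
      proof (rule plin_diff[OF T t])
        fix i :: nat assume i: "i \<le> 2 ^ k" "tent (2 ^ k * t / T - real i) \<noteq> 0"
        have "\<bar>2 ^ k * t / T - real i\<bar> < 1" using i(2) by (auto simp: tent_def)
        then have "real i < real (m k + 2)" "real (m k) < real (i + 1)" using m[of k] by auto
        then have "i = m k \<or> i = Suc (m k)" by (simp only: of_nat_less_iff) linarith
        then have "\<bar>x (\<tau> k) - x (gridpt T k i)\<bar> \<le> osc T x k"
        proof
          assume "i = m k" then show ?thesis by (simp add: \<tau>_def osc_nonneg)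
        next
          assume e: "i = Suc (m k)"
          then have "m k < 2 ^ k" using i(1) by simp
          from osc_ge[OF this, of x T] show ?thesis by (simp add: \<tau>_def e abs_minus_commute)
        qed
        then show "\<bar>restrict x {0..T} t - x (gridpt T k i)\<bar> \<le> s" using xt t by simp
      qed
    qed
  qed (use T x in \<open>auto intro: plin_C_space restrict_C_space simp del: mspace_cfunspace\<close>)
  then show ?thesis unfolding s(1) by (rule ennreal_leI)
qed simp

section \<open>Functionals of continuous processes\<close>

locale path_process = prob_space M for M :: "'a measure" +
  fixes T :: real and X :: "real \<Rightarrow> 'a \<Rightarrow> real"
  assumes T: "T > 0"
    and meas: "t \<in> {0..T} \<Longrightarrow> X t \<in> borel_measurable M"
    and cont: "\<omega> \<in> space M \<Longrightarrow> continuous_on {0..T} (\<lambda>t. X t \<omega>)"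
begin

definition path :: "'a \<Rightarrow> real \<Rightarrow> real" where
  "path \<omega> = restrict (\<lambda>t. X t \<omega>) {0..T}"

definition interp :: "nat \<Rightarrow> 'a \<Rightarrow> real \<Rightarrow> real" where
  "interp k \<omega> = plin T k (\<lambda>i. X (gridpt T k i) \<omega>)"

lemma path_C_space: "\<omega> \<in> space M \<Longrightarrow> path \<omega> \<in> C_space T"
  unfolding path_def by (rule restrict_C_space[OF cont])

lemma interp_C_space: "interp k \<omega> \<in> C_space T"
  unfolding interp_def by (rule plin_C_space[OF T])

lemma interp_tendsto: "\<omega> \<in> space M \<Longrightarrow> (\<lambda>k. C_dist T (path \<omega>) (interp k \<omega>)) \<longlonglongrightarrow> 0"
  unfolding path_def interp_def by (rule plin_tendsto[OF T cont])

end

text \<open>On interpolations such a functional is a Lipschitz function of finitely many values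
  (\<open>plin_lip\<close>), and paths are limits of interpolations. Its measurability along a
  process is derived in this way rather than assumed.\<close>

locale lipschitz_functional =
  fixes T :: real and \<Phi> :: "(real \<Rightarrow> real) \<Rightarrow> real" and L b :: real
  assumes lip: "f \<in> C_space T \<Longrightarrow> g \<in> C_space T \<Longrightarrow> \<bar>\<Phi> f - \<Phi> g\<bar> \<le> L * C_dist T f g"
    and bound: "f \<in> C_space T \<Longrightarrow> \<bar>\<Phi> f\<bar> \<le> b"
    and L: "L \<ge> 0"
begin

lemma plin_lip:
  assumes T: "T > 0" and b: "\<And>i. i < 2 ^ k + 1 \<Longrightarrow> \<bar>v i - w i\<bar> \<le> e"
  shows "\<bar>\<Phi> (plin T k v) - \<Phi> (plin T k w)\<bar> \<le> L * e"
proof -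
  have "\<bar>\<Phi> (plin T k v) - \<Phi> (plin T k w)\<bar> \<le> L * C_dist T (plin T k v) (plin T k w)"
    by (rule lip[OF plin_C_space[OF T] plin_C_space[OF T]])
  also have "\<dots> \<le> L * e" by (rule mult_left_mono[OF plin_lipschitz[OF T b] L])
  finally show ?thesis .
qed

lemma plin_measurable:
  assumes X: "path_process M T X"
  shows "(\<lambda>\<omega>. \<Phi> (path_process.interp T X k \<omega>)) \<in> borel_measurable M"
proof -
  interpret X: path_process M T X by (rule X)
  have "(\<lambda>\<omega>. \<Phi> (plin T k (\<lambda>j. X (gridpt T k j) \<omega>))) \<in> borel_measurable M"
  proof (rule lipschitz_measurable[where L = L and b = b and d = "2 ^ k + 1" and \<Psi> = "\<lambda>v. \<Phi> (plin T k v)" and X = "\<lambda>j. X (gridpt T k j)"])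
    show "\<bar>\<Phi> (plin T k x)\<bar> \<le> b" for x by (rule bound[OF plin_C_space[OF X.T]])
    show "X (gridpt T k j) \<in> borel_measurable M" if "j < 2 ^ k + 1" for j
      by (rule X.meas[OF gridpt_in[OF X.T]]) (use that in simp)
  qed (use plin_lip[OF X.T] L in auto)
  then show ?thesis by (simp add: X.interp_def)
qed

lemma interp_lim:
  assumes X: "path_process M T X" and \<omega>: "\<omega> \<in> space M"
  shows "(\<lambda>k. \<Phi> (path_process.interp T X k \<omega>)) \<longlonglongrightarrow> \<Phi> (path_process.path T X \<omega>)"
proof -
  interpret X: path_process M T X by (rule X)
  show ?thesis
  proof (rule LIM_zero_cancel, rule Lim_null_comparison)
    show "\<forall>\<^sub>F k in sequentially. norm (\<Phi> (X.interp k \<omega>) - \<Phi> (X.path \<omega>)) \<le> L * C_dist T (X.path \<omega>) (X.interp k \<omega>)"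
    proof (intro always_eventually allI)
      fix k
      show "norm (\<Phi> (X.interp k \<omega>) - \<Phi> (X.path \<omega>)) \<le> L * C_dist T (X.path \<omega>) (X.interp k \<omega>)"
        using lip[OF X.path_C_space[OF \<omega>] X.interp_C_space[of k \<omega>]] by (simp only: real_norm_def abs_minus_commute)
    qed
    have "(\<lambda>k. L * C_dist T (X.path \<omega>) (X.interp k \<omega>)) \<longlonglongrightarrow> L * 0"
      by (intro tendsto_intros X.interp_tendsto[OF \<omega>])
    then show "(\<lambda>k. L * C_dist T (X.path \<omega>) (X.interp k \<omega>)) \<longlonglongrightarrow> 0" by (simp only: mult_zero_right)
  qed
qed

lemma path_measurable:
  assumes X: "path_process M T X"
  shows "(\<lambda>\<omega>. \<Phi> (path_process.path T X \<omega>)) \<in> borel_measurable M"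
  by (rule borel_measurable_LIMSEQ_real[OF interp_lim[OF X] plin_measurable[OF X]])

end

text \<open>Lower semicontinuity rather than continuity, so that the same approximation by Lipschitz
  functionals from below serves indicators of open sets (measurability of the path map) as well as
  \<open>b + \<phi>\<close> and \<open>b - \<phi>\<close> (the limit theorem).\<close>

locale lsc_functional =
  fixes T :: real and \<phi> :: "(real \<Rightarrow> real) \<Rightarrow> real" and b :: real
  assumes nonneg: "f \<in> C_space T \<Longrightarrow> 0 \<le> \<phi> f"
    and bound: "f \<in> C_space T \<Longrightarrow> \<phi> f \<le> b"
    and lsc: "f \<in> C_space T \<Longrightarrow> e > 0 \<Longrightarrow> \<exists>r>0. \<forall>g\<in>C_space T. C_dist T f g < r \<longrightarrow> \<phi> g \<ge> \<phi> f - e"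
begin

abbreviation \<psi> :: "nat \<Rightarrow> (real \<Rightarrow> real) \<Rightarrow> real" where
  "\<psi> j \<equiv> CM.infconv T \<phi> (real j)"

lemma \<psi>_bounds: "f \<in> C_space T \<Longrightarrow> 0 \<le> \<psi> j f" "f \<in> C_space T \<Longrightarrow> \<psi> j f \<le> \<phi> f"
  using CM.infconv_bounds(1,2)[where \<phi> = \<phi> and j = "real j" and f = f, OF nonneg] by auto

lemma \<psi>_lipschitz: "lipschitz_functional T (\<psi> j) (real j) b"
proof
  show "\<bar>\<psi> j f - \<psi> j g\<bar> \<le> real j * C_dist T f g" if "f \<in> C_space T" "g \<in> C_space T" for f g
    by (rule CM.infconv_lipschitz[OF nonneg _ that]) auto
  show "\<bar>\<psi> j f\<bar> \<le> b" if "f \<in> C_space T" for f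
    using \<psi>_bounds[OF that, of j] bound[OF that] by linarith
qed auto

lemma \<psi>_tendsto: "f \<in> C_space T \<Longrightarrow> (\<lambda>j. \<psi> j f) \<longlonglongrightarrow> \<phi> f"
  by (rule CM.infconv_tendsto[OF nonneg _ lsc])

lemma path_measurable:
  assumes X: "path_process M T X"
  shows "(\<lambda>\<omega>. \<phi> (path_process.path T X \<omega>)) \<in> borel_measurable M"
  by (rule borel_measurable_LIMSEQ_real[OF \<psi>_tendsto[OF path_process.path_C_space[OF X]] lipschitz_functional.path_measurable[OF \<psi>_lipschitz X]])

end

lemma C_interval_topspace: "topspace (C_interval T) = C_space T"
  unfolding C_interval_eq by (rule CM.topspace_mtopology)

lemma indicator_lsc:
  assumes U: "openin (C_interval T) U"
  shows "lsc_functional T (indicator U) 1"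
proof
  fix f :: "real \<Rightarrow> real" and e :: real
  assume f: "f \<in> C_space T" and e: "e > 0"
  show "\<exists>r>0. \<forall>g\<in>C_space T. C_dist T f g < r \<longrightarrow> indicator U g \<ge> (indicator U f - e :: real)"
  proof (cases "f \<in> U")
    case True
    then obtain r where r: "r > 0" "CM.mball T f r \<subseteq> U"
      using U unfolding C_interval_eq CM.openin_mtopology by blast
    have "g \<in> U" if "g \<in> C_space T" "C_dist T f g < r" for g
      using r(2) that f by (auto simp only: CM.in_mball subset_iff)
    then show ?thesis using r(1) e by (intro exI[of _ r]) (auto simp del: mspace_cfunspace simp: indicator_def)
  next
    case False
    then show ?thesis using e by (intro exI[of _ 1]) (auto simp del: mspace_cfunspace simp: indicator_def)
  qed
qed (auto simp: indicator_def)

text \<open>The indicator of an open set is a pointwise limit of Lipschitz functionals, whose values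
  along the path are already random variables; this yields Borel measurability for the supremum
  metric directly, bypassing cylinder sets.\<close>

lemma path_measurable_borel:
  assumes X: "path_process M T X"
  shows "path_process.path T X \<in> measurable M (borel_of (C_interval T))"
proof -
  interpret X: path_process M T X by (rule X)
  show ?thesis unfolding borel_of_def
  proof (rule measurable_measure_of)
    show "{U. openin (C_interval T) U} \<subseteq> Pow (topspace (C_interval T))" by (auto dest: openin_subset)
    show "X.path \<in> space M \<rightarrow> topspace (C_interval T)" unfolding C_interval_topspace using X.path_C_space by blast
    fix U assume "U \<in> {U. openin (C_interval T) U}"
    then have "(\<lambda>\<omega>. indicator U (X.path \<omega>) :: real) \<in> borel_measurable M"
      by (intro lsc_functional.path_measurable[OF indicator_lsc X]) simp
    then have "(\<lambda>\<omega>. indicator U (X.path \<omega>) :: real) -` {0<..} \<inter> space M \<in> sets M"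
      by (rule measurable_sets) simp
    moreover have "(\<lambda>\<omega>. indicator U (X.path \<omega>) :: real) -` {0<..} = X.path -` U"
      by (auto simp: indicator_def split: if_splits)
    ultimately show "X.path -` U \<inter> space M \<in> sets M" by simp
  qed
qed

lemma (in path_process) path_law_props:
  shows "prob_space (path_law M T X)" "sets (path_law M T X) = sets (borel_of (C_interval T))"
    and "continuous_map (C_interval T) euclideanreal \<phi> \<Longrightarrow> integral\<^sup>L (path_law M T X) \<phi> = (LINT \<omega>|M. \<phi> (path \<omega>))"
proof -
  have p: "path \<in> measurable M (borel_of (C_interval T))"
    by (rule path_measurable_borel) unfold_locales
  have e: "path_law M T X = distr M (borel_of (C_interval T)) path"
    by (simp add: path_law_def path_def[abs_def])
  show "prob_space (path_law M T X)" unfolding e by (rule prob_space_distr[OF p])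
  show "sets (path_law M T X) = sets (borel_of (C_interval T))" unfolding e by simp
  assume \<phi>: "continuous_map (C_interval T) euclideanreal \<phi>"
  have sub: "{U. openin (C_interval T) U} \<subseteq> Pow (topspace (C_interval T))" by (auto dest: openin_subset)
  have "\<phi> \<in> borel_measurable (borel_of (C_interval T))"
  proof (rule borel_measurableI)
    fix S :: "real set" assume "open S"
    then have "openin (C_interval T) {x \<in> topspace (C_interval T). \<phi> x \<in> S}"
      using \<phi> by (intro openin_continuous_map_preimage) auto
    then have "{x \<in> topspace (C_interval T). \<phi> x \<in> S} \<in> sets (borel_of (C_interval T))"
      unfolding borel_of_def sets_measure_of[OF sub] by (intro sigma_sets.Basic) simp
    moreover have "\<phi> -` S \<inter> space (borel_of (C_interval T)) = {x \<in> topspace (C_interval T). \<phi> x \<in> S}"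
      unfolding borel_of_def space_measure_of[OF sub] by auto
    ultimately show "\<phi> -` S \<inter> space (borel_of (C_interval T)) \<in> sets (borel_of (C_interval T))" by simp
  qed
  then show "integral\<^sup>L (path_law M T X) \<phi> = (LINT \<omega>|M. \<phi> (path \<omega>))"
    unfolding e by (rule integral_distr[OF p])
qed

text \<open>Trades a maximum for fourth moments: either \<open>x\<close> is at most the threshold
  \<open>a\<close>, or x / a \<ge> 1 and its cube can be inserted as a factor.\<close>

lemma le_pow4: "0 < a \<Longrightarrow> 0 \<le> x \<Longrightarrow> x \<le> a + x ^ 4 / a ^ 3" for a x :: real
proof (cases "x \<le> a")
  case False
  assume a: "0 < a" "0 \<le> x"
  have "x * a ^ 3 \<le> x * x ^ 3" using a False by (intro mult_left_mono power_mono) auto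
  then have "x \<le> x ^ 4 / a ^ 3" using a by (simp add: pos_le_divide_eq eval_nat_numeral)
  then show ?thesis using a by linarith
qed (simp add: add_increasing2)

context path_process
begin

text \<open>Level \<open>j\<close> is bounded by \<open>osc \<le> a + osc\<^sup>4 / a\<^sup>3\<close> with \<open>a = (9/10)\<^sup>j\<close>; the \<open>2\<^sup>j\<close> increments
  contribute \<open>(1/2)\<^sup>j / a\<^sup>3 = (500/729)\<^sup>j \<le> a\<close>.\<close>

lemma nn_osc_sum:
  assumes C: "C \<ge> 0"
    and mom: "\<And>s t. s \<in> {0..T} \<Longrightarrow> t \<in> {0..T} \<Longrightarrow> (\<integral>\<^sup>+\<omega>. ennreal ((X t \<omega> - X s \<omega>) ^ 4) \<partial>M) \<le> ennreal (C * (t - s)\<^sup>2)"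
  shows "(\<integral>\<^sup>+\<omega>. (\<Sum>j. ennreal (osc T (\<lambda>t. X t \<omega>) (k + j))) \<partial>M) \<le> ennreal (10 * (1 + C * T\<^sup>2) * (9/10) ^ k)"
proof -
  define a where "a j = (9/10 :: real) ^ j" for j
  have a0: "a j > 0" for j by (simp add: a_def)
  define D where "D j i \<omega> = ennreal ((X (gridpt T j (Suc i)) \<omega> - X (gridpt T j i) \<omega>) ^ 4)" for j i \<omega>
  define G where "G j \<omega> = ennreal (a j) + ennreal (1 / a j ^ 3) * (\<Sum>i<2 ^ j. D j i \<omega>)" for j \<omega>
  have E: "ennreal x + ennreal y * ennreal z = ennreal (x + y * z)" if "x \<ge> 0" "y \<ge> 0" "z \<ge> 0" for x y z
    using that by (simp add: ennreal_mult)
  have gin: "gridpt T j i \<in> {0..T}" "gridpt T j (Suc i) \<in> {0..T}" if "i < 2 ^ j" for i j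
    using that by (auto intro!: gridpt_in[OF T] simp del: atLeastAtMost_iff)
  have Dm: "D j i \<in> borel_measurable M" if "i < 2 ^ j" for i j
    unfolding D_def[abs_def] using meas[OF gin(1)[OF that]] meas[OF gin(2)[OF that]] by measurable
  have Sm: "(\<lambda>\<omega>. \<Sum>i<2 ^ j. D j i \<omega>) \<in> borel_measurable M" for j
    by (rule borel_measurable_sum) (use Dm in auto)
  have Gm: "G j \<in> borel_measurable M" for j
    unfolding G_def[abs_def] by (intro borel_measurable_add borel_measurable_times_ennreal Sm) auto
  \<comment> \<open>The maximum is attained at one increment, whose fourth power is at most the sum
    over all \<open>2 ^ j\<close> of them.\<close>
  have oscG: "ennreal (osc T (\<lambda>t. X t \<omega>) j) \<le> G j \<omega>" for j \<omega>
  proof -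
    obtain i where i: "i < 2 ^ j" "osc T (\<lambda>t. X t \<omega>) j = \<bar>X (gridpt T j (Suc i)) \<omega> - X (gridpt T j i) \<omega>\<bar>"
      using osc_attained by blast
    define x where "x = osc T (\<lambda>t. X t \<omega>) j"
    have x0: "x \<ge> 0" unfolding x_def by (rule osc_nonneg)
    have xD: "ennreal (x ^ 4) = D j i \<omega>" by (simp add: x_def i(2) D_def power_even_abs)
    have "ennreal x \<le> ennreal (a j + 1 / a j ^ 3 * x ^ 4)"
      using le_pow4[OF a0 x0, of j] by (intro ennreal_leI) simp
    also have "\<dots> = ennreal (a j) + ennreal (1 / a j ^ 3) * ennreal (x ^ 4)"
      by (rule E[symmetric]) (use a0[of j] x0 in auto)
    also have "\<dots> \<le> G j \<omega>"
      unfolding xD G_def by (intro add_left_mono mult_left_mono member_le_sum) (use i in auto)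
    finally show ?thesis by (simp only: x_def)
  qed
  have IG: "(\<integral>\<^sup>+\<omega>. G j \<omega> \<partial>M) \<le> ennreal ((1 + C * T\<^sup>2) * a j)" for j
  proof -
    have "(\<integral>\<^sup>+\<omega>. G j \<omega> \<partial>M) = ennreal (a j) + ennreal (1 / a j ^ 3) * (\<Sum>i<2 ^ j. (\<integral>\<^sup>+\<omega>. D j i \<omega> \<partial>M))"
    proof -
      have "(\<integral>\<^sup>+\<omega>. G j \<omega> \<partial>M) = (\<integral>\<^sup>+\<omega>. ennreal (a j) \<partial>M) + (\<integral>\<^sup>+\<omega>. ennreal (1 / a j ^ 3) * (\<Sum>i<2 ^ j. D j i \<omega>) \<partial>M)"
        unfolding G_def by (rule nn_integral_add) (intro borel_measurable_times_ennreal Sm borel_measurable_const)+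
      also have "(\<integral>\<^sup>+\<omega>. ennreal (1 / a j ^ 3) * (\<Sum>i<2 ^ j. D j i \<omega>) \<partial>M) = ennreal (1 / a j ^ 3) * (\<integral>\<^sup>+\<omega>. (\<Sum>i<2 ^ j. D j i \<omega>) \<partial>M)"
        by (rule nn_integral_cmult[OF Sm])
      also have "(\<integral>\<^sup>+\<omega>. (\<Sum>i<2 ^ j. D j i \<omega>) \<partial>M) = (\<Sum>i<2 ^ j. (\<integral>\<^sup>+\<omega>. D j i \<omega> \<partial>M))"
        by (rule nn_integral_sum) (use Dm in auto)
      finally show ?thesis by (simp add: emeasure_space_1)
    qed
    also have "\<dots> \<le> ennreal (a j) + ennreal (1 / a j ^ 3) * (\<Sum>i<(2::nat) ^ j. ennreal (C * (T / 2 ^ j)\<^sup>2))"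
    proof (intro add_left_mono mult_left_mono sum_mono)
      fix i :: nat assume "i \<in> {..<2 ^ j}"
      then have i: "i < 2 ^ j" by simp
      have "gridpt T j (Suc i) - gridpt T j i = T / 2 ^ j"
        by (simp add: gridpt_def algebra_simps flip: diff_divide_distrib)
      then show "(\<integral>\<^sup>+\<omega>. D j i \<omega> \<partial>M) \<le> ennreal (C * (T / 2 ^ j)\<^sup>2)"
        using mom[OF gin[OF i]] by (simp add: D_def)
    qed auto
    also have "\<dots> = ennreal (a j + 1 / a j ^ 3 * (2 ^ j * (C * (T / 2 ^ j)\<^sup>2)))"
    proof -
      have "(\<Sum>i<(2::nat) ^ j. ennreal (C * (T / 2 ^ j)\<^sup>2)) = ennreal (2 ^ j * (C * (T / 2 ^ j)\<^sup>2))"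
        using C by (simp add: ennreal_mult ennreal_power flip: ennreal_numeral)
      then show ?thesis by (simp only:) (rule E, use C a0[of j] in auto)
    qed
    also have "\<dots> \<le> ennreal ((1 + C * T\<^sup>2) * a j)"
    proof (rule ennreal_leI)
      have "1 / a j ^ 3 * (2 ^ j * (C * (T / 2 ^ j)\<^sup>2)) = C * T\<^sup>2 * (500/729) ^ j"
      proof -
        have "a j ^ 3 = ((9/10) ^ 3) ^ j" unfolding a_def by (simp only: power_mult[symmetric] mult.commute)
        also have "(9/10 :: real) ^ 3 = 729/1000" by (simp add: power3_eq_cube)
        finally have "a j ^ 3 = (729/1000) ^ j" .
        then have "1 / a j ^ 3 * (2 ^ j * (C * (T / 2 ^ j)\<^sup>2)) = C * T\<^sup>2 * (1 / ((729/1000) ^ j * 2 ^ j))"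
          by (simp add: power2_eq_square)
        also have "(729/1000) ^ j * 2 ^ j = (729/500 :: real) ^ j" by (simp flip: power_mult_distrib)
        finally show ?thesis by (simp add: power_divide)
      qed
      also have "\<dots> \<le> C * T\<^sup>2 * (9/10) ^ j" using C by (intro mult_left_mono power_mono) auto
      finally show "a j + 1 / a j ^ 3 * (2 ^ j * (C * (T / 2 ^ j)\<^sup>2)) \<le> (1 + C * T\<^sup>2) * a j"
        by (simp only: a_def distrib_right mult_1)
    qed
    finally show ?thesis .
  qed
  have "(\<integral>\<^sup>+\<omega>. (\<Sum>j. ennreal (osc T (\<lambda>t. X t \<omega>) (k + j))) \<partial>M) \<le> (\<integral>\<^sup>+\<omega>. (\<Sum>j. G (k + j) \<omega>) \<partial>M)"
    by (rule nn_integral_mono, rule suminf_le) (use oscG in auto)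
  also have "\<dots> = (\<Sum>j. (\<integral>\<^sup>+\<omega>. G (k + j) \<omega> \<partial>M))" by (rule nn_integral_suminf[OF Gm])
  also have "\<dots> \<le> (\<Sum>j. ennreal ((1 + C * T\<^sup>2) * a (k + j)))"
    by (rule suminf_le) (use IG in auto)
  \<comment> \<open>10 = 1 / (1 - 9/10) sums the geometric tail.\<close>
  also have "\<dots> = ennreal (10 * (1 + C * T\<^sup>2) * (9/10) ^ k)"
  proof (rule suminf_ennreal_eq)
    show "0 \<le> (1 + C * T\<^sup>2) * a (k + i)" for i using C a0[of "k + i"] by (intro mult_nonneg_nonneg) auto
    have "(\<lambda>i. (9/10 :: real) ^ i) sums (1 / (1 - 9/10))" by (rule geometric_sums) simp
    then have "(\<lambda>i. (1 + C * T\<^sup>2) * (9/10) ^ k * (9/10) ^ i) sums ((1 + C * T\<^sup>2) * (9/10) ^ k * (1 / (1 - 9/10)))"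
      by (rule sums_mult)
    then show "(\<lambda>i. (1 + C * T\<^sup>2) * a (k + i)) sums (10 * (1 + C * T\<^sup>2) * (9/10) ^ k)"
      by (simp add: a_def power_add mult.assoc) (simp add: algebra_simps)
  qed
  finally show ?thesis .
qed

lemma lipschitz_interp_close:
  assumes \<Phi>: "lipschitz_functional T \<Phi> L b" and C: "C \<ge> 0"
    and mom: "\<And>s t. s \<in> {0..T} \<Longrightarrow> t \<in> {0..T} \<Longrightarrow> (\<integral>\<^sup>+\<omega>. ennreal ((X t \<omega> - X s \<omega>) ^ 4) \<partial>M) \<le> ennreal (C * (t - s)\<^sup>2)"
  shows "\<bar>(LINT \<omega>|M. \<Phi> (path \<omega>)) - (LINT \<omega>|M. \<Phi> (interp k \<omega>))\<bar> \<le> L * (10 * (1 + C * T\<^sup>2) * (9/10) ^ k)"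
proof -
  interpret \<Phi>: lipschitz_functional T \<Phi> L b by (rule \<Phi>)
  have pp: "path_process M T X" by unfold_locales
  have i1: "integrable M (\<lambda>\<omega>. \<Phi> (path \<omega>))"
    by (rule integrable_const_bound[where B = b]) (use \<Phi>.path_measurable[OF pp] \<Phi>.bound[OF path_C_space] in auto)
  have i2: "integrable M (\<lambda>\<omega>. \<Phi> (interp k \<omega>))"
    by (rule integrable_const_bound[where B = b]) (use \<Phi>.plin_measurable[OF pp] \<Phi>.bound[OF interp_C_space] in auto)
  have "ennreal (norm (LINT \<omega>|M. \<Phi> (path \<omega>) - \<Phi> (interp k \<omega>))) \<le> (\<integral>\<^sup>+\<omega>. ennreal (norm (\<Phi> (path \<omega>) - \<Phi> (interp k \<omega>))) \<partial>M)"
    by (rule integral_norm_bound_ennreal) (use i1 i2 in auto)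
  also have "\<dots> \<le> (\<integral>\<^sup>+\<omega>. ennreal L * (\<Sum>j. ennreal (osc T (\<lambda>t. X t \<omega>) (k + j))) \<partial>M)"
  proof (rule nn_integral_mono)
    fix \<omega> assume \<omega>: "\<omega> \<in> space M"
    have "ennreal (norm (\<Phi> (path \<omega>) - \<Phi> (interp k \<omega>))) \<le> ennreal (L * C_dist T (path \<omega>) (interp k \<omega>))"
      using \<Phi>.lip[OF path_C_space[OF \<omega>] interp_C_space] by (intro ennreal_leI) (simp only: real_norm_def)
    also have "\<dots> = ennreal L * ennreal (C_dist T (path \<omega>) (interp k \<omega>))"
      by (rule ennreal_mult[OF \<Phi>.L CM.nonneg])
    also have "\<dots> \<le> ennreal L * (\<Sum>j. ennreal (osc T (\<lambda>t. X t \<omega>) (k + j)))"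
      unfolding path_def interp_def by (intro mult_left_mono plin_chain[OF T cont[OF \<omega>]]) simp
    finally show "ennreal (norm (\<Phi> (path \<omega>) - \<Phi> (interp k \<omega>))) \<le> ennreal L * (\<Sum>j. ennreal (osc T (\<lambda>t. X t \<omega>) (k + j)))" .
  qed
  also have "\<dots> \<le> ennreal L * ennreal (10 * (1 + C * T\<^sup>2) * (9/10) ^ k)"
  proof -
    have "(\<lambda>\<omega>. osc T (\<lambda>t. X t \<omega>) j) \<in> borel_measurable M" for j
      unfolding osc_def
    proof (rule borel_measurable_Max)
      fix i :: nat assume "i \<in> {..<2 ^ j}"
      then have "X (gridpt T j (Suc i)) \<in> borel_measurable M" "X (gridpt T j i) \<in> borel_measurable M"
        by (auto intro!: meas gridpt_in[OF T] simp del: atLeastAtMost_iff)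
      then show "(\<lambda>\<omega>. \<bar>X (gridpt T j (Suc i)) \<omega> - X (gridpt T j i) \<omega>\<bar>) \<in> borel_measurable M" by measurable
    qed simp
    then have "(\<lambda>\<omega>. \<Sum>j. ennreal (osc T (\<lambda>t. X t \<omega>) (k + j))) \<in> borel_measurable M" by measurable
    then have "(\<integral>\<^sup>+\<omega>. ennreal L * (\<Sum>j. ennreal (osc T (\<lambda>t. X t \<omega>) (k + j))) \<partial>M) = ennreal L * (\<integral>\<^sup>+\<omega>. (\<Sum>j. ennreal (osc T (\<lambda>t. X t \<omega>) (k + j))) \<partial>M)"
      by (rule nn_integral_cmult)
    then show ?thesis using mult_left_mono[OF nn_osc_sum[OF C mom, of k], of "ennreal L"] by simp
  qed
  also have "\<dots> = ennreal (L * (10 * (1 + C * T\<^sup>2) * (9/10) ^ k))"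
    using C \<Phi>.L by (intro ennreal_mult[symmetric]) auto
  finally have "norm (LINT \<omega>|M. \<Phi> (path \<omega>) - \<Phi> (interp k \<omega>)) \<le> L * (10 * (1 + C * T\<^sup>2) * (9/10) ^ k)"
    using C \<Phi>.L by (subst (asm) ennreal_le_iff) auto
  then show ?thesis using i1 i2 by simp
qed

end

section \<open>Weak convergence of path laws\<close>

text \<open>The interpolation error is uniform in \<open>n\<close>, so the level \<open>k\<close> is
  fixed before \<open>n\<close> grows, and at fixed \<open>k\<close> only finitely many coordinates
  occur. For the limit \<open>Y\<close> the interpolations converge by path continuity and dominated
  convergence.\<close>

lemma lipschitz_weak_conv:
  fixes X :: "nat \<Rightarrow> real \<Rightarrow> 'a \<Rightarrow> real" and Y :: "real \<Rightarrow> 'b \<Rightarrow> real"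
  assumes X: "\<And>n. path_process M T (X n)" and Y: "path_process M' T Y"
    and C: "C \<ge> 0"
    and mom: "\<And>n s t. s \<in> {0..T} \<Longrightarrow> t \<in> {0..T} \<Longrightarrow> (\<integral>\<^sup>+\<omega>. ennreal ((X n t \<omega> - X n s \<omega>) ^ 4) \<partial>M) \<le> ennreal (C * (t - s)\<^sup>2)"
    and char: "\<And>d t \<theta>. (\<And>j::nat. j < d \<Longrightarrow> t j \<in> {0..T}) \<Longrightarrow>
      (\<lambda>n. LINT \<omega>|M. iexp (\<Sum>j<d. \<theta> j * X n (t j) \<omega>)) \<longlonglongrightarrow> (LINT \<omega>|M'. iexp (\<Sum>j<d. \<theta> j * Y (t j) \<omega>))"
    and \<Phi>: "lipschitz_functional T \<Phi> L b"
  shows "(\<lambda>n. LINT \<omega>|M. \<Phi> (path_process.path T (X n) \<omega>)) \<longlonglongrightarrow> (LINT \<omega>|M'. \<Phi> (path_process.path T Y \<omega>))"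
proof -
  interpret \<Phi>: lipschitz_functional T \<Phi> L b by (rule \<Phi>)
  interpret X: path_process M T "X n" for n by (rule X)
  interpret Y: path_process M' T Y by (rule Y)
  have Tp: "T > 0" by (rule Y.T)
  define x y where "x n = (LINT \<omega>|M. \<Phi> (X.path n \<omega>))" and "y = (LINT \<omega>|M'. \<Phi> (Y.path \<omega>))" for n
  define xi yi where "xi k n = (LINT \<omega>|M. \<Phi> (X.interp n k \<omega>))" and "yi k = (LINT \<omega>|M'. \<Phi> (Y.interp k \<omega>))" for k n
  define r where "r k = L * (10 * (1 + C * T\<^sup>2) * (9/10 :: real) ^ k)" for k :: nat
  have close: "\<bar>x n - xi k n\<bar> \<le> r k" for k n
    unfolding x_def xi_def r_def by (rule X.lipschitz_interp_close[OF \<Phi> C mom])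
  have fdd: "xi k \<longlonglongrightarrow> yi k" for k
  proof -
    have g: "gridpt T k j \<in> {0..T}" if "j < 2 ^ k + 1" for j by (rule gridpt_in[OF Tp]) (use that in simp)
    have "(\<lambda>n. LINT \<omega>|M. (\<lambda>v. \<Phi> (plin T k v)) (\<lambda>j. X n (gridpt T k j) \<omega>)) \<longlonglongrightarrow> (LINT \<omega>|M'. (\<lambda>v. \<Phi> (plin T k v)) (\<lambda>j. Y (gridpt T k j) \<omega>))"
    proof (rule char_conv_imp_lipschitz_conv[where d = "2 ^ k + 1" and \<Psi> = "\<lambda>v. \<Phi> (plin T k v)" and L = L and b = b
          and X = "\<lambda>n j. X n (gridpt T k j)" and Y = "\<lambda>j. Y (gridpt T k j)"])
      show "\<bar>\<Phi> (plin T k v)\<bar> \<le> b" for v by (rule \<Phi>.bound[OF plin_C_space[OF Tp]])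
      show "\<bar>\<Phi> (plin T k v) - \<Phi> (plin T k w)\<bar> \<le> L * e" if "\<And>j. j < 2 ^ k + 1 \<Longrightarrow> \<bar>v j - w j\<bar> \<le> e" for v w e
        by (rule \<Phi>.plin_lip[OF Tp that])
      show "X n (gridpt T k j) \<in> borel_measurable M" "Y (gridpt T k j) \<in> borel_measurable M'" if "j < 2 ^ k + 1" for n j
        by (rule X.meas[OF g[OF that]], rule Y.meas[OF g[OF that]])
      show "(\<lambda>n. LINT \<omega>|M. iexp (\<Sum>j<2 ^ k + 1. \<theta> j * X n (gridpt T k j) \<omega>)) \<longlonglongrightarrow> (LINT \<omega>|M'. iexp (\<Sum>j<2 ^ k + 1. \<theta> j * Y (gridpt T k j) \<omega>))" for \<theta>
        by (rule char[OF g])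
    qed (rule X.prob_space_axioms Y.prob_space_axioms \<Phi>.L)+
    then show ?thesis by (simp only: xi_def[abs_def] yi_def X.interp_def Y.interp_def)
  qed
  have yiy: "yi \<longlonglongrightarrow> y"
    unfolding y_def yi_def[abs_def]
  proof (rule integral_dominated_convergence[where w = "\<lambda>_. b"])
    show "AE \<omega> in M'. (\<lambda>k. \<Phi> (Y.interp k \<omega>)) \<longlonglongrightarrow> \<Phi> (Y.path \<omega>)"
      by (rule AE_I2, rule \<Phi>.interp_lim[OF Y])
    show "AE \<omega> in M'. norm (\<Phi> (Y.interp k \<omega>)) \<le> b" for k
      by (rule AE_I2) (use \<Phi>.bound[OF Y.interp_C_space] in simp)
  qed (use \<Phi>.path_measurable[OF Y] \<Phi>.plin_measurable[OF Y] in auto)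
  have r0: "r \<longlonglongrightarrow> 0"
  proof -
    have "r \<longlonglongrightarrow> L * (10 * (1 + C * T\<^sup>2) * 0)"
      unfolding r_def[abs_def] by (intro tendsto_intros LIMSEQ_realpow_zero) auto
    then show ?thesis by simp
  qed
  show ?thesis unfolding x_def[symmetric] y_def[symmetric]
  proof (rule LIMSEQ_I)
    fix e :: real assume e: "e > 0"
    have "\<forall>\<^sub>F k in sequentially. r k < e / 3 \<and> dist (yi k) y < e / 3"
      by (intro eventually_conj order_tendstoD(2)[OF r0] tendstoD[OF yiy]) (use e in auto)
    then obtain k where k: "r k < e / 3" "\<bar>yi k - y\<bar> < e / 3" by (auto simp: eventually_sequentially dist_real_def)
    have "\<forall>\<^sub>F n in sequentially. dist (xi k n) (yi k) < e / 3" by (rule tendstoD[OF fdd]) (use e in simp)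
    then obtain N where N: "\<And>n. n \<ge> N \<Longrightarrow> \<bar>xi k n - yi k\<bar> < e / 3" by (auto simp: eventually_sequentially dist_real_def)
    show "\<exists>N. \<forall>n\<ge>N. norm (x n - y) < e"
    proof (intro exI[of _ N] allI impI)
      fix n assume "N \<le> n"
      then show "norm (x n - y) < e" using N[of n] k close[of n k] unfolding real_norm_def by linarith
    qed
  qed
qed

text \<open>One half of the portmanteau theorem: a Lipschitz minorant close to \<open>\<phi>\<close>
  in mean under the limit law has converging expectations, and it stays below \<open>\<phi>\<close>
  along the sequence.\<close>

lemma lsc_lower_bound:
  fixes X :: "nat \<Rightarrow> real \<Rightarrow> 'a \<Rightarrow> real" and Y :: "real \<Rightarrow> 'b \<Rightarrow> real"
  assumes X: "\<And>n. path_process M T (X n)" and Y: "path_process M' T Y"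
    and lc: "\<And>\<Phi> L b. lipschitz_functional T \<Phi> L b \<Longrightarrow>
      (\<lambda>n. LINT \<omega>|M. \<Phi> (path_process.path T (X n) \<omega>)) \<longlonglongrightarrow> (LINT \<omega>|M'. \<Phi> (path_process.path T Y \<omega>))"
    and \<phi>: "lsc_functional T \<phi> b" and e: "e > 0"
  shows "\<forall>\<^sub>F n in sequentially. (LINT \<omega>|M. \<phi> (path_process.path T (X n) \<omega>)) > (LINT \<omega>|M'. \<phi> (path_process.path T Y \<omega>)) - e"
proof -
  interpret \<phi>: lsc_functional T \<phi> b by (rule \<phi>)
  interpret X: path_process M T "X n" for n by (rule X)
  interpret Y: path_process M' T Y by (rule Y)
  note lf = \<phi>.\<psi>_lipschitz
  have "(\<lambda>j. LINT \<omega>|M'. \<phi>.\<psi> j (Y.path \<omega>)) \<longlonglongrightarrow> (LINT \<omega>|M'. \<phi> (Y.path \<omega>))"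
  proof (rule integral_dominated_convergence[where w = "\<lambda>_. b"])
    show "AE \<omega> in M'. (\<lambda>j. \<phi>.\<psi> j (Y.path \<omega>)) \<longlonglongrightarrow> \<phi> (Y.path \<omega>)"
      by (rule AE_I2, rule \<phi>.\<psi>_tendsto[OF Y.path_C_space])
    show "AE \<omega> in M'. norm (\<phi>.\<psi> j (Y.path \<omega>)) \<le> b" for j
      by (rule AE_I2) (use lipschitz_functional.bound[OF lf Y.path_C_space] in simp)
    show "(\<lambda>\<omega>. \<phi> (Y.path \<omega>)) \<in> borel_measurable M'" by (rule \<phi>.path_measurable[OF Y])
    show "(\<lambda>\<omega>. \<phi>.\<psi> j (Y.path \<omega>)) \<in> borel_measurable M'" for j by (rule lipschitz_functional.path_measurable[OF lf Y])
  qed simp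
  then have "\<forall>\<^sub>F j in sequentially. (LINT \<omega>|M'. \<phi>.\<psi> j (Y.path \<omega>)) > (LINT \<omega>|M'. \<phi> (Y.path \<omega>)) - e"
    by (rule order_tendstoD) (use e in simp)
  then obtain j where j: "(LINT \<omega>|M'. \<phi>.\<psi> j (Y.path \<omega>)) > (LINT \<omega>|M'. \<phi> (Y.path \<omega>)) - e"
    by (auto simp: eventually_sequentially)
  have "\<forall>\<^sub>F n in sequentially. (LINT \<omega>|M. \<phi>.\<psi> j (X.path n \<omega>)) > (LINT \<omega>|M'. \<phi> (Y.path \<omega>)) - e"
    by (rule order_tendstoD(1)[OF lc[OF lf] j])
  then show ?thesis
  proof eventually_elim
    case (elim n)
    have "(LINT \<omega>|M. \<phi>.\<psi> j (X.path n \<omega>)) \<le> (LINT \<omega>|M. \<phi> (X.path n \<omega>))"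
    proof (rule integral_mono)
      have l: "norm (\<phi>.\<psi> j (X.path n \<omega>)) \<le> b" "norm (\<phi> (X.path n \<omega>)) \<le> b" if "\<omega> \<in> space M" for \<omega>
        using lipschitz_functional.bound[OF lf X.path_C_space[OF that], of j n] \<phi>.nonneg[OF X.path_C_space[OF that], of n] \<phi>.bound[OF X.path_C_space[OF that], of n] by auto
      show "integrable M (\<lambda>\<omega>. \<phi>.\<psi> j (X.path n \<omega>))"
        by (rule X.integrable_const_bound[OF AE_I2 lipschitz_functional.path_measurable[OF lf X]]) (rule l(1))
      show "integrable M (\<lambda>\<omega>. \<phi> (X.path n \<omega>))"
        by (rule X.integrable_const_bound[OF AE_I2 \<phi>.path_measurable[OF X]]) (rule l(2))
      show "\<phi>.\<psi> j (X.path n \<omega>) \<le> \<phi> (X.path n \<omega>)" if "\<omega> \<in> space M" for \<omega>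
        by (rule \<phi>.\<psi>_bounds(2)[OF X.path_C_space[OF that]])
    qed
    then show ?case using elim by linarith
  qed
qed

text \<open>The shift by \<open>b\<close> supplies the nonnegativity required of the functionals
  regularized by inf-convolution.\<close>

lemma continuous_lsc:
  assumes \<phi>: "continuous_map (C_interval T) euclideanreal \<phi>" and b: "\<And>f. f \<in> C_space T \<Longrightarrow> \<bar>\<phi> f\<bar> \<le> b"
  shows "lsc_functional T (\<lambda>f. b + \<phi> f) (2 * b)"
proof
  fix f :: "real \<Rightarrow> real" and e :: real
  assume f: "f \<in> C_space T" and e: "e > 0"
  have "openin (C_interval T) {x \<in> topspace (C_interval T). \<phi> x \<in> {\<phi> f - e<..}}"
    using \<phi> by (intro openin_continuous_map_preimage) auto
  moreover have "f \<in> {x \<in> topspace (C_interval T). \<phi> x \<in> {\<phi> f - e<..}}"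
    using f e by (simp only: C_interval_topspace) simp
  ultimately obtain r where r: "r > 0" "CM.mball T f r \<subseteq> {x \<in> topspace (C_interval T). \<phi> x \<in> {\<phi> f - e<..}}"
    unfolding C_interval_eq CM.openin_mtopology by blast
  have "\<phi> g \<ge> \<phi> f - e" if "g \<in> C_space T" "C_dist T f g < r" for g
  proof -
    have "g \<in> CM.mball T f r" unfolding CM.in_mball using f that by blast
    then show ?thesis using r(2) by auto
  qed
  then show "\<exists>r>0. \<forall>g\<in>C_space T. C_dist T f g < r \<longrightarrow> b + \<phi> f - e \<le> b + \<phi> g"
    using r(1) by (intro exI[of _ r]) (force simp del: mspace_cfunspace)
next
  fix f :: "real \<Rightarrow> real" assume "f \<in> C_space T"
  from b[OF this] show "0 \<le> b + \<phi> f" "b + \<phi> f \<le> 2 * b" by linarith+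
qed

lemma continuous_path_integrable:
  assumes \<phi>: "continuous_map (C_interval T) euclideanreal \<phi>" and b: "\<And>f. f \<in> C_space T \<Longrightarrow> \<bar>\<phi> f\<bar> \<le> b"
    and Z: "path_process N T Z"
  shows "integrable N (\<lambda>\<omega>. \<phi> (path_process.path T Z \<omega>))"
proof -
  interpret Z: path_process N T Z by (rule Z)
  have "(\<lambda>\<omega>. b + \<phi> (Z.path \<omega>)) \<in> borel_measurable N"
    by (rule lsc_functional.path_measurable[OF continuous_lsc[OF \<phi> b] Z])
  then have "(\<lambda>\<omega>. (b + \<phi> (Z.path \<omega>)) - b) \<in> borel_measurable N" by measurable
  then have m: "(\<lambda>\<omega>. \<phi> (Z.path \<omega>)) \<in> borel_measurable N" by simp
  show ?thesis by (rule Z.integrable_const_bound[OF AE_I2 m]) (use b[OF Z.path_C_space] in simp)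
qed

theorem path_law_weak_conv:
  fixes X :: "nat \<Rightarrow> real \<Rightarrow> 'a \<Rightarrow> real" and Y :: "real \<Rightarrow> 'b \<Rightarrow> real"
  assumes X: "\<And>n. path_process M T (X n)" and Y: "path_process M' T Y"
    and C: "C \<ge> 0"
    and mom: "\<And>n s t. s \<in> {0..T} \<Longrightarrow> t \<in> {0..T} \<Longrightarrow> (\<integral>\<^sup>+\<omega>. ennreal ((X n t \<omega> - X n s \<omega>) ^ 4) \<partial>M) \<le> ennreal (C * (t - s)\<^sup>2)"
    and char: "\<And>d t \<theta>. (\<And>j::nat. j < d \<Longrightarrow> t j \<in> {0..T}) \<Longrightarrow>
      (\<lambda>n. LINT \<omega>|M. iexp (\<Sum>j<d. \<theta> j * X n (t j) \<omega>)) \<longlonglongrightarrow> (LINT \<omega>|M'. iexp (\<Sum>j<d. \<theta> j * Y (t j) \<omega>))"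
    and \<phi>: "continuous_map (C_interval T) euclideanreal \<phi>" "bounded (\<phi> ` topspace (C_interval T))"
  shows "(\<lambda>n. integral\<^sup>L (path_law M T (X n)) \<phi>) \<longlonglongrightarrow> integral\<^sup>L (path_law M' T Y) \<phi>"
proof -
  interpret X: path_process M T "X n" for n by (rule X)
  interpret Y: path_process M' T Y by (rule Y)
  note lc = lipschitz_weak_conv[OF X Y C mom char]
  obtain b where b: "\<And>f. f \<in> C_space T \<Longrightarrow> \<bar>\<phi> f\<bar> \<le> b"
    using \<phi>(2) unfolding C_interval_topspace bounded_iff by auto
  have \<phi>': "continuous_map (C_interval T) euclideanreal (\<lambda>f. - \<phi> f)" using \<phi>(1) by (intro continuous_intros)
  have l1: "lsc_functional T (\<lambda>f. b + \<phi> f) (2 * b)" by (rule continuous_lsc[OF \<phi>(1) b])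
  have l2: "lsc_functional T (\<lambda>f. b + - \<phi> f) (2 * b)" by (rule continuous_lsc[OF \<phi>']) (use b in simp)
  have I: "integrable M (\<lambda>\<omega>. \<phi> (X.path n \<omega>))" "integrable M' (\<lambda>\<omega>. \<phi> (Y.path \<omega>))" for n
    using continuous_path_integrable[OF \<phi>(1) b X] continuous_path_integrable[OF \<phi>(1) b Y] by auto
  define x y where "x n = (LINT \<omega>|M. \<phi> (X.path n \<omega>))" and "y = (LINT \<omega>|M'. \<phi> (Y.path \<omega>))" for n
  have s: "(LINT \<omega>|M. b + \<phi> (X.path n \<omega>)) = b + x n" "(LINT \<omega>|M'. b + \<phi> (Y.path \<omega>)) = b + y"
    "(LINT \<omega>|M. b + - \<phi> (X.path n \<omega>)) = b - x n" "(LINT \<omega>|M'. b + - \<phi> (Y.path \<omega>)) = b - y" for n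
    using I by (simp_all add: x_def y_def X.prob_space Y.prob_space)
  have "x \<longlonglongrightarrow> y"
  proof (rule order_tendstoI)
    fix a assume "a < y"
    then have "\<forall>\<^sub>F n in sequentially. b + x n > b + y - (y - a)"
      using lsc_lower_bound[OF X Y lc l1, where e = "y - a"] unfolding s by simp
    then show "\<forall>\<^sub>F n in sequentially. a < x n" by eventually_elim simp
  next
    fix a assume "y < a"
    then have "\<forall>\<^sub>F n in sequentially. b - x n > b - y - (a - y)"
      using lsc_lower_bound[OF X Y lc l2, where e = "a - y"] unfolding s by simp
    then show "\<forall>\<^sub>F n in sequentially. x n < a" by eventually_elim simp
  qed
  then show ?thesis by (simp only: x_def[abs_def] y_def X.path_law_props(3)[OF \<phi>(1)] Y.path_law_props(3)[OF \<phi>(1)])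
qed

subsection \<open>Convergence of the Rosenblatt Ornstein-Uhlenbeck processes\<close>

lemma fOU_eq: "(\<lambda>u. indicator {..t} u * exp (- lam * (t - u))) = fOU lam t"
  by (simp add: fOU_def fun_eq_iff)

lemma rosenblatt_OU_D:
  assumes "rosenblatt_OU M B H lam \<sigma> T X" and "t \<in> {0..T}"
  shows "X t \<in> borel_measurable M"
    and "\<exists>Y. has_double_wiener_integral M B (rosenblatt_kernel H (fOU lam t)) Y \<and> (AE \<omega> in M. X t \<omega> = \<sigma> * Y \<omega>)"
  using assms unfolding rosenblatt_OU_def continuous_modification_def has_rosenblatt_integral_def fOU_eq by blast+

lemma wiener_OU_D:
  assumes "wiener_OU M W lam \<sigma> T X" and "t \<in> {0..T}"
  shows "X t \<in> borel_measurable M"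
    and "\<exists>Y. has_wiener_integral M W (fOU lam t) Y \<and> (AE \<omega> in M. X t \<omega> = \<sigma> * Y \<omega>)"
  using assms unfolding wiener_OU_def continuous_modification_def fOU_eq by blast+

lemma rosenblatt_OU_path: "prob_space M \<Longrightarrow> T > 0 \<Longrightarrow> rosenblatt_OU M B H lam \<sigma> T X \<Longrightarrow> path_process M T X"
  unfolding path_process_def path_process_axioms_def rosenblatt_OU_def continuous_modification_def by blast

lemma wiener_OU_path: "prob_space M \<Longrightarrow> T > 0 \<Longrightarrow> wiener_OU M W lam \<sigma> T X \<Longrightarrow> path_process M T X"
  unfolding path_process_def path_process_axioms_def wiener_OU_def continuous_modification_def by blast

lemma L2_tendsto_AE_cong:
  assumes "L2_tendsto M F Y" "X \<in> borel_measurable M" "AE \<omega> in M. X \<omega> = Y \<omega>"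
  shows "L2_tendsto M F X"
proof -
  have "(\<integral>\<^sup>+ x. ennreal ((F k x - X x)\<^sup>2) \<partial>M) = (\<integral>\<^sup>+ x. ennreal ((F k x - Y x)\<^sup>2) \<partial>M)" for k
    by (rule nn_integral_cong_AE) (use assms(3) in auto)
  then show ?thesis using assms(1,2) by (simp add: L2_tendsto_def)
qed

text \<open>Lets the continuous modification take the place of the integral that it
  modifies.\<close>

lemma has_double_wiener_integral_AE_cong:
  assumes "has_double_wiener_integral M B h Y" "X \<in> borel_measurable M" "AE \<omega> in M. X \<omega> = Y \<omega>"
  shows "has_double_wiener_integral M B h X"
  using assms L2_tendsto_AE_cong unfolding has_double_wiener_integral_def by blast

lemma has_wiener_integral_AE_cong:
  assumes "has_wiener_integral M B h Y" "X \<in> borel_measurable M" "AE \<omega> in M. X \<omega> = Y \<omega>"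
  shows "has_wiener_integral M B h X"
  using assms L2_tendsto_AE_cong unfolding has_wiener_integral_def by blast

text \<open>A linear combination of values of the process is a single double integral with the
  combined kernel, so the bounds for one integral give joint characteristic functions.\<close>

lemma rosenblatt_OU_sum:
  assumes X: "rosenblatt_OU M B H lam \<sigma> T X" and I: "finite I" "\<And>i. i \<in> I \<Longrightarrow> t i \<in> {0..T}"
  shows "has_double_wiener_integral M B (\<lambda>z. \<Sum>i\<in>I. (\<theta> i * \<sigma>) * rosenblatt_kernel H (fOU lam (t i)) z) (\<lambda>\<omega>. \<Sum>i\<in>I. \<theta> i * X (t i) \<omega>)"
proof -
  have "\<forall>i\<in>I. \<exists>Y. has_double_wiener_integral M B (rosenblatt_kernel H (fOU lam (t i))) Y \<and> (AE \<omega> in M. X (t i) \<omega> = \<sigma> * Y \<omega>)"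
    using rosenblatt_OU_D(2)[OF X I(2)] by blast
  then obtain Y where Y: "\<And>i. i \<in> I \<Longrightarrow> has_double_wiener_integral M B (rosenblatt_kernel H (fOU lam (t i))) (Y i)"
    "\<And>i. i \<in> I \<Longrightarrow> AE \<omega> in M. X (t i) \<omega> = \<sigma> * Y i \<omega>" by metis
  show ?thesis
  proof (rule has_double_wiener_integral_AE_cong)
    show "has_double_wiener_integral M B (\<lambda>z. \<Sum>i\<in>I. (\<theta> i * \<sigma>) * rosenblatt_kernel H (fOU lam (t i)) z) (\<lambda>\<omega>. \<Sum>i\<in>I. (\<theta> i * \<sigma>) * Y i \<omega>)"
      by (rule has_double_wiener_integral_sum[OF I(1) Y(1)])
    show "(\<lambda>\<omega>. \<Sum>i\<in>I. \<theta> i * X (t i) \<omega>) \<in> borel_measurable M"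
      using rosenblatt_OU_D(1)[OF X I(2)] by (intro borel_measurable_sum borel_measurable_times) auto
    have "AE \<omega> in M. \<forall>i\<in>I. X (t i) \<omega> = \<sigma> * Y i \<omega>" by (rule AE_finite_allI[OF I(1) Y(2)])
    then show "AE \<omega> in M. (\<Sum>i\<in>I. \<theta> i * X (t i) \<omega>) = (\<Sum>i\<in>I. (\<theta> i * \<sigma>) * Y i \<omega>)"
      by eventually_elim (simp add: mult.assoc)
  qed
qed

lemma wiener_OU_sum:
  assumes X: "wiener_OU M W lam \<sigma> T X" and I: "finite I" "\<And>i. i \<in> I \<Longrightarrow> t i \<in> {0..T}"
  shows "has_wiener_integral M W (\<lambda>z. \<Sum>i\<in>I. (\<theta> i * \<sigma>) * fOU lam (t i) z) (\<lambda>\<omega>. \<Sum>i\<in>I. \<theta> i * X (t i) \<omega>)"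
proof -
  have "\<forall>i\<in>I. \<exists>Y. has_wiener_integral M W (fOU lam (t i)) Y \<and> (AE \<omega> in M. X (t i) \<omega> = \<sigma> * Y \<omega>)"
    using wiener_OU_D(2)[OF X I(2)] by blast
  then obtain Y where Y: "\<And>i. i \<in> I \<Longrightarrow> has_wiener_integral M W (fOU lam (t i)) (Y i)"
    "\<And>i. i \<in> I \<Longrightarrow> AE \<omega> in M. X (t i) \<omega> = \<sigma> * Y i \<omega>" by metis
  show ?thesis
  proof (rule has_wiener_integral_AE_cong)
    show "has_wiener_integral M W (\<lambda>z. \<Sum>i\<in>I. (\<theta> i * \<sigma>) * fOU lam (t i) z) (\<lambda>\<omega>. \<Sum>i\<in>I. (\<theta> i * \<sigma>) * Y i \<omega>)"
      by (rule has_wiener_integral_sum[OF I(1) Y(1)])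
    show "(\<lambda>\<omega>. \<Sum>i\<in>I. \<theta> i * X (t i) \<omega>) \<in> borel_measurable M"
      using wiener_OU_D(1)[OF X I(2)] by (intro borel_measurable_sum borel_measurable_times) auto
    have "AE \<omega> in M. \<forall>i\<in>I. X (t i) \<omega> = \<sigma> * Y i \<omega>" by (rule AE_finite_allI[OF I(1) Y(2)])
    then show "AE \<omega> in M. (\<Sum>i\<in>I. \<theta> i * X (t i) \<omega>) = (\<Sum>i\<in>I. (\<theta> i * \<sigma>) * Y i \<omega>)"
      by eventually_elim (simp add: mult.assoc)
  qed
qed

definition cov_form :: "nat set \<Rightarrow> (nat \<Rightarrow> real) \<Rightarrow> (nat \<Rightarrow> real) \<Rightarrow> (real \<Rightarrow> real) \<Rightarrow> real" where
  "cov_form I \<theta> t N = (\<Sum>i\<in>I. \<Sum>j\<in>I. \<theta> i * \<theta> j * N (t i - t j))"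

lemma cov_form_scale: "cov_form I (\<lambda>i. \<theta> i * \<sigma>) t N = \<sigma>\<^sup>2 * cov_form I \<theta> t N"
  unfolding cov_form_def sum_distrib_left by (simp add: power2_eq_square ac_simps)

context wiener_process
begin

text \<open>\<open>v\<close> is half the variance of the combination. The coefficients absorb the
  frequency, so the characteristic function is evaluated at 1 only.\<close>

lemma rosenblatt_OU_bounds:
  fixes \<theta> :: "nat \<Rightarrow> real"
  assumes lam: "lam > 0" and H: "1/2 < H" "H \<le> 3/4"
    and X: "rosenblatt_OU M B H lam \<sigma> T X" and I: "finite I" "\<And>i. i \<in> I \<Longrightarrow> t i \<in> {0..T}"
  defines "v \<equiv> \<sigma>\<^sup>2 * cov_form I \<theta> t (cov_ROU H lam) / 2"
  shows "v \<ge> 0" and "(\<integral>\<^sup>+\<omega>. ennreal ((\<Sum>i\<in>I. \<theta> i * X (t i) \<omega>) ^ 4) \<partial>M) \<le> ennreal (324 * v\<^sup>2)"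
    and "norm (expectation (\<lambda>\<omega>. iexp (\<Sum>i\<in>I. \<theta> i * X (t i) \<omega>)) - exp (- v)) \<le>
      4 * sqrt (3 * ((\<Sum>i\<in>I. \<bar>\<theta> i * \<sigma>\<bar> * exp (lam * (T - t i))) ^ 4 * (8 * (8 + 1 / lam) ^ 3 * (1 / lam)) * (H * (2 * H - 1) / 2)\<^sup>2))"
proof -
  define h where "h z = (\<Sum>i\<in>I. (\<theta> i * \<sigma>) * rosenblatt_kernel H (fOU lam (t i)) z)" for z
  define c where "c = (\<Sum>i\<in>I. \<bar>\<theta> i * \<sigma>\<bar> * exp (lam * (T - t i))) ^ 4 * (8 * (8 + 1 / lam) ^ 3 * (1 / lam)) * (H * (2 * H - 1) / 2)\<^sup>2"
  have D: "has_double_wiener_integral M B h (\<lambda>\<omega>. \<Sum>i\<in>I. \<theta> i * X (t i) \<omega>)"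
    unfolding h_def[abs_def] by (rule rosenblatt_OU_sum[OF X I])
  have sym: "h (x, y) = h (y, x)" for x y
    unfolding h_def by (intro sum.cong refl arg_cong2[where f = "(*)"] rosenblatt_kernel_props(4)[OF H(1)]) auto
  have c: "contr_norm h \<le> ennreal c"
    unfolding h_def[abs_def] c_def by (rule kernel_sum_contr_norm[OF lam H I(1)]) (use I(2) in auto)
  have c0: "c \<ge> 0" unfolding c_def using lam by (intro mult_nonneg_nonneg) auto
  have v: "(LINT z|lborel. (h z)\<^sup>2) = v"
    unfolding h_def v_def cov_form_scale[symmetric] by (subst kernel_sum_square[OF lam H(1) _ I(1)]) (use H(2) in \<open>auto simp: cov_form_def\<close>)
  show "v \<ge> 0" unfolding v[symmetric] by simp
  show "(\<integral>\<^sup>+\<omega>. ennreal ((\<Sum>i\<in>I. \<theta> i * X (t i) \<omega>) ^ 4) \<partial>M) \<le> ennreal (324 * v\<^sup>2)"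
    using double_wiener_integral_bounds(2)[OF D sym c c0] by (simp only: v)
  show "norm (expectation (\<lambda>\<omega>. iexp (\<Sum>i\<in>I. \<theta> i * X (t i) \<omega>)) - exp (- v)) \<le>
      4 * sqrt (3 * ((\<Sum>i\<in>I. \<bar>\<theta> i * \<sigma>\<bar> * exp (lam * (T - t i))) ^ 4 * (8 * (8 + 1 / lam) ^ 3 * (1 / lam)) * (H * (2 * H - 1) / 2)\<^sup>2))"
    using double_wiener_integral_bounds(3)[OF D sym c c0, of 1] by (simp only: v c_def mult_1 power_one)
qed

lemma wiener_OU_iexp:
  assumes lam: "lam > 0" and X: "wiener_OU M B lam \<sigma> T X" and I: "finite I" "\<And>i. i \<in> I \<Longrightarrow> t i \<in> {0..T}"
  shows "expectation (\<lambda>\<omega>. iexp (\<Sum>i\<in>I. \<theta> i * X (t i) \<omega>)) = exp (- (\<sigma>\<^sup>2 * cov_form I \<theta> t (\<lambda>\<tau>. exp (- lam * \<bar>\<tau>\<bar>) / (2 * lam)) / 2))"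
proof -
  have "(LINT u|lborel. (\<Sum>i\<in>I. (\<theta> i * \<sigma>) * fOU lam (t i) u)\<^sup>2) = \<sigma>\<^sup>2 * cov_form I \<theta> t (\<lambda>\<tau>. exp (- lam * \<bar>\<tau>\<bar>) / (2 * lam))"
    unfolding cov_form_scale[symmetric] fOU_sum_square[OF lam I(1)] by (simp only: cov_form_def)
  then show ?thesis
    using wiener_integral_iexp(2)[OF wiener_OU_sum[OF X I], where u = 1] by (simp only: mult_1 power_one)
qed

text \<open>The increment is the combination with coefficients 1 and -1. Half its variance is
  \<open>\<sigma>\<^sup>2\<close> times the drop of the covariance over the lag (averaged over both
  signs), which is linear in the lag by \<open>cov_ROU_diff_le\<close>; the fourth moment is then
  quadratic, and \<open>K\<close> makes the constant independent of \<open>H\<close>.\<close>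

lemma rosenblatt_OU_moment:
  assumes lam: "lam > 0" and H: "1/2 < H" "H \<le> 3/4"
    and X: "rosenblatt_OU M B H lam \<sigma> T X" and st: "s \<in> {0..T}" "t \<in> {0..T}"
    and K: "cov_ROU H lam 0 \<le> K"
  shows "(\<integral>\<^sup>+\<omega>. ennreal ((X t \<omega> - X s \<omega>) ^ 4) \<partial>M) \<le> ennreal (324 * (\<sigma>\<^sup>2 * lam * K)\<^sup>2 * (t - s)\<^sup>2)"
proof -
  define \<theta> where "\<theta> i = (if i = 0 then 1 else -1 :: real)" for i :: nat
  define p where "p i = (if i = 0 then t else s)" for i :: nat
  define v where "v = \<sigma>\<^sup>2 * cov_form {0, 1} \<theta> p (cov_ROU H lam) / 2"
  have I: "p i \<in> {0..T}" if "i \<in> {0, 1}" for i using st by (simp add: p_def)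
  note b = rosenblatt_OU_bounds(1,2)[OF lam H X, where I = "{0, 1}" and t = p and \<theta> = \<theta>, folded v_def]
  have b: "v \<ge> 0" "(\<integral>\<^sup>+\<omega>. ennreal ((X t \<omega> - X s \<omega>) ^ 4) \<partial>M) \<le> ennreal (324 * v\<^sup>2)"
    using b I by (simp_all add: \<theta>_def p_def)
  have "cov_form {0, 1} \<theta> p (cov_ROU H lam) = (cov_ROU H lam 0 - cov_ROU H lam (t - s)) + (cov_ROU H lam 0 - cov_ROU H lam (s - t))"
    by (simp add: cov_form_def \<theta>_def p_def)
  also have "\<dots> \<le> lam * \<bar>t - s\<bar> * cov_ROU H lam 0 + lam * \<bar>s - t\<bar> * cov_ROU H lam 0"
    using H by (intro add_mono cov_ROU_diff_le[OF lam]) auto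
  also have "\<dots> = 2 * (lam * \<bar>t - s\<bar> * cov_ROU H lam 0)" by (simp add: abs_minus_commute)
  also have "\<dots> \<le> 2 * (lam * \<bar>t - s\<bar> * K)" using lam K by (intro mult_left_mono) auto
  finally have "\<sigma>\<^sup>2 * cov_form {0, 1} \<theta> p (cov_ROU H lam) \<le> \<sigma>\<^sup>2 * (2 * (lam * \<bar>t - s\<bar> * K))" by (intro mult_left_mono) auto
  then have "v \<le> \<sigma>\<^sup>2 * lam * K * \<bar>t - s\<bar>" by (simp add: v_def mult_ac)
  then have "v\<^sup>2 \<le> (\<sigma>\<^sup>2 * lam * K * \<bar>t - s\<bar>)\<^sup>2" by (rule power_mono[OF _ b(1)])
  then have "324 * v\<^sup>2 \<le> 324 * (\<sigma>\<^sup>2 * lam * K)\<^sup>2 * (t - s)\<^sup>2" by (simp add: power_mult_distrib)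
  then show ?thesis using b(2) by (meson ennreal_leI order_trans)
qed

end

theorem proposition7:
  fixes M :: "'a measure" and M' :: "'b measure"
    and B :: "real \<Rightarrow> 'a \<Rightarrow> real" and W :: "real \<Rightarrow> 'b \<Rightarrow> real"
    and X :: "real \<Rightarrow> real \<Rightarrow> 'a \<Rightarrow> real" and X0 :: "real \<Rightarrow> 'b \<Rightarrow> real"
    and lam \<sigma> T :: real
  assumes "lam > 0" and "\<sigma> > 0" and "T > 0"
    and "wiener_process M B" and "wiener_process M' W"
    and "\<And>H. H \<in> {1/2<..<1} \<Longrightarrow> rosenblatt_OU M B H lam \<sigma> T (X H)"
    and "wiener_OU M' W lam \<sigma> T X0"
  shows "weak_conv_on (C_interval T) (\<lambda>H. path_law M T (X H)) (path_law M' T X0) (at_right (1/2))"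
proof -
  interpret B: wiener_process M B by fact
  interpret W: wiener_process M' W by fact
  note lam = \<open>lam > 0\<close> and X = assms(6) and X0 = assms(7)
  have pX: "path_process M T (X H)" if "1/2 < H" "H < 1" for H
    by (rule rosenblatt_OU_path[OF B.prob_space_axioms \<open>T > 0\<close> X]) (use that in simp)
  have pX0: "path_process M' T X0" by (rule wiener_OU_path[OF W.prob_space_axioms \<open>T > 0\<close> X0])
  \<comment> \<open>For \<sigma> = 1 the variances converge to 1 / (2 lam), so near H = 1/2 they
    stay below this limit plus one.\<close>
  define K where "K = 1 / (2 * lam) + 1"
  have "\<forall>\<^sub>F H in at_right (1/2). cov_ROU H lam 0 < K"
    by (rule order_tendstoD(2)[OF cov_ROU_tendsto[OF lam]]) (simp add: K_def)
  then obtain b0 where b0: "b0 > 1/2" "\<And>H. 1/2 < H \<Longrightarrow> H < b0 \<Longrightarrow> cov_ROU H lam 0 < K"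
    unfolding eventually_at_right_field by blast
  \<comment> \<open>3/4 bounds the range in which the contraction estimate is uniform.\<close>
  define b where "b = min b0 (3/4)"
  have b: "b > 1/2" "b \<le> 3/4" "\<And>H. 1/2 < H \<Longrightarrow> H < b \<Longrightarrow> cov_ROU H lam 0 < K" using b0 by (auto simp: b_def)
  have ev: "\<forall>\<^sub>F H in at_right (1/2). 1/2 < H \<and> H < (1::real)"
    using eventually_at_right_real[of "1/2" 1] by (auto elim: eventually_mono)
  show ?thesis unfolding weak_conv_on_def
  proof (intro conjI allI impI)
    show "\<forall>\<^sub>F H in at_right (1/2). prob_space (path_law M T (X H)) \<and> sets (path_law M T (X H)) = sets (borel_of (C_interval T))"
      using ev by eventually_elim (use path_process.path_law_props(1,2)[OF pX] in blast)
    show "prob_space (path_law M' T X0)" "sets (path_law M' T X0) = sets (borel_of (C_interval T))"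
      by (rule path_process.path_law_props[OF pX0])+
    fix \<phi> assume \<phi>: "continuous_map (C_interval T) euclideanreal \<phi>" "bounded (\<phi> ` topspace (C_interval T))"
    show "((\<lambda>H. integral\<^sup>L (path_law M T (X H)) \<phi>) \<longlongrightarrow> integral\<^sup>L (path_law M' T X0) \<phi>) (at_right (1/2))"
    \<comment> \<open>It suffices to follow sequences in (1/2, b), where the moment constant is
      uniform; the convergence theorems above are sequential.\<close>
    proof (rule tendsto_at_right_sequentially[OF b(1)])
      fix S :: "nat \<Rightarrow> real" assume S: "\<And>n. 1/2 < S n" "\<And>n. S n < b" "S \<longlonglongrightarrow> 1/2"
      have S': "S n \<le> 3/4" "S n < 1" for n using S(2)[of n] b(2) by auto
      have XS: "rosenblatt_OU M B (S n) lam \<sigma> T (X (S n))" for n by (rule X) (use S(1)[of n] S'(2)[of n] in simp)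
      have flt: "filterlim S (at_right (1/2)) sequentially"
        unfolding filterlim_at using S(1,3) by (auto intro!: always_eventually simp: less_imp_neq[symmetric])
      show "(\<lambda>n. integral\<^sup>L (path_law M T (X (S n))) \<phi>) \<longlonglongrightarrow> integral\<^sup>L (path_law M' T X0) \<phi>"
      proof (rule path_law_weak_conv[OF pX[OF S(1) S'(2)] pX0 _ _ _ \<phi>])
        show "0 \<le> 324 * (\<sigma>\<^sup>2 * lam * K)\<^sup>2" by simp
        show "(\<integral>\<^sup>+\<omega>. ennreal ((X (S n) t \<omega> - X (S n) s \<omega>) ^ 4) \<partial>M) \<le> ennreal (324 * (\<sigma>\<^sup>2 * lam * K)\<^sup>2 * (t - s)\<^sup>2)"
          if "s \<in> {0..T}" "t \<in> {0..T}" for n s t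
          by (rule B.rosenblatt_OU_moment[OF lam S(1) S'(1) XS that less_imp_le[OF b(3)[OF S(1,2)]]])
        fix d t \<theta> assume t: "\<And>j::nat. j < d \<Longrightarrow> t j \<in> {0..T}"
        then have I: "finite {..<d}" "\<And>j. j \<in> {..<d} \<Longrightarrow> t j \<in> {0..T}" by auto
        define v v0 where "v n = \<sigma>\<^sup>2 * cov_form {..<d} \<theta> t (cov_ROU (S n) lam) / 2"
          and "v0 = \<sigma>\<^sup>2 * cov_form {..<d} \<theta> t (\<lambda>\<tau>. exp (- lam * \<bar>\<tau>\<bar>) / (2 * lam)) / 2" for n
        define A where "A = (\<Sum>i<d. \<bar>\<theta> i * \<sigma>\<bar> * exp (lam * (T - t i))) ^ 4 * (8 * (8 + 1 / lam) ^ 3 * (1 / lam))"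
        have "v \<longlonglongrightarrow> v0"
          unfolding v_def[abs_def] v0_def cov_form_def
          by (intro tendsto_intros filterlim_compose[OF cov_ROU_tendsto[OF lam] flt]) simp
        then have lim: "(\<lambda>n. complex_of_real (exp (- v n))) \<longlonglongrightarrow> complex_of_real (exp (- v0))"
          by (intro tendsto_intros)
        \<comment> \<open>Comparison with a Gaussian of the variance belonging to
          \<open>S n\<close>: the error has the factor \<open>2 * S n - 1\<close>, while
          \<open>A\<close> is fixed. The convergence of these variances is the separate limit
          \<open>lim\<close>.\<close>
        have null: "(\<lambda>n. (LINT \<omega>|M. iexp (\<Sum>j<d. \<theta> j * X (S n) (t j) \<omega>)) - exp (- v n)) \<longlonglongrightarrow> 0"
        proof (rule Lim_null_comparison)
          show "\<forall>\<^sub>F n in sequentially. norm ((LINT \<omega>|M. iexp (\<Sum>j<d. \<theta> j * X (S n) (t j) \<omega>)) - exp (- v n)) \<le>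
              4 * sqrt (3 * (A * (S n * (2 * S n - 1) / 2)\<^sup>2))"
            unfolding A_def v_def by (intro always_eventually allI B.rosenblatt_OU_bounds(3)[OF lam S(1) S'(1) XS I])
          have "(\<lambda>n. 4 * sqrt (3 * (A * (S n * (2 * S n - 1) / 2)\<^sup>2))) \<longlonglongrightarrow> 4 * sqrt (3 * (A * ((1/2) * (2 * (1/2) - 1) / 2)\<^sup>2))"
            by (intro tendsto_intros S(3)) simp
          then show "(\<lambda>n. 4 * sqrt (3 * (A * (S n * (2 * S n - 1) / 2)\<^sup>2))) \<longlonglongrightarrow> 0" by simp
        qed
        have Y: "(LINT \<omega>|M'. iexp (\<Sum>j<d. \<theta> j * X0 (t j) \<omega>)) = complex_of_real (exp (- v0))"
          unfolding v0_def by (rule W.wiener_OU_iexp[OF lam X0 I])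
        from tendsto_add[OF null lim]
        have "(\<lambda>n. LINT \<omega>|M. iexp (\<Sum>j<d. \<theta> j * X (S n) (t j) \<omega>)) \<longlonglongrightarrow> complex_of_real (exp (- v0))"
          by (simp only: diff_add_cancel add_0)
        then show "(\<lambda>n. LINT \<omega>|M. iexp (\<Sum>j<d. \<theta> j * X (S n) (t j) \<omega>)) \<longlonglongrightarrow> (LINT \<omega>|M'. iexp (\<Sum>j<d. \<theta> j * X0 (t j) \<omega>))"
          by (simp only: Y)
      qed
    qed
  qed
qed

end
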